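(* Fix an integer $n\ge 0$ and let $b_{m,n}$ be the number of Borel orbits of the symmetric variety $SO_{2m+2n+1}/S(O_{2m}\times O_{2n+1})$ over an algebraically closed field of characteristic $\neq2$. As a polynomial in $m$, $b_{m,n}$ has degree $2n+1$, and its leading coefficient is not an integer when $n>0$.
   Context: It is known (Can and Uğurlu) that for fixed $n$, $b_{m,n}$ agrees with a polynomial in $m$; "the polynomial $b_{m,n}$" refers to this polynomial. *)

theory Defs
  imports
    "Jordan_Normal_Form.Determinant"
    "HOL-Algebra.Group_Action"
    "HOL-Algebra.Left_Coset"
    "HOL-Algebra.Solvable_Groups"
    "HOL-Analysis.Abstract_Topology"
begin

definition orthogonal_matrices :: "nat \<Rightarrow> 'k::field mat set" where
  "orthogonal_matrices r = {A \<in> carrier_mat r r. transpose_mat A * A = 1\<^sub>m r}"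

text \<open>The group of the quadratic form \<open>x\<^sub>1\<^sup>2 + \<dots> + x\<^sub>N\<^sup>2\<close>; over an algebraically closed field
  of characteristic other than 2 every nondegenerate quadratic form is equivalent to it.\<close>

definition SO :: "nat \<Rightarrow> 'k::field mat monoid" where
  "SO N = \<lparr>carrier = {A \<in> orthogonal_matrices N. det A = 1}, mult = (*), one = 1\<^sub>m N\<rparr>"

definition S_O_times_O :: "nat \<Rightarrow> nat \<Rightarrow> 'k::field mat set" where
  "S_O_times_O p q =
     {four_block_mat A (0\<^sub>m p q) (0\<^sub>m q p) D | A D.
        A \<in> orthogonal_matrices p \<and> D \<in> orthogonal_matrices q} \<inter> carrier (SO (p + q))"

definition symmetric_variety :: "nat \<Rightarrow> nat \<Rightarrow> 'k::field mat set set" where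
  "symmetric_variety p q = lcosets\<^bsub>SO (p + q)\<^esub> (S_O_times_O p q)"

text \<open>Polynomial functions in the entries of an \<open>N \<times> N\<close> matrix.\<close>

inductive_set polynomial_functions :: "nat \<Rightarrow> ('k::field mat \<Rightarrow> 'k) set" for N :: nat where
  const: "(\<lambda>A. c) \<in> polynomial_functions N"
| entry: "i < N \<Longrightarrow> j < N \<Longrightarrow> (\<lambda>A. A $$ (i, j)) \<in> polynomial_functions N"
| add: "f \<in> polynomial_functions N \<Longrightarrow> g \<in> polynomial_functions N
    \<Longrightarrow> (\<lambda>A. f A + g A) \<in> polynomial_functions N"
| mult: "f \<in> polynomial_functions N \<Longrightarrow> g \<in> polynomial_functions N
    \<Longrightarrow> (\<lambda>A. f A * g A) \<in> polynomial_functions N"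

text \<open>The Zariski topology on the affine space of \<open>N \<times> N\<close> matrices. Since \<open>SO N\<close> is closed in it,
  a subset of \<open>SO N\<close> is closed (connected) in \<open>SO N\<close> iff it is so here.\<close>

definition zariski :: "nat \<Rightarrow> 'k::field mat topology" where
  "zariski N = topology_generated_by
     {{A \<in> carrier_mat N N. f A \<noteq> 0} | f. f \<in> polynomial_functions N}"

definition closed_connected_solvable :: "nat \<Rightarrow> 'k::field mat set \<Rightarrow> bool" where
  "closed_connected_solvable N H \<longleftrightarrow>
     subgroup H (SO N) \<and> closedin (zariski N) H \<and> connectedin (zariski N) H \<and>
     solvable (SO N\<lparr>carrier := H\<rparr>)"

definition borel_subgroup :: "nat \<Rightarrow> 'k::field mat set \<Rightarrow> bool" where
  "borel_subgroup N B \<longleftrightarrow>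
     closed_connected_solvable N B \<and>
     (\<forall>H. closed_connected_solvable N H \<longrightarrow> B \<subseteq> H \<longrightarrow> H = B)"

definition orbits_on_symmetric_variety ::
    "nat \<Rightarrow> nat \<Rightarrow> 'k::field mat set \<Rightarrow> 'k mat set set set" where
  "orbits_on_symmetric_variety p q B =
     orbits (SO (p + q)\<lparr>carrier := B\<rparr>) (symmetric_variety p q) (\<lambda>b X. b <#\<^bsub>SO (p + q)\<^esub> X)"

end

theory Submission
  imports Defs "Jordan_Normal_Form.Char_Poly"
begin

text \<open>By the Lie-Kolchin theorem a Borel subgroup \<open>B\<close> of \<open>SO\<^sub>N\<close>, \<open>N = 2m + 2n + 1\<close>, fixes a full isotropic
  flag, and the stabiliser of such a flag is closed, connected and solvable, so \<open>B\<close> is that stabiliser.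
  A point \<open>g K\<close> of the symmetric variety is the same as the symmetric involution
  \<open>\<theta> = g E g\<^sup>T\<close>, where \<open>E\<close> has \<open>2m\<close> diagonal entries \<open>1\<close> and \<open>2n + 1\<close> entries \<open>-1\<close>, and \<open>B\<close> acts by conjugation.
  Some hyperbolic basis adapted to the flag is permuted by \<open>\<theta>\<close> up to signs, and the resulting signed
  involution, a symmetric clan, is a complete invariant of the orbit; its signature is that of \<open>E\<close>.
  Removing the orbits of one index under the matching and the reversal gives a recursion for the
  number of clans on \<open>2l + 1\<close> points. Along the diagonals where \<open>l\<close> minus half the excess of plus signs
  is constant it becomes a difference equation, whose solutions are polynomials of degree \<open>k\<close> with
  leading coefficients \<open>L\<^sub>k\<close>, where \<open>k L\<^sub>k = L\<^sub>k\<^sub>-\<^sub>1 + 2 L\<^sub>k\<^sub>-\<^sub>2\<close>. Here \<open>k = 2n + 1\<close>, and \<open>L\<^sub>3 = 7/6\<close>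
  while \<open>0 < L\<^sub>k < 1\<close> for \<open>k \<ge> 5\<close>.\<close>

section \<open>Regular maps and connectedness in the Zariski topology\<close>

text \<open>The topology is kept to what polynomial identities give: eigenvector conditions are
  closed, regular maps preserve connectedness, and a rational curve is connected because nonempty
  open sets pull back to cofinite ones. Hence subspaces are carried as orthogonal complements and
  quotients as congruences. As N is odd, -1 has determinant -1, preserves every flag and acts
  trivially by conjugation; so an orthogonal matrix can be corrected to determinant 1, and clans
  separate orbits under SO, not only under O. The recursion removes a point x with its mirror image
  y. A plus pair stays on the k-th diagonal, a minus pair leads to diagonal k - 2, matching x with y
  leads to diagonal k - 1, and matching x with one of 2 l further points leads to 2 l times diagonal
  k - 2. The minus pairs have too low a degree to matter, while the last term gains a degree from
  its factor l; the difference on the k-th diagonal thus has top coefficient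
  \<open>L\<^sub>k\<^sub>-\<^sub>1 + 2 L\<^sub>k\<^sub>-\<^sub>2\<close>, and summation over l
  divides it by k.\<close>

definition regular :: "nat \<Rightarrow> ('k::field mat \<Rightarrow> 'k) \<Rightarrow> bool" where
  "regular N f \<longleftrightarrow> (\<exists>g \<in> polynomial_functions N. \<forall>A \<in> carrier_mat N N. f A = g A)"

lemma regular_const [intro]: "regular N (\<lambda>A. c)"
  unfolding regular_def by (intro bexI[OF _ polynomial_functions.const[of c]]) simp

lemma regular_entry: "i < N \<Longrightarrow> j < N \<Longrightarrow> regular N (\<lambda>A. A $$ (i, j))"
  unfolding regular_def by (intro bexI[OF _ polynomial_functions.entry[of i N j]]) simp_all

lemma regular_add: assumes "regular N f" "regular N g" shows "regular N (\<lambda>A. f A + g A)"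
proof -
  obtain f' g' where "f' \<in> polynomial_functions N" "g' \<in> polynomial_functions N"
    "\<forall>A \<in> carrier_mat N N. f A = f' A" "\<forall>A \<in> carrier_mat N N. g A = g' A"
    using assms unfolding regular_def by blast
  then show ?thesis unfolding regular_def
    by (intro bexI[of _ "\<lambda>A. f' A + g' A"] polynomial_functions.add) auto
qed

lemma regular_mult: assumes "regular N f" "regular N g" shows "regular N (\<lambda>A. f A * g A)"
proof -
  obtain f' g' where "f' \<in> polynomial_functions N" "g' \<in> polynomial_functions N"
    "\<forall>A \<in> carrier_mat N N. f A = f' A" "\<forall>A \<in> carrier_mat N N. g A = g' A"
    using assms unfolding regular_def by blast
  then show ?thesis unfolding regular_def
    by (intro bexI[of _ "\<lambda>A. f' A * g' A"] polynomial_functions.mult) auto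
qed

lemma regular_diff: assumes "regular N f" "regular N g" shows "regular N (\<lambda>A. f A - g A)"
  using regular_add[OF assms(1) regular_mult[OF regular_const[of N "-1"] assms(2)]] by simp

lemma regular_sum: "finite S \<Longrightarrow> (\<And>s. s \<in> S \<Longrightarrow> regular N (f s)) \<Longrightarrow> regular N (\<lambda>A. \<Sum>s\<in>S. f s A)"
  by (induction S rule: finite_induct) (auto intro: regular_add)

lemma regular_prod: "finite S \<Longrightarrow> (\<And>s. s \<in> S \<Longrightarrow> regular N (f s)) \<Longrightarrow> regular N (\<lambda>A. \<Prod>s\<in>S. f s A)"
  by (induction S rule: finite_induct) (auto intro: regular_mult)

lemma regular_cong: "regular N f \<Longrightarrow> (\<And>A. A \<in> carrier_mat N N \<Longrightarrow> g A = f A) \<Longrightarrow> regular N g"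
  unfolding regular_def by (metis (no_types, lifting))

text \<open>The Leibniz formula with a fixed N describes \<open>det\<close> only on N x N matrices.
  This is why \<open>regular\<close> asks for agreement with a polynomial on the carrier
  only.\<close>

lemma regular_det: "regular N det"
proof (rule regular_cong)
  show "regular N (\<lambda>A::'a mat. \<Sum>p\<in>{p. p permutes {0..<N}}. signof p * (\<Prod>i = 0..<N. A $$ (i, p i)))"
    by (intro regular_sum regular_mult regular_const regular_prod regular_entry finite_permutations)
       (auto dest: permutes_in_image)
qed (auto simp: det_def)

definition regular_map :: "nat \<Rightarrow> ('k::field mat \<Rightarrow> 'k mat) \<Rightarrow> bool" where
  "regular_map N \<psi> \<longleftrightarrow> (\<forall>A \<in> carrier_mat N N. \<psi> A \<in> carrier_mat N N) \<and>
     (\<forall>i<N. \<forall>j<N. regular N (\<lambda>A. \<psi> A $$ (i, j)))"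

lemma regular_map_id: "regular_map N (\<lambda>A. A)"
  by (auto simp: regular_map_def regular_entry)

lemma regular_map_const: "C \<in> carrier_mat N N \<Longrightarrow> regular_map N (\<lambda>A. C)"
  by (auto simp: regular_map_def)

lemma regular_map_transpose: "regular_map N \<psi> \<Longrightarrow> regular_map N (\<lambda>A. transpose_mat (\<psi> A))"
  unfolding regular_map_def
proof (intro conjI allI impI ballI)
  fix i j assume a: "(\<forall>A\<in>carrier_mat N N. \<psi> A \<in> carrier_mat N N) \<and> (\<forall>i<N. \<forall>j<N. regular N (\<lambda>A. \<psi> A $$ (i, j)))"
    and ij: "i < N" "j < N"
  have "regular N (\<lambda>A. \<psi> A $$ (j, i))" using a ij by blast
  then show "regular N (\<lambda>A. transpose_mat (\<psi> A) $$ (i, j))"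
    by (rule regular_cong) (use a ij in auto)
qed auto

lemma regular_map_mult:
  assumes "regular_map N \<psi>" "regular_map N \<phi>"
  shows "regular_map N (\<lambda>A. \<psi> A * \<phi> A)"
  unfolding regular_map_def
proof (intro conjI allI impI ballI)
  fix i j assume ij: "i < N" "j < N"
  have "regular N (\<lambda>A. \<Sum>k = 0..<N. \<psi> A $$ (i, k) * \<phi> A $$ (k, j))"
    using assms ij by (intro regular_sum regular_mult) (auto simp: regular_map_def)
  then show "regular N (\<lambda>A. (\<psi> A * \<phi> A) $$ (i, j))"
  proof (rule regular_cong)
    fix A :: "'a mat" assume "A \<in> carrier_mat N N"
    then have "\<psi> A \<in> carrier_mat N N" "\<phi> A \<in> carrier_mat N N" using assms by (auto simp: regular_map_def)
    then show "(\<psi> A * \<phi> A) $$ (i, j) = (\<Sum>k = 0..<N. \<psi> A $$ (i, k) * \<phi> A $$ (k, j))"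
      using ij by (auto simp: scalar_prod_def)
  qed
qed (use assms in \<open>auto simp: regular_map_def\<close>)

lemma regular_compose:
  assumes f: "regular N f" and \<psi>: "regular_map N \<psi>"
  shows "regular N (\<lambda>A. f (\<psi> A))"
proof -
  have c: "\<psi> A \<in> carrier_mat N N" if "A \<in> carrier_mat N N" for A using \<psi> that by (auto simp: regular_map_def)
  obtain g where g: "g \<in> polynomial_functions N" "\<forall>A \<in> carrier_mat N N. f A = g A"
    using f unfolding regular_def by blast
  have "regular N (\<lambda>A. g (\<psi> A))"
    using g(1) by induction (use \<psi> in \<open>auto simp: regular_map_def intro: regular_add regular_mult\<close>)
  then show ?thesis by (rule regular_cong) (use g(2) c in auto)
qed

lemma topspace_zariski: "topspace (zariski N) = (carrier_mat N N :: 'k::field mat set)"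
  unfolding zariski_def topology_generated_by_topspace
proof (intro equalityI subsetI)
  fix B :: "'k mat" assume "B \<in> carrier_mat N N"
  then have "B \<in> {A \<in> carrier_mat N N. (\<lambda>A. 1 :: 'k) A \<noteq> 0}" by simp
  then show "B \<in> \<Union> {{A \<in> carrier_mat N N. f A \<noteq> 0} |f. f \<in> polynomial_functions N}"
    using polynomial_functions.const[of 1 N] by blast
qed auto

lemma openin_zariski_basic:
  assumes "regular N f" shows "openin (zariski N) {A \<in> carrier_mat N N. f A \<noteq> 0}"
proof -
  obtain g where "g \<in> polynomial_functions N" "\<forall>A \<in> carrier_mat N N. f A = g A"
    using assms unfolding regular_def by blast
  then have "{A \<in> carrier_mat N N. f A \<noteq> 0} = {A \<in> carrier_mat N N. g A \<noteq> 0}" by auto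
  then show ?thesis unfolding zariski_def
    using \<open>g \<in> polynomial_functions N\<close> by (intro topology_generated_by_Basis) auto
qed

lemma closedin_zariski_zero:
  assumes "regular N f" shows "closedin (zariski N) {A \<in> carrier_mat N N. f A = 0}"
proof -
  have "topspace (zariski N) - {A \<in> carrier_mat N N. f A = 0} = {A \<in> carrier_mat N N. f A \<noteq> 0}"
    by (auto simp: topspace_zariski)
  then show ?thesis using openin_zariski_basic[OF assms] by (auto simp: closedin_def topspace_zariski)
qed

lemma closedin_zariski_zeros:
  assumes "\<And>t. t \<in> T \<Longrightarrow> regular N (f t)"
  shows "closedin (zariski N) {A \<in> carrier_mat N N. \<forall>t\<in>T. f t A = 0}"
proof (cases "T = {}")
  case True
  then show ?thesis using closedin_topspace[of "zariski N"] by (simp add: topspace_zariski)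
next
  case False
  have "{A \<in> carrier_mat N N. \<forall>t\<in>T. f t A = 0} = \<Inter> ((\<lambda>t. {A \<in> carrier_mat N N. f t A = 0}) ` T)"
    using False by auto
  then show ?thesis using False closedin_zariski_zero[OF assms] by (auto intro!: closedin_Inter)
qed

lemma continuous_regular_map:
  assumes \<psi>: "regular_map N \<psi>"
  shows "continuous_map (zariski N) (zariski N) \<psi>"
  unfolding zariski_def[of N]
proof (rule continuous_on_generated_topo, unfold zariski_def[of N, symmetric])
  fix U :: "'a mat set" assume "U \<in> {{A \<in> carrier_mat N N. f A \<noteq> 0} |f. f \<in> polynomial_functions N}"
  then obtain f where f: "f \<in> polynomial_functions N" "U = {A \<in> carrier_mat N N. f A \<noteq> 0}" by auto
  have "\<psi> -` U \<inter> topspace (zariski N) = {A \<in> carrier_mat N N. f (\<psi> A) \<noteq> 0}"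
    using \<psi> f(2) by (auto simp: topspace_zariski regular_map_def)
  moreover have "regular N f" using f(1) by (auto simp: regular_def)
  ultimately show "openin (zariski N) (\<psi> -` U \<inter> topspace (zariski N))"
    using openin_zariski_basic[OF regular_compose[OF _ \<psi>]] by metis
next
  have "\<psi> ` topspace (zariski N) \<subseteq> topspace (zariski N)"
    using \<psi> by (auto simp: topspace_zariski regular_map_def)
  then show "\<psi> ` topspace (zariski N) \<subseteq> \<Union> {{A \<in> carrier_mat N N. f A \<noteq> 0} |f. f \<in> polynomial_functions N}"
    unfolding zariski_def topology_generated_by_topspace .
qed

lemma connectedin_regular_image:
  "regular_map N \<psi> \<Longrightarrow> connectedin (zariski N) S \<Longrightarrow> connectedin (zariski N) (\<psi> ` S)"
  using connectedin_continuous_map_image continuous_regular_map by blast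

text \<open>With finitely many closed pieces the union of all but one is closed as well, so the
  piece through \<open>x\<close> and the rest would separate \<open>S\<close>. It is applied to the
  level sets of a function with finitely many values.\<close>

lemma connectedin_finite_closed_cover:
  assumes S: "connectedin X S" and fin: "finite \<Lambda>"
    and cl: "\<And>l. l \<in> \<Lambda> \<Longrightarrow> closedin X (C l)"
    and cov: "S \<subseteq> (\<Union>l\<in>\<Lambda>. C l)"
    and disj: "\<And>l m. l \<in> \<Lambda> \<Longrightarrow> m \<in> \<Lambda> \<Longrightarrow> l \<noteq> m \<Longrightarrow> C l \<inter> C m \<inter> S = {}"
    and l: "l \<in> \<Lambda>" and x: "x \<in> S" "x \<in> C l"
  shows "S \<subseteq> C l"
proof (rule ccontr)
  assume ne: "\<not> S \<subseteq> C l"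
  let ?E = "\<Union>m\<in>\<Lambda> - {l}. C m"
  have "closedin X ?E" using fin cl by (intro closedin_Union) auto
  moreover have "S \<subseteq> C l \<union> ?E" using cov by auto
  moreover have "C l \<inter> ?E \<inter> S = {}" using disj l by blast
  moreover have "C l \<inter> S \<noteq> {}" using x by auto
  moreover have "?E \<inter> S \<noteq> {}" using ne cov by blast
  ultimately show False using S cl[OF l] unfolding connectedin_closedin by blast
qed

text \<open>Over a finite field, one plus the product of all \<open>[:-a, 1:]\<close> has positive
  degree and takes only the value 1.\<close>

lemma infinite_alg_closed: "infinite (UNIV :: 'k::alg_closed_field set)"
proof
  assume fin: "finite (UNIV :: 'k set)"
  define p :: "'k poly" where "p = (\<Prod>a\<in>UNIV. [:-a, 1:]) + 1"
  have deg: "degree (\<Prod>a\<in>(UNIV :: 'k set). [:-a, 1:]) = card (UNIV :: 'k set)"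
    by (subst degree_prod_eq_sum_degree) auto
  have "card (UNIV :: 'k set) > 0" using fin by (simp add: card_gt_0_iff)
  then have "degree p > 0" unfolding p_def using deg by (subst degree_add_eq_left) auto
  then obtain x where "poly p x = 0" using alg_closed_imp_poly_has_root by blast
  moreover have "poly p x = 1" unfolding p_def using fin by (auto simp: poly_prod)
  ultimately show False by simp
qed

text \<open>Along the curve a polynomial function becomes a polynomial divided by a power of
  \<open>q\<close>, so an open set is met for no parameter or for all but finitely many. Two
  cofinite sets of parameters in an infinite field intersect.\<close>

lemma connectedin_rational_curve:
  fixes c :: "'k::alg_closed_field \<Rightarrow> 'k mat"
  assumes fin: "finite (- D)"
    and car: "\<And>x. x \<in> D \<Longrightarrow> c x \<in> carrier_mat N N"
    and q: "\<And>x. x \<in> D \<Longrightarrow> poly q x \<noteq> 0"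
    and ent: "\<And>x i j. x \<in> D \<Longrightarrow> i < N \<Longrightarrow> j < N \<Longrightarrow> c x $$ (i, j) = poly (p i j) x / poly q x"
  shows "connectedin (zariski N) (c ` D)"
proof -
  have rat: "\<exists>P k. \<forall>x\<in>D. f (c x) = poly P x / poly q x ^ k" if "f \<in> polynomial_functions N" for f
    using that
  proof induction
    case (const a)
    show ?case by (intro exI[of _ "[:a:]"] exI[of _ 0]) auto
  next
    case (entry i j)
    then show ?case using ent by (intro exI[of _ "p i j"] exI[of _ 1]) auto
  next
    case (add f g)
    then obtain P k Q l where "\<forall>x\<in>D. f (c x) = poly P x / poly q x ^ k"
      "\<forall>x\<in>D. g (c x) = poly Q x / poly q x ^ l" by blast
    then show ?case using q
      by (intro exI[of _ "P * q ^ l + Q * q ^ k"] exI[of _ "k + l"])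
         (auto simp: field_simps power_add)
  next
    case (mult f g)
    then obtain P k Q l where "\<forall>x\<in>D. f (c x) = poly P x / poly q x ^ k"
      "\<forall>x\<in>D. g (c x) = poly Q x / poly q x ^ l" by blast
    then show ?case using q
      by (intro exI[of _ "P * Q"] exI[of _ "k + l"]) (auto simp: power_add)
  qed
  have cof: "{x \<in> D. c x \<in> U} = {} \<or> finite (- {x \<in> D. c x \<in> U})" if "openin (zariski N) U" for U
    using that unfolding zariski_def openin_topology_generated_by_iff
  proof induction
    case Empty
    then show ?case by simp
  next
    case (Int a b)
    have "- {x \<in> D. c x \<in> a \<inter> b} = - {x \<in> D. c x \<in> a} \<union> - {x \<in> D. c x \<in> b}" by auto
    then show ?case using Int.IH by (metis (no_types, lifting) IntD1 IntD2 empty_Collect_eq finite_UnI)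
  next
    case (UN K)
    show ?case
    proof (cases "\<exists>k\<in>K. {x \<in> D. c x \<in> k} \<noteq> {}")
      case True
      then obtain k where k: "k \<in> K" "{x \<in> D. c x \<in> k} \<noteq> {}" by blast
      then have "finite (- {x \<in> D. c x \<in> k})" using UN by blast
      moreover have "- {x \<in> D. c x \<in> \<Union> K} \<subseteq> - {x \<in> D. c x \<in> k}" using k by auto
      ultimately show ?thesis using finite_subset by blast
    qed auto
  next
    case (Basis U)
    then obtain f where f: "f \<in> polynomial_functions N" "U = {A \<in> carrier_mat N N. f A \<noteq> 0}" by auto
    obtain P k where P: "\<forall>x\<in>D. f (c x) = poly P x / poly q x ^ k" using rat[OF f(1)] by blast
    have eq: "{x \<in> D. c x \<in> U} = {x \<in> D. poly P x \<noteq> 0}" using P f(2) car q by auto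
    show ?case
    proof (cases "P = 0")
      case False
      have "- {x \<in> D. poly P x \<noteq> 0} \<subseteq> - D \<union> {x. poly P x = 0}" by auto
      then show ?thesis unfolding eq using fin False poly_roots_finite finite_subset by (metis finite_UnI)
    qed (use eq in auto)
  qed
  show ?thesis unfolding connectedin
  proof (intro conjI notI)
    show "c ` D \<subseteq> topspace (zariski N)" using car by (auto simp: topspace_zariski)
    assume "\<exists>E1 E2. openin (zariski N) E1 \<and> openin (zariski N) E2 \<and> c ` D \<subseteq> E1 \<union> E2 \<and>
      E1 \<inter> E2 \<inter> c ` D = {} \<and> E1 \<inter> c ` D \<noteq> {} \<and> E2 \<inter> c ` D \<noteq> {}"
    then obtain E1 E2 where E: "openin (zariski N) E1" "openin (zariski N) E2"
      "E1 \<inter> E2 \<inter> c ` D = {}" "E1 \<inter> c ` D \<noteq> {}" "E2 \<inter> c ` D \<noteq> {}" by blast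
    have "finite (- {x \<in> D. c x \<in> E1} \<union> - {x \<in> D. c x \<in> E2})" using cof[OF E(1)] cof[OF E(2)] E by blast
    moreover have "- {x \<in> D. c x \<in> E1} \<union> - {x \<in> D. c x \<in> E2} = UNIV" using E(3) by auto
    ultimately show False using infinite_alg_closed by metis
  qed
qed

section \<open>Special orthogonal groups and their commutator subgroups\<close>

lemma SO_simps [simp]: "one (SO N) = 1\<^sub>m N" "mult (SO N) = (*)"
  "carrier (SO N) = {A \<in> orthogonal_matrices N. det A = 1}"
  by (simp_all add: SO_def)

lemma orthogonal_matricesD:
  assumes "A \<in> orthogonal_matrices N"
  shows "A \<in> carrier_mat N N" "transpose_mat A * A = 1\<^sub>m N" "A * transpose_mat A = 1\<^sub>m N"
proof -
  show A: "A \<in> carrier_mat N N" and AA: "transpose_mat A * A = 1\<^sub>m N"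
    using assms by (auto simp: orthogonal_matrices_def)
  show "A * transpose_mat A = 1\<^sub>m N"
    by (rule mat_mult_left_right_inverse[OF _ A AA]) (use A in simp)
qed

lemma orthogonal_matrices_mult:
  assumes "A \<in> orthogonal_matrices N" "B \<in> orthogonal_matrices N"
  shows "A * B \<in> orthogonal_matrices N"
proof -
  note A = orthogonal_matricesD[OF assms(1)] and B = orthogonal_matricesD[OF assms(2)]
  have "transpose_mat (A * B) * (A * B) = transpose_mat B * (transpose_mat A * (A * B))"
    unfolding transpose_mult[OF A(1) B(1)]
    by (rule assoc_mult_mat[of _ N N _ N _ N]) (use A(1) B(1) in simp_all)
  also have "transpose_mat A * (A * B) = transpose_mat A * A * B"
    by (rule assoc_mult_mat[of _ N N _ N _ N, symmetric]) (use A(1) B(1) in simp_all)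
  finally have "transpose_mat (A * B) * (A * B) = 1\<^sub>m N" using A(2) B by simp
  then show ?thesis using A(1) B(1) unfolding orthogonal_matrices_def by simp
qed

lemma orthogonal_matrices_transpose:
  assumes "A \<in> orthogonal_matrices N" shows "transpose_mat A \<in> orthogonal_matrices N"
  using orthogonal_matricesD(1,3)[OF assms] unfolding orthogonal_matrices_def by simp

lemma orthogonal_matrices_one: "1\<^sub>m N \<in> orthogonal_matrices N"
  by (simp add: orthogonal_matrices_def)

lemma det_mult_orthogonal: "A \<in> orthogonal_matrices N \<Longrightarrow> B \<in> orthogonal_matrices N \<Longrightarrow> det (A * B) = det A * det B"
  using det_mult[of A N B] orthogonal_matricesD(1) by blast

lemma det_transpose_orthogonal: "A \<in> orthogonal_matrices N \<Longrightarrow> det (transpose_mat A) = det A"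
  using det_transpose[of A N] orthogonal_matricesD(1) by blast

lemma group_SO: "group (SO N :: 'k::field mat monoid)"
proof (rule groupI)
  fix A :: "'k mat" assume "A \<in> carrier (SO N)"
  then show "\<exists>B\<in>carrier (SO N). B \<otimes>\<^bsub>SO N\<^esub> A = \<one>\<^bsub>SO N\<^esub>"
    using orthogonal_matricesD(2)[of A N] orthogonal_matrices_transpose[of A N]
    by (intro bexI[of _ "transpose_mat A"]) (simp_all add: det_transpose_orthogonal[of A N])
qed (auto simp: orthogonal_matrices_mult orthogonal_matrices_one det_mult_orthogonal
       intro!: assoc_mult_mat[of _ N N _ N _ N] dest: orthogonal_matricesD)

lemma inv_SO: 
  assumes "A \<in> carrier (SO N)" shows "inv\<^bsub>SO N\<^esub> A = transpose_mat A"
proof -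
  interpret group "SO N" by (rule group_SO)
  show ?thesis
    using assms orthogonal_matricesD(2)[of A N] orthogonal_matrices_transpose[of A N]
    by (intro inv_equality) (simp_all add: det_transpose_orthogonal[of A N])
qed

text \<open>Since 1 lies in \<open>D\<close>, each translate c D contains c and so meets
  \<open>C\<close>. The product set is the union of the connected sets
  \<open>C \<union> c D\<close>, which all share \<open>C\<close>.\<close>

lemma connectedin_mult_closure:
  assumes C: "connectedin (zariski N) C" and D: "connectedin (zariski N) D"
    and "1\<^sub>m N \<in> D" "C \<noteq> {}"
  shows "connectedin (zariski N) {c * d | c d. c \<in> C \<and> d \<in> D}"
proof -
  have Cc: "C \<subseteq> carrier_mat N N" and Dc: "D \<subseteq> carrier_mat N N"
    using connectedin_subset_topspace[OF C] connectedin_subset_topspace[OF D] by (auto simp: topspace_zariski)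
  have con: "connectedin (zariski N) (C \<union> (*) c ` D)" if "c \<in> C" for c
  proof (rule connectedin_Un[OF C])
    show "connectedin (zariski N) ((*) c ` D)"
      using that Cc by (intro connectedin_regular_image regular_map_mult regular_map_id regular_map_const D) auto
    have "c * 1\<^sub>m N = c" using that Cc by auto
    then show "C \<inter> (*) c ` D \<noteq> {}" using that assms(3) by (metis IntI empty_iff image_eqI)
  qed
  have "connectedin (zariski N) (\<Union>c\<in>C. C \<union> (*) c ` D)"
    by (rule connectedin_Union) (use con assms(4) in auto)
  moreover have "c = c * 1\<^sub>m N" if "c \<in> C" for c using that Cc by auto
  then have "(\<Union>c\<in>C. C \<union> (*) c ` D) = {c * d | c d. c \<in> C \<and> d \<in> D}"
    using assms(3) by blast
  ultimately show ?thesis by simp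
qed

text \<open>As \<open>S\<close> contains the inverses of its elements, the subgroup is the union of
  the sets \<open>P k\<close> of products of k + 1 factors from \<open>S\<close>; these are
  connected and share the identity.\<close>

lemma connectedin_generate:
  assumes S: "connectedin (zariski N) S" "S \<subseteq> carrier (SO N)" "1\<^sub>m N \<in> S"
    and inv: "\<And>s. s \<in> S \<Longrightarrow> transpose_mat s \<in> S"
  shows "connectedin (zariski N) (generate (SO N) S)"
proof -
  define P where "P k = ((\<lambda>T. {c * d | c d. c \<in> S \<and> d \<in> T}) ^^ k) S" for k
  have P: "connectedin (zariski N) (P k) \<and> 1\<^sub>m N \<in> P k" for k
  proof (induction k)
    case (Suc k)
    have "P (Suc k) = {c * d | c d. c \<in> S \<and> d \<in> P k}" by (simp add: P_def)
    moreover have "1\<^sub>m N * 1\<^sub>m N = (1\<^sub>m N :: 'a mat)" by simp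
    ultimately show ?case using connectedin_mult_closure[OF S(1), of "P k"] Suc S(3)
      by (metis (mono_tags, lifting) emptyE mem_Collect_eq)
  qed (use S in \<open>simp add: P_def\<close>)
  have sub: "P k \<subseteq> generate (SO N) S" for k
  proof (induction k)
    case (Suc k)
    then show ?case by (auto simp: P_def intro: generate.eng[of _ "SO N", simplified] generate.incl)
  qed (auto simp: P_def generate.incl)
  \<comment> \<open>Products of k + 1 and of l + 1 factors have k + l + 2 factors, which is level
    \<open>Suc (k + l)\<close>.\<close>
  have mul: "c * d \<in> P (Suc (k + l))" if "c \<in> P k" "d \<in> P l" for c d k l
    using that
  proof (induction k arbitrary: c)
    case (Suc k)
    then obtain a b where ab: "c = a * b" "a \<in> S" "b \<in> P k" by (auto simp: P_def)
    have "P j \<subseteq> carrier_mat N N" for j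
      using P[of j] connectedin_subset_topspace by (fastforce simp: topspace_zariski)
    then have "b \<in> carrier_mat N N" "d \<in> carrier_mat N N" 
      using ab Suc.prems by blast+
    moreover have "a \<in> carrier_mat N N" using ab(2) S(2) orthogonal_matricesD(1) by auto
    ultimately have "c * d = a * (b * d)" using ab by simp
    moreover have "b * d \<in> P (Suc (k + l))" using Suc ab by blast
    ultimately show ?case using ab(2) by (auto simp: P_def)
  qed (auto simp: P_def)
  have "x \<in> (\<Union>k. P k)" if "x \<in> generate (SO N) S" for x
    using that
  proof induction
    case one
    then show ?case using P[of 0] by auto
  next
    case (incl h)
    then show ?case by (auto simp: P_def intro!: exI[of _ 0])
  next
    case (inv h)
    then have "inv\<^bsub>SO N\<^esub> h \<in> S" using assms(2,4) inv_SO by (metis subsetD)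
    then show ?case by (auto simp: P_def intro!: exI[of _ 0])
  next
    case (eng h1 h2)
    then show ?case using mul by (simp, blast)
  qed
  then have "generate (SO N) S = (\<Union>k. P k)" using sub by blast
  moreover have "connectedin (zariski N) (\<Union>k. P k)"
    by (rule connectedin_Union) (use P in auto)
  ultimately show ?thesis by simp
qed

lemma subgroup_SO_D:
  assumes "subgroup H (SO N)"
  shows "h \<in> H \<Longrightarrow> h \<in> orthogonal_matrices N" "h \<in> H \<Longrightarrow> h \<in> carrier_mat N N"
    "h \<in> H \<Longrightarrow> transpose_mat h \<in> H" "1\<^sub>m N \<in> H" "g \<in> H \<Longrightarrow> h \<in> H \<Longrightarrow> g * h \<in> H" "h \<in> H \<Longrightarrow> det h = 1"
    "h \<in> H \<Longrightarrow> h \<in> carrier (SO N)"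
proof -
  show 1: "h \<in> H \<Longrightarrow> h \<in> orthogonal_matrices N" for h using subgroup.mem_carrier[OF assms] by simp
  then show "h \<in> H \<Longrightarrow> h \<in> carrier_mat N N" using orthogonal_matricesD by blast
  show c: "h \<in> H \<Longrightarrow> h \<in> carrier (SO N)" using subgroup.mem_carrier[OF assms] by simp
  then show "h \<in> H \<Longrightarrow> transpose_mat h \<in> H" using subgroup.m_inv_closed[OF assms] inv_SO by metis
  show "1\<^sub>m N \<in> H" using subgroup.one_closed[OF assms] by simp
  show "g \<in> H \<Longrightarrow> h \<in> H \<Longrightarrow> g * h \<in> H" using subgroup.m_closed[OF assms] by simp
  show "h \<in> H \<Longrightarrow> det h = 1" using subgroup.mem_carrier[OF assms] by simp
qed

lemma transpose_transpose_mult4: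
  fixes a b :: "'k::field mat"
  assumes "a \<in> carrier_mat N N" "b \<in> carrier_mat N N"
  shows "transpose_mat (a * b * transpose_mat a * transpose_mat b) = b * a * transpose_mat b * transpose_mat a"
  using assms by (simp add: transpose_mult[of _ N N _ N] mult_carrier_mat[of _ N N _ N]
      assoc_mult_mat[of _ N N _ N _ N] del: assoc_mult_mat)

text \<open>For a fixed second entry the commutators are the image of \<open>H\<close> under a
  regular map, and all these images contain 1. The inverse of a commutator is the commutator in the
  opposite order, so the generating set is closed under inverses.\<close>

lemma connectedin_derived:
  fixes H :: "'k::field mat set"
  assumes H: "subgroup H (SO N)" and con: "connectedin (zariski N) H"
  shows "connectedin (zariski N) (derived (SO N) H)"
proof -
  note HD = subgroup_SO_D[OF H]
  let ?S = "\<Union>h1 \<in> H. \<Union>h2 \<in> H. {h1 * h2 * transpose_mat h1 * transpose_mat h2}"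
  have S: "derived_set (SO N) H = ?S" using HD(7) by (auto simp: inv_SO simp del: SO_simps(3))
  have oneH: "1\<^sub>m N * h2 * transpose_mat (1\<^sub>m N) * transpose_mat h2 = 1\<^sub>m N" if "h2 \<in> H" for h2
    using HD(1)[OF that] orthogonal_matricesD[of h2 N] by simp
  show ?thesis unfolding derived_def S
  proof (rule connectedin_generate)
    have "?S = \<Union> ((\<lambda>h2. (\<lambda>h1. h1 * h2 * transpose_mat h1 * transpose_mat h2) ` H) ` H)" by auto
    moreover have "connectedin (zariski N) \<dots>"
    proof (rule connectedin_Union)
      fix T assume "T \<in> (\<lambda>h2. (\<lambda>h1. h1 * h2 * transpose_mat h1 * transpose_mat h2) ` H) ` H"
      then obtain h2 where h2: "h2 \<in> H" "T = (\<lambda>h1. h1 * h2 * transpose_mat h1 * transpose_mat h2) ` H" by auto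
      show "connectedin (zariski N) T" unfolding h2(2) using HD(2)[OF h2(1)]
        by (intro connectedin_regular_image regular_map_mult regular_map_transpose regular_map_id
            regular_map_const con) auto
    next
      have "1\<^sub>m N \<in> (\<lambda>h1. h1 * h2 * transpose_mat h1 * transpose_mat h2) ` H" if "h2 \<in> H" for h2
        by (rule image_eqI[where x = "1\<^sub>m N"]) (simp_all only: oneH[OF that] HD(4))
      then show "\<Inter> ((\<lambda>h2. (\<lambda>h1. h1 * h2 * transpose_mat h1 * transpose_mat h2) ` H) ` H) \<noteq> {}" by auto
    qed
    ultimately show "connectedin (zariski N) ?S" by simp
    show "?S \<subseteq> carrier (SO N)"
      by (intro UN_least; simp only: insert_subset empty_subsetI simp_thms; intro HD(7) HD(5) HD(3); assumption)
    have "(1\<^sub>m N :: 'k mat) \<in> {1\<^sub>m N * 1\<^sub>m N * transpose_mat (1\<^sub>m N) * transpose_mat (1\<^sub>m N)}"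
      unfolding oneH[OF HD(4)] by (rule singletonI)
    then show "1\<^sub>m N \<in> ?S" by (rule UN_I[OF HD(4) UN_I[OF HD(4)]])
  next
    fix s assume "s \<in> ?S"
    then obtain a b where ab: "a \<in> H" "b \<in> H" "s = a * b * transpose_mat a * transpose_mat b" by auto
    have "transpose_mat s \<in> {b * a * transpose_mat b * transpose_mat a}"
      unfolding ab(3) transpose_transpose_mult4[OF HD(2)[OF ab(1)] HD(2)[OF ab(2)]] by (rule singletonI)
    then show "transpose_mat s \<in> ?S" by (rule UN_I[OF ab(2) UN_I[OF ab(1)]])
  qed
qed

section \<open>Subspaces of coordinate space and the existence of minimal ones\<close>

definition subspace_vec :: "nat \<Rightarrow> 'k::field vec set \<Rightarrow> bool" where
  "subspace_vec N W \<longleftrightarrow> W \<subseteq> carrier_vec N \<and> 0\<^sub>v N \<in> W \<and> (\<forall>x\<in>W. \<forall>y\<in>W. x + y \<in> W) \<and>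
     (\<forall>c. \<forall>x\<in>W. c \<cdot>\<^sub>v x \<in> W)"

lemma subspace_vecD:
  assumes "subspace_vec N W"
  shows "x \<in> W \<Longrightarrow> x \<in> carrier_vec N" "0\<^sub>v N \<in> W" "x \<in> W \<Longrightarrow> y \<in> W \<Longrightarrow> x + y \<in> W"
    "x \<in> W \<Longrightarrow> c \<cdot>\<^sub>v x \<in> W" "x \<in> W \<Longrightarrow> y \<in> W \<Longrightarrow> x - y \<in> W"
proof -
  show c: "x \<in> W \<Longrightarrow> x \<in> carrier_vec N" "0\<^sub>v N \<in> W" "x \<in> W \<Longrightarrow> y \<in> W \<Longrightarrow> x + y \<in> W"
    "x \<in> W \<Longrightarrow> c \<cdot>\<^sub>v x \<in> W" for x y c using assms by (auto simp: subspace_vec_def)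
  assume xy: "x \<in> W" "y \<in> W"
  have "x - y = x + (-1) \<cdot>\<^sub>v y" using c(1)[OF xy(1)] c(1)[OF xy(2)] by auto
  then show "x - y \<in> W" using c xy by metis
qed

lemma subspace_vec_cancel:
  assumes W: "subspace_vec N W" and "c \<noteq> 0" "c \<cdot>\<^sub>v x \<in> W" "x \<in> carrier_vec N"
  shows "x \<in> W"
proof -
  have "x = inverse c \<cdot>\<^sub>v (c \<cdot>\<^sub>v x)" using assms by (simp add: smult_smult_assoc)
  then show ?thesis using subspace_vecD(4)[OF W assms(3)] by metis
qed

text \<open>The number of pivots is the dimension; only its monotonicity is needed.\<close>

definition pivots :: "nat \<Rightarrow> 'k::field vec set \<Rightarrow> nat set" where
  "pivots N W = {i. i < N \<and> (\<exists>w\<in>W. w $ i \<noteq> 0 \<and> (\<forall>j. i < j \<longrightarrow> j < N \<longrightarrow> w $ j = 0))}"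

lemma finite_pivots [simp]: "finite (pivots N W)"
  by (rule finite_subset[of _ "{..<N}"]) (auto simp: pivots_def)

lemma pivots_mono: "W \<subseteq> W' \<Longrightarrow> pivots N W \<subseteq> pivots N W'"
  by (fastforce simp: pivots_def)

text \<open>Gaussian elimination from the last coordinate downwards: a vector of \<open>W'\<close>
  whose last nonzero entry is at \<open>n\<close> is reduced by a vector of \<open>W\<close> with
  pivot \<open>n\<close>, and the remainder lies in \<open>W\<close> by induction.\<close>

lemma subspace_eqI_pivots:
  assumes W: "subspace_vec N W" and W': "subspace_vec N W'" and sub: "W \<subseteq> W'"
    and piv: "pivots N W = pivots N W'"
  shows "W = W'"
proof -
  have "w \<in> W" if "w \<in> W'" "\<forall>j. n \<le> j \<longrightarrow> j < N \<longrightarrow> w $ j = 0" for w n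
    using that
  proof (induction n arbitrary: w)
    case 0
    then have "w = 0\<^sub>v N" using subspace_vecD(1)[OF W'] by auto
    then show ?case using subspace_vecD(2)[OF W] by simp
  next
    case (Suc n)
    show ?case
    proof (cases "n < N \<and> w $ n \<noteq> 0")
      case False
      have "\<forall>j. n \<le> j \<longrightarrow> j < N \<longrightarrow> w $ j = 0"
        using Suc.prems(2) False by (metis Suc_leI le_eq_less_or_eq)
      then show ?thesis using Suc by blast
    next
      case True
      then have "n \<in> pivots N W'" using Suc.prems by (auto simp: pivots_def)
      then have "n \<in> pivots N W" using piv by simp
      then obtain u where u: "u \<in> W" "u $ n \<noteq> 0" "\<forall>j. n < j \<longrightarrow> j < N \<longrightarrow> u $ j = 0"
        by (auto simp: pivots_def)
      let ?c = "w $ n / u $ n"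
      have car: "w \<in> carrier_vec N" "u \<in> carrier_vec N"
        using Suc.prems u subspace_vecD(1)[OF W'] sub by auto
      have "w - ?c \<cdot>\<^sub>v u \<in> W"
      proof (rule Suc.IH)
        show "w - ?c \<cdot>\<^sub>v u \<in> W'"
          using Suc.prems(1) u(1) sub subspace_vecD[OF W'] by blast
        show "\<forall>j. n \<le> j \<longrightarrow> j < N \<longrightarrow> (w - ?c \<cdot>\<^sub>v u) $ j = 0"
        proof (intro allI impI)
          fix j assume j: "n \<le> j" "j < N"
          show "(w - ?c \<cdot>\<^sub>v u) $ j = 0"
            using j car u Suc.prems(2) by (cases "j = n") auto
        qed
      qed
      then have "w - ?c \<cdot>\<^sub>v u + ?c \<cdot>\<^sub>v u \<in> W" using subspace_vecD[OF W] u(1) by blast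
      moreover have "w - ?c \<cdot>\<^sub>v u + ?c \<cdot>\<^sub>v u = w" using car by auto
      ultimately show ?thesis by simp
    qed
  qed
  from this[of _ N] show ?thesis using sub by auto
qed

text \<open>An inclusion of subspaces with equally many pivots is an equality, so a member of
  \<open>F\<close> with the fewest pivots is minimal.\<close>

lemma minimal_subspace_exists:
  assumes "W0 \<in> F" "\<And>W. W \<in> F \<Longrightarrow> subspace_vec N W"
  obtains W where "W \<in> F" "\<And>W'. W' \<in> F \<Longrightarrow> W' \<subseteq> W \<Longrightarrow> W' = W"
proof -
  obtain W where W: "W \<in> F" "\<And>W'. W' \<in> F \<Longrightarrow> card (pivots N W) \<le> card (pivots N W')"
    using assms(1) ex_has_least_nat[of "\<lambda>W. W \<in> F" W0 "\<lambda>W. card (pivots N W)"] by blast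
  have "W' = W" if "W' \<in> F" "W' \<subseteq> W" for W'
    using that W assms(2) subspace_eqI_pivots pivots_mono card_seteq finite_pivots by metis
  then show ?thesis using that W(1) by blast
qed

section \<open>Polynomials evaluated at a matrix and split into linear factors\<close>

abbreviation shift_apply :: "'k::field mat \<Rightarrow> 'k \<Rightarrow> 'k vec \<Rightarrow> 'k vec" where
  "shift_apply A a w \<equiv> A *\<^sub>v w - a \<cdot>\<^sub>v w"

definition poly_apply :: "nat \<Rightarrow> 'k::field mat \<Rightarrow> 'k poly \<Rightarrow> 'k vec \<Rightarrow> 'k vec" where
  "poly_apply N A p v = vec N (\<lambda>r. \<Sum>k\<le>degree p. coeff p k * ((A ^\<^sub>m k *\<^sub>v v) $ r))"

lemma poly_apply_index:
  assumes "r < N" "degree p \<le> d"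
  shows "poly_apply N A p v $ r = (\<Sum>k\<le>d. coeff p k * ((A ^\<^sub>m k *\<^sub>v v) $ r))"
proof -
  have "(\<Sum>k\<le>d. coeff p k * ((A ^\<^sub>m k *\<^sub>v v) $ r)) = (\<Sum>k\<le>degree p. coeff p k * ((A ^\<^sub>m k *\<^sub>v v) $ r))"
    using assms(2) by (intro sum.mono_neutral_right) (auto simp: coeff_eq_0)
  then show ?thesis using assms(1) by (simp add: poly_apply_def)
qed

lemma pow_mat_Suc_left: "A \<in> carrier_mat N N \<Longrightarrow> A ^\<^sub>m Suc k = A * A ^\<^sub>m k"
proof (induction k)
  case (Suc k)
  then have "A ^\<^sub>m Suc (Suc k) = (A * A ^\<^sub>m k) * A" by simp
  also have "\<dots> = A * (A ^\<^sub>m k * A)" by (rule assoc_mult_mat[of _ N N _ N _ N]) (use Suc in auto)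
  finally show ?case by simp
qed simp

lemma poly_apply_linear_factor:
  assumes A: "A \<in> carrier_mat N N" and v: "v \<in> carrier_vec N"
  shows "poly_apply N A ([:-a, 1:] * q) v = shift_apply A a (poly_apply N A q v)"
proof (rule eq_vecI)
  let ?d = "degree q"
  let ?u = "\<lambda>k r. (A ^\<^sub>m k *\<^sub>v v) $ r"
  fix r assume "r < dim_vec (shift_apply A a (poly_apply N A q v))"
  then have r: "r < N" using A by (simp add: poly_apply_def)
  have deg: "degree ([:-a, 1:] * q) \<le> Suc ?d"
    using degree_mult_le[of "[:-a, 1:]" q] by (simp add: le_trans)
  have co: "coeff ([:-a, 1:] * q) k = (case k of 0 \<Rightarrow> 0 | Suc l \<Rightarrow> coeff q l) - a * coeff q k" for k
    by (simp add: coeff_pCons split: nat.split)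
  have pa: "poly_apply N A q v \<in> carrier_vec N" by (simp add: poly_apply_def)
  have "poly_apply N A ([:-a, 1:] * q) v $ r = (\<Sum>k\<le>Suc ?d. ((case k of 0 \<Rightarrow> 0 | Suc l \<Rightarrow> coeff q l) - a * coeff q k) * ?u k r)"
    unfolding poly_apply_index[OF r deg] co ..
  also have "\<dots> = (\<Sum>k\<le>Suc ?d. (case k of 0 \<Rightarrow> 0 | Suc l \<Rightarrow> coeff q l) * ?u k r) - a * (\<Sum>k\<le>Suc ?d. coeff q k * ?u k r)"
    by (simp add: left_diff_distrib sum_subtractf sum_distrib_left mult.assoc del: sum.atMost_Suc)
  also have "(\<Sum>k\<le>Suc ?d. coeff q k * ?u k r) = poly_apply N A q v $ r"
    by (rule poly_apply_index[symmetric]) (use r in auto)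
  also have "(\<Sum>k\<le>Suc ?d. (case k of 0 \<Rightarrow> 0 | Suc l \<Rightarrow> coeff q l) * ?u k r) = (\<Sum>l\<le>?d. coeff q l * ?u (Suc l) r)"
    by (subst sum.atMost_Suc_shift) simp
  also have "\<dots> = (\<Sum>l\<le>?d. coeff q l * (\<Sum>j = 0..<N. A $$ (r, j) * ?u l j))"
  proof (intro sum.cong refl arg_cong2[of _ _ _ _ "(*)"])
    fix l
    have "A ^\<^sub>m Suc l *\<^sub>v v = A *\<^sub>v (A ^\<^sub>m l *\<^sub>v v)" 
      unfolding pow_mat_Suc_left[OF A] using A v by (intro assoc_mult_mat_vec[of _ N N _ N]) auto
    then show "?u (Suc l) r = (\<Sum>j = 0..<N. A $$ (r, j) * ?u l j)"
      using r A v by (simp add: scalar_prod_def)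
  qed
  also have "\<dots> = (\<Sum>j = 0..<N. A $$ (r, j) * (\<Sum>l\<le>?d. coeff q l * ?u l j))"
    by (simp add: sum_distrib_left, subst sum.swap, simp add: mult.left_commute)
  also have "\<dots> = (\<Sum>j = 0..<N. A $$ (r, j) * poly_apply N A q v $ j)"
    by (intro sum.cong refl) (simp add: poly_apply_def)
  also have "\<dots> = (A *\<^sub>v poly_apply N A q v) $ r"
    using r A pa by (simp add: scalar_prod_def)
  finally show "poly_apply N A ([:-a, 1:] * q) v $ r = shift_apply A a (poly_apply N A q v) $ r"
    using r A pa by simp
qed (use A in \<open>simp add: poly_apply_def\<close>)

text \<open>The first N * N + 1 powers of \<open>A\<close> are linearly dependent, so some nonzero
  polynomial annihilates \<open>A\<close>. Over an algebraically closed field it splits, and its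
  roots form the list.\<close>

lemma shift_annihilator_exists:
  fixes A :: "'k::alg_closed_field mat"
  assumes A: "A \<in> carrier_mat N N"
  shows "\<exists>as. \<forall>v\<in>carrier_vec N. foldr (shift_apply A) as v = 0\<^sub>v N"
proof -
  let ?M = "Suc (N * N)"
  \<comment> \<open>Column \<open>c\<close> lists the entries of the c-th power of \<open>A\<close>.
    The extra zero row makes \<open>R\<close> square with determinant 0, so that a linear dependency
    of the powers appears as a kernel vector.\<close>
  define R where "R = mat ?M ?M (\<lambda>(r, c). if r < N * N then (A ^\<^sub>m c) $$ (r div N, r mod N) else 0)"
  have R: "R \<in> carrier_mat ?M ?M" by (simp add: R_def)
  have "det R = 0"
  proof -
    have "det R = (\<Sum>j<?M. R $$ (N * N, j) * cofactor R (N * N) j)"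
      by (rule laplace_expansion_row[OF R]) simp
    also have "\<dots> = 0" by (intro sum.neutral) (simp add: R_def)
    finally show ?thesis .
  qed
  then obtain x where x: "x \<in> carrier_vec ?M" "x \<noteq> 0\<^sub>v ?M" "R *\<^sub>v x = 0\<^sub>v ?M"
    using det_0_iff_vec_prod_zero[OF R] by blast
  define p where "p = Poly (list_of_vec x)"
  have cp: "coeff p k = (if k < ?M then x $ k else 0)" for k
    using x(1) by (auto simp: p_def nth_default_def list_of_vec_index)
  have degp: "degree p \<le> N * N" by (rule degree_le) (simp add: cp)
  have "p \<noteq> 0"
  proof
    assume "p = 0"
    then have "x $ k = 0" if "k < ?M" for k using cp[of k] that by simp
    then have "x = 0\<^sub>v ?M" using x(1) by auto
    then show False using x(2) by simp
  qed
  then obtain as0 where as0: "p = smult (lead_coeff p) (\<Prod>a\<in>#as0. [:-a, 1:])"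
    using alg_closed_imp_factorization by blast
  obtain as where as: "mset as = as0" using ex_mset by blast
  have ann: "(\<Sum>c<?M. x $ c * (A ^\<^sub>m c) $$ (i, j)) = 0" if "i < N" "j < N" for i j
  proof -
    have "i * N + j < i * N + N" using that by simp
    also have "\<dots> \<le> N * N" using that by (metis Suc_leI add.commute mult_Suc mult_le_mono1)
    finally have lt: "i * N + j < N * N" .
    have "(R *\<^sub>v x) $ (i * N + j) = (\<Sum>c = 0..<?M. (A ^\<^sub>m c) $$ (i, j) * x $ c)"
      using lt x(1) that by (simp add: R_def scalar_prod_def)
    then show ?thesis using x(3) lt by (simp add: mult.commute atLeast0LessThan)
  qed
  have pv: "poly_apply N A p v = 0\<^sub>v N" if v: "v \<in> carrier_vec N" for v
  proof (rule eq_vecI)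
    fix i assume "i < dim_vec (0\<^sub>v N :: 'k vec)"
    then have i: "i < N" by simp
    have "poly_apply N A p v $ i = (\<Sum>k\<le>N * N. coeff p k * ((A ^\<^sub>m k *\<^sub>v v) $ i))"
      by (rule poly_apply_index[OF i degp])
    also have "\<dots> = (\<Sum>k<?M. x $ k * (\<Sum>j = 0..<N. (A ^\<^sub>m k) $$ (i, j) * v $ j))"
      using i v A by (intro sum.cong) (auto simp: cp scalar_prod_def pow_carrier_mat[THEN carrier_matD(1)])
    also have "\<dots> = (\<Sum>j = 0..<N. (\<Sum>k<?M. x $ k * (A ^\<^sub>m k) $$ (i, j)) * v $ j)"
      by (simp only: sum_distrib_left sum_distrib_right, subst sum.swap, simp only: mult.assoc)
    also have "\<dots> = 0" using ann i by (intro sum.neutral) auto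
    finally show "poly_apply N A p v $ i = 0\<^sub>v N $ i" using i by simp
  qed (simp add: poly_apply_def)
  have prod: "poly_apply N A (smult c (\<Prod>a\<leftarrow>bs. [:-a, 1:])) v = c \<cdot>\<^sub>v foldr (shift_apply A) bs v"
    if v: "v \<in> carrier_vec N" for v bs c
  proof (induction bs)
    case Nil
    then show ?case using v A by (intro eq_vecI) (auto simp: poly_apply_def)
  next
    case (Cons a bs)
    have car: "foldr (shift_apply A) bs v \<in> carrier_vec N"
      using v A by (induction bs) auto
    have "smult c (\<Prod>a\<leftarrow>a # bs. [:-a, 1:]) = [:-a, 1:] * smult c (\<Prod>a\<leftarrow>bs. [:-a, 1:])" by simp
    then have "poly_apply N A (smult c (\<Prod>a\<leftarrow>a # bs. [:-a, 1:])) v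
       = shift_apply A a (c \<cdot>\<^sub>v foldr (shift_apply A) bs v)"
      unfolding Cons[symmetric] by (simp only: poly_apply_linear_factor[OF A v])
    also have "\<dots> = c \<cdot>\<^sub>v foldr (shift_apply A) (a # bs) v"
      using car A mult_mat_vec[OF A car]
      by (intro eq_vecI) (auto simp: algebra_simps)
    finally show ?case .
  qed
  have "foldr (shift_apply A) as v = 0\<^sub>v N" if v: "v \<in> carrier_vec N" for v
  proof -
    have "p = smult (lead_coeff p) (\<Prod>a\<leftarrow>as. [:-a, 1:])"
      using as0 as by (metis mset_map prod_mset_prod_list)
    then have z: "lead_coeff p \<cdot>\<^sub>v foldr (shift_apply A) as v = 0\<^sub>v N"
      using prod[OF v] pv[OF v] by metis
    have car: "foldr (shift_apply A) as v \<in> carrier_vec N"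
      using v A by (induction as) auto
    have "foldr (shift_apply A) as v = inverse (lead_coeff p) \<cdot>\<^sub>v 0\<^sub>v N"
      unfolding z[symmetric] using \<open>p \<noteq> 0\<close> car by (simp add: smult_smult_assoc)
    also have "\<dots> = 0\<^sub>v N" by (intro eq_vecI) auto
    finally show ?thesis .
  qed
  then show ?thesis by blast
qed

section \<open>Eigenvectors modulo a stable subspace\<close>

text \<open>Here \<open>a - b \<in> W\<close> plays the role of equality in the quotient by
  \<open>W\<close>; these rules stand in for quotient spaces.\<close>

lemma congruent_add:
  assumes "subspace_vec N W" "a - b \<in> W" "c - d \<in> W"
    "a \<in> carrier_vec N" "b \<in> carrier_vec N" "c \<in> carrier_vec N" "d \<in> carrier_vec N"
  shows "(a + c) - (b + d) \<in> W"
proof -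
  have "(a + c) - (b + d) = (a - b) + (c - d)" using assms(4-7) by auto
  then show ?thesis using subspace_vecD(3)[OF assms(1-3)] by simp
qed

lemma congruent_smult:
  assumes "subspace_vec N W" "a - b \<in> W" "a \<in> carrier_vec N" "b \<in> carrier_vec N"
  shows "c \<cdot>\<^sub>v a - c \<cdot>\<^sub>v b \<in> W"
proof -
  have "c \<cdot>\<^sub>v a - c \<cdot>\<^sub>v b = c \<cdot>\<^sub>v (a - b)" using assms(3,4) by (auto simp: right_diff_distrib)
  then show ?thesis using subspace_vecD(4)[OF assms(1,2)] by simp
qed

lemma congruent_trans:
  assumes "subspace_vec N W" "a - b \<in> W" "b - c \<in> W"
    "a \<in> carrier_vec N" "b \<in> carrier_vec N" "c \<in> carrier_vec N"
  shows "a - c \<in> W"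
proof -
  have "a - c = (a - b) + (b - c)" using assms(4-6) by auto
  then show ?thesis using subspace_vecD(3)[OF assms(1-3)] by simp
qed

lemma congruent_sym:
  assumes "subspace_vec N W" "a - b \<in> W" "a \<in> carrier_vec N" "b \<in> carrier_vec N"
  shows "b - a \<in> W"
proof -
  have "b - a = (-1) \<cdot>\<^sub>v (a - b)" using assms(3,4) by auto
  then show ?thesis using subspace_vecD(4)[OF assms(1,2)] by simp
qed

lemma congruent_apply:
  fixes A :: "'k::field mat"
  assumes "\<And>w. w \<in> W \<Longrightarrow> A *\<^sub>v w \<in> W" "a - b \<in> W" 
    "A \<in> carrier_mat N N" "a \<in> carrier_vec N" "b \<in> carrier_vec N"
  shows "A *\<^sub>v a - A *\<^sub>v b \<in> W"
  using assms(1)[OF assms(2)] mult_minus_distrib_mat_vec[OF assms(3-5)] by simp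

lemma congruent_eigenvalue_unique:
  assumes W: "subspace_vec N W" and "x - a \<cdot>\<^sub>v w \<in> W" "x - b \<cdot>\<^sub>v w \<in> W"
    "x \<in> carrier_vec N" "w \<in> carrier_vec N" "w \<notin> W"
  shows "a = b"
proof (rule ccontr)
  assume ne: "a \<noteq> b"
  have "b \<cdot>\<^sub>v w - a \<cdot>\<^sub>v w \<in> W" 
    using congruent_trans[OF W congruent_sym[OF W assms(3)] assms(2)] assms by simp
  moreover have "b \<cdot>\<^sub>v w - a \<cdot>\<^sub>v w = (b - a) \<cdot>\<^sub>v w" using assms(5) by (auto simp: left_diff_distrib)
  ultimately show False using subspace_vec_cancel[OF W, of "b - a" w] ne assms by simp
qed

text \<open>On a vector with eigenvalue \<open>a\<close> modulo \<open>W\<close> the annihilating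
  product of shifts acts as multiplication by the product of the differences a - b, where
  \<open>b\<close> runs through the list. This product must vanish, so \<open>a\<close> is one of
  the \<open>b\<close>.\<close>

lemma finite_eigenvalues_mod:
  fixes A :: "'k::alg_closed_field mat"
  assumes A: "A \<in> carrier_mat N N" and W: "subspace_vec N W" and st: "\<And>w. w \<in> W \<Longrightarrow> A *\<^sub>v w \<in> W"
  shows "finite {a. \<exists>w \<in> carrier_vec N. w \<notin> W \<and> A *\<^sub>v w - a \<cdot>\<^sub>v w \<in> W}"
proof -
  obtain as where as: "\<forall>v\<in>carrier_vec N. foldr (shift_apply A) as v = 0\<^sub>v N"
    using shift_annihilator_exists[OF A] by blast
  have "a \<in> set as" if w: "w \<in> carrier_vec N" "w \<notin> W" and ev: "A *\<^sub>v w - a \<cdot>\<^sub>v w \<in> W" for a w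
  proof -
    have car: "foldr (shift_apply A) bs w \<in> carrier_vec N" for bs
      using w A by (induction bs) auto
    have "foldr (shift_apply A) bs w - (\<Prod>b\<leftarrow>bs. a - b) \<cdot>\<^sub>v w \<in> W" for bs
    proof (induction bs)
      case Nil
      have "w - 1 \<cdot>\<^sub>v w = 0\<^sub>v N" using w by auto
      then show ?case using subspace_vecD(2)[OF W] by simp
    next
      case (Cons b bs)
      let ?u = "foldr (shift_apply A) bs w" and ?c = "\<Prod>b\<leftarrow>bs. a - b"
      have "A *\<^sub>v ?u - A *\<^sub>v (?c \<cdot>\<^sub>v w) \<in> W"
        by (rule congruent_apply[OF st Cons A]) (use car w in auto)
      moreover have "A *\<^sub>v (?c \<cdot>\<^sub>v w) - ?c \<cdot>\<^sub>v (a \<cdot>\<^sub>v w) \<in> W"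
        unfolding mult_mat_vec[OF A w(1)] by (rule congruent_smult[OF W ev]) (use A w in auto)
      ultimately have 1: "A *\<^sub>v ?u - ?c \<cdot>\<^sub>v (a \<cdot>\<^sub>v w) \<in> W"
        using congruent_trans[OF W] A car w by (meson mult_mat_vec_carrier smult_carrier_vec)
      have 2: "(-b) \<cdot>\<^sub>v ?u - (-b) \<cdot>\<^sub>v (?c \<cdot>\<^sub>v w) \<in> W"
        by (rule congruent_smult[OF W Cons]) (use car w in auto)
      have "(A *\<^sub>v ?u + (-b) \<cdot>\<^sub>v ?u) - (?c \<cdot>\<^sub>v (a \<cdot>\<^sub>v w) + (-b) \<cdot>\<^sub>v (?c \<cdot>\<^sub>v w)) \<in> W"
        by (rule congruent_add[OF W 1 2]) (use A car w in auto)
      moreover have "A *\<^sub>v ?u + (-b) \<cdot>\<^sub>v ?u = shift_apply A b ?u" using A car by auto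
      moreover have "?c \<cdot>\<^sub>v (a \<cdot>\<^sub>v w) + (-b) \<cdot>\<^sub>v (?c \<cdot>\<^sub>v w) = (\<Prod>b\<leftarrow>b # bs. a - b) \<cdot>\<^sub>v w"
        using w by (auto simp: algebra_simps)
      ultimately show ?case by simp
    qed
    from this[of as] have "0\<^sub>v N - (\<Prod>b\<leftarrow>as. a - b) \<cdot>\<^sub>v w \<in> W" using as w by simp
    then have "(\<Prod>b\<leftarrow>as. a - b) \<cdot>\<^sub>v w - 0\<^sub>v N \<in> W" by (rule congruent_sym[OF W]) (use w in auto)
    then have "(\<Prod>b\<leftarrow>as. a - b) \<cdot>\<^sub>v w \<in> W" using w by simp
    then have "(\<Prod>b\<leftarrow>as. a - b) = 0" using subspace_vec_cancel[OF W] w by blast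
    then show ?thesis by (auto simp: prod_list_zero_iff)
  qed
  then have "{a. \<exists>w \<in> carrier_vec N. w \<notin> W \<and> A *\<^sub>v w - a \<cdot>\<^sub>v w \<in> W} \<subseteq> set as" by blast
  then show ?thesis using finite_subset by blast
qed

text \<open>Apply the annihilating shifts to \<open>v\<close> one after the other: the vectors stay
  in \<open>W\<close> and end in \<open>W0\<close>, and the last one before the sequence drops into
  \<open>W0\<close> is the eigenvector.\<close>

lemma eigenvector_mod_exists:
  fixes A :: "'k::alg_closed_field mat"
  assumes A: "A \<in> carrier_mat N N" and W: "subspace_vec N W" "\<And>w. w \<in> W \<Longrightarrow> A *\<^sub>v w \<in> W"
    and W0: "subspace_vec N W0" and v: "v \<in> W" "v \<notin> W0"
  obtains w a where "w \<in> W" "w \<notin> W0" "A *\<^sub>v w - a \<cdot>\<^sub>v w \<in> W0"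
proof -
  obtain as where as: "\<forall>v\<in>carrier_vec N. foldr (shift_apply A) as v = 0\<^sub>v N"
    using shift_annihilator_exists[OF A] by blast
  then have "foldr (shift_apply A) as v \<in> W0" using v subspace_vecD[OF W(1)] subspace_vecD(2)[OF W0] by simp
  then have "\<exists>w a. w \<in> W \<and> w \<notin> W0 \<and> A *\<^sub>v w - a \<cdot>\<^sub>v w \<in> W0"
  proof (induction as)
    case (Cons a as)
    have "foldr (shift_apply A) as v \<in> W"
      using v W(2) subspace_vecD[OF W(1)] by (induction as) auto
    then show ?case using Cons by auto
  qed (use v in simp)
  then show thesis using that by blast
qed

section \<open>Closed eigenvalue conditions and the Lie-Kolchin argument\<close>

definition perp :: "nat \<Rightarrow> 'k::field vec set \<Rightarrow> 'k vec set" where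
  "perp N Q = {x \<in> carrier_vec N. \<forall>q\<in>Q. x \<bullet> q = 0}"

lemma subspace_perp: "Q \<subseteq> carrier_vec N \<Longrightarrow> subspace_vec N (perp N Q)"
  unfolding subspace_vec_def perp_def
  by (auto simp: add_scalar_prod_distrib[where n = N] subset_iff)

lemma regular_apply:
  assumes \<psi>: "regular_map N \<psi>" and w: "w \<in> carrier_vec N" "q \<in> carrier_vec N"
  shows "regular N (\<lambda>A. (\<psi> A *\<^sub>v w) \<bullet> q)"
proof -
  have "regular N (\<lambda>A. \<Sum>i = 0..<N. (\<Sum>j = 0..<N. \<psi> A $$ (i, j) * w $ j) * q $ i)"
    using \<psi> by (intro regular_sum regular_mult) (auto simp: regular_map_def)
  then show ?thesis
  proof (rule regular_cong)
    fix A :: "'a mat" assume "A \<in> carrier_mat N N"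
    then have "\<psi> A \<in> carrier_mat N N" using \<psi> by (auto simp: regular_map_def)
    then show "(\<psi> A *\<^sub>v w) \<bullet> q = (\<Sum>i = 0..<N. (\<Sum>j = 0..<N. \<psi> A $$ (i, j) * w $ j) * q $ i)"
      using w by (auto simp: scalar_prod_def)
  qed
qed

text \<open>This is the reason for writing subspaces as orthogonal complements: membership in
  \<open>perp N Q\<close> is a family of equations \<open>x \<bullet> q = 0\<close>, which are
  polynomial in the entries of \<open>A\<close>.\<close>

lemma closedin_eigen_perp:
  assumes \<psi>: "regular_map N \<psi>" and w: "w \<in> carrier_vec N" and Q: "Q \<subseteq> carrier_vec N"
  shows "closedin (zariski N) {A \<in> carrier_mat N N. \<psi> A *\<^sub>v w - a \<cdot>\<^sub>v w \<in> perp N Q}"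
proof -
  have "closedin (zariski N) {A \<in> carrier_mat N N. \<forall>q\<in>Q. (\<psi> A *\<^sub>v w) \<bullet> q - (a \<cdot>\<^sub>v w) \<bullet> q = 0}"
    using Q by (intro closedin_zariski_zeros regular_diff regular_apply \<psi> w regular_const) auto
  moreover have "{A \<in> carrier_mat N N. \<psi> A *\<^sub>v w - a \<cdot>\<^sub>v w \<in> perp N Q}
    = {A \<in> carrier_mat N N. \<forall>q\<in>Q. (\<psi> A *\<^sub>v w) \<bullet> q - (a \<cdot>\<^sub>v w) \<bullet> q = 0}"
  proof (intro Collect_cong conj_cong refl)
    fix A :: "'a mat" assume "A \<in> carrier_mat N N"
    then have "\<psi> A \<in> carrier_mat N N" using \<psi> by (auto simp: regular_map_def)
    then have c: "\<psi> A *\<^sub>v w \<in> carrier_vec N" using w by simp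
    then have "(\<psi> A *\<^sub>v w - a \<cdot>\<^sub>v w) \<bullet> q = (\<psi> A *\<^sub>v w) \<bullet> q - (a \<cdot>\<^sub>v w) \<bullet> q" if "q \<in> Q" for q
      using minus_scalar_prod_distrib[of "\<psi> A *\<^sub>v w" N "a \<cdot>\<^sub>v w" q] Q w that by auto
    then show "(\<psi> A *\<^sub>v w - a \<cdot>\<^sub>v w \<in> perp N Q) = (\<forall>q\<in>Q. (\<psi> A *\<^sub>v w) \<bullet> q - (a \<cdot>\<^sub>v w) \<bullet> q = 0)"
      unfolding perp_def using c w by auto
  qed
  ultimately show ?thesis by simp
qed

text \<open>The function \<open>\<mu>\<close> is not known to be regular; it is constant because its level sets are cut out by the
  closed conditions of \<open>closedin_eigen_perp\<close>.\<close>

lemma eigenvalue_constant: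
  assumes H: "connectedin (zariski N) H" and \<psi>: "regular_map N \<psi>" and Q: "Q \<subseteq> carrier_vec N"
    and w: "w \<in> carrier_vec N" "w \<notin> perp N Q"
    and ev: "\<And>g. g \<in> H \<Longrightarrow> \<psi> g *\<^sub>v w - \<mu> g \<cdot>\<^sub>v w \<in> perp N Q"
    and fin: "finite (\<mu> ` H)" and gh: "g \<in> H" "h \<in> H"
  shows "\<mu> g = \<mu> h"
proof -
  let ?C = "\<lambda>a. {A \<in> carrier_mat N N. \<psi> A *\<^sub>v w - a \<cdot>\<^sub>v w \<in> perp N Q}"
  have Hc: "H \<subseteq> carrier_mat N N" using connectedin_subset_topspace[OF H] by (simp add: topspace_zariski)
  have uniq: "a = b" if "A \<in> ?C a" "A \<in> ?C b" for A a b
  proof (rule congruent_eigenvalue_unique[OF subspace_perp[OF Q]])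
    show "\<psi> A *\<^sub>v w \<in> carrier_vec N" using that \<psi> w by (auto simp: regular_map_def)
  qed (use that w in auto)
  have "H \<subseteq> ?C (\<mu> h)"
  proof (rule connectedin_finite_closed_cover[OF H fin])
    show "H \<subseteq> (\<Union>l\<in>\<mu> ` H. ?C l)" using ev Hc by blast
    show "?C l \<inter> ?C m \<inter> H = {}" if "l \<noteq> m" for l m using uniq that by blast
    show "h \<in> ?C (\<mu> h)" using ev gh Hc by blast
  qed (use gh closedin_eigen_perp[OF \<psi> w(1) Q] in auto)
  then have "g \<in> ?C (\<mu> h)" using gh by blast
  moreover have "g \<in> ?C (\<mu> g)" using ev gh Hc by blast
  ultimately show ?thesis using uniq by blast
qed

lemma derived_conjugate:
  assumes H: "subgroup H (SO N :: 'k::field mat monoid)" and g: "g \<in> H" and h: "h \<in> derived (SO N) H"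
  shows "transpose_mat g * h * g \<in> derived (SO N) H"
proof -
  interpret group "SO N :: 'k mat monoid" by (rule group_SO)
  have n: "derived (SO N) H \<lhd> (SO N\<lparr>carrier := H\<rparr>)" by (rule derived_subgroup_is_normal[OF H])
  have "inv\<^bsub>SO N\<lparr>carrier := H\<rparr>\<^esub> g \<otimes>\<^bsub>SO N\<lparr>carrier := H\<rparr>\<^esub> h \<otimes>\<^bsub>SO N\<lparr>carrier := H\<rparr>\<^esub> g \<in> derived (SO N) H"
    by (rule normal.inv_op_closed1[OF n]) (use g h in auto)
  moreover have "inv\<^bsub>SO N\<lparr>carrier := H\<rparr>\<^esub> g = transpose_mat g"
    using m_inv_consistent[OF H g] inv_SO[OF subgroup_SO_D(7)[OF H g]] by simp
  ultimately show ?thesis by simp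
qed

lemma commutator_in_derived:
  assumes H: "subgroup H (SO N :: 'k::field mat monoid)" and "g \<in> H" "h \<in> H"
  shows "g * h * transpose_mat g * transpose_mat h \<in> derived (SO N) H"
proof -
  have "g * h * transpose_mat g * transpose_mat h \<in> derived_set (SO N) H"
    using assms(2,3) subgroup_SO_D(7)[OF H] by (auto simp: inv_SO simp del: SO_simps(3))
  then show ?thesis unfolding derived_def by (rule generate.incl)
qed

lemma mult_mat_vec_cancel_orth:
  assumes "g \<in> orthogonal_matrices N" "x \<in> carrier_vec N"
  shows "transpose_mat g *\<^sub>v (g *\<^sub>v x) = x" "g *\<^sub>v (transpose_mat g *\<^sub>v x) = x"
proof -
  note D = orthogonal_matricesD[OF assms(1)]
  have "transpose_mat g *\<^sub>v (g *\<^sub>v x) = (transpose_mat g * g) *\<^sub>v x" 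
    using D(1) assms(2) by (subst assoc_mult_mat_vec[of _ N N _ N]) auto
  then show "transpose_mat g *\<^sub>v (g *\<^sub>v x) = x" using D(2) assms(2) by simp
  have "g *\<^sub>v (transpose_mat g *\<^sub>v x) = (g * transpose_mat g) *\<^sub>v x" 
    using D(1) assms(2) by (subst assoc_mult_mat_vec[of _ N N _ N]) auto
  then show "g *\<^sub>v (transpose_mat g *\<^sub>v x) = x" using D(3) assms(2) by simp
qed

lemma conj_eigen:
  fixes W :: "'k::field vec set"
  assumes g: "g \<in> orthogonal_matrices N" and h: "h \<in> carrier_mat N N" and x: "x \<in> carrier_vec N"
    and st: "\<And>w. w \<in> W \<Longrightarrow> g *\<^sub>v w \<in> W"
    and ev: "(transpose_mat g * h * g) *\<^sub>v x - c \<cdot>\<^sub>v x \<in> W"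
  shows "h *\<^sub>v (g *\<^sub>v x) - c \<cdot>\<^sub>v (g *\<^sub>v x) \<in> W"
proof -
  have gc: "g \<in> carrier_mat N N" using orthogonal_matricesD[OF g] by blast
  have 1: "(transpose_mat g * h * g) *\<^sub>v x = transpose_mat g *\<^sub>v (h *\<^sub>v (g *\<^sub>v x))"
    using gc h x by (simp add: assoc_mult_mat_vec[of _ N N _ N] mult_carrier_mat[of _ N N _ N])
  have "g *\<^sub>v ((transpose_mat g * h * g) *\<^sub>v x) - g *\<^sub>v (c \<cdot>\<^sub>v x) \<in> W"
    by (rule congruent_apply[OF st ev gc]) (use gc h x 1 in auto)
  then show ?thesis unfolding 1 
    using mult_mat_vec_cancel_orth(2)[OF g, of "h *\<^sub>v (g *\<^sub>v x)"] gc h x mult_mat_vec[OF gc x] by simp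
qed

lemma commutator_rewrite:
  assumes g: "g \<in> orthogonal_matrices N" and h: "(h :: 'k::field mat) \<in> orthogonal_matrices N"
    and x: "x \<in> carrier_vec N"
  shows "(g * h * transpose_mat g * transpose_mat h) *\<^sub>v (h *\<^sub>v (g *\<^sub>v x)) = g *\<^sub>v (h *\<^sub>v x)"
proof -
  have c: "g \<in> carrier_mat N N" "h \<in> carrier_mat N N" using orthogonal_matricesD g h by blast+
  have "(g * h * transpose_mat g * transpose_mat h) *\<^sub>v (h *\<^sub>v (g *\<^sub>v x))
     = g *\<^sub>v (h *\<^sub>v (transpose_mat g *\<^sub>v (transpose_mat h *\<^sub>v (h *\<^sub>v (g *\<^sub>v x)))))"
    using c x by (simp add: assoc_mult_mat_vec[of _ N N _ N] mult_carrier_mat[of _ N N _ N])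
  also have "transpose_mat h *\<^sub>v (h *\<^sub>v (g *\<^sub>v x)) = g *\<^sub>v x"
    by (rule mult_mat_vec_cancel_orth(1)[OF h]) (use c x in simp)
  also have "transpose_mat g *\<^sub>v (g *\<^sub>v x) = x" by (rule mult_mat_vec_cancel_orth(1)[OF g x])
  finally show ?thesis .
qed

text \<open>The Lie-Kolchin theorem on \<open>W1 / perp N Q\<close>. In a minimal stable \<open>W\<close> above \<open>perp N Q\<close> the derived
  subgroup acts by scalars, since the eigenvalues of \<open>g\<inverse> h g\<close> and of \<open>h\<close> agree by connectedness.
  Likewise the scalar by which the commutator of \<open>g\<close> and \<open>h\<close> acts multiplies eigenvalues of \<open>h\<close> to
  eigenvalues of \<open>h\<close>, so it is \<open>1\<close>, and then every element acts by a scalar.\<close>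

lemma lie_kolchin_mod:
  fixes H :: "'k::alg_closed_field mat set"
  assumes "subgroup H (SO N)" "connectedin (zariski N) H" "(derived (SO N) ^^ n) H = {1\<^sub>m N}"
    and Q: "Q \<subseteq> carrier_vec N" and st0: "\<And>h w. h \<in> H \<Longrightarrow> w \<in> perp N Q \<Longrightarrow> h *\<^sub>v w \<in> perp N Q"
    and "subspace_vec N W1" "\<And>h w. h \<in> H \<Longrightarrow> w \<in> W1 \<Longrightarrow> h *\<^sub>v w \<in> W1" "perp N Q \<subset> W1"
  shows "\<exists>v\<in>W1 - perp N Q. \<exists>\<chi>. \<forall>h\<in>H. h *\<^sub>v v - \<chi> h \<cdot>\<^sub>v v \<in> perp N Q"
  using assms(1-3,5-)
proof (induction n arbitrary: H W1)
  case 0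
  then have H1: "H = {1\<^sub>m N}" by (simp only: funpow_0)
  obtain v where v: "v \<in> W1" "v \<notin> perp N Q" using "0.prems"(7) by blast
  have vc: "v \<in> carrier_vec N" using subspace_vecD(1)[OF "0.prems"(5)] v by simp
  have "1\<^sub>m N *\<^sub>v v - 1 \<cdot>\<^sub>v v = 0\<^sub>v N" using vc by auto
  then have "1\<^sub>m N *\<^sub>v v - 1 \<cdot>\<^sub>v v \<in> perp N Q" using subspace_vecD(2)[OF subspace_perp[OF Q]] by simp
  then show ?case using v H1 by (intro bexI[of _ v] exI[of _ "\<lambda>_. 1"]) auto
next
  case (Suc n H W1)
  note H = Suc.prems(1) and con = Suc.prems(2) and st0 = Suc.prems(4) and W1 = Suc.prems(5)
    and st1 = Suc.prems(6) and W01 = Suc.prems(7)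
  note HD = subgroup_SO_D[OF H]
  let ?W0 = "perp N Q" and ?H' = "derived (SO N) H"
  note W0 = subspace_perp[OF Q]
  define F where "F = {W. subspace_vec N W \<and> ?W0 \<subset> W \<and> W \<subseteq> W1 \<and> (\<forall>h\<in>H. \<forall>w\<in>W. h *\<^sub>v w \<in> W)}"
  have "W1 \<in> F" unfolding F_def using W1 st1 W01 by simp
  then obtain W where WF: "W \<in> F" and min: "\<And>W'. W' \<in> F \<Longrightarrow> W' \<subseteq> W \<Longrightarrow> W' = W"
    using minimal_subspace_exists[of W1 F N] unfolding F_def by blast
  have W: "subspace_vec N W" and W0W: "?W0 \<subset> W" and WW1: "W \<subseteq> W1"
    and st: "\<And>h w. h \<in> H \<Longrightarrow> w \<in> W \<Longrightarrow> h *\<^sub>v w \<in> W" using WF unfolding F_def by blast+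
  note WD = subspace_vecD[OF W] and W0D = subspace_vecD[OF W0]
  have minimal: "W' = W" if "subspace_vec N W'" "?W0 \<subseteq> W'" "W' \<subseteq> W" "w \<in> W'" "w \<notin> ?W0"
    "\<And>h w. h \<in> H \<Longrightarrow> w \<in> W' \<Longrightarrow> h *\<^sub>v w \<in> W'" for W' w
  proof (rule min)
    show "W' \<in> F" unfolding F_def using that WW1 by blast
  qed (rule that(3))
  interpret group "SO N :: 'k mat monoid" by (rule group_SO)
  have H': "subgroup ?H' (SO N)" by (rule derived_is_subgroup) (use HD(7) in blast)
  have H'H: "?H' \<subseteq> H" by (rule derived_incl[OF subset_refl H])
  note H'D = subgroup_SO_D[OF H']
  have "\<exists>v\<in>W - ?W0. \<exists>\<chi>. \<forall>h\<in>?H'. h *\<^sub>v v - \<chi> h \<cdot>\<^sub>v v \<in> ?W0"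
  proof (rule Suc.IH[OF H' connectedin_derived[OF H con] _ _ W _ W0W])
    show "(derived (SO N) ^^ n) ?H' = {1\<^sub>m N}" using Suc.prems(3) by (simp only: funpow_Suc_right o_apply)
  qed (use st0 st H'H in blast)+
  then obtain v \<chi> where v: "v \<in> W" "v \<notin> ?W0" and \<chi>: "\<And>h. h \<in> ?H' \<Longrightarrow> h *\<^sub>v v - \<chi> h \<cdot>\<^sub>v v \<in> ?W0"
    by blast
  \<comment> \<open>The joint eigenspace of the derived subgroup, modulo \<open>perp N Q\<close>,
    for its eigenvalues on \<open>v\<close>. Once it is known to be stable under \<open>H\<close>,
    minimality makes it all of \<open>W\<close>.\<close>
  define U where "U = {w \<in> W. \<forall>h\<in>?H'. h *\<^sub>v w - \<chi> h \<cdot>\<^sub>v w \<in> ?W0}"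
  \<comment> \<open>Each value is an eigenvalue of \<open>h\<close>, taken at the vector
    \<open>x *\<^sub>v w\<close>. Only finitely many occur, so connectedness of \<open>H\<close>
    makes them equal; the choice x = 1 gives \<open>\<chi> h\<close>.\<close>
  have conj_const: "\<chi> (transpose_mat g * h * g) = \<chi> h" if w: "w \<in> U" "w \<notin> ?W0" and g: "g \<in> H" and h: "h \<in> ?H'" for w g h
  proof -
    have wc: "w \<in> carrier_vec N" using w WD(1) by (auto simp: U_def)
    have ev: "(transpose_mat x * h * x) *\<^sub>v w - \<chi> (transpose_mat x * h * x) \<cdot>\<^sub>v w \<in> ?W0" if "x \<in> H" for x
      using w derived_conjugate[OF H that h] by (auto simp: U_def)
    have "\<chi> (transpose_mat g * h * g) = \<chi> (transpose_mat (1\<^sub>m N) * h * 1\<^sub>m N)"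
    proof (rule eigenvalue_constant[OF con _ Q wc w(2) ev])
      show "regular_map N (\<lambda>x. transpose_mat x * h * x)"
        by (intro regular_map_mult regular_map_transpose regular_map_id regular_map_const H'D(2)[OF h])
      show "finite ((\<lambda>x. \<chi> (transpose_mat x * h * x)) ` H)"
      proof (rule finite_subset)
        show "finite {a. \<exists>w \<in> carrier_vec N. w \<notin> ?W0 \<and> h *\<^sub>v w - a \<cdot>\<^sub>v w \<in> ?W0}"
          by (rule finite_eigenvalues_mod[OF H'D(2)[OF h] W0]) (use st0 h H'H in blast)
        show "(\<lambda>x. \<chi> (transpose_mat x * h * x)) ` H \<subseteq> {a. \<exists>w \<in> carrier_vec N. w \<notin> ?W0 \<and> h *\<^sub>v w - a \<cdot>\<^sub>v w \<in> ?W0}"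
        proof (rule image_subsetI, rule CollectI)
          fix x assume x: "x \<in> H"
          have "x *\<^sub>v w \<notin> ?W0"
          proof
            assume "x *\<^sub>v w \<in> ?W0"
            then have "transpose_mat x *\<^sub>v (x *\<^sub>v w) \<in> ?W0" using st0 HD(3)[OF x] by blast
            then show False using w(2) mult_mat_vec_cancel_orth(1)[OF HD(1)[OF x] wc] by simp
          qed
          moreover have "h *\<^sub>v (x *\<^sub>v w) - \<chi> (transpose_mat x * h * x) \<cdot>\<^sub>v (x *\<^sub>v w) \<in> ?W0"
            by (rule conj_eigen[OF HD(1)[OF x] H'D(2)[OF h] wc _ ev[OF x]]) (use st0 x in blast)
          moreover have "x *\<^sub>v w \<in> carrier_vec N" using HD(2)[OF x] wc by simp
          ultimately show "\<exists>w \<in> carrier_vec N. w \<notin> ?W0 \<and> h *\<^sub>v w - \<chi> (transpose_mat x * h * x) \<cdot>\<^sub>v w \<in> ?W0" by blast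
        qed
      qed
    qed (use g HD(4) in auto)
    also have "transpose_mat (1\<^sub>m N) * h * 1\<^sub>m N = h" using H'D(2)[OF h] by simp
    finally show ?thesis .
  qed
  have W0U: "?W0 \<subseteq> U"
  proof
    fix w assume w: "w \<in> ?W0"
    have "h *\<^sub>v w - \<chi> h \<cdot>\<^sub>v w \<in> ?W0" if "h \<in> ?H'" for h
      by (rule W0D(5)[OF st0[OF subsetD[OF H'H that] w] W0D(4)[OF w]])
    then show "w \<in> U" using w W0W by (auto simp: U_def)
  qed
  have subU: "subspace_vec N U" unfolding subspace_vec_def
  proof (intro conjI ballI allI)
    show "U \<subseteq> carrier_vec N" using WD(1) by (auto simp: U_def)
    show "0\<^sub>v N \<in> U" using W0U W0D(2) by blast
  next
    fix x y assume xy: "x \<in> U" "y \<in> U"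
    then have c: "x \<in> carrier_vec N" "y \<in> carrier_vec N" using WD(1) by (auto simp: U_def)
    have "h *\<^sub>v (x + y) - \<chi> h \<cdot>\<^sub>v (x + y) \<in> ?W0" if h: "h \<in> ?H'" for h
    proof -
      have "(h *\<^sub>v x + h *\<^sub>v y) - (\<chi> h \<cdot>\<^sub>v x + \<chi> h \<cdot>\<^sub>v y) \<in> ?W0"
        by (rule congruent_add[OF W0]) (use xy h c H'D(2)[OF h] in \<open>auto simp: U_def\<close>)
      then show ?thesis using c mult_add_distrib_mat_vec[OF H'D(2)[OF h] c] smult_add_distrib_vec[OF c] by metis
    qed
    then show "x + y \<in> U" using xy WD(3) by (auto simp: U_def)
  next
    fix a x assume x: "x \<in> U"
    then have c: "x \<in> carrier_vec N" using WD(1) by (auto simp: U_def)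
    have "h *\<^sub>v (a \<cdot>\<^sub>v x) - \<chi> h \<cdot>\<^sub>v (a \<cdot>\<^sub>v x) \<in> ?W0" if h: "h \<in> ?H'" for h
    proof -
      have "a \<cdot>\<^sub>v (h *\<^sub>v x) - a \<cdot>\<^sub>v (\<chi> h \<cdot>\<^sub>v x) \<in> ?W0"
        by (rule congruent_smult[OF W0]) (use x h c H'D(2)[OF h] in \<open>auto simp: U_def\<close>)
      then show ?thesis using mult_mat_vec[OF H'D(2)[OF h] c] by (simp add: smult_smult_assoc mult.commute)
    qed
    then show "a \<cdot>\<^sub>v x \<in> U" using x WD(4) by (auto simp: U_def)
  qed
  have UW: "U = W"
  proof (rule minimal[OF subU W0U])
    show "v \<in> U" using v \<chi> by (auto simp: U_def)
    show "v \<notin> ?W0" by (rule v(2))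
    fix g w assume g: "g \<in> H" and w: "w \<in> U"
    show "g *\<^sub>v w \<in> U"
    proof (cases "w \<in> ?W0")
      case True
      then show ?thesis using st0[OF g] W0U by blast
    next
      case False
      have wc: "w \<in> carrier_vec N" using w WD(1) by (auto simp: U_def)
      have "h *\<^sub>v (g *\<^sub>v w) - \<chi> h \<cdot>\<^sub>v (g *\<^sub>v w) \<in> ?W0" if h: "h \<in> ?H'" for h
      proof (rule conj_eigen[OF HD(1)[OF g] H'D(2)[OF h] wc])
        show "(transpose_mat g * h * g) *\<^sub>v w - \<chi> h \<cdot>\<^sub>v w \<in> ?W0"
          using w derived_conjugate[OF H g h] conj_const[OF w False g h] by (force simp: U_def)
      qed (use st0 g in blast)
      then show ?thesis using w st[OF g] by (auto simp: U_def)
    qed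
  qed (auto simp: U_def)
  have ch: "h *\<^sub>v w - \<chi> h \<cdot>\<^sub>v w \<in> ?W0" if "h \<in> ?H'" "w \<in> W" for h w
    using that UW by (auto simp: U_def)
  have not0: "g *\<^sub>v w \<notin> ?W0" if "g \<in> H" "w \<notin> ?W0" "w \<in> carrier_vec N" for g w
    using st0[OF HD(3)[OF that(1)], of "g *\<^sub>v w"] mult_mat_vec_cancel_orth(1)[OF HD(1)[OF that(1)] that(3)] that(2) by metis
  have comm1: "\<chi> (g * h * transpose_mat g * transpose_mat h) = 1" if g: "g \<in> H" and h: "h \<in> H" for g h
  proof -
    let ?c = "\<lambda>x. x * h * transpose_mat x * transpose_mat h"
    obtain w a where w: "w \<in> W" "w \<notin> ?W0" "h *\<^sub>v w - a \<cdot>\<^sub>v w \<in> ?W0"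
      using eigenvector_mod_exists[OF HD(2)[OF h] W st[OF h] W0 v] by blast
    have wc: "w \<in> carrier_vec N" using WD(1) w by blast
    have hc: "h \<in> carrier_mat N N" using HD(2) h by blast
    have a0: "a \<noteq> 0"
    proof
      assume "a = 0"
      then have "h *\<^sub>v w = h *\<^sub>v w - a \<cdot>\<^sub>v w" using wc hc by (intro eq_vecI) auto
      then show False using not0[OF h w(2) wc] w(3) by simp
    qed
    have cH': "?c x \<in> ?H'" if "x \<in> H" for x by (rule commutator_in_derived[OF H that h])
    have "\<chi> (?c g) = \<chi> (?c (1\<^sub>m N))"
    proof (rule eigenvalue_constant[where \<psi> = ?c and \<mu> = "\<lambda>x. \<chi> (?c x)", OF con _ Q wc w(2)])
      show "regular_map N ?c"
        by (intro regular_map_mult regular_map_transpose regular_map_id regular_map_const hc) (use hc in simp)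
      show "?c x *\<^sub>v w - \<chi> (?c x) \<cdot>\<^sub>v w \<in> ?W0" if "x \<in> H" for x using ch[OF cH'[OF that] w(1)] .
      \<comment> \<open>On \<open>w\<close> the conjugate of \<open>h\<close> by \<open>x\<close> is
        the commutator after \<open>h\<close>, so it has eigenvalue
        \<open>a * \<chi> (?c x)\<close>; transported back, \<open>h\<close> has this eigenvalue on
        \<open>transpose_mat x *\<^sub>v w\<close>. Division by the nonzero \<open>a\<close> leaves
        finitely many values.\<close>
      have "(\<lambda>x. \<chi> (?c x)) ` H \<subseteq> (\<lambda>b. b / a) ` {b. \<exists>w \<in> carrier_vec N. w \<notin> ?W0 \<and> h *\<^sub>v w - b \<cdot>\<^sub>v w \<in> ?W0}"
      proof (rule image_subsetI)
        fix x assume x: "x \<in> H"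
        let ?y = "transpose_mat x *\<^sub>v w"
        have yc: "?y \<in> carrier_vec N" using HD(2)[OF x] wc by simp
        have xc: "x \<in> carrier_mat N N" using HD(2) x by blast
        have cc: "?c x \<in> carrier_mat N N" using H'D(2) cH' x by blast
        have "(transpose_mat (transpose_mat x) * h * transpose_mat x) *\<^sub>v w = ?c x *\<^sub>v (h *\<^sub>v w)"
        proof -
          have "?c x *\<^sub>v (h *\<^sub>v w) = x *\<^sub>v (h *\<^sub>v (transpose_mat x *\<^sub>v (transpose_mat h *\<^sub>v (h *\<^sub>v w))))"
            using xc hc wc by (simp add: assoc_mult_mat_vec[of _ N N _ N] mult_carrier_mat[of _ N N _ N])
          also have "transpose_mat h *\<^sub>v (h *\<^sub>v w) = w" by (rule mult_mat_vec_cancel_orth(1)[OF HD(1)[OF h] wc])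
          finally show ?thesis using xc hc wc by (simp add: assoc_mult_mat_vec[of _ N N _ N] mult_carrier_mat[of _ N N _ N])
        qed
        moreover have "?c x *\<^sub>v (h *\<^sub>v w) - (a * \<chi> (?c x)) \<cdot>\<^sub>v w \<in> ?W0"
        proof (rule congruent_trans[OF W0])
          show "?c x *\<^sub>v (h *\<^sub>v w) - ?c x *\<^sub>v (a \<cdot>\<^sub>v w) \<in> ?W0"
            by (rule congruent_apply[OF _ w(3) cc]) (use st0 cH'[OF x] H'H hc wc in auto)
          have "a \<cdot>\<^sub>v (?c x *\<^sub>v w) - a \<cdot>\<^sub>v (\<chi> (?c x) \<cdot>\<^sub>v w) \<in> ?W0"
            by (rule congruent_smult[OF W0 ch[OF cH'[OF x] w(1)]]) (use cc wc in auto)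
          then show "?c x *\<^sub>v (a \<cdot>\<^sub>v w) - (a * \<chi> (?c x)) \<cdot>\<^sub>v w \<in> ?W0"
            using mult_mat_vec[OF cc wc] by (simp add: smult_smult_assoc)
        qed (use cc hc wc in auto)
        ultimately have E: "(transpose_mat (transpose_mat x) * h * transpose_mat x) *\<^sub>v w - (a * \<chi> (?c x)) \<cdot>\<^sub>v w \<in> ?W0"
          by simp
        have "h *\<^sub>v ?y - (a * \<chi> (?c x)) \<cdot>\<^sub>v ?y \<in> ?W0"
          by (rule conj_eigen[OF HD(1)[OF HD(3)[OF x]] hc wc _ E]) (use st0 HD(3)[OF x] in blast)
        moreover have "?y \<notin> ?W0" by (rule not0[OF HD(3)[OF x] w(2) wc])
        ultimately have "a * \<chi> (?c x) \<in> {b. \<exists>w \<in> carrier_vec N. w \<notin> ?W0 \<and> h *\<^sub>v w - b \<cdot>\<^sub>v w \<in> ?W0}"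
          using yc by blast
        moreover have "\<chi> (?c x) = (a * \<chi> (?c x)) / a" using a0 by simp
        ultimately show "\<chi> (?c x) \<in> (\<lambda>b. b / a) ` {b. \<exists>w \<in> carrier_vec N. w \<notin> ?W0 \<and> h *\<^sub>v w - b \<cdot>\<^sub>v w \<in> ?W0}" by blast
      qed
      moreover have "finite {b. \<exists>w \<in> carrier_vec N. w \<notin> ?W0 \<and> h *\<^sub>v w - b \<cdot>\<^sub>v w \<in> ?W0}"
        by (rule finite_eigenvalues_mod[OF hc W0]) (use st0 h in blast)
      ultimately show "finite ((\<lambda>x. \<chi> (?c x)) ` H)" using finite_subset by blast
    qed (use g HD(4) in auto)
    also have "?c (1\<^sub>m N) = 1\<^sub>m N" using hc orthogonal_matricesD(3)[OF HD(1)[OF h]] by simp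
    also have "\<chi> (1\<^sub>m N) = 1"
    proof (rule congruent_eigenvalue_unique[OF W0, of "1\<^sub>m N *\<^sub>v w"])
      show "1\<^sub>m N *\<^sub>v w - \<chi> (1\<^sub>m N) \<cdot>\<^sub>v w \<in> ?W0" using ch[OF H'D(4) w(1)] .
      have "1\<^sub>m N *\<^sub>v w - 1 \<cdot>\<^sub>v w = 0\<^sub>v N" using wc by auto
      then show "1\<^sub>m N *\<^sub>v w - 1 \<cdot>\<^sub>v w \<in> ?W0" using W0D(2) by simp
    qed (use wc w in auto)
    finally show ?thesis .
  qed
  have commute: "g *\<^sub>v (h *\<^sub>v x) - h *\<^sub>v (g *\<^sub>v x) \<in> ?W0" if g: "g \<in> H" and h: "h \<in> H" and x: "x \<in> W" for g h x
  proof -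
    have xc: "x \<in> carrier_vec N" using WD(1) x by blast
    have "(g * h * transpose_mat g * transpose_mat h) *\<^sub>v (h *\<^sub>v (g *\<^sub>v x)) - 1 \<cdot>\<^sub>v (h *\<^sub>v (g *\<^sub>v x)) \<in> ?W0"
      using ch[OF commutator_in_derived[OF H g h], of "h *\<^sub>v (g *\<^sub>v x)"] st g h x comm1[OF g h] by metis
    then show ?thesis unfolding commutator_rewrite[OF HD(1)[OF g] HD(1)[OF h] xc] by simp
  qed
  \<comment> \<open>By \<open>commute\<close> the action of \<open>H\<close> on \<open>W\<close> is
    commutative modulo \<open>perp N Q\<close>, so an eigenspace of \<open>h\<close> is stable under
    \<open>H\<close> and by minimality equals \<open>W\<close>.\<close>
  have scalar: "\<exists>a. \<forall>w\<in>W. h *\<^sub>v w - a \<cdot>\<^sub>v w \<in> ?W0" if h: "h \<in> H" for h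
  proof -
    have hc: "h \<in> carrier_mat N N" using HD(2) h by blast
    obtain w a where w: "w \<in> W" "w \<notin> ?W0" "h *\<^sub>v w - a \<cdot>\<^sub>v w \<in> ?W0"
      using eigenvector_mod_exists[OF hc W st[OF h] W0 v] by blast
    define E where "E = {w \<in> W. h *\<^sub>v w - a \<cdot>\<^sub>v w \<in> ?W0}"
    have W0E: "?W0 \<subseteq> E"
      using W0W W0D(5)[OF st0[OF h] W0D(4)] by (auto simp: E_def)
    have "E = W"
    proof (rule minimal[OF _ W0E])
      show "subspace_vec N E" unfolding subspace_vec_def
      proof (intro conjI ballI allI)
        show "E \<subseteq> carrier_vec N" using WD(1) by (auto simp: E_def)
        show "0\<^sub>v N \<in> E" using W0E W0D(2) by blast
      next
        fix x y assume xy: "x \<in> E" "y \<in> E"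
        then have c: "x \<in> carrier_vec N" "y \<in> carrier_vec N" using WD(1) by (auto simp: E_def)
        have "(h *\<^sub>v x + h *\<^sub>v y) - (a \<cdot>\<^sub>v x + a \<cdot>\<^sub>v y) \<in> ?W0"
          by (rule congruent_add[OF W0]) (use xy c hc in \<open>auto simp: E_def\<close>)
        then have "h *\<^sub>v (x + y) - a \<cdot>\<^sub>v (x + y) \<in> ?W0"
          using c mult_add_distrib_mat_vec[OF hc c] smult_add_distrib_vec[OF c] by metis
        then show "x + y \<in> E" using xy WD(3) by (auto simp: E_def)
      next
        fix b x assume x: "x \<in> E"
        then have c: "x \<in> carrier_vec N" using WD(1) by (auto simp: E_def)
        have "b \<cdot>\<^sub>v (h *\<^sub>v x) - b \<cdot>\<^sub>v (a \<cdot>\<^sub>v x) \<in> ?W0"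
          by (rule congruent_smult[OF W0]) (use x c hc in \<open>auto simp: E_def\<close>)
        then have "h *\<^sub>v (b \<cdot>\<^sub>v x) - a \<cdot>\<^sub>v (b \<cdot>\<^sub>v x) \<in> ?W0"
          using mult_mat_vec[OF hc c] by (simp add: smult_smult_assoc mult.commute)
        then show "b \<cdot>\<^sub>v x \<in> E" using x WD(4) by (auto simp: E_def)
      qed
      show "w \<in> E" "w \<notin> ?W0" using w by (auto simp: E_def)
      fix g x assume g: "g \<in> H" and x: "x \<in> E"
      have gc: "g \<in> carrier_mat N N" using HD(2) g by blast
      have xc: "x \<in> carrier_vec N" using WD(1) x by (auto simp: E_def)
      have "h *\<^sub>v (g *\<^sub>v x) - a \<cdot>\<^sub>v (g *\<^sub>v x) \<in> ?W0"
      proof (rule congruent_trans[OF W0])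
        show "h *\<^sub>v (g *\<^sub>v x) - g *\<^sub>v (h *\<^sub>v x) \<in> ?W0" using commute[OF h g] x by (auto simp: E_def)
        have "g *\<^sub>v (h *\<^sub>v x) - g *\<^sub>v (a \<cdot>\<^sub>v x) \<in> ?W0"
          by (rule congruent_apply[OF _ _ gc]) (use st0[OF g] x xc hc in \<open>auto simp: E_def\<close>)
        then show "g *\<^sub>v (h *\<^sub>v x) - a \<cdot>\<^sub>v (g *\<^sub>v x) \<in> ?W0" using mult_mat_vec[OF gc xc] by simp
      qed (use gc hc xc in auto)
      then show "g *\<^sub>v x \<in> E" using x st[OF g] by (auto simp: E_def)
    qed (auto simp: E_def)
    then show ?thesis unfolding E_def by blast
  qed
  then obtain ev where "\<And>h. h \<in> H \<Longrightarrow> \<forall>w\<in>W. h *\<^sub>v w - ev h \<cdot>\<^sub>v w \<in> ?W0" by metis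
  then show ?case using v WW1 by blast
qed

section \<open>Isotropic flags and hyperbolic bases\<close>

text \<open>The Gram matrix is the antidiagonal unit matrix: \<open>p (N - Suc i)\<close> is dual to
  \<open>p i\<close>. All vectors are isotropic except, for odd \<open>N\<close>, the middle one,
  whose square is 1.\<close>

definition hyp_basis :: "nat \<Rightarrow> (nat \<Rightarrow> 'k::field vec) \<Rightarrow> bool" where
  "hyp_basis N p \<longleftrightarrow> (\<forall>i<N. p i \<in> carrier_vec N) \<and>
     (\<forall>i<N. \<forall>j<N. p i \<bullet> p j = (if Suc (i + j) = N then 1 else 0))"

text \<open>The subspace spanned by \<open>p 0, \<dots>, p (i - 1)\<close>, described as an orthogonal complement.\<close>

definition flag :: "nat \<Rightarrow> (nat \<Rightarrow> 'k::field vec) \<Rightarrow> nat \<Rightarrow> 'k vec set" where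
  "flag N p i = perp N {p l | l. l + i < N}"

lemma flag_iff: "v \<in> flag N p i \<longleftrightarrow> v \<in> carrier_vec N \<and> (\<forall>l. l + i < N \<longrightarrow> v \<bullet> p l = 0)"
  by (auto simp: flag_def perp_def)

lemma hyp_basisD:
  assumes "hyp_basis N p"
  shows "i < N \<Longrightarrow> p i \<in> carrier_vec N"
    "i < N \<Longrightarrow> j < N \<Longrightarrow> p i \<bullet> p j = (if Suc (i + j) = N then 1 else 0)"
  using assms by (auto simp: hyp_basis_def)

lemma flag_mono: "i \<le> j \<Longrightarrow> flag N p i \<subseteq> flag N p j"
  by (auto simp: flag_iff)

text \<open>The Gram relations say that a product of two square matrices is 1; the product in the
  opposite order is this completeness relation.\<close>

lemma hyp_basis_resolution:
  assumes p: "hyp_basis N p" and ab: "a < N" "b < N"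
  shows "(\<Sum>k<N. p (N - Suc k) $ a * p k $ b) = (if a = b then 1 else 0)"
proof -
  define B where "B = mat N N (\<lambda>(k, b). p k $ b)"
  define A where "A = mat N N (\<lambda>(a, k). p (N - Suc k) $ a)"
  have c: "A \<in> carrier_mat N N" "B \<in> carrier_mat N N" by (auto simp: A_def B_def)
  have "B * A = 1\<^sub>m N"
  proof (rule eq_matI)
    fix i j assume ij: "i < dim_row (1\<^sub>m N)" "j < dim_col (1\<^sub>m N)"
    then have d: "dim_vec (p (N - Suc j)) = N" "i < N" "j < N"
      using hyp_basisD(1)[OF p, of "N - Suc j"] by auto
    have "(B * A) $$ (i, j) = (\<Sum>k = 0..<N. p i $ k * p (N - Suc j) $ k)"
      using d by (simp add: A_def B_def scalar_prod_def)
    also have "\<dots> = p i \<bullet> p (N - Suc j)" using d by (simp add: scalar_prod_def)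
    also have "\<dots> = 1\<^sub>m N $$ (i, j)" using hyp_basisD(2)[OF p, of i "N - Suc j"] d by auto
    finally show "(B * A) $$ (i, j) = 1\<^sub>m N $$ (i, j)" .
  qed (use c in auto)
  then have "A * B = 1\<^sub>m N" by (rule mat_mult_left_right_inverse[OF c(2) c(1)])
  then have "(A * B) $$ (a, b) = (if a = b then 1 else 0)" using ab by simp
  moreover have "(A * B) $$ (a, b) = (\<Sum>k = 0..<N. p (N - Suc k) $ a * p k $ b)"
    using ab by (simp add: A_def B_def scalar_prod_def)
  ultimately show ?thesis by (simp add: atLeast0LessThan)
qed

lemma parseval:
  assumes p: "hyp_basis N p" and v: "v \<in> carrier_vec N" and u: "u \<in> carrier_vec N"
  shows "v \<bullet> u = (\<Sum>k<N. (v \<bullet> p k) * (u \<bullet> p (N - Suc k)))"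
proof -
  have e: "w \<bullet> p k = (\<Sum>a<N. w $ a * p k $ a)" if "k < N" for w k
    using hyp_basisD(1)[OF p that] by (simp add: scalar_prod_def atLeast0LessThan)
  have "(\<Sum>k<N. (v \<bullet> p k) * (u \<bullet> p (N - Suc k)))
     = (\<Sum>k<N. \<Sum>b<N. \<Sum>a<N. v $ b * u $ a * (p (N - Suc k) $ a * p k $ b))"
  proof (intro sum.cong refl)
    fix k assume "k \<in> {..<N}"
    then have k: "k < N" "N - Suc k < N" by auto
    show "(v \<bullet> p k) * (u \<bullet> p (N - Suc k)) = (\<Sum>b<N. \<Sum>a<N. v $ b * u $ a * (p (N - Suc k) $ a * p k $ b))"
      unfolding e[OF k(1)] e[OF k(2)] sum_product by (intro sum.cong refl) (simp add: mult_ac)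
  qed
  also have "\<dots> = (\<Sum>b<N. \<Sum>k<N. \<Sum>a<N. v $ b * u $ a * (p (N - Suc k) $ a * p k $ b))"
    by (rule sum.swap)
  also have "\<dots> = (\<Sum>b<N. \<Sum>a<N. \<Sum>k<N. v $ b * u $ a * (p (N - Suc k) $ a * p k $ b))"
    by (rule sum.cong[OF refl], rule sum.swap)
  also have "\<dots> = (\<Sum>b<N. \<Sum>a<N. v $ b * u $ a * (if a = b then 1 else 0))"
    by (intro sum.cong refl) (simp only: sum_distrib_left[symmetric] hyp_basis_resolution[OF p] lessThan_iff)
  also have "\<dots> = v \<bullet> u" using v u by (simp add: scalar_prod_def atLeast0LessThan if_distrib cong: if_cong)
  finally show ?thesis by simp
qed

lemma subspace_flag: "hyp_basis N p \<Longrightarrow> subspace_vec N (flag N p i)"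
  unfolding flag_def by (rule subspace_perp) (auto intro: hyp_basisD(1))

lemma flag_carrier: "v \<in> flag N p i \<Longrightarrow> v \<in> carrier_vec N"
  by (simp add: flag_iff)

lemma basis_in_flag: "hyp_basis N p \<Longrightarrow> l < i \<Longrightarrow> l < N \<Longrightarrow> p l \<in> flag N p i"
  by (auto simp: flag_iff hyp_basisD)

lemma flag_pairing_zero:
  assumes p: "hyp_basis N p" and v: "v \<in> flag N p i" and u: "u \<in> flag N p j" and ij: "i + j \<le> N"
  shows "v \<bullet> u = 0"
proof -
  have "(v \<bullet> p k) * (u \<bullet> p (N - Suc k)) = 0" if "k < N" for k
  proof (cases "k + i < N")
    case True then show ?thesis using v by (simp add: flag_iff)
  next
    case False
    then have "N - Suc k + j < N" using ij that by linarith
    then show ?thesis using u by (simp add: flag_iff)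
  qed
  then show ?thesis unfolding parseval[OF p flag_carrier[OF v] flag_carrier[OF u]]
    by (intro sum.neutral) auto
qed

text \<open>Only the term k = j of \<open>parseval\<close> survives, so vectors from complementary
  steps of the flag pair by the product of their leading coefficients. This is the device by which
  levels are compared later.\<close>

lemma flag_pairing_top:
  assumes p: "hyp_basis N p" and v: "v \<in> flag N p (Suc i)" and u: "u \<in> flag N p (Suc j)" and ij: "Suc (i + j) = N"
  shows "v \<bullet> u = (v \<bullet> p j) * (u \<bullet> p i)"
proof -
  have "(v \<bullet> p k) * (u \<bullet> p (N - Suc k)) = 0" if "k < N" "k \<noteq> j" for k
  proof (cases "k + Suc i < N")
    case True then show ?thesis using v by (simp add: flag_iff)
  next
    case False
    then have "N - Suc k + Suc j < N" using ij that by linarith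
    then show ?thesis using u by (simp add: flag_iff)
  qed
  then have "(\<Sum>k<N. (v \<bullet> p k) * (u \<bullet> p (N - Suc k))) = (\<Sum>k\<in>{j}. (v \<bullet> p k) * (u \<bullet> p (N - Suc k)))"
    using ij by (intro sum.mono_neutral_right) auto
  moreover have "N - Suc j = i" using ij by linarith
  ultimately show ?thesis unfolding parseval[OF p flag_carrier[OF v] flag_carrier[OF u]] by simp
qed

lemma flag_iff_perp:
  assumes p: "hyp_basis N p" and i: "i \<le> N"
  shows "v \<in> flag N p (N - i) \<longleftrightarrow> v \<in> carrier_vec N \<and> (\<forall>u\<in>flag N p i. v \<bullet> u = 0)"
proof
  assume "v \<in> flag N p (N - i)"
  then show "v \<in> carrier_vec N \<and> (\<forall>u\<in>flag N p i. v \<bullet> u = 0)"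
    using flag_pairing_zero[OF p, of v "N - i" _ i] flag_carrier i by auto
next
  assume v: "v \<in> carrier_vec N \<and> (\<forall>u\<in>flag N p i. v \<bullet> u = 0)"
  have "v \<bullet> p l = 0" if "l + (N - i) < N" for l
    using v basis_in_flag[OF p, of l i] that by simp
  then show "v \<in> flag N p (N - i)" using v by (simp add: flag_iff)
qed

lemma flag_0: 
  assumes p: "hyp_basis N p" and v: "v \<in> flag N p 0" shows "v = 0\<^sub>v N"
proof (rule eq_vecI)
  fix i assume i: "i < dim_vec (0\<^sub>v N)"
  have "v \<bullet> unit_vec N i = (\<Sum>k<N. (v \<bullet> p k) * (unit_vec N i \<bullet> p (N - Suc k)))"
    by (rule parseval[OF p flag_carrier[OF v]]) simp
  also have "\<dots> = 0" using v by (intro sum.neutral) (auto simp: flag_iff)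
  finally show "v $ i = 0\<^sub>v N $ i" using i by simp
qed (use flag_carrier[OF v] in simp)

lemma hyp_basis_exists:
  assumes two: "(2 :: 'k::alg_closed_field) \<noteq> 0"
  shows "\<exists>p :: nat \<Rightarrow> 'k vec. hyp_basis N p"
proof -
  obtain c :: 'k where c: "c ^ 2 = -1" using nth_root_exists[of 2 "-1"] by auto
  obtain s :: 'k where s: "s ^ 2 = 1 / 2" using nth_root_exists[of 2 "1/2"] by auto
  have ss: "s * s = 1 / 2" and cc: "c * c = -1" using s c by (auto simp: power2_eq_square)
  define w where "w k = N - Suc k" for k
  \<comment> \<open>For k below its mirror index k' the two vectors are s (e_k + c e_k') and s (e_k
    - c e_k'). They are isotropic because the square of \<open>c\<close> is -1, and they pair to 1
    because the square of \<open>s\<close> is 1/2. The middle vector stays a unit vector.\<close>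
  define a where "a k = (if k < w k then s else if k = w k then 1 else - (s * c))" for k
  define b where "b k = (if k < w k then s * c else if k = w k then 0 else s)" for k
  define p where "p k = a k \<cdot>\<^sub>v unit_vec N k + b k \<cdot>\<^sub>v unit_vec N (w k)" for k
  have wN: "w k < N" if "k < N" for k using that by (auto simp: w_def)
  have ww: "w (w k) = k" if "k < N" for k using that by (auto simp: w_def)
  have uu: "unit_vec N i \<bullet> unit_vec N j = (if i = j then 1 else 0 :: 'k)" if "i < N" "j < N" for i j
    using that by simp
  have dot: "p k \<bullet> p l = (if k = l then a k * a l + b k * b l else 0) + (if l = w k then a k * b l + b k * a l else 0)"
    if kl: "k < N" "l < N" for k l
  proof -
    have "p k \<bullet> p l = a k * a l * (unit_vec N k \<bullet> unit_vec N l) + a k * b l * (unit_vec N k \<bullet> unit_vec N (w l))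
      + b k * a l * (unit_vec N (w k) \<bullet> unit_vec N l) + b k * b l * (unit_vec N (w k) \<bullet> unit_vec N (w l))"
      unfolding p_def
      by (simp add: add_scalar_prod_distrib[where n = N] scalar_prod_add_distrib[where n = N] algebra_simps
          del: scalar_prod_left_unit scalar_prod_right_unit)
    moreover have "k = w l \<longleftrightarrow> l = w k" "w k = w l \<longleftrightarrow> k = l" using ww kl by metis+
    ultimately show ?thesis using kl wN by (simp only: uu) auto
  qed
  have "hyp_basis N p" unfolding hyp_basis_def
  proof (intro conjI allI impI)
    fix i assume "i < N" then show "p i \<in> carrier_vec N" by (simp add: p_def)
    fix j assume ij: "i < N" "j < N"
    have eqv: "Suc (i + j) = N \<longleftrightarrow> j = w i" using ij by (auto simp: w_def)
    have half: "1 / 2 + 1 / 2 = (1 :: 'k)" using two by (simp add: field_simps)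
    have "a i * a i + b i * b i = (if i = w i then 1 else 0)"
      by (auto simp: a_def b_def algebra_simps ss cc)
    moreover have "a i * b (w i) + b i * a (w i) = (if i = w i then 0 else 1)"
      using ww[OF ij(1)] half
      by (auto simp: a_def b_def algebra_simps ss cc)
    ultimately show "p i \<bullet> p j = (if Suc (i + j) = N then 1 else 0)"
      unfolding dot[OF ij] eqv by auto
  qed
  then show ?thesis by blast
qed

section \<open>Reflections and the extension of isotropic flags\<close>

context fixes N :: nat begin

lemmas bil = add_scalar_prod_distrib[where n = N] scalar_prod_add_distrib[where n = N]
  minus_scalar_prod_distrib[where n = N] scalar_prod_minus_distrib[where n = N]
  smult_scalar_prod_distrib[where n = N] scalar_prod_smult_distrib[where n = N]

lemmas comm = comm_scalar_prod[where n = N]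

definition reflection :: "'k::field vec \<Rightarrow> 'k vec \<Rightarrow> 'k vec" where
  "reflection a x = x - (2 * (x \<bullet> a) / (a \<bullet> a)) \<cdot>\<^sub>v a"

lemma reflection_carrier: "a \<in> carrier_vec N \<Longrightarrow> x \<in> carrier_vec N \<Longrightarrow> reflection a x \<in> carrier_vec N"
  by (simp add: reflection_def)

lemma reflection_isometry:
  assumes "a \<in> carrier_vec N" "x \<in> carrier_vec N" "y \<in> carrier_vec N" "a \<bullet> a \<noteq> 0"
  shows "reflection a x \<bullet> reflection a y = x \<bullet> y"
  using assms(4) by (simp add: reflection_def bil assms(1-3) comm[OF assms(1,2)] comm[OF assms(1,3)] field_simps)

lemma reflection_fix: 
  "a \<in> carrier_vec N \<Longrightarrow> x \<in> carrier_vec N \<Longrightarrow> x \<bullet> a = 0 \<Longrightarrow> reflection a x = x"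
  by (intro eq_vecI) (auto simp: reflection_def)

lemma reflection_adjoint:
  assumes "a \<in> carrier_vec N" "x \<in> carrier_vec N" "y \<in> carrier_vec N"
  shows "reflection a x \<bullet> y = x \<bullet> reflection a y"
  by (simp add: reflection_def bil assms comm[OF assms(1,3)] )

text \<open>Two isotropic vectors with nonzero pairing are exchanged by the reflection in their
  difference, whose square is -2 times that pairing. The difference lies in
  \<open>flag N p (N - r)\<close>, hence is orthogonal to the flags up to \<open>r\<close>, which
  therefore do not change.\<close>

lemma hyp_basis_reflect:
  fixes p :: "nat \<Rightarrow> 'k::field vec"
  assumes two: "(2 :: 'k) \<noteq> 0" and p: "hyp_basis N p" and r: "2 * r + 1 < N"
    and v: "v \<in> flag N p (N - r)" "v \<bullet> v = 0" "v \<bullet> p r \<noteq> 0"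
  shows "\<exists>p'. hyp_basis N p' \<and> p' r = v \<and> (\<forall>i\<le>r. flag N p' i = flag N p i)"
proof -
  note pD = hyp_basisD[OF p]
  have vc: "v \<in> carrier_vec N" using v flag_carrier by blast
  have rc: "p r \<in> carrier_vec N" using pD r by simp
  define a where "a = v - p r"
  have ac: "a \<in> carrier_vec N" using vc rc by (simp add: a_def)
  have prr: "p r \<bullet> p r = 0" using pD(2)[of r r] r by simp
  have aa: "a \<bullet> a = - 2 * (v \<bullet> p r)" using vc rc v prr by (simp add: a_def bil comm[OF rc vc])
  have aa0: "a \<bullet> a \<noteq> 0" using aa v two by simp
  have a_flag: "a \<in> flag N p (N - r)" unfolding a_def
    by (rule subspace_vecD(5)[OF subspace_flag[OF p] v(1)]) (rule basis_in_flag[OF p], use r in auto)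
  define p' where "p' l = reflection a (p l)" for l
  have p'c: "p' l \<in> carrier_vec N" if "l < N" for l using that pD ac by (simp add: p'_def reflection_carrier)
  have p': "hyp_basis N p'" unfolding hyp_basis_def
    using p'c pD ac aa0 by (simp add: p'_def reflection_isometry)
  have "p' r = v"
  proof -
    have "p r \<bullet> a = v \<bullet> p r" using vc rc prr by (simp add: a_def bil comm[OF rc vc])
    then have "2 * (p r \<bullet> a) / (a \<bullet> a) = -1" unfolding aa using v two by simp
    then have "p' r = p r - (-1) \<cdot>\<^sub>v a" by (simp add: p'_def reflection_def)
    also have "\<dots> = v" using vc rc by (auto simp: a_def)
    finally show ?thesis .
  qed
  moreover have "flag N p' i = flag N p i" if i: "i \<le> r" for i
  proof -
    have eq: "x \<bullet> p' l = x \<bullet> p l" if "x \<in> carrier_vec N" "x \<bullet> a = 0" "l < N" for x l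
    proof -
      have "x \<bullet> p' l = reflection a x \<bullet> p l" unfolding p'_def
        by (rule reflection_adjoint[symmetric]) (use ac that pD in auto)
      then show ?thesis using reflection_fix[OF ac that(1,2)] by simp
    qed
    have small: "p' l = p l" if "l < r" for l
    proof -
      have "a \<bullet> p l = 0" using a_flag that r by (auto simp: flag_iff)
      then show ?thesis unfolding p'_def
        using reflection_fix[OF ac pD(1)[of l]] comm[OF ac pD(1)[of l]] that r by simp
    qed
    have a_flag': "a \<in> flag N p' (N - r)"
      using a_flag small r ac by (auto simp: flag_iff)
    show ?thesis
    proof (intro equalityI subsetI)
      fix x assume x: "x \<in> flag N p' i"
      have "x \<bullet> a = 0" by (rule flag_pairing_zero[OF p' x a_flag']) (use i r in simp)
      then show "x \<in> flag N p i" using x eq by (auto simp: flag_iff)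
    next
      fix x assume x: "x \<in> flag N p i"
      have "x \<bullet> a = 0" by (rule flag_pairing_zero[OF p x a_flag]) (use i r in simp)
      then show "x \<in> flag N p' i" using x eq by (auto simp: flag_iff)
    qed
  qed
  ultimately show ?thesis using p' by blast
qed

lemma flag_perp_cong:
  assumes p: "hyp_basis N p" and p': "hyp_basis N p'" and "i \<le> N" "flag N p' i = flag N p i"
  shows "flag N p' (N - i) = flag N p (N - i)"
  using flag_iff_perp[OF p assms(3)] flag_iff_perp[OF p' assms(3)] assms(4) by blast

text \<open>The vector \<open>p r\<close> is moved to \<open>v\<close> by one reflection if the two are not orthogonal, and otherwise by two
  reflections through an isotropic vector \<open>u\<close> orthogonal to neither.\<close>

lemma hyp_basis_extend:
  fixes p :: "nat \<Rightarrow> 'k::field vec"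
  assumes two: "(2 :: 'k) \<noteq> 0" and p: "hyp_basis N p" and r: "2 * r + 1 < N"
    and v: "v \<in> flag N p (N - r)" "v \<notin> flag N p r" "v \<bullet> v = 0"
  shows "\<exists>p'. hyp_basis N p' \<and> v \<in> flag N p' (Suc r) \<and> (\<forall>i\<le>r. flag N p' i = flag N p i)"
proof -
  note pD = hyp_basisD[OF p]
  have vc: "v \<in> carrier_vec N" using v flag_carrier by blast
  have vin: "v \<in> flag N p' (Suc r)" if "hyp_basis N p'" "p' r = v" for p'
    using basis_in_flag[OF that(1), of r "Suc r"] that r by simp
  show ?thesis
  proof (cases "v \<bullet> p r = 0")
    case False
    then show ?thesis using hyp_basis_reflect[OF two p r v(1,3)] vin by blast
  next
    case vr: True
    show ?thesis
    proof (cases "v \<in> flag N p (Suc r)")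
      case True
      then show ?thesis using p by blast
    next
      case False
      then obtain l0 where l0: "l0 + Suc r < N" "v \<bullet> p l0 \<noteq> 0" using vc by (auto simp: flag_iff)
      have low: "v \<bullet> p l = 0" if "l \<le> r" for l
        using v(1) vr that r by (cases "l = r") (auto simp: flag_iff)
      \<comment> \<open>If only the middle coordinate were nonzero in this range,
        \<open>v \<bullet> v\<close> would be its square, contrary to isotropy. The middle index has
        to be avoided because \<open>p\<close> is not isotropic there.\<close>
      have "\<exists>l. l + Suc r < N \<and> v \<bullet> p l \<noteq> 0 \<and> Suc (l + l) \<noteq> N"
      proof (rule ccontr)
        assume "\<not> ?thesis"
        then have z: "v \<bullet> p l = 0" if "l + Suc r < N" "Suc (l + l) \<noteq> N" for l using that by blast
        have mid: "Suc (l0 + l0) = N" using z l0 by blast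
        have "(v \<bullet> p k) * (v \<bullet> p (N - Suc k)) = 0" if k: "k < N" "k \<noteq> l0" for k
        proof (cases "k + Suc r < N")
          case True
          then have "v \<bullet> p k = 0" using z mid k by force
          then show ?thesis by simp
        next
          case False
          then have "v \<bullet> p (N - Suc k) = 0" using low[of "N - Suc k"] by simp
          then show ?thesis by simp
        qed
        then have "(\<Sum>k<N. (v \<bullet> p k) * (v \<bullet> p (N - Suc k))) = (\<Sum>k\<in>{l0}. (v \<bullet> p k) * (v \<bullet> p (N - Suc k)))"
          using mid by (intro sum.mono_neutral_right) auto
        moreover have "N - Suc l0 = l0" using mid by linarith
        ultimately have "v \<bullet> v = (v \<bullet> p l0) * (v \<bullet> p l0)" using parseval[OF p vc vc] by simp
        then show False using v(3) l0 by simp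
      qed
      then obtain l where l: "l + Suc r < N" "v \<bullet> p l \<noteq> 0" "Suc (l + l) \<noteq> N" by blast
      have rl: "r < l" using low l(2) by (metis not_le)
      let ?t = "N - Suc r"
      \<comment> \<open>One of 1 and -1 works: if 1 fails, then -1 gives twice
        \<open>v \<bullet> p l\<close>. The vector \<open>u\<close> built from it is isotropic,
        pairs to \<open>b\<close> with \<open>p r\<close>, and is not orthogonal to
        \<open>v\<close>.\<close>
      obtain b :: 'k where b: "b \<noteq> 0" "v \<bullet> p l + b * (v \<bullet> p ?t) \<noteq> 0"
      proof (cases "v \<bullet> p l + v \<bullet> p ?t = 0")
        case True
        then have e: "v \<bullet> p ?t = - (v \<bullet> p l)" by (simp add: eq_neg_iff_add_eq_0 add.commute)
        have "v \<bullet> p l + (-1) * (v \<bullet> p ?t) = 2 * (v \<bullet> p l)" unfolding e by simp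
        then have "v \<bullet> p l + (-1) * (v \<bullet> p ?t) \<noteq> 0" using l two by simp
        then show ?thesis using that[of "-1"] by simp
      qed (use that[of 1] in simp)
      define u where "u = p l + b \<cdot>\<^sub>v p ?t"
      have lc: "p l \<in> carrier_vec N" "p ?t \<in> carrier_vec N" "p r \<in> carrier_vec N" using pD l r by auto
      have ne: "Suc (?t + ?t) \<noteq> N" "Suc (l + ?t) \<noteq> N" using r rl by arith+
      have uu: "u \<bullet> u = 0"
        using lc l rl r pD(2)[of l l] pD(2)[of l ?t] pD(2)[of ?t ?t] ne
        by (simp add: u_def bil comm[OF lc(2) lc(1)])
      have ur: "u \<bullet> p r = b" using lc l rl r pD(2)[of l r] pD(2)[of ?t r] by (simp add: u_def bil)
      have vu: "v \<bullet> u \<noteq> 0" using b vc lc by (simp add: u_def bil)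
      have "u \<in> flag N p (N - r)"
        unfolding u_def using subspace_flag[OF p, of "N - r"] basis_in_flag[OF p, of _ "N - r"] l r
        by (intro subspace_vecD(3)[OF subspace_flag[OF p]] subspace_vecD(4)[OF subspace_flag[OF p]]) auto
      from hyp_basis_reflect[OF two p r this uu] ur b
      obtain p1 where p1: "hyp_basis N p1" "p1 r = u" "\<forall>i\<le>r. flag N p1 i = flag N p i" by auto
      have "v \<in> flag N p1 (N - r)" using flag_perp_cong[OF p p1(1), of r] p1(3) r v(1) by simp
      from hyp_basis_reflect[OF two p1(1) r this v(3)] vu p1
      obtain p2 where p2: "hyp_basis N p2" "p2 r = v" "\<forall>i\<le>r. flag N p2 i = flag N p1 i" by auto
      then show ?thesis using vin p1 by metis
    qed
  qed
qed

lemma flag_Suc_decompose: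
  fixes p :: "nat \<Rightarrow> 'k::field vec"
  assumes p: "hyp_basis N p" and r: "r < N" and v: "v \<in> flag N p (Suc r)" "v \<notin> flag N p r"
    and x: "x \<in> flag N p (Suc r)"
  shows "\<exists>c. x - c \<cdot>\<^sub>v v \<in> flag N p r"
proof -
  let ?t = "N - Suc r"
  have t: "?t < N" using r by simp
  have vc: "v \<in> carrier_vec N" and xc: "x \<in> carrier_vec N" using v x flag_carrier by blast+
  have vt: "v \<bullet> p ?t \<noteq> 0"
  proof
    assume z: "v \<bullet> p ?t = 0"
    have "v \<bullet> p l = 0" if "l + r < N" for l
      using that v(1) z r by (cases "l = ?t") (auto simp: flag_iff)
    then show False using v(2) vc by (simp add: flag_iff)
  qed
  let ?c = "(x \<bullet> p ?t) / (v \<bullet> p ?t)"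
  have "(x - ?c \<cdot>\<^sub>v v) \<bullet> p l = 0" if l: "l + r < N" for l
  proof (cases "l = ?t")
    case True
    then show ?thesis using vc xc hyp_basisD(1)[OF p t] vt by (simp add: bil)
  next
    case False
    then have "x \<bullet> p l = 0" "v \<bullet> p l = 0" using l x v(1) r by (auto simp: flag_iff)
    then show ?thesis using vc xc hyp_basisD(1)[OF p, of l] l by (simp add: bil)
  qed
  then have "x - ?c \<cdot>\<^sub>v v \<in> flag N p r" using vc xc by (simp add: flag_iff)
  then show ?thesis by blast
qed

end

text \<open>Lie-Kolchin yields an eigenvector \<open>v\<close> in \<open>flag N p (N - r)\<close>
  modulo \<open>flag N p r\<close>, but perhaps a non-isotropic one. Its eigenvalues then square to
  1 and are constantly 1 by connectedness; the complement of \<open>v\<close> is stable and contains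
  a second eigenvector \<open>u\<close>. If \<open>u\<close> is not isotropic either,
  \<open>H\<close> fixes both modulo the small flag, and with them an isotropic combination v + c u.
  The bound on \<open>r\<close> leaves room for \<open>u\<close>.\<close>

lemma isotropic_eigenvector_exists:
  fixes H :: "'k::alg_closed_field mat set"
  assumes two: "(2 :: 'k) \<noteq> 0"
    and H: "subgroup H (SO N)" and con: "connectedin (zariski N) H" and sol: "(derived (SO N) ^^ n) H = {1\<^sub>m N}"
    and p: "hyp_basis N p" and r: "2 * r + 1 < N"
    and st: "\<And>h v. h \<in> H \<Longrightarrow> v \<in> flag N p r \<Longrightarrow> h *\<^sub>v v \<in> flag N p r"
    and st': "\<And>h v. h \<in> H \<Longrightarrow> v \<in> flag N p (N - r) \<Longrightarrow> h *\<^sub>v v \<in> flag N p (N - r)"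
  shows "\<exists>v \<chi>. v \<in> flag N p (N - r) \<and> v \<notin> flag N p r \<and> v \<bullet> v = 0 \<and>
    (\<forall>h\<in>H. h *\<^sub>v v - \<chi> h \<cdot>\<^sub>v v \<in> flag N p r)"
proof -
  note HD = subgroup_SO_D[OF H] and pD = hyp_basisD[OF p] and b = bil[of _ N]
  let ?W0 = "flag N p r" and ?W1 = "flag N p (N - r)"
  let ?Q = "{p l | l. l + r < N}"
  have Q: "?Q \<subseteq> carrier_vec N" using pD(1) by auto
  have W0Q: "?W0 = perp N ?Q" by (simp add: flag_def)
  note W0 = subspace_flag[OF p, of r] and W1 = subspace_flag[OF p, of "N - r"]
  have W01: "?W0 \<subseteq> ?W1" by (rule flag_mono) (use r in simp)
  have pair: "x \<bullet> y = 0" "y \<bullet> x = 0" if "x \<in> ?W0" "y \<in> ?W1" for x y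
    using flag_pairing_zero[OF p that] flag_pairing_zero[OF p that(2,1)] r by simp_all
  have lk: "\<exists>v\<in>W - ?W0. \<exists>\<chi>. \<forall>h\<in>H. h *\<^sub>v v - \<chi> h \<cdot>\<^sub>v v \<in> ?W0"
    if "subspace_vec N W" "\<And>h w. h \<in> H \<Longrightarrow> w \<in> W \<Longrightarrow> h *\<^sub>v w \<in> W" "?W0 \<subset> W" for W
    unfolding W0Q by (rule lie_kolchin_mod[OF H con sol Q _ that(1,2)]) (use st that(3) in \<open>auto simp: W0Q\<close>)
  have triv: "\<chi> h = 1" if v: "v \<in> ?W1" "v \<notin> ?W0" "v \<bullet> v \<noteq> 0"
    and ev: "\<And>h. h \<in> H \<Longrightarrow> h *\<^sub>v v - \<chi> h \<cdot>\<^sub>v v \<in> ?W0" and h: "h \<in> H" for v \<chi> h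
  proof -
    have vc: "v \<in> carrier_vec N" using v flag_carrier by blast
    have sq: "\<chi> g * \<chi> g = 1" if g: "g \<in> H" for g
    proof -
      define z where "z = g *\<^sub>v v - \<chi> g \<cdot>\<^sub>v v"
      have z: "z \<in> ?W0" using ev[OF g] by (simp add: z_def)
      have gv: "g *\<^sub>v v \<in> carrier_vec N" using HD(2)[OF g] vc by simp
      have zc: "z \<in> carrier_vec N" using z flag_carrier by blast
      have e: "g *\<^sub>v v = \<chi> g \<cdot>\<^sub>v v + z" using vc HD(2)[OF g] by (intro eq_vecI) (auto simp: z_def)
      have "v \<bullet> v = v \<bullet> (transpose_mat g *\<^sub>v (g *\<^sub>v v))"
        using mult_mat_vec_cancel_orth(1)[OF HD(1)[OF g] vc] by simp
      also have "\<dots> = (g *\<^sub>v v) \<bullet> (g *\<^sub>v v)"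
        using transpose_vec_mult_scalar[OF HD(2)[OF g] vc gv] comm[OF vc, of "transpose_mat g *\<^sub>v (g *\<^sub>v v)"] HD(2)[OF g] gv by simp
      also have "\<dots> = \<chi> g * \<chi> g * (v \<bullet> v)"
        unfolding e using pair[OF z v(1)] pair[OF z subsetD[OF W01 z]] vc zc by (simp add: b)
      finally show ?thesis using v(3) by simp
    qed
    have "\<chi> h = \<chi> (1\<^sub>m N)"
    proof (rule eigenvalue_constant[where \<psi> = "\<lambda>x. x" and \<mu> = \<chi>, OF con regular_map_id Q vc])
      show "v \<notin> perp N ?Q" using v by (simp add: W0Q)
      show "g *\<^sub>v v - \<chi> g \<cdot>\<^sub>v v \<in> perp N ?Q" if "g \<in> H" for g using ev[OF that] by (simp add: W0Q)
      have "\<chi> ` H \<subseteq> {1, -1}" using sq by (auto simp: square_eq_1_iff)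
      then show "finite (\<chi> ` H)" using finite_subset by blast
    qed (use h HD(4) in auto)
    also have "\<chi> (1\<^sub>m N) = 1"
    proof (rule congruent_eigenvalue_unique[OF W0, of "1\<^sub>m N *\<^sub>v v"])
      show "1\<^sub>m N *\<^sub>v v - \<chi> (1\<^sub>m N) \<cdot>\<^sub>v v \<in> ?W0" by (rule ev[OF HD(4)])
      have "1\<^sub>m N *\<^sub>v v - 1 \<cdot>\<^sub>v v = 0\<^sub>v N" using vc by auto
      then show "1\<^sub>m N *\<^sub>v v - 1 \<cdot>\<^sub>v v \<in> ?W0" using subspace_vecD(2)[OF W0] by simp
    qed (use vc v in auto)
    finally show ?thesis .
  qed
  have rW1: "p r \<in> ?W1" "p (Suc r) \<in> ?W1" using basis_in_flag[OF p, of _ "N - r"] r by auto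
  have "p r \<bullet> p (N - Suc r) \<noteq> 0" using pD(2)[of r "N - Suc r"] r by simp
  then have rW0: "p r \<notin> ?W0" using r by (auto simp: flag_iff intro!: exI[of _ "N - Suc r"])
  obtain v \<chi> where v: "v \<in> ?W1" "v \<notin> ?W0" and ev: "\<And>h. h \<in> H \<Longrightarrow> h *\<^sub>v v - \<chi> h \<cdot>\<^sub>v v \<in> ?W0"
    using lk[OF W1 st'] W01 rW1 rW0 by blast
  show ?thesis
  proof (cases "v \<bullet> v = 0")
    case True
    then show ?thesis using v ev by blast
  next
    case vv: False
    have ev1: "h *\<^sub>v v - v \<in> ?W0" if "h \<in> H" for h using ev[OF that] triv[OF v vv ev that] by simp
    have vc: "v \<in> carrier_vec N" using v flag_carrier by blast
    define W where "W = {x \<in> ?W1. x \<bullet> v = 0}"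
    have W: "subspace_vec N W"
      unfolding subspace_vec_def W_def
      using subspace_vecD[OF W1] flag_carrier vc by (auto simp: b)
    have W0W: "?W0 \<subseteq> W" using pair v W01 by (auto simp: W_def)
    have stW: "h *\<^sub>v x \<in> W" if h: "h \<in> H" and x: "x \<in> W" for h x
    proof -
      have xW: "x \<in> ?W1" "x \<bullet> v = 0" using x by (auto simp: W_def)
      have xc: "x \<in> carrier_vec N" using xW flag_carrier by blast
      define z where "z = h *\<^sub>v v - v"
      have z: "z \<in> ?W0" using ev1[OF h] by (simp add: z_def)
      have hc: "h *\<^sub>v v \<in> carrier_vec N" "h *\<^sub>v x \<in> carrier_vec N" using HD(2)[OF h] vc xc by simp_all
      have zc: "z \<in> carrier_vec N" using z flag_carrier by blast
      have e: "v = h *\<^sub>v v - z" using vc HD(2)[OF h] by (intro eq_vecI) (auto simp: z_def)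
      have "(h *\<^sub>v x) \<bullet> v = (h *\<^sub>v x) \<bullet> (h *\<^sub>v v) - (h *\<^sub>v x) \<bullet> z"
        by (subst (1) e) (use hc zc in \<open>simp add: b\<close>)
      also have "(h *\<^sub>v x) \<bullet> z = 0" by (rule pair(2)[OF z st'[OF h xW(1)]])
      also have "(h *\<^sub>v x) \<bullet> (h *\<^sub>v v) = (transpose_mat h *\<^sub>v (h *\<^sub>v x)) \<bullet> v"
        using transpose_vec_mult_scalar[OF HD(2)[OF h] vc hc(2)] HD(2)[OF h] hc vc by simp
      also have "transpose_mat h *\<^sub>v (h *\<^sub>v x) = x" by (rule mult_mat_vec_cancel_orth(1)[OF HD(1)[OF h] xc])
      finally have "(h *\<^sub>v x) \<bullet> v = 0" using xW by simp
      then show ?thesis using st'[OF h xW(1)] by (simp add: W_def)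
    qed
    \<comment> \<open>Either \<open>p r\<close> is already orthogonal to \<open>v\<close>, or
      \<open>p (Suc r)\<close> becomes so after subtracting a multiple of \<open>p r\<close>.
      Pairing with the dual basis vector shows that the result lies outside the small flag.\<close>
    have "\<exists>y. y \<in> W \<and> y \<notin> ?W0"
    proof (cases "p r \<bullet> v = 0")
      case True
      then show ?thesis using rW1 rW0 by (auto simp: W_def)
    next
      case False
      define y where "y = p (Suc r) - ((p (Suc r) \<bullet> v) / (p r \<bullet> v)) \<cdot>\<^sub>v p r"
      have c: "p r \<in> carrier_vec N" "p (Suc r) \<in> carrier_vec N" "p (N - Suc (Suc r)) \<in> carrier_vec N" using pD r by auto
      have "y \<in> ?W1" unfolding y_def using subspace_vecD(4,5)[OF W1] rW1 by blast
      moreover have "y \<bullet> v = 0" using c vc False by (simp add: y_def b)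
      moreover have "y \<bullet> p (N - Suc (Suc r)) = 1"
        using c r pD(2)[of "Suc r" "N - Suc (Suc r)"] pD(2)[of r "N - Suc (Suc r)"] by (simp add: y_def b)
      then have "y \<notin> ?W0" using r by (auto simp: flag_iff intro!: exI[of _ "N - Suc (Suc r)"])
      ultimately show ?thesis by (auto simp: W_def)
    qed
    then have "?W0 \<subset> W" using W0W by blast
    from lk[OF W stW this] obtain u \<chi>' where u: "u \<in> W" "u \<notin> ?W0"
      and evu: "\<And>h. h \<in> H \<Longrightarrow> h *\<^sub>v u - \<chi>' h \<cdot>\<^sub>v u \<in> ?W0" by blast
    have uW1: "u \<in> ?W1" and uv: "u \<bullet> v = 0" using u by (auto simp: W_def)
    have uc: "u \<in> carrier_vec N" using uW1 flag_carrier by blast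
    show ?thesis
    proof (cases "u \<bullet> u = 0")
      case True
      then show ?thesis using uW1 u evu by blast
    next
      case uu: False
      have evu1: "h *\<^sub>v u - u \<in> ?W0" if "h \<in> H" for h using evu[OF that] triv[OF uW1 u(2) uu evu that] by simp
      obtain c where c: "c ^ 2 = - (v \<bullet> v) / (u \<bullet> u)" using nth_root_exists[of 2 "- (v \<bullet> v) / (u \<bullet> u)"] by auto
      define w where "w = v + c \<cdot>\<^sub>v u"
      have "w \<bullet> w = v \<bullet> v + c ^ 2 * (u \<bullet> u)"
        using vc uc uv comm[OF vc uc] by (simp add: w_def b power2_eq_square)
      also have "\<dots> = 0" unfolding c using uu by simp
      finally have ww: "w \<bullet> w = 0" .
      have wW1: "w \<in> ?W1" unfolding w_def using subspace_vecD(3,4)[OF W1] v uW1 by blast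
      have "w \<bullet> v = v \<bullet> v" using vc uc uv by (simp add: w_def b)
      then have wW0: "w \<notin> ?W0" using pair[of w v] v vv by auto
      have "h *\<^sub>v w - 1 \<cdot>\<^sub>v w \<in> ?W0" if h: "h \<in> H" for h
      proof -
        have hm: "h \<in> carrier_mat N N" by (rule HD(2)[OF h])
        have "(h *\<^sub>v v + c \<cdot>\<^sub>v (h *\<^sub>v u)) - (v + c \<cdot>\<^sub>v u) \<in> ?W0"
          by (rule congruent_add[OF W0 ev1[OF h] congruent_smult[OF W0 evu1[OF h]]]) (use hm vc uc in auto)
        moreover have "h *\<^sub>v w = h *\<^sub>v v + c \<cdot>\<^sub>v (h *\<^sub>v u)"
          unfolding w_def using mult_add_distrib_mat_vec[OF hm vc, of "c \<cdot>\<^sub>v u"] mult_mat_vec[OF hm uc] uc by simp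
        ultimately show ?thesis by (simp add: w_def)
      qed
      then show ?thesis using ww wW1 wW0 by (intro exI[of _ w] exI[of _ "\<lambda>_. 1"]) blast
    qed
  qed
qed

lemma stable_flag_perp:
  fixes H :: "'k::field mat set"
  assumes H: "subgroup H (SO N)" and p: "hyp_basis N p" and i: "i \<le> N"
    and st: "\<And>h v. h \<in> H \<Longrightarrow> v \<in> flag N p i \<Longrightarrow> h *\<^sub>v v \<in> flag N p i"
    and h: "h \<in> H" and v: "v \<in> flag N p (N - i)"
  shows "h *\<^sub>v v \<in> flag N p (N - i)"
  unfolding flag_iff_perp[OF p i]
proof (intro conjI ballI)
  note HD = subgroup_SO_D[OF H]
  have vc: "v \<in> carrier_vec N" using v flag_carrier by blast
  show hc: "h *\<^sub>v v \<in> carrier_vec N" using HD(2)[OF h] vc by simp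
  fix u assume u: "u \<in> flag N p i"
  have uc: "u \<in> carrier_vec N" using u flag_carrier by blast
  have "(h *\<^sub>v v) \<bullet> u = u \<bullet> (h *\<^sub>v v)" by (rule comm[OF hc uc])
  also have "\<dots> = (transpose_mat h *\<^sub>v u) \<bullet> v" 
    using transpose_vec_mult_scalar[OF HD(2)[OF h] vc uc] by simp
  also have "\<dots> = v \<bullet> (transpose_mat h *\<^sub>v u)" by (rule comm) (use HD(2)[OF h] uc vc in auto)
  also have "\<dots> = 0"
    using v st[OF HD(3)[OF h] u] unfolding flag_iff_perp[OF p i] by blast
  finally show "(h *\<^sub>v v) \<bullet> u = 0" .
qed

text \<open>Only the flags up to N div 2 are built, one isotropic eigenvector at a time, the basis
  being replaced without moving the earlier flags. The upper flags are orthogonal complements of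
  lower ones and stable for that reason.\<close>

theorem stable_flag_exists:
  fixes H :: "'k::alg_closed_field mat set"
  assumes two: "(2 :: 'k) \<noteq> 0" and N: "odd N"
    and H: "subgroup H (SO N)" and con: "connectedin (zariski N) H" and sol: "(derived (SO N) ^^ n) H = {1\<^sub>m N}"
  shows "\<exists>p. hyp_basis N p \<and> (\<forall>i\<le>N. \<forall>h\<in>H. \<forall>v\<in>flag N p i. h *\<^sub>v v \<in> flag N p i)"
proof -
  note HD = subgroup_SO_D[OF H]
  have "2 * r < N \<Longrightarrow> \<exists>p. hyp_basis N p \<and> (\<forall>i\<le>r. \<forall>h\<in>H. \<forall>v\<in>flag N p i. h *\<^sub>v v \<in> flag N p i)" for r
  proof (induction r)
    case 0
    obtain p :: "nat \<Rightarrow> 'k vec" where p: "hyp_basis N p" using hyp_basis_exists[OF two] by blast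
    have "h *\<^sub>v v \<in> flag N p 0" if "h \<in> H" "v \<in> flag N p 0" for h v
    proof -
      have "h *\<^sub>v v = 0\<^sub>v N" using flag_0[OF p that(2)] HD(2)[OF that(1)] by (intro eq_vecI) auto
      then show ?thesis using subspace_vecD(2)[OF subspace_flag[OF p]] by simp
    qed
    then show ?case using p by auto
  next
    case (Suc r)
    then obtain p where p: "hyp_basis N p"
      and st: "\<And>i h v. i \<le> r \<Longrightarrow> h \<in> H \<Longrightarrow> v \<in> flag N p i \<Longrightarrow> h *\<^sub>v v \<in> flag N p i" by fastforce
    have r: "2 * r + 1 < N" "r < N" "r \<le> N" using Suc.prems by simp_all
    obtain v \<chi> where v: "v \<in> flag N p (N - r)" "v \<notin> flag N p r" "v \<bullet> v = 0"
      and ev: "\<And>h. h \<in> H \<Longrightarrow> h *\<^sub>v v - \<chi> h \<cdot>\<^sub>v v \<in> flag N p r"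
      using isotropic_eigenvector_exists[OF two H con sol p r(1) st[OF order_refl]
          stable_flag_perp[OF H p r(3) st[OF order_refl]]] by blast
    obtain p' where p': "hyp_basis N p'" "v \<in> flag N p' (Suc r)" and same: "\<And>i. i \<le> r \<Longrightarrow> flag N p' i = flag N p i"
      using hyp_basis_extend[OF two p r(1) v] by blast
    note sub = subspace_vecD[OF subspace_flag[OF p'(1), of "Suc r"]]
    have vc: "v \<in> carrier_vec N" using v flag_carrier by blast
    have le: "flag N p r \<subseteq> flag N p' (Suc r)" using same[of r] flag_mono[of r "Suc r" N p'] by simp
    have "h *\<^sub>v x \<in> flag N p' (Suc r)" if h: "h \<in> H" and x: "x \<in> flag N p' (Suc r)" for h x
    proof -
      have hm: "h \<in> carrier_mat N N" by (rule HD(2)[OF h])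
      have xc: "x \<in> carrier_vec N" using x flag_carrier by blast
      obtain c where c: "x - c \<cdot>\<^sub>v v \<in> flag N p r"
        using flag_Suc_decompose[OF p'(1) r(2) p'(2) _ x] v(2) same by auto
      let ?y = "x - c \<cdot>\<^sub>v v" and ?z = "h *\<^sub>v v - \<chi> h \<cdot>\<^sub>v v"
      have "h *\<^sub>v ?y \<in> flag N p' (Suc r)" using st[OF order_refl h c] le by blast
      moreover have "?z \<in> flag N p' (Suc r)" using ev[OF h] le by blast
      moreover have "h *\<^sub>v x = h *\<^sub>v ?y + c \<cdot>\<^sub>v (?z + \<chi> h \<cdot>\<^sub>v v)"
      proof -
        have "?z + \<chi> h \<cdot>\<^sub>v v = h *\<^sub>v v" using hm vc by (intro eq_vecI) auto
        moreover have "h *\<^sub>v ?y = h *\<^sub>v x - c \<cdot>\<^sub>v (h *\<^sub>v v)"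
          using mult_minus_distrib_mat_vec[OF hm xc, of "c \<cdot>\<^sub>v v"] vc mult_mat_vec[OF hm vc] by simp
        ultimately show ?thesis using hm vc xc by (intro eq_vecI) auto
      qed
      ultimately show ?thesis using sub(3,4) p'(2) by metis
    qed
    then have "\<forall>i\<le>Suc r. \<forall>h\<in>H. \<forall>x\<in>flag N p' i. h *\<^sub>v x \<in> flag N p' i"
      using st same le_Suc_eq by metis
    then show ?case using p'(1) by blast
  qed
  from this[of "N div 2"] N obtain p where p: "hyp_basis N p"
    and st: "\<And>i h v. i \<le> N div 2 \<Longrightarrow> h \<in> H \<Longrightarrow> v \<in> flag N p i \<Longrightarrow> h *\<^sub>v v \<in> flag N p i"
    by (auto elim!: oddE)
  have "h *\<^sub>v v \<in> flag N p i" if "i \<le> N" "h \<in> H" "v \<in> flag N p i" for i h v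
  proof (cases "i \<le> N div 2")
    case True
    then show ?thesis using st that by blast
  next
    case False
    then have i: "N - i \<le> N div 2" "N - i \<le> N" "N - (N - i) = i" using that by auto
    show ?thesis
      using stable_flag_perp[OF H p i(2) st[OF i(1)] that(2), of v] that(3) i(3) by simp
  qed
  then show ?thesis using p by blast
qed

section \<open>Borel subgroups are stabilisers of isotropic flags\<close>

definition basis_mat :: "nat \<Rightarrow> (nat \<Rightarrow> 'k::field vec) \<Rightarrow> 'k mat" where
  "basis_mat N p = mat N N (\<lambda>(a, j). p j $ a)"

definition dual_mat :: "nat \<Rightarrow> (nat \<Rightarrow> 'k::field vec) \<Rightarrow> 'k mat" where
  "dual_mat N p = mat N N (\<lambda>(i, a). p (N - Suc i) $ a)"

definition coords :: "nat \<Rightarrow> (nat \<Rightarrow> 'k::field vec) \<Rightarrow> 'k mat \<Rightarrow> 'k mat" where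
  "coords N p A = dual_mat N p * A * basis_mat N p"

definition uncoords :: "nat \<Rightarrow> (nat \<Rightarrow> 'k::field vec) \<Rightarrow> 'k mat \<Rightarrow> 'k mat" where
  "uncoords N p T = basis_mat N p * T * dual_mat N p"

lemma basis_mat_carrier [simp]: "basis_mat N p \<in> carrier_mat N N" "dual_mat N p \<in> carrier_mat N N"
  by (auto simp: basis_mat_def dual_mat_def)

lemma coords_carrier [simp]: "A \<in> carrier_mat N N \<Longrightarrow> coords N p A \<in> carrier_mat N N"
  "A \<in> carrier_mat N N \<Longrightarrow> uncoords N p A \<in> carrier_mat N N"
  by (auto simp: coords_def uncoords_def intro!: mult_carrier_mat[of _ N N _ N])

lemma dual_basis_mat:
  assumes p: "hyp_basis N p"
  shows "dual_mat N p * basis_mat N p = 1\<^sub>m N" "basis_mat N p * dual_mat N p = 1\<^sub>m N"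
proof -
  show 1: "dual_mat N p * basis_mat N p = 1\<^sub>m N"
  proof (rule eq_matI)
    fix i j assume ij: "i < dim_row (1\<^sub>m N)" "j < dim_col (1\<^sub>m N)"
    then have d: "dim_vec (p j) = N" "i < N" "j < N"
      using hyp_basisD(1)[OF p, of j] by auto
    have "(dual_mat N p * basis_mat N p) $$ (i, j) = p (N - Suc i) \<bullet> p j"
      using d by (simp add: dual_mat_def basis_mat_def scalar_prod_def)
    also have "\<dots> = 1\<^sub>m N $$ (i, j)" using hyp_basisD(2)[OF p, of "N - Suc i" j] d by auto
    finally show "(dual_mat N p * basis_mat N p) $$ (i, j) = 1\<^sub>m N $$ (i, j)" .
  qed (auto simp: dual_mat_def basis_mat_def)
  show "basis_mat N p * dual_mat N p = 1\<^sub>m N"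
    by (rule mat_mult_left_right_inverse[OF _ _ 1]) simp_all
qed

lemma coords_uncoords:
  assumes p: "hyp_basis N p" and T: "T \<in> carrier_mat N N"
  shows "coords N p (uncoords N p T) = T" "uncoords N p (coords N p T) = T"
proof -
  let ?P = "basis_mat N p" and ?D = "dual_mat N p"
  note as = assoc_mult_mat[of _ N N _ N _ N] mult_carrier_mat[of _ N N _ N]
  have 1: "?D * (?P * X) = X" "?P * (?D * X) = X" if "X \<in> carrier_mat N N" for X
    using that dual_basis_mat[OF p] by (simp_all add: as(1)[symmetric])
  show "coords N p (uncoords N p T) = T" "uncoords N p (coords N p T) = T"
    using T dual_basis_mat[OF p] by (simp_all add: coords_def uncoords_def as 1 del: assoc_mult_mat)
qed

lemma coords_mult:
  assumes p: "hyp_basis N p" and A: "A \<in> carrier_mat N N" "B \<in> carrier_mat N N"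
  shows "coords N p (A * B) = coords N p A * coords N p B"
proof -
  let ?P = "basis_mat N p" and ?D = "dual_mat N p"
  note as = assoc_mult_mat[of _ N N _ N _ N] mult_carrier_mat[of _ N N _ N]
  have 1: "?P * (?D * X) = X" if "X \<in> carrier_mat N N" for X
    using that dual_basis_mat[OF p] by (simp_all add: as(1)[symmetric])
  show ?thesis using A by (simp add: coords_def as 1 del: assoc_mult_mat)
qed

lemma coords_one: "hyp_basis N p \<Longrightarrow> coords N p (1\<^sub>m N) = 1\<^sub>m N"
  by (simp add: coords_def dual_basis_mat right_mult_one_mat[of _ N N])

lemma coords_inj:
  assumes "hyp_basis N p" "A \<in> carrier_mat N N" "B \<in> carrier_mat N N" "coords N p A = coords N p B"
  shows "A = B"
  using coords_uncoords(2)[OF assms(1)] assms by metis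

lemma det_uncoords:
  assumes p: "hyp_basis N p" and T: "T \<in> carrier_mat N N"
  shows "det (uncoords N p T) = det T"
proof -
  have "det (basis_mat N p) * det (dual_mat N p) = 1"
    using det_mult[of "basis_mat N p" N "dual_mat N p"] dual_basis_mat(2)[OF p] by simp
  moreover have "det (uncoords N p T) = det (basis_mat N p) * det T * det (dual_mat N p)"
    unfolding uncoords_def using T det_mult[of "basis_mat N p" N T] 
      det_mult[of "basis_mat N p * T" N "dual_mat N p"] mult_carrier_mat[of "basis_mat N p" N N T N] by simp
  ultimately show ?thesis by (simp add: mult_ac)
qed

lemma coords_entry:
  assumes p: "hyp_basis N p" and A: "A \<in> carrier_mat N N" and ij: "i < N" "j < N"
  shows "coords N p A $$ (i, j) = (A *\<^sub>v p j) \<bullet> p (N - Suc i)"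
proof -
  have c: "p j \<in> carrier_vec N" "p (N - Suc i) \<in> carrier_vec N" using hyp_basisD(1)[OF p] ij by auto
  have "coords N p A = dual_mat N p * (A * basis_mat N p)"
    unfolding coords_def by (rule assoc_mult_mat[of _ N N _ N _ N]) (use A in simp_all)
  moreover have "(dual_mat N p * (A * basis_mat N p)) $$ (i, j) = (\<Sum>a = 0..<N. p (N - Suc i) $ a * (\<Sum>b = 0..<N. A $$ (a, b) * p j $ b))"
    using A ij c by (simp add: dual_mat_def basis_mat_def scalar_prod_def)
  moreover have "(A *\<^sub>v p j) \<bullet> p (N - Suc i) = (\<Sum>a = 0..<N. p (N - Suc i) $ a * (\<Sum>b = 0..<N. A $$ (a, b) * p j $ b))"
    using A ij c by (simp add: scalar_prod_def mult.commute)
  ultimately show ?thesis by simp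
qed

text \<open>With J the antidiagonal unit matrix and T' the transpose of T, this is T' J T = J:
  orthogonality read in a hyperbolic basis.\<close>

definition split_form :: "nat \<Rightarrow> 'k::field mat \<Rightarrow> bool" where
  "split_form N T \<longleftrightarrow> (\<forall>j<N. \<forall>l<N. (\<Sum>k<N. T $$ (N - Suc k, j) * T $$ (k, l)) = (if Suc (j + l) = N then 1 else 0))"

lemma eq_one_by_basis:
  assumes p: "hyp_basis N p" and X: "X \<in> carrier_mat N N"
    and e: "\<And>j l. j < N \<Longrightarrow> l < N \<Longrightarrow> (X *\<^sub>v p j) \<bullet> p l = p j \<bullet> p l"
  shows "X = 1\<^sub>m N"
proof (rule coords_inj[OF p X])
  show "coords N p X = coords N p (1\<^sub>m N)"
  proof (rule eq_matI)
    fix i j assume "i < dim_row (coords N p (1\<^sub>m N))" "j < dim_col (coords N p (1\<^sub>m N))"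
    then have ij: "i < N" "j < N" using coords_one[OF p] by auto
    then show "coords N p X $$ (i, j) = coords N p (1\<^sub>m N) $$ (i, j)"
      using e[of j "N - Suc i"] hyp_basisD(1)[OF p, of j] X by (simp add: coords_entry[OF p])
  qed (use carrier_matD[OF coords_carrier(1)[OF X, of p]] in \<open>simp_all add: coords_one[OF p]\<close>)
qed simp

lemma orthogonal_iff_split_form:
  assumes p: "hyp_basis N p" and A: "A \<in> carrier_mat N N"
  shows "A \<in> orthogonal_matrices N \<longleftrightarrow> split_form N (coords N p A)"
proof -
  have key: "(transpose_mat A * A *\<^sub>v p j) \<bullet> p l = (\<Sum>k<N. coords N p A $$ (N - Suc k, j) * coords N p A $$ (k, l))"
    if jl: "j < N" "l < N" for j l
  proof -
    have c: "p j \<in> carrier_vec N" "p l \<in> carrier_vec N" using hyp_basisD(1)[OF p] jl by auto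
    have Ac: "A *\<^sub>v p j \<in> carrier_vec N" "A *\<^sub>v p l \<in> carrier_vec N" using A c by auto
    have "(transpose_mat A * A *\<^sub>v p j) \<bullet> p l = (transpose_mat A *\<^sub>v (A *\<^sub>v p j)) \<bullet> p l"
      using A c by (simp add: assoc_mult_mat_vec[of _ N N _ N])
    also have "\<dots> = (A *\<^sub>v p j) \<bullet> (A *\<^sub>v p l)"
      by (rule transpose_vec_mult_scalar[OF A c(2) Ac(1)])
    also have "\<dots> = (\<Sum>k<N. ((A *\<^sub>v p j) \<bullet> p k) * ((A *\<^sub>v p l) \<bullet> p (N - Suc k)))"
      by (rule parseval[OF p Ac])
    also have "\<dots> = (\<Sum>k<N. coords N p A $$ (N - Suc k, j) * coords N p A $$ (k, l))"
      by (intro sum.cong refl) (use jl in \<open>auto simp: coords_entry[OF p A]\<close>)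
    finally show ?thesis .
  qed
  show ?thesis
  proof
    assume "A \<in> orthogonal_matrices N"
    then have AA: "transpose_mat A * A = 1\<^sub>m N" by (simp add: orthogonal_matrices_def)
    show "split_form N (coords N p A)" unfolding split_form_def
    proof (intro allI impI)
      fix j l assume jl: "j < N" "l < N"
      show "(\<Sum>k<N. coords N p A $$ (N - Suc k, j) * coords N p A $$ (k, l)) = (if Suc (j + l) = N then 1 else 0)"
        unfolding key[OF jl, symmetric] AA one_mult_mat_vec[OF hyp_basisD(1)[OF p jl(1)]]
        by (rule hyp_basisD(2)[OF p jl])
    qed
  next
    assume "split_form N (coords N p A)"
    then have "transpose_mat A * A = 1\<^sub>m N"
      using key hyp_basisD(2)[OF p] A by (intro eq_one_by_basis[OF p]) (auto simp: split_form_def)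
    then show "A \<in> orthogonal_matrices N" using A by (simp add: orthogonal_matrices_def)
  qed
qed

definition split_borel :: "nat \<Rightarrow> 'k::field mat set" where
  "split_borel N = {T \<in> carrier_mat N N. split_form N T \<and> det T = 1 \<and> (\<forall>i<N. \<forall>j<i. T $$ (i, j) = 0)}"

definition flag_stabilizer :: "nat \<Rightarrow> (nat \<Rightarrow> 'k::field vec) \<Rightarrow> 'k mat set" where
  "flag_stabilizer N p = {A \<in> carrier (SO N). coords N p A \<in> split_borel N}"

lemma flag_stabilizer_image:
  assumes p: "hyp_basis N p"
  shows "flag_stabilizer N p = uncoords N p ` split_borel N"
proof (intro equalityI subsetI)
  fix A assume "A \<in> flag_stabilizer N p"
  then have "A \<in> carrier_mat N N" "coords N p A \<in> split_borel N"
    by (auto simp: flag_stabilizer_def dest: orthogonal_matricesD)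
  then show "A \<in> uncoords N p ` split_borel N" using coords_uncoords(2)[OF p, of A] by (metis image_eqI)
next
  fix A assume "A \<in> uncoords N p ` split_borel N"
  then obtain T where T: "A = uncoords N p T" "T \<in> split_borel N" by blast
  then have Tc: "T \<in> carrier_mat N N" "det T = 1" "split_form N T" by (auto simp: split_borel_def)
  then show "A \<in> flag_stabilizer N p"
    using T coords_uncoords(1)[OF p Tc(1)] det_uncoords[OF p Tc(1)] orthogonal_iff_split_form[OF p, of A]
    by (simp add: flag_stabilizer_def)
qed

lemma flag_stabilizer_iff:
  assumes p: "hyp_basis N p"
  shows "A \<in> flag_stabilizer N p \<longleftrightarrow> A \<in> orthogonal_matrices N \<and> det A = 1 \<and>
    (\<forall>j<N. A *\<^sub>v p j \<in> flag N p (Suc j))"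
proof (cases "A \<in> orthogonal_matrices N \<and> det A = 1")
  case True
  then have Ac: "A \<in> carrier_mat N N" using orthogonal_matricesD by blast
  have "uncoords N p (coords N p A) = A" by (rule coords_uncoords(2)[OF p Ac])
  then have "det (coords N p A) = 1" using det_uncoords[OF p, of "coords N p A"] Ac True by simp
  moreover have "(\<forall>i<N. \<forall>j<i. coords N p A $$ (i, j) = 0) \<longleftrightarrow> (\<forall>j<N. A *\<^sub>v p j \<in> flag N p (Suc j))"
  proof (intro iffI allI impI)
    fix j assume z: "\<forall>i<N. \<forall>j<i. coords N p A $$ (i, j) = 0" and j: "j < N"
    have "(A *\<^sub>v p j) \<bullet> p l = 0" if "l + Suc j < N" for l
      using z[rule_format, of "N - Suc l" j] that by (simp add: coords_entry[OF p Ac])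
    then show "A *\<^sub>v p j \<in> flag N p (Suc j)" using Ac hyp_basisD(1)[OF p j] by (simp add: flag_iff)
  next
    fix i j assume "\<forall>j<N. A *\<^sub>v p j \<in> flag N p (Suc j)" and ij: "i < N" "j < i"
    then have "A *\<^sub>v p j \<in> flag N p (Suc j)" by simp
    then show "coords N p A $$ (i, j) = 0" using ij by (simp add: coords_entry[OF p Ac] flag_iff)
  qed
  ultimately show ?thesis
    using True Ac orthogonal_iff_split_form[OF p Ac] by (simp add: flag_stabilizer_def split_borel_def)
qed (auto simp: flag_stabilizer_def)

lemma flag_preserved:
  assumes p: "hyp_basis N p" and A: "A \<in> carrier_mat N N" and st: "\<And>j. j < N \<Longrightarrow> A *\<^sub>v p j \<in> flag N p (Suc j)"
    and i: "i \<le> N" and v: "v \<in> flag N p i"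
  shows "A *\<^sub>v v \<in> flag N p i"
proof -
  have vc: "v \<in> carrier_vec N" using v flag_carrier by blast
  have "(A *\<^sub>v v) \<bullet> p l = 0" if l: "l + i < N" for l
  proof -
    have lc: "p l \<in> carrier_vec N" using hyp_basisD(1)[OF p] l by simp
    have Tc: "transpose_mat A *\<^sub>v p l \<in> carrier_vec N" using A lc by simp
    have "(A *\<^sub>v v) \<bullet> p l = p l \<bullet> (A *\<^sub>v v)" by (rule comm) (use A vc lc in auto)
    also have "\<dots> = (transpose_mat A *\<^sub>v p l) \<bullet> v" using transpose_vec_mult_scalar[OF A vc lc] by simp
    also have "\<dots> = v \<bullet> (transpose_mat A *\<^sub>v p l)" by (rule comm[OF Tc vc])
    also have "\<dots> = (\<Sum>k<N. (v \<bullet> p k) * ((transpose_mat A *\<^sub>v p l) \<bullet> p (N - Suc k)))"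
      by (rule parseval[OF p vc Tc])
    also have "\<dots> = 0"
    proof (intro sum.neutral ballI)
      fix k assume "k \<in> {..<N}"
      then have k: "k < N" by simp
      show "(v \<bullet> p k) * ((transpose_mat A *\<^sub>v p l) \<bullet> p (N - Suc k)) = 0"
      proof (cases "k + i < N")
        case True
        then show ?thesis using v by (simp add: flag_iff)
      next
        case False
        let ?k = "N - Suc k"
        have kc: "p ?k \<in> carrier_vec N" using hyp_basisD(1)[OF p] k by simp
        have "(transpose_mat A *\<^sub>v p l) \<bullet> p ?k = p l \<bullet> (A *\<^sub>v p ?k)" by (rule transpose_vec_mult_scalar[OF A kc lc])
        also have "\<dots> = (A *\<^sub>v p ?k) \<bullet> p l" by (rule comm) (use A lc kc in auto)
        also have "\<dots> = 0" using st[of ?k] k False l by (simp add: flag_iff)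
        finally show ?thesis by simp
      qed
    qed
    finally show ?thesis .
  qed
  then show ?thesis using A vc by (simp add: flag_iff)
qed

lemma subgroup_flag_stabilizer:
  assumes p: "hyp_basis N p"
  shows "subgroup (flag_stabilizer N p) (SO N)"
proof -
  interpret group "SO N" by (rule group_SO)
  note iff = flag_stabilizer_iff[OF p]
  show ?thesis
  proof (rule subgroupI)
    show "flag_stabilizer N p \<subseteq> carrier (SO N)" by (auto simp: flag_stabilizer_def)
    have "1\<^sub>m N \<in> flag_stabilizer N p" unfolding iff
      using basis_in_flag[OF p] hyp_basisD(1)[OF p] by (auto simp: orthogonal_matrices_one)
    then show "flag_stabilizer N p \<noteq> {}" by blast
  next
    fix A assume A: "A \<in> flag_stabilizer N p"
    then have Ao: "A \<in> orthogonal_matrices N" "det A = 1" and st: "\<And>j. j < N \<Longrightarrow> A *\<^sub>v p j \<in> flag N p (Suc j)"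
      unfolding iff by auto
    have Ac: "A \<in> carrier_mat N N" using orthogonal_matricesD Ao by blast
    have "transpose_mat A *\<^sub>v p j \<in> flag N p (Suc j)" if j: "j < N" for j
    proof -
      have jc: "p j \<in> carrier_vec N" using hyp_basisD(1)[OF p j] .
      have "(transpose_mat A *\<^sub>v p j) \<bullet> p l = 0" if l: "l + Suc j < N" for l
      proof -
        have lc: "p l \<in> carrier_vec N" using hyp_basisD(1)[OF p] l by simp
        have "(transpose_mat A *\<^sub>v p j) \<bullet> p l = p j \<bullet> (A *\<^sub>v p l)" by (rule transpose_vec_mult_scalar[OF Ac lc jc])
        also have "\<dots> = (A *\<^sub>v p l) \<bullet> p j" by (rule comm) (use Ac lc jc in auto)
        also have "\<dots> = 0" using st[of l] l by (simp add: flag_iff)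
        finally show ?thesis .
      qed
      then show ?thesis using Ac jc by (simp add: flag_iff)
    qed
    then have "transpose_mat A \<in> flag_stabilizer N p" unfolding iff
      using orthogonal_matrices_transpose[OF Ao(1)] det_transpose_orthogonal[OF Ao(1)] Ao(2) by simp
    then show "inv\<^bsub>SO N\<^esub> A \<in> flag_stabilizer N p" using inv_SO[of A N] Ao by simp
  next
    fix A B assume "A \<in> flag_stabilizer N p" "B \<in> flag_stabilizer N p"
    then have A: "A \<in> orthogonal_matrices N" "det A = 1" "\<And>j. j < N \<Longrightarrow> A *\<^sub>v p j \<in> flag N p (Suc j)"
      and B: "B \<in> orthogonal_matrices N" "det B = 1" "\<And>j. j < N \<Longrightarrow> B *\<^sub>v p j \<in> flag N p (Suc j)"
      unfolding iff by auto
    note Ac = orthogonal_matricesD(1)[OF A(1)] and Bc = orthogonal_matricesD(1)[OF B(1)]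
    have "(A * B) *\<^sub>v p j \<in> flag N p (Suc j)" if j: "j < N" for j
    proof -
      have "(A * B) *\<^sub>v p j = A *\<^sub>v (B *\<^sub>v p j)"
        by (rule assoc_mult_mat_vec[OF Ac Bc hyp_basisD(1)[OF p j]])
      then show ?thesis using flag_preserved[OF p Ac A(3) _ B(3)[OF j]] j by simp
    qed
    then show "A \<otimes>\<^bsub>SO N\<^esub> B \<in> flag_stabilizer N p" unfolding iff
      using A B orthogonal_matrices_mult[OF A(1) B(1)] det_mult_orthogonal[OF A(1) B(1)] by simp
  qed
qed

lemma closedin_flag_stabilizer:
  assumes p: "hyp_basis N p"
  shows "closedin (zariski N) (flag_stabilizer N p)"
proof -
  let ?T1 = "{..<N} \<times> {..<N}"
  have rm: "regular_map N (\<lambda>A. transpose_mat A * A)"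
    by (intro regular_map_mult regular_map_transpose regular_map_id)
  have "closedin (zariski N) {A \<in> carrier_mat N N. \<forall>t\<in>?T1. (transpose_mat A * A) $$ t - 1\<^sub>m N $$ t = 0}"
    using rm by (intro closedin_zariski_zeros regular_diff regular_const) (auto simp: regular_map_def)
  moreover have "closedin (zariski N) {A \<in> carrier_mat N N. det A - 1 = 0}"
    by (intro closedin_zariski_zero regular_diff regular_const regular_det)
  moreover have "closedin (zariski N) {A \<in> carrier_mat N N. \<forall>t\<in>{(j, l). l + Suc j < N}. (A *\<^sub>v p (fst t)) \<bullet> p (snd t) = 0}"
    by (intro closedin_zariski_zeros regular_apply regular_map_id) (use hyp_basisD(1)[OF p] in auto)
  ultimately have "closedin (zariski N) ({A \<in> carrier_mat N N. \<forall>t\<in>?T1. (transpose_mat A * A) $$ t - 1\<^sub>m N $$ t = 0} \<inter>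
     {A \<in> carrier_mat N N. det A - 1 = 0} \<inter> {A \<in> carrier_mat N N. \<forall>t\<in>{(j, l). l + Suc j < N}. (A *\<^sub>v p (fst t)) \<bullet> p (snd t) = 0})"
    by (intro closedin_Int)
  moreover have "flag_stabilizer N p = ({A \<in> carrier_mat N N. \<forall>t\<in>?T1. (transpose_mat A * A) $$ t - 1\<^sub>m N $$ t = 0} \<inter>
     {A \<in> carrier_mat N N. det A - 1 = 0} \<inter> {A \<in> carrier_mat N N. \<forall>t\<in>{(j, l). l + Suc j < N}. (A *\<^sub>v p (fst t)) \<bullet> p (snd t) = 0})"
    (is "_ = ?S")
  proof (intro equalityI subsetI)
    fix A assume "A \<in> flag_stabilizer N p"
    then have A: "A \<in> orthogonal_matrices N" "det A = 1" "\<And>j. j < N \<Longrightarrow> A *\<^sub>v p j \<in> flag N p (Suc j)"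
      unfolding flag_stabilizer_iff[OF p] by auto
    then show "A \<in> ?S" using orthogonal_matricesD[OF A(1)] by (auto simp: flag_iff)
  next
    fix A assume A: "A \<in> ?S"
    then have Ac: "A \<in> carrier_mat N N" by simp
    have "transpose_mat A * A = 1\<^sub>m N" by (rule eq_matI) (use A Ac in auto)
    moreover have "A *\<^sub>v p j \<in> flag N p (Suc j)" if "j < N" for j
      using A Ac hyp_basisD(1)[OF p that] by (auto simp: flag_iff)
    ultimately show "A \<in> flag_stabilizer N p" unfolding flag_stabilizer_iff[OF p]
      using A Ac by (simp add: orthogonal_matrices_def)
  qed
  ultimately show ?thesis by simp
qed

section \<open>Diagonal entries and connectedness of the split Borel subgroup\<close>

lemma split_borelD:
  assumes "T \<in> split_borel N"
  shows "T \<in> carrier_mat N N" "split_form N T" "det T = 1" "i < N \<Longrightarrow> j < i \<Longrightarrow> T $$ (i, j) = 0"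
  using assms by (auto simp: split_borel_def)

lemma det_upper: 
  assumes "T \<in> carrier_mat N N" "\<And>i j. i < N \<Longrightarrow> j < i \<Longrightarrow> T $$ (i, j) = 0"
  shows "det T = (\<Prod>i<N. T $$ (i, i))"
proof -
  have "det T = prod_list (diag_mat T)"
    by (rule det_upper_triangular[OF _ assms(1)]) (use assms in auto)
  also have "\<dots> = (\<Prod>i<N. T $$ (i, i))"
    using assms(1) by (simp add: diag_mat_def prod.list_conv_set_nth atLeast0LessThan)
  finally show ?thesis .
qed

lemma split_form_diag:
  assumes T: "T \<in> split_borel N" and i: "i < N"
  shows "T $$ (i, i) * T $$ (N - Suc i, N - Suc i) = 1"
proof -
  note D = split_borelD[OF T]
  let ?w = "N - Suc i"
  have "(\<Sum>k<N. T $$ (N - Suc k, i) * T $$ (k, ?w)) = 1"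
    using D(2) i by (auto simp: split_form_def)
  moreover have "(\<Sum>k<N. T $$ (N - Suc k, i) * T $$ (k, ?w)) = (\<Sum>k\<in>{?w}. T $$ (N - Suc k, i) * T $$ (k, ?w))"
  proof (intro sum.mono_neutral_right ballI)
    fix k assume k: "k \<in> {..<N} - {?w}"
    show "T $$ (N - Suc k, i) * T $$ (k, ?w) = 0"
    proof (cases "?w < k")
      case True then show ?thesis using D(4)[of k ?w] k by simp
    next
      case False
      then have "i < N - Suc k" using k i by auto
      then show ?thesis using D(4)[of "N - Suc k" i] k by simp
    qed
  qed (use i in auto)
  ultimately show ?thesis using i by simp
qed

text \<open>Meant for the diagonal entries of an element of \<open>split_borel\<close>: the form
  makes mirror entries inverse to each other but fixes the middle entry only up to sign. The product
  identifies the middle entry with the determinant, hence with 1.\<close>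

lemma prod_symmetric:
  fixes g :: "nat \<Rightarrow> 'k::field"
  assumes N: "N = Suc (2 * l)" and g: "\<And>i. i < l \<Longrightarrow> g i * g (N - Suc i) = 1"
  shows "(\<Prod>i<N. g i) = g l"
proof -
  have "(\<Prod>i<N. g i) = (\<Prod>i<l. g i) * (g l * (\<Prod>i\<in>{Suc l..<N}. g i))"
  proof -
    have lN: "l < N" using N by simp
    have "prod g {0..<N} = prod g {0..<l} * prod g {l..<N}"
      using prod.atLeastLessThan_concat[of 0 l N g] lN by simp
    also have "prod g {l..<N} = g l * prod g {Suc l..<N}" by (rule prod.atLeast_Suc_lessThan[OF lN])
    finally show ?thesis by (simp only: atLeast0LessThan)
  qed
  also have "(\<Prod>i\<in>{Suc l..<N}. g i) = (\<Prod>i<l. g (N - Suc i))"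
    by (rule prod.reindex_bij_witness[of _ "\<lambda>i. N - Suc i" "\<lambda>i. N - Suc i"]) (use N in auto)
  also have "(\<Prod>i<l. g i) * (g l * (\<Prod>i<l. g (N - Suc i))) = g l * (\<Prod>i<l. g i * g (N - Suc i))"
    by (simp add: prod.distrib)
  also have "\<dots> = g l" using g by simp
  finally show ?thesis .
qed

text \<open>For nonzero \<open>x\<close> this is conjugation by the diagonal matrix whose i-th entry
  is x to the power -i. Written with the powers j - i it still makes sense at x = 0, where only the
  diagonal remains. The form survives because the two exponents in each nonzero term of
  \<open>split_form\<close> add up to \<open>Suc (j + l) - N\<close>, whatever \<open>k\<close>
  is.\<close>

lemma split_borel_contract:
  assumes T: "T \<in> split_borel N"
  shows "mat N N (\<lambda>(i, j). if j < i then 0 else x ^ (j - i) * T $$ (i, j)) \<in> split_borel N" (is "?M \<in> _")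
proof -
  note D = split_borelD[OF T]
  have up: "i < N \<Longrightarrow> j < i \<Longrightarrow> ?M $$ (i, j) = 0" for i j by simp
  have "split_form N ?M" unfolding split_form_def
  proof (intro allI impI)
    fix j l assume jl: "j < N" "l < N"
    have "(\<Sum>k<N. ?M $$ (N - Suc k, j) * ?M $$ (k, l)) = (\<Sum>k<N. x ^ (Suc (j + l) - N) * (T $$ (N - Suc k, j) * T $$ (k, l)))"
    proof (intro sum.cong refl)
      fix k assume "k \<in> {..<N}"
      then have k: "k < N" by simp
      show "?M $$ (N - Suc k, j) * ?M $$ (k, l) = x ^ (Suc (j + l) - N) * (T $$ (N - Suc k, j) * T $$ (k, l))"
      proof (cases "N - Suc k \<le> j \<and> k \<le> l")
        case True
        then have "x ^ (Suc (j + l) - N) = x ^ (j - (N - Suc k)) * x ^ (l - k)"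
          unfolding power_add[symmetric] using k by (intro arg_cong[where f = "power x"]) linarith
        then show ?thesis using True k jl by (simp add: mult_ac)
      next
        case False
        then have "T $$ (N - Suc k, j) * T $$ (k, l) = 0" using D(4)[of k l] D(4)[of "N - Suc k" j] k by auto
        then show ?thesis using False k jl by auto
      qed
    qed
    also have "\<dots> = x ^ (Suc (j + l) - N) * (if Suc (j + l) = N then 1 else 0)"
      using D(2) jl by (simp add: sum_distrib_left[symmetric] split_form_def)
    also have "\<dots> = (if Suc (j + l) = N then 1 else 0)" by auto
    finally show "(\<Sum>k<N. ?M $$ (N - Suc k, j) * ?M $$ (k, l)) = (if Suc (j + l) = N then 1 else 0)" .
  qed
  moreover have "det ?M = det T"
    using det_upper[of ?M N, OF _ up] det_upper[OF D(1,4)] by simp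
  ultimately show ?thesis using D(3) up by (simp add: split_borel_def)
qed

text \<open>Every element of the standard Borel subgroup is joined to its diagonal part by conjugation with
  a degenerating one-parameter torus, and the diagonal part to the identity by interpolation.\<close>

lemma connectedin_split_borel:
  assumes N: "odd N"
  shows "connectedin (zariski N) (split_borel N :: 'k::alg_closed_field mat set)"
proof -
  obtain l where l: "N = Suc (2 * l)" using N by (auto elim: oddE)
  have main: "\<exists>S. connectedin (zariski N) S \<and> S \<subseteq> split_borel N \<and> T \<in> S \<and> 1\<^sub>m N \<in> S"
    if T: "T \<in> split_borel N" for T :: "'k mat"
  proof -
    note D = split_borelD[OF T]
    define t where "t i = T $$ (i, i)" for i
    have tt: "t i * t (N - Suc i) = 1" if "i < N" for i using split_form_diag[OF T that] by (simp add: t_def)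
    have "(\<Prod>i<N. t i) = t l" by (rule prod_symmetric[OF l]) (use tt l in simp)
    then have tl: "t l = 1" using det_upper[OF D(1,4)] D(3) by (simp add: t_def)
    define c where "c x = mat N N (\<lambda>(i, j). if j < i then 0 else x ^ (j - i) * T $$ (i, j))" for x
    have con_c: "connectedin (zariski N) (c ` UNIV)"
    proof (rule connectedin_rational_curve[where q = 1 and p = "\<lambda>i j. if j < i then 0 else monom (T $$ (i, j)) (j - i)"])
      show "c x $$ (i, j) = poly (if j < i then 0 else monom (T $$ (i, j)) (j - i)) x / poly 1 x"
        if "i < N" "j < N" for x i j using that by (simp add: c_def poly_monom mult.commute)
    qed (auto simp: c_def)
    have cB: "c x \<in> split_borel N" for x unfolding c_def by (rule split_borel_contract[OF T])
    have c1: "c 1 = T"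
      using D(1) by (intro eq_matI) (auto simp: c_def D(4))
    \<comment> \<open>The polynomial \<open>f i\<close> is 1 at 0 and \<open>t i\<close> at 1. The
      mirror entry has to be its inverse, so the path is a rational curve with common denominator
      \<open>q\<close>, restricted to the cofinite set \<open>E\<close> of parameters where
      \<open>q\<close> does not vanish.\<close>
    define f where "f i = [:1, t i - 1:]" for i
    define q where "q = (\<Prod>i<l. f i)"
    define P where "P i j = (if i \<noteq> j then 0 else if i < l then f i * q else if i = l then q else (\<Prod>k\<in>{..<l} - {N - Suc i}. f k))" for i j
    have q0: "poly q 0 = 1" by (simp add: q_def f_def poly_prod)
    have q1: "poly q 1 \<noteq> 0"
    proof -
      have "poly q 1 = (\<Prod>i<l. t i)" by (simp add: q_def f_def poly_prod)
      moreover have "t i \<noteq> 0" if "i < l" for i using tt[of i] that l by auto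
      ultimately show ?thesis by simp
    qed
    define E where "E = {x. poly q x \<noteq> 0}"
    define g where "g x i = (if i < l then poly (f i) x else if i = l then 1 else inverse (poly (f (N - Suc i)) x))" for x i
    define d where "d x = mat N N (\<lambda>(i, j). if i = j then g x i else 0)" for x
    have fx: "poly (f i) x \<noteq> 0" if "x \<in> E" "i < l" for x i
      using that by (auto simp: E_def q_def poly_prod)
    have con_d: "connectedin (zariski N) (d ` E)"
    proof (rule connectedin_rational_curve[where q = q and p = P])
      have "q \<noteq> 0" using q0 by auto
      then show "finite (- E)" using poly_roots_finite by (simp add: E_def Collect_neg_eq[symmetric])
      show "d x $$ (i, j) = poly (P i j) x / poly q x" if x: "x \<in> E" and ij: "i < N" "j < N" for x i j
      proof -
        have qx: "poly q x \<noteq> 0" using x by (simp add: E_def)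
        have "poly q x = poly (f (N - Suc i)) x * poly (\<Prod>k\<in>{..<l} - {N - Suc i}. f k) x" if "l < i"
        proof -
          have m: "N - Suc i \<in> {..<l}" using l that ij by auto
          show ?thesis unfolding q_def by (subst prod.remove[OF _ m]) auto
        qed
        then show ?thesis using qx ij l fx[OF x] by (auto simp: d_def g_def P_def field_simps)
      qed
    qed (auto simp: d_def E_def)
    have dB: "d x \<in> split_borel N" if x: "x \<in> E" for x
    proof -
      have gg: "g x i * g x (N - Suc i) = 1" if "i < N" for i
      proof -
        consider "i < l" | "i = l" | "l < i" by linarith
        then show ?thesis using that l fx[OF x, of i] fx[OF x, of "N - Suc i"] by cases (auto simp: g_def)
      qed
      have "split_form N (d x)" unfolding split_form_def
      proof (intro allI impI)
        fix j i assume ij: "j < N" "i < N"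
        have "(\<Sum>k<N. d x $$ (N - Suc k, j) * d x $$ (k, i)) = (\<Sum>k<N. if k = i then (if N - Suc i = j then g x j * g x i else 0) else 0)"
          by (intro sum.cong refl) (use ij in \<open>auto simp: d_def\<close>)
        also have "\<dots> = (if N - Suc i = j then g x j * g x i else 0)" using ij by simp
        also have "\<dots> = (if Suc (j + i) = N then 1 else 0)" using ij gg[of i] by (auto simp: mult.commute)
        finally show "(\<Sum>k<N. d x $$ (N - Suc k, j) * d x $$ (k, i)) = (if Suc (j + i) = N then 1 else 0)" .
      qed
      moreover have "det (d x) = (\<Prod>i<N. g x i)" by (subst det_upper[of _ N]) (auto simp: d_def)
      moreover have "(\<Prod>i<N. g x i) = g x l" by (rule prod_symmetric[OF l]) (use gg l in simp)
      ultimately show ?thesis by (simp add: split_borel_def d_def g_def)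
    qed
    have d0: "d 0 = 1\<^sub>m N" by (rule eq_matI) (auto simp: d_def g_def f_def)
    have d1: "d 1 = c 0"
    proof (rule eq_matI)
      fix i j assume "i < dim_row (c 0)" "j < dim_col (c 0)"
      then have ij: "i < N" "j < N" by (auto simp: c_def)
      have "g 1 i = t i"
      proof -
        consider "i < l" | "i = l" | "l < i" by linarith
        then show ?thesis
        proof cases
          case 3
          then have "t (N - Suc i) * t i = 1" using tt[OF ij(1)] by (simp add: mult.commute)
          then have "inverse (t (N - Suc i)) = t i" by (rule inverse_unique)
          then show ?thesis using 3 by (simp add: g_def f_def)
        qed (use tl in \<open>auto simp: g_def f_def\<close>)
      qed
      then show "d 1 $$ (i, j) = c 0 $$ (i, j)" using ij by (auto simp: d_def c_def t_def)
    qed (auto simp: d_def c_def)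
    have E01: "0 \<in> E" "1 \<in> E" using q0 q1 by (auto simp: E_def)
    have "connectedin (zariski N) (c ` UNIV \<union> d ` E)"
      by (rule connectedin_Un[OF con_c con_d]) (use d1 E01 in blast)
    then show ?thesis
      using cB dB c1 d0 E01 by (intro exI[of _ "c ` UNIV \<union> d ` E"]) (auto intro: image_eqI[of _ c 1] image_eqI[of _ d 0])
  qed
  let ?U = "{S. connectedin (zariski N) S \<and> S \<subseteq> split_borel N \<and> (1\<^sub>m N :: 'k mat) \<in> S}"
  have "connectedin (zariski N) (\<Union> ?U)" by (rule connectedin_Union) auto
  moreover have "\<Union> ?U = split_borel N" using main by blast
  ultimately show ?thesis by simp
qed

lemma connectedin_flag_stabilizer:
  fixes p :: "nat \<Rightarrow> 'k::alg_closed_field vec"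
  assumes N: "odd N" and p: "hyp_basis N p"
  shows "connectedin (zariski N) (flag_stabilizer N p)"
  unfolding flag_stabilizer_image[OF p] uncoords_def
  by (intro connectedin_regular_image regular_map_mult regular_map_id regular_map_const connectedin_split_borel[OF N])
     simp_all

text \<open>At \<open>d = 0\<close> this is the whole stabiliser and at \<open>d = 1\<close> its
  unipotent part; afterwards one more superdiagonal vanishes at each step, and at
  \<open>d = N\<close> only the identity is left.\<close>

definition unipotent_filtration :: "nat \<Rightarrow> (nat \<Rightarrow> 'k::field vec) \<Rightarrow> nat \<Rightarrow> 'k mat set" where
  "unipotent_filtration N p d = {A \<in> flag_stabilizer N p.
     \<forall>i<N. \<forall>j<N. j < i + d \<longrightarrow> coords N p A $$ (i, j) = (if i = j then 1 else 0)}"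

lemma mat_mult_entry:
  assumes "X \<in> carrier_mat N N" "Y \<in> carrier_mat N N" "i < N" "j < N"
  shows "(X * Y) $$ (i, j) = (\<Sum>k<N. X $$ (i, k) * Y $$ (k, j))"
  using assms by (simp add: scalar_prod_def atLeast0LessThan)

lemma sum_eq_sum_support:
  assumes "finite A" "B \<subseteq> A" "\<And>k. k \<in> A - B \<Longrightarrow> f k = (0::'k::field)"
  shows "sum f A = sum f B"
  using assms by (intro sum.mono_neutral_right) auto

lemma flag_stabilizer_coords:
  assumes p: "hyp_basis N p" and A: "A \<in> flag_stabilizer N p"
  shows "A \<in> orthogonal_matrices N" "A \<in> carrier_mat N N" "coords N p A \<in> carrier_mat N N"
    "i < N \<Longrightarrow> j < i \<Longrightarrow> coords N p A $$ (i, j) = 0"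
proof -
  show "A \<in> orthogonal_matrices N" using A by (simp add: flag_stabilizer_def)
  then show c: "A \<in> carrier_mat N N" by (rule orthogonal_matricesD)
  then show "coords N p A \<in> carrier_mat N N" by simp
  show "i < N \<Longrightarrow> j < i \<Longrightarrow> coords N p A $$ (i, j) = 0"
    using A split_borelD(4) by (auto simp: flag_stabilizer_def)
qed

lemma subgroup_unipotent_filtration:
  assumes p: "hyp_basis N p"
  shows "subgroup (unipotent_filtration N p d) (SO N)"
proof -
  interpret group "SO N" by (rule group_SO)
  note SD = subgroup_SO_D[OF subgroup_flag_stabilizer[OF p]]
  note fc = flag_stabilizer_coords[OF p]
  show ?thesis
  proof (rule subgroupI)
    show "unipotent_filtration N p d \<subseteq> carrier (SO N)" 
      unfolding unipotent_filtration_def flag_stabilizer_def by blast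
    have "1\<^sub>m N \<in> unipotent_filtration N p d"
      using SD(4) coords_one[OF p] by (simp add: unipotent_filtration_def)
    then show "unipotent_filtration N p d \<noteq> {}" by blast
  next
    fix A assume A: "A \<in> unipotent_filtration N p d"
    then have AS: "A \<in> flag_stabilizer N p"
      and Ad: "\<And>i j. i < N \<Longrightarrow> j < N \<Longrightarrow> j < i + d \<Longrightarrow> coords N p A $$ (i, j) = (if i = j then 1 else 0)"
      by (auto simp: unipotent_filtration_def)
    have TS: "transpose_mat A \<in> flag_stabilizer N p" by (rule SD(3)[OF AS])
    let ?a = "coords N p A" and ?z = "coords N p (transpose_mat A)"
    have "?a * ?z = 1\<^sub>m N"
      using coords_mult[OF p fc(2)[OF AS] fc(2)[OF TS]] orthogonal_matricesD(3)[OF fc(1)[OF AS]] coords_one[OF p] by simp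
    then have az: "(\<Sum>k<N. ?a $$ (i, k) * ?z $$ (k, j)) = (if i = j then 1 else 0)" if "i < N" "j < N" for i j
      using mat_mult_entry[OF fc(3)[OF AS] fc(3)[OF TS] that] that by simp
    have "?z $$ (i, j) = (if i = j then 1 else 0)" if ij: "i < N" "j < N" "j < i + d" for i j
    proof -
      have "(\<Sum>k<N. ?a $$ (i, k) * ?z $$ (k, j)) = (\<Sum>k<N. if k = i then ?z $$ (i, j) else 0)"
      proof (intro sum.cong refl)
        fix k assume "k \<in> {..<N}"
        then have k: "k < N" by simp
        show "?a $$ (i, k) * ?z $$ (k, j) = (if k = i then ?z $$ (i, j) else 0)"
        proof (cases "k < i + d")
          case True
          then show ?thesis using Ad[OF ij(1) k] by auto
        next
          case False
          then have "?z $$ (k, j) = 0" using fc(4)[OF TS k] ij by simp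
          then show ?thesis by auto
        qed
      qed
      then show ?thesis using az[OF ij(1,2)] ij by simp
    qed
    then show "inv\<^bsub>SO N\<^esub> A \<in> unipotent_filtration N p d"
      using TS inv_SO[OF SD(7)[OF AS]] by (simp add: unipotent_filtration_def)
  next
    fix A B assume A: "A \<in> unipotent_filtration N p d" and B: "B \<in> unipotent_filtration N p d"
    then have AS: "A \<in> flag_stabilizer N p"
      and Ad: "\<And>i j. i < N \<Longrightarrow> j < N \<Longrightarrow> j < i + d \<Longrightarrow> coords N p A $$ (i, j) = (if i = j then 1 else 0)"
      and BS: "B \<in> flag_stabilizer N p"
      and Bd: "\<And>i j. i < N \<Longrightarrow> j < N \<Longrightarrow> j < i + d \<Longrightarrow> coords N p B $$ (i, j) = (if i = j then 1 else 0)"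
      by (auto simp: unipotent_filtration_def)
    let ?a = "coords N p A" and ?z = "coords N p B"
    have "coords N p (A * B) $$ (i, j) = (if i = j then 1 else 0)" if ij: "i < N" "j < N" "j < i + d" for i j
    proof -
      have "coords N p (A * B) $$ (i, j) = (\<Sum>k<N. ?a $$ (i, k) * ?z $$ (k, j))"
        unfolding coords_mult[OF p fc(2)[OF AS] fc(2)[OF BS]] by (rule mat_mult_entry[OF fc(3)[OF AS] fc(3)[OF BS] ij(1,2)])
      also have "\<dots> = (\<Sum>k<N. if k = i then ?z $$ (i, j) else 0)"
      proof (intro sum.cong refl)
        fix k assume "k \<in> {..<N}"
        then have k: "k < N" by simp
        show "?a $$ (i, k) * ?z $$ (k, j) = (if k = i then ?z $$ (i, j) else 0)"
        proof (cases "k < i + d")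
          case True
          then show ?thesis using Ad[OF ij(1) k] by auto
        next
          case False
          then have "?z $$ (k, j) = 0" using fc(4)[OF BS k] ij by simp
          then show ?thesis by auto
        qed
      qed
      finally show ?thesis using Bd[OF ij] ij by simp
    qed
    then show "A \<otimes>\<^bsub>SO N\<^esub> B \<in> unipotent_filtration N p d"
      using SD(5)[OF AS BS] by (simp add: unipotent_filtration_def)
  qed
qed

text \<open>An index k strictly between \<open>i\<close> and \<open>j\<close> satisfies k < i + d,
  so only k = i and k = j contribute. For \<open>d > 0\<close> the diagonal entries are 1 and the
  sum is symmetric in \<open>A\<close> and \<open>B\<close>; on the diagonal itself it is a product
  of two scalars.\<close>

lemma filtration_coords_commute:
  assumes p: "hyp_basis N p" and A: "A \<in> unipotent_filtration N p d" and B: "B \<in> unipotent_filtration N p d"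
    and ij: "i < N" "j < N" "j \<le> i + d"
  shows "coords N p (A * B) $$ (i, j) = coords N p (B * A) $$ (i, j)"
proof -
  note fc = flag_stabilizer_coords[OF p]
  have AS: "A \<in> flag_stabilizer N p"
    and Ad: "\<And>i j. i < N \<Longrightarrow> j < N \<Longrightarrow> j < i + d \<Longrightarrow> coords N p A $$ (i, j) = (if i = j then 1 else 0)"
    and BS: "B \<in> flag_stabilizer N p"
    and Bd: "\<And>i j. i < N \<Longrightarrow> j < N \<Longrightarrow> j < i + d \<Longrightarrow> coords N p B $$ (i, j) = (if i = j then 1 else 0)"
    using A B by (auto simp: unipotent_filtration_def)
  let ?a = "coords N p A" and ?b = "coords N p B"
  have e: "coords N p (A * B) $$ (i, j) = (\<Sum>k<N. ?a $$ (i, k) * ?b $$ (k, j))"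
    "coords N p (B * A) $$ (i, j) = (\<Sum>k<N. ?b $$ (i, k) * ?a $$ (k, j))"
    unfolding coords_mult[OF p fc(2)[OF AS] fc(2)[OF BS]] coords_mult[OF p fc(2)[OF BS] fc(2)[OF AS]]
    by (rule mat_mult_entry[OF fc(3)[OF AS] fc(3)[OF BS] ij(1,2)],
        rule mat_mult_entry[OF fc(3)[OF BS] fc(3)[OF AS] ij(1,2)])
  have z: "?a $$ (i, k) * ?b $$ (k, j) = 0 \<and> ?b $$ (i, k) * ?a $$ (k, j) = 0" if k: "k < N" "k \<noteq> i" "k \<noteq> j" for k
  proof (cases "k < i \<or> j < k")
    case True
    then show ?thesis using fc(4)[OF AS, of i k] fc(4)[OF BS, of i k] fc(4)[OF AS, of k j] fc(4)[OF BS, of k j] k ij by auto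
  next
    case False
    then show ?thesis using Ad[of i k] Bd[of i k] k ij by auto
  qed
  have s: "(\<Sum>k<N. ?a $$ (i, k) * ?b $$ (k, j)) = (\<Sum>k\<in>{i, j}. ?a $$ (i, k) * ?b $$ (k, j))"
    "(\<Sum>k<N. ?b $$ (i, k) * ?a $$ (k, j)) = (\<Sum>k\<in>{i, j}. ?b $$ (i, k) * ?a $$ (k, j))"
    by (intro sum_eq_sum_support; use z ij in auto)+
  show ?thesis
  proof (cases "i = j")
    case True
    then show ?thesis unfolding e s by (simp add: mult.commute)
  next
    case False
    show ?thesis
    proof (cases "j < i")
      case True
      then show ?thesis unfolding e s using False fc(4)[OF AS ij(1) True] fc(4)[OF BS ij(1) True] by simp
    next
      case ge: False
      then have "0 < d" using False ij by simp
      then show ?thesis unfolding e s using False Ad[of i i] Ad[of j j] Bd[of i i] Bd[of j j] ij by simp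
    qed
  qed
qed

text \<open>A commutator is X Z with X = A B and Z the inverse of Y = B A. As X and Y agree up to
  the d-th superdiagonal and Z is upper triangular, X Z agrees there with Y Z = 1.\<close>

lemma derived_unipotent_filtration:
  assumes p: "hyp_basis N p"
  shows "derived (SO N) (unipotent_filtration N p d) \<subseteq> unipotent_filtration N p (Suc d)"
proof -
  interpret group "SO N" by (rule group_SO)
  note SD = subgroup_SO_D[OF subgroup_flag_stabilizer[OF p]]
  note fc = flag_stabilizer_coords[OF p]
  have "derived_set (SO N) (unipotent_filtration N p d) \<subseteq> unipotent_filtration N p (Suc d)"
  proof
    fix C assume "C \<in> derived_set (SO N) (unipotent_filtration N p d)"
    then obtain A B where AB: "A \<in> unipotent_filtration N p d" "B \<in> unipotent_filtration N p d"
      and C0: "C = A * B * inv\<^bsub>SO N\<^esub> A * inv\<^bsub>SO N\<^esub> B" by auto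
    have AS: "A \<in> flag_stabilizer N p" and BS: "B \<in> flag_stabilizer N p" using AB by (auto simp: unipotent_filtration_def)
    let ?A = "transpose_mat A" and ?B = "transpose_mat B"
    have AT: "?A \<in> flag_stabilizer N p" and BT: "?B \<in> flag_stabilizer N p" using SD(3) AS BS by auto
    note car = fc(2)[OF AS] fc(2)[OF BS] fc(2)[OF AT] fc(2)[OF BT]
    have C: "C = (A * B) * (?A * ?B)"
      unfolding C0 inv_SO[OF SD(7)[OF AS]] inv_SO[OF SD(7)[OF BS]]
      by (rule assoc_mult_mat[of _ N N _ N _ N]) (use car in \<open>simp_all add: mult_carrier_mat[of _ N N _ N]\<close>)
    have CS: "C \<in> flag_stabilizer N p" unfolding C using SD(5) AS BS AT BT by blast
    have ZS: "?A * ?B \<in> flag_stabilizer N p" using SD(5) AT BT by blast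
    have XS: "A * B \<in> flag_stabilizer N p" "B * A \<in> flag_stabilizer N p" using SD(5) AS BS by blast+
    have YZ: "(B * A) * (?A * ?B) = 1\<^sub>m N"
    proof -
      have "(B * A) * (?A * ?B) = B * (A * (?A * ?B))"
        by (rule assoc_mult_mat[of _ N N _ N _ N]) (use car in \<open>simp_all add: mult_carrier_mat[of _ N N _ N]\<close>)
      also have "A * (?A * ?B) = A * ?A * ?B"
        by (rule assoc_mult_mat[of _ N N _ N _ N, symmetric]) (use car in simp_all)
      finally show ?thesis using orthogonal_matricesD(3)[OF fc(1)[OF AS]] orthogonal_matricesD(3)[OF fc(1)[OF BS]] car by simp
    qed
    let ?X = "coords N p (A * B)" and ?Y = "coords N p (B * A)" and ?Z = "coords N p (?A * ?B)"
    have "coords N p C $$ (i, j) = (if i = j then 1 else 0)" if ij: "i < N" "j < N" "j < i + Suc d" for i j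
    proof -
      have "coords N p C $$ (i, j) = (\<Sum>k<N. ?X $$ (i, k) * ?Z $$ (k, j))"
        unfolding C coords_mult[OF p fc(2)[OF XS(1)] fc(2)[OF ZS]]
        by (rule mat_mult_entry[OF fc(3)[OF XS(1)] fc(3)[OF ZS] ij(1,2)])
      also have "\<dots> = (\<Sum>k<N. ?Y $$ (i, k) * ?Z $$ (k, j))"
      proof (intro sum.cong refl)
        fix k assume "k \<in> {..<N}"
        then have k: "k < N" by simp
        show "?X $$ (i, k) * ?Z $$ (k, j) = ?Y $$ (i, k) * ?Z $$ (k, j)"
        proof (cases "k \<le> i + d")
          case True
          then show ?thesis using filtration_coords_commute[OF p AB ij(1) k] by simp
        next
          case False
          then have "?Z $$ (k, j) = 0" using fc(4)[OF ZS k] ij by simp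
          then show ?thesis by simp
        qed
      qed
      also have "\<dots> = coords N p ((B * A) * (?A * ?B)) $$ (i, j)"
        unfolding coords_mult[OF p fc(2)[OF XS(2)] fc(2)[OF ZS]]
        by (rule mat_mult_entry[OF fc(3)[OF XS(2)] fc(3)[OF ZS] ij(1,2), symmetric])
      finally show ?thesis unfolding YZ coords_one[OF p] using ij by simp
    qed
    then show "C \<in> unipotent_filtration N p (Suc d)" using CS by (simp add: unipotent_filtration_def)
  qed
  then show ?thesis unfolding derived_def
    by (rule generate_subgroup_incl[OF _ subgroup_unipotent_filtration[OF p]])
qed

lemma solvable_restrict_iff:
  assumes "group G" "subgroup H G"
  shows "solvable (G\<lparr>carrier := H\<rparr>) \<longleftrightarrow> (\<exists>n. (derived G ^^ n) H = {\<one>\<^bsub>G\<^esub>})"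
proof -
  interpret G: group G by fact
  interpret H: group "G\<lparr>carrier := H\<rparr>" by (rule G.subgroup_imp_group[OF assms(2)])
  have "(derived (G\<lparr>carrier := H\<rparr>) ^^ n) H = (derived G ^^ n) H \<and> (derived G ^^ n) H \<subseteq> H" for n
  proof (induction n)
    case (Suc n)
    then show ?case using G.derived_consistent[OF _ assms(2)] G.derived_incl[OF _ assms(2)] by simp
  qed simp
  then show ?thesis unfolding H.solvable_iff_trivial_derived_seq by simp
qed

lemma solvable_flag_stabilizer:
  assumes p: "hyp_basis N p"
  shows "solvable (SO N\<lparr>carrier := flag_stabilizer N p\<rparr>)"
proof -
  interpret group "SO N" by (rule group_SO)
  note S = subgroup_flag_stabilizer[OF p]
  note fc = flag_stabilizer_coords[OF p]
  have "(derived (SO N) ^^ n) (flag_stabilizer N p) \<subseteq> unipotent_filtration N p n" for n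
  proof (induction n)
    case 0
    then show ?case using fc(4) by (auto simp: unipotent_filtration_def)
  next
    case (Suc n)
    then show ?case using mono_derived[OF Suc] derived_unipotent_filtration[OF p, of n] by simp
  qed
  moreover have "unipotent_filtration N p N \<subseteq> {1\<^sub>m N}"
  proof
    fix A assume A: "A \<in> unipotent_filtration N p N"
    then have AS: "A \<in> flag_stabilizer N p" by (simp add: unipotent_filtration_def)
    have "coords N p A = coords N p (1\<^sub>m N)"
      unfolding coords_one[OF p] using A fc(3)[OF AS] by (intro eq_matI) (auto simp: unipotent_filtration_def)
    then show "A \<in> {1\<^sub>m N}" using coords_inj[OF p fc(2)[OF AS], of "1\<^sub>m N"] by simp
  qed
  moreover have "1\<^sub>m N \<in> (derived (SO N) ^^ N) (flag_stabilizer N p)"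
    using subgroup.one_closed[OF exp_of_derived_is_subgroup[OF S]] by simp
  ultimately have "(derived (SO N) ^^ N) (flag_stabilizer N p) = {\<one>\<^bsub>SO N\<^esub>}" by fastforce
  then show ?thesis unfolding solvable_restrict_iff[OF group_SO S] by blast
qed

theorem borel_subgroup_is_flag_stabilizer:
  fixes B :: "'k::alg_closed_field mat set"
  assumes two: "(2 :: 'k) \<noteq> 0" and N: "odd N" and B: "borel_subgroup N B"
  obtains p where "hyp_basis N p" "B = flag_stabilizer N p"
proof -
  have ccs: "subgroup B (SO N)" "connectedin (zariski N) B" "solvable (SO N\<lparr>carrier := B\<rparr>)"
    and max: "\<And>H. closed_connected_solvable N H \<Longrightarrow> B \<subseteq> H \<Longrightarrow> H = B"
    using B by (auto simp: borel_subgroup_def closed_connected_solvable_def)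
  obtain n where "(derived (SO N) ^^ n) B = {1\<^sub>m N}"
    using ccs(3) unfolding solvable_restrict_iff[OF group_SO ccs(1)] by auto
  from stable_flag_exists[OF two N ccs(1,2) this]
  obtain p where p: "hyp_basis N p" and st: "\<And>i h v. i \<le> N \<Longrightarrow> h \<in> B \<Longrightarrow> v \<in> flag N p i \<Longrightarrow> h *\<^sub>v v \<in> flag N p i"
    by blast
  have "B \<subseteq> flag_stabilizer N p"
  proof
    fix h assume h: "h \<in> B"
    show "h \<in> flag_stabilizer N p" unfolding flag_stabilizer_iff[OF p]
      using subgroup_SO_D(1,6)[OF ccs(1) h] st[OF _ h basis_in_flag[OF p]] by (simp add: Suc_leI)
  qed
  moreover have "closed_connected_solvable N (flag_stabilizer N p)"
    unfolding closed_connected_solvable_def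
    using subgroup_flag_stabilizer[OF p] closedin_flag_stabilizer[OF p]
      connectedin_flag_stabilizer[OF N p] solvable_flag_stabilizer[OF p] by blast
  ultimately have "flag_stabilizer N p = B" using max by blast
  then show thesis using that p by blast
qed

section \<open>Normal forms of symmetric involutions\<close>

text \<open>A pair \<open>(\<sigma>, M)\<close> encodes a symmetric clan: \<open>\<sigma>\<close> is the matching, commuting with the reversal
  \<open>k \<mapsto> N - 1 - k\<close>, and \<open>M\<close> is the set of fixed points that carry the sign \<open>-\<close>.\<close>

definition clans :: "nat \<Rightarrow> nat set \<Rightarrow> ((nat \<Rightarrow> nat) \<times> nat set) set" where
  "clans N I = {(\<sigma>, M). (\<forall>k\<in>I. \<sigma> k \<in> I \<and> \<sigma> (\<sigma> k) = k \<and> \<sigma> (N - Suc k) = N - Suc (\<sigma> k)) \<and>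
     (\<forall>k. k \<notin> I \<longrightarrow> \<sigma> k = k) \<and> M \<subseteq> {k \<in> I. \<sigma> k = k} \<and> (\<forall>k\<in>M. N - Suc k \<in> M)}"

lemma clansD:
  assumes "(\<sigma>, M) \<in> clans N I"
  shows "k \<in> I \<Longrightarrow> \<sigma> k \<in> I" "k \<in> I \<Longrightarrow> \<sigma> (\<sigma> k) = k" "k \<in> I \<Longrightarrow> \<sigma> (N - Suc k) = N - Suc (\<sigma> k)"
    "k \<notin> I \<Longrightarrow> \<sigma> k = k" "M \<subseteq> I" "k \<in> M \<Longrightarrow> \<sigma> k = k" "k \<in> M \<Longrightarrow> N - Suc k \<in> M"
  using assms by (auto simp: clans_def)

lemma clans_merge:
  assumes D: "(\<sigma>, M) \<in> clans N D" and cl: "(\<tau>, L) \<in> clans N S"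
    and S: "S \<inter> D = {}" "\<And>k. k \<in> S \<Longrightarrow> N - Suc k \<in> S" and D3: "\<And>k. k \<in> D \<Longrightarrow> N - Suc k \<in> D"
  shows "(\<lambda>k. if k \<in> S then \<tau> k else \<sigma> k, M \<union> L) \<in> clans N (D \<union> S)"
proof -
  note C = clansD[OF D] and C' = clansD[OF cl]
  have dj: "k \<notin> S" if "k \<in> D" for k using that S(1) by blast
  show ?thesis
    unfolding clans_def
  proof (intro CollectI case_prodI conjI ballI allI impI subsetI)
    fix k assume k: "k \<in> D \<union> S"
    show "(if k \<in> S then \<tau> k else \<sigma> k) \<in> D \<union> S" using k C(1) C'(1) by auto
    show "(if (if k \<in> S then \<tau> k else \<sigma> k) \<in> S then \<tau> (if k \<in> S then \<tau> k else \<sigma> k) else \<sigma> (if k \<in> S then \<tau> k else \<sigma> k)) = k"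
      using k C(1,2) C'(1,2) dj by auto
    show "(if N - Suc k \<in> S then \<tau> (N - Suc k) else \<sigma> (N - Suc k)) = N - Suc (if k \<in> S then \<tau> k else \<sigma> k)"
      using k C(3) C'(3) dj S(2) D3 by auto
  next
    fix k assume "k \<notin> D \<union> S"
    then show "(if k \<in> S then \<tau> k else \<sigma> k) = k" using C(4) by auto
  next
    fix k assume "k \<in> M \<union> L"
    then show "k \<in> D \<union> S" "(if k \<in> S then \<tau> k else \<sigma> k) = k" using C(5,6) C'(5,6) dj by auto
  next
    fix k assume "k \<in> M \<union> L"
    then show "N - Suc k \<in> M \<union> L" using C(7) C'(7) by auto
  qed
qed

definition clan_sign :: "nat set \<Rightarrow> nat \<Rightarrow> 'k::field" where
  "clan_sign M k = (if k \<in> M then -1 else 1)"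

text \<open>The domain \<open>D\<close> allows the basis to be built by adding index sets that are
  symmetric under the reversal. Since \<open>g k\<close> pairs to 1 with
  \<open>g (N - Suc k)\<close>, its level is exactly \<open>k\<close> and not merely at most
  \<open>k\<close>.\<close>

definition normal_form_on ::
    "nat \<Rightarrow> (nat \<Rightarrow> 'k::field vec) \<Rightarrow> 'k mat \<Rightarrow> nat set \<Rightarrow> (nat \<Rightarrow> 'k vec) \<Rightarrow> (nat \<Rightarrow> nat) \<times> nat set \<Rightarrow> bool" where
  "normal_form_on N p \<theta> D g = (\<lambda>(\<sigma>, M). D \<subseteq> {..<N} \<and> (\<forall>k\<in>D. N - Suc k \<in> D) \<and>
     (\<forall>k\<in>D. g k \<in> flag N p (Suc k)) \<and> (\<forall>k\<in>D. \<forall>l\<in>D. g k \<bullet> g l = (if Suc (k + l) = N then 1 else 0)) \<and>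
     (\<sigma>, M) \<in> clans N D \<and> (\<forall>k\<in>D. \<theta> *\<^sub>v g k = clan_sign M k \<cdot>\<^sub>v g (\<sigma> k)))"

lemma normal_form_onD:
  assumes "normal_form_on N p \<theta> D g (\<sigma>, M)"
  shows "D \<subseteq> {..<N}" "k \<in> D \<Longrightarrow> k < N" "k \<in> D \<Longrightarrow> N - Suc k \<in> D" "k \<in> D \<Longrightarrow> g k \<in> flag N p (Suc k)"
    "k \<in> D \<Longrightarrow> l \<in> D \<Longrightarrow> g k \<bullet> g l = (if Suc (k + l) = N then 1 else 0)" "(\<sigma>, M) \<in> clans N D"
    "k \<in> D \<Longrightarrow> \<theta> *\<^sub>v g k = clan_sign M k \<cdot>\<^sub>v g (\<sigma> k)" "k \<in> D \<Longrightarrow> g k \<in> carrier_vec N"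
  using assms flag_carrier[of "g k" N p "Suc k"] by (auto simp: normal_form_on_def)

locale symmetric_involution =
  fixes N :: nat and p :: "nat \<Rightarrow> 'k::alg_closed_field vec" and \<theta> :: "'k mat"
  assumes two: "(2 :: 'k) \<noteq> 0" and p: "hyp_basis N p" and \<theta>: "\<theta> \<in> carrier_mat N N"
    and sym: "transpose_mat \<theta> = \<theta>" and inv: "\<theta> * \<theta> = 1\<^sub>m N"
begin

lemma \<theta>_adj: "x \<in> carrier_vec N \<Longrightarrow> y \<in> carrier_vec N \<Longrightarrow> (\<theta> *\<^sub>v x) \<bullet> y = x \<bullet> (\<theta> *\<^sub>v y)"
  using transpose_vec_mult_scalar[OF \<theta>, of y x] sym by simp

lemma \<theta>_inv: "x \<in> carrier_vec N \<Longrightarrow> \<theta> *\<^sub>v (\<theta> *\<^sub>v x) = x"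
  using assoc_mult_mat_vec[OF \<theta> \<theta>, of x] inv by simp

lemma \<theta>_carrier [simp]: "x \<in> carrier_vec N \<Longrightarrow> \<theta> *\<^sub>v x \<in> carrier_vec N"
  using \<theta> by simp

lemma \<theta>_lin: "x \<in> carrier_vec N \<Longrightarrow> y \<in> carrier_vec N \<Longrightarrow> \<theta> *\<^sub>v (x + y) = \<theta> *\<^sub>v x + \<theta> *\<^sub>v y"
  "x \<in> carrier_vec N \<Longrightarrow> y \<in> carrier_vec N \<Longrightarrow> \<theta> *\<^sub>v (x - y) = \<theta> *\<^sub>v x - \<theta> *\<^sub>v y"
  "x \<in> carrier_vec N \<Longrightarrow> \<theta> *\<^sub>v (a \<cdot>\<^sub>v x) = a \<cdot>\<^sub>v (\<theta> *\<^sub>v x)"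
  using mult_add_distrib_mat_vec[OF \<theta>] mult_minus_distrib_mat_vec[OF \<theta>] mult_mat_vec[OF \<theta>] by blast+

lemmas bilN = bil[of _ N]

lemma comN: "(x :: 'k vec) \<in> carrier_vec N \<Longrightarrow> y \<in> carrier_vec N \<Longrightarrow> x \<bullet> y = y \<bullet> x"
  by (rule comm)

text \<open>This fixes the notion of level: \<open>flag N p (Suc j)\<close> is the least flag
  containing \<open>v\<close>, and the pairing in the last clause is the leading coefficient of
  \<open>v\<close>.\<close>

lemma level_exists:
  assumes v: "v \<in> carrier_vec N" "v \<noteq> 0\<^sub>v N"
  obtains j where "j < N" "v \<in> flag N p (Suc j)" "v \<bullet> p (N - Suc j) \<noteq> 0"
proof -
  let ?P = "\<lambda>j. v \<in> flag N p j"
  have PN: "?P N" using v(1) by (simp add: flag_iff)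
  have "\<not> ?P 0" using v flag_0[OF p] by blast
  define m where "m = (LEAST j. ?P j)"
  have m: "?P m" unfolding m_def by (rule LeastI[of ?P, OF PN])
  have "m \<noteq> 0" using m \<open>\<not> ?P 0\<close> by metis
  then obtain j where j: "m = Suc j" by (cases m) auto
  have nj: "\<not> ?P j" using not_less_Least[of j ?P] j by (simp add: m_def)
  have "m \<le> N" unfolding m_def by (rule Least_le[of ?P, OF PN])
  then have jN: "j < N" using j by simp
  have "v \<bullet> p (N - Suc j) \<noteq> 0"
  proof
    assume z: "v \<bullet> p (N - Suc j) = 0"
    have "v \<bullet> p l = 0" if "l + j < N" for l
      using m j that z by (cases "l = N - Suc j") (auto simp: flag_iff)
    then show False using nj v by (simp add: flag_iff)
  qed
  then show thesis using that[OF jN] m j by simp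
qed

context
  fixes D :: "nat set" and g :: "nat \<Rightarrow> 'k vec" and \<sigma> :: "nat \<Rightarrow> nat" and M :: "nat set"
  assumes nf: "normal_form_on N p \<theta> D g (\<sigma>, M)"
begin

lemmas D = normal_form_onD[OF nf]

definition compl :: "'k vec set" where
  "compl = {v \<in> carrier_vec N. \<forall>k\<in>D. v \<bullet> g k = 0}"

lemma compl_subspace: "subspace_vec N compl"
  unfolding subspace_vec_def compl_def using D(8) by (auto simp: bilN)

lemma compl_carrier: "v \<in> compl \<Longrightarrow> v \<in> carrier_vec N"
  by (simp add: compl_def)

lemma compl_\<theta>: assumes v: "v \<in> compl" shows "\<theta> *\<^sub>v v \<in> compl"
  unfolding compl_def
proof (intro CollectI conjI ballI)
  note vc = compl_carrier[OF v]
  show "\<theta> *\<^sub>v v \<in> carrier_vec N" using vc by simp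
  fix k assume k: "k \<in> D"
  have sk: "\<sigma> k \<in> D" using clansD(1)[OF D(6) k] .
  have "(\<theta> *\<^sub>v v) \<bullet> g k = v \<bullet> (clan_sign M k \<cdot>\<^sub>v g (\<sigma> k))"
    using \<theta>_adj[OF vc D(8)[OF k]] D(7)[OF k] by simp
  also have "\<dots> = 0" using v sk vc D(8)[OF sk] by (simp add: compl_def bilN)
  finally show "(\<theta> *\<^sub>v v) \<bullet> g k = 0" .
qed

text \<open>If \<open>j\<close> were treated already, \<open>g (N - Suc j)\<close> would pair with
  \<open>v\<close> by a product of two nonzero leading coefficients. Vectors orthogonal to
  everything treated therefore have new levels.\<close>

lemma compl_level:
  assumes v: "v \<in> compl" and j: "j < N" "v \<in> flag N p (Suc j)" "v \<bullet> p (N - Suc j) \<noteq> 0"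
  shows "j \<notin> D"
proof
  assume jD: "j \<in> D"
  let ?w = "N - Suc j"
  have wD: "?w \<in> D" by (rule D(3)[OF jD])
  have s: "Suc (j + ?w) = N" "Suc (?w + j) = N" using j by auto
  have "v \<bullet> g ?w = (v \<bullet> p ?w) * (g ?w \<bullet> p j)" by (rule flag_pairing_top[OF p j(2) D(4)[OF wD] s(1)])
  moreover have "g ?w \<bullet> g j = (g ?w \<bullet> p j) * (g j \<bullet> p ?w)"
    by (rule flag_pairing_top[OF p D(4)[OF wD] D(4)[OF jD] s(2)])
  then have "g ?w \<bullet> p j \<noteq> 0" using D(5)[OF wD jD] s by auto
  ultimately show False using v wD j(3) by (auto simp: compl_def)
qed

definition proj :: "'k vec \<Rightarrow> 'k vec" where
  "proj x = vec N (\<lambda>a. x $ a - (\<Sum>k\<in>D. (x \<bullet> g (N - Suc k)) * g k $ a))"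

lemma proj_scalar:
  assumes "x \<in> carrier_vec N" "y \<in> carrier_vec N"
  shows "proj x \<bullet> y = x \<bullet> y - (\<Sum>k\<in>D. (x \<bullet> g (N - Suc k)) * (g k \<bullet> y))"
proof -
  have "proj x \<bullet> y = (\<Sum>a<N. x $ a * y $ a) - (\<Sum>a<N. \<Sum>k\<in>D. (x \<bullet> g (N - Suc k)) * (g k $ a * y $ a))"
    using assms by (simp add: scalar_prod_def proj_def atLeast0LessThan left_diff_distrib sum_subtractf sum_distrib_right mult.assoc)
  also have "(\<Sum>a<N. \<Sum>k\<in>D. (x \<bullet> g (N - Suc k)) * (g k $ a * y $ a)) = (\<Sum>k\<in>D. (x \<bullet> g (N - Suc k)) * (\<Sum>a<N. g k $ a * y $ a))"
    by (subst sum.swap) (simp add: sum_distrib_left)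
  finally show ?thesis using assms by (simp add: scalar_prod_def atLeast0LessThan)
qed

text \<open>Of the correction terms in \<open>proj\<close>, those with k < i lie in lower flags, and
  those with k > i have coefficient zero by orthogonality of flags. So the projection keeps the
  level \<open>i\<close> and the leading coefficient 1.\<close>

lemma proj_basis:
  assumes i: "i < N" "i \<notin> D"
  shows "proj (p i) \<in> compl" "proj (p i) \<in> flag N p (Suc i)" "proj (p i) \<bullet> p (N - Suc i) = 1"
proof -
  have ic: "p i \<in> carrier_vec N" using hyp_basisD(1)[OF p i(1)] .
  have fin: "finite D" using D(1) finite_subset by blast
  have pc: "proj (p i) \<in> carrier_vec N" by (simp add: proj_def)
  have "proj (p i) \<bullet> g l = 0" if l: "l \<in> D" for l
  proof -
    have "(\<Sum>k\<in>D. (p i \<bullet> g (N - Suc k)) * (g k \<bullet> g l)) = (\<Sum>k\<in>D. if k = N - Suc l then p i \<bullet> g l else 0)"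
    proof (intro sum.cong refl)
      fix k assume k: "k \<in> D"
      have "Suc (k + l) = N \<longleftrightarrow> k = N - Suc l" using D(2)[OF l] by auto
      moreover have "N - Suc (N - Suc l) = l" using D(2)[OF l] by simp
      ultimately show "(p i \<bullet> g (N - Suc k)) * (g k \<bullet> g l) = (if k = N - Suc l then p i \<bullet> g l else 0)"
        using D(5)[OF k l] by auto
    qed
    also have "\<dots> = p i \<bullet> g l" using fin D(3)[OF l] by simp
    finally show ?thesis using proj_scalar[OF ic D(8)[OF l]] by simp
  qed
  then show "proj (p i) \<in> compl" using pc by (simp add: compl_def)
  have z: "(p i \<bullet> g (N - Suc k)) * (g k \<bullet> p l) = 0" if k: "k \<in> D" and l: "l + i < N" for k l
  proof (cases "k < i")
    case True
    then show ?thesis using D(4)[OF k] l by (simp add: flag_iff)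
  next
    case False
    then have ki: "i < k" using k i by (cases "k = i") auto
    have "p i \<bullet> g (N - Suc k) = 0"
      by (rule flag_pairing_zero[OF p basis_in_flag[OF p lessI i(1)] D(4)[OF D(3)[OF k]]]) (use ki D(2)[OF k] in simp)
    then show ?thesis by simp
  qed
  have eq: "proj (p i) \<bullet> p l = p i \<bullet> p l" if l: "l + i < N" for l
  proof -
    have lc: "p l \<in> carrier_vec N" using hyp_basisD(1)[OF p] l by simp
    have "(\<Sum>k\<in>D. (p i \<bullet> g (N - Suc k)) * (g k \<bullet> p l)) = 0" using z[OF _ l] by (intro sum.neutral) auto
    then show ?thesis using proj_scalar[OF ic lc] by simp
  qed
  show "proj (p i) \<in> flag N p (Suc i)"
    using pc eq hyp_basisD(2)[OF p i(1)] by (auto simp: flag_iff)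
  show "proj (p i) \<bullet> p (N - Suc i) = 1"
    using eq[of "N - Suc i"] hyp_basisD(2)[OF p i(1), of "N - Suc i"] i(1) by simp
qed

lemma normal_form_extend:
  assumes S: "S \<subseteq> {..<N}" "S \<inter> D = {}" "\<And>k. k \<in> S \<Longrightarrow> N - Suc k \<in> S"
    and h: "\<And>k. k \<in> S \<Longrightarrow> h k \<in> compl" "\<And>k. k \<in> S \<Longrightarrow> h k \<in> flag N p (Suc k)"
    and gram: "\<And>k l. k \<in> S \<Longrightarrow> l \<in> S \<Longrightarrow> h k \<bullet> h l = (if Suc (k + l) = N then 1 else 0)"
    and cl: "(\<tau>, L) \<in> clans N S" and \<theta>h: "\<And>k. k \<in> S \<Longrightarrow> \<theta> *\<^sub>v h k = clan_sign L k \<cdot>\<^sub>v h (\<tau> k)"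
  shows "normal_form_on N p \<theta> (D \<union> S) (\<lambda>k. if k \<in> S then h k else g k) (\<lambda>k. if k \<in> S then \<tau> k else \<sigma> k, M \<union> L)"
proof -
  note C = clansD[OF D(6)] and C' = clansD[OF cl]
  have dj: "k \<notin> S" if "k \<in> D" for k using that S(2) by blast
  have dj': "k \<notin> D" if "k \<in> S" for k using that S(2) by blast
  have hc: "h k \<in> carrier_vec N" if "k \<in> S" for k using h(1)[OF that] compl_carrier by blast
  have cross: "h k \<bullet> g l = 0" "g l \<bullet> h k = 0" if "k \<in> S" "l \<in> D" for k l
    using h(1)[OF that(1)] that(2) comN[OF hc[OF that(1)] D(8)[OF that(2)]] by (auto simp: compl_def)
  have sne: "Suc (k + l) \<noteq> N" "Suc (l + k) \<noteq> N" if "k \<in> S" "l \<in> D" for k l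
  proof -
    have "l \<noteq> N - Suc k" using S(3)[OF that(1)] that(2) dj by blast
    then show "Suc (k + l) \<noteq> N" "Suc (l + k) \<noteq> N" by auto
  qed
  have cl': "(\<lambda>k. if k \<in> S then \<tau> k else \<sigma> k, M \<union> L) \<in> clans N (D \<union> S)"
    by (rule clans_merge[OF D(6) cl S(2,3) D(3)])
  have sgn: "(clan_sign (M \<union> L) k :: 'k) = clan_sign M k" if "k \<in> D" for k
    using that C'(5) dj by (auto simp: clan_sign_def)
  have sgn': "(clan_sign (M \<union> L) k :: 'k) = clan_sign L k" if "k \<in> S" for k
    using that C(5) dj' by (auto simp: clan_sign_def)
  show ?thesis unfolding normal_form_on_def prod.case
  proof (intro conjI ballI)
    show "D \<union> S \<subseteq> {..<N}" using S(1) D(1) by auto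
    show "(\<lambda>k. if k \<in> S then \<tau> k else \<sigma> k, M \<union> L) \<in> clans N (D \<union> S)" by (rule cl')
  next
    fix k assume k: "k \<in> D \<union> S"
    show "N - Suc k \<in> D \<union> S" using k S(3) D(3) by auto
    show "(if k \<in> S then h k else g k) \<in> flag N p (Suc k)" using k h(2) D(4) by auto
    show "\<theta> *\<^sub>v (if k \<in> S then h k else g k) = clan_sign (M \<union> L) k \<cdot>\<^sub>v
      (if (if k \<in> S then \<tau> k else \<sigma> k) \<in> S then h (if k \<in> S then \<tau> k else \<sigma> k) else g (if k \<in> S then \<tau> k else \<sigma> k))"
    proof (cases "k \<in> S")
      case True
      then show ?thesis using C'(1) \<theta>h sgn' by simp
    next
      case False
      then have kD: "k \<in> D" using k by blast
      then show ?thesis using False C(1)[OF kD] dj D(7)[OF kD] sgn by simp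
    qed
    fix l assume l: "l \<in> D \<union> S"
    consider "k \<in> S" "l \<in> S" | "k \<in> S" "l \<in> D" | "k \<in> D" "l \<in> S" | "k \<in> D" "l \<in> D" using k l by blast
    then show "(if k \<in> S then h k else g k) \<bullet> (if l \<in> S then h l else g l) = (if Suc (k + l) = N then 1 else 0)"
    proof cases
      case 1 then show ?thesis using gram by simp
    next
      case 2 then show ?thesis using dj cross sne by simp
    next
      case 3 then show ?thesis using dj cross sne by simp
    next
      case 4 then show ?thesis using dj D(5) by simp
    qed
  qed
qed

lemma square_one_cases:
  assumes "x \<in> carrier_vec N" "x \<noteq> 0\<^sub>v N" "\<theta> *\<^sub>v x = c \<cdot>\<^sub>v x" shows "c = 1 \<or> c = -1"
proof -
  have "x = c \<cdot>\<^sub>v (c \<cdot>\<^sub>v x)" using \<theta>_inv[OF assms(1)] assms \<theta>_lin(3)[OF assms(1)] by simp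
  then have "x = (c * c) \<cdot>\<^sub>v x" by (simp add: smult_smult_assoc)
  moreover obtain a where a: "a < N" "x $ a \<noteq> 0" using assms(1,2) by (metis eq_vecI index_zero_vec carrier_vecD)
  ultimately have "x $ a = c * c * x $ a" using assms(1) by (metis carrier_vecD index_smult_vec(1))
  then have "c * c = 1" using a by simp
  then show ?thesis by (simp add: square_eq_1_iff)
qed

lemma clans_pair:
  assumes "S \<subseteq> {..<N}" "\<And>k. k \<in> S \<Longrightarrow> N - Suc k \<in> S" 
    "\<And>k. k \<in> S \<Longrightarrow> \<tau> k \<in> S" "\<And>k. k \<in> S \<Longrightarrow> \<tau> (\<tau> k) = k" "\<And>k. k \<in> S \<Longrightarrow> \<tau> (N - Suc k) = N - Suc (\<tau> k)"
    "\<And>k. k \<notin> S \<Longrightarrow> \<tau> k = k"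
  shows "(\<tau>, {}) \<in> clans N S"
  using assms by (auto simp: clans_def)

lemma clans_signs: "S \<subseteq> {..<N} \<Longrightarrow> (\<And>k. k \<in> S \<Longrightarrow> N - Suc k \<in> S) \<Longrightarrow> L = {} \<or> L = S \<Longrightarrow> (\<lambda>k. k, L) \<in> clans N S"
  by (auto simp: clans_def)

text \<open>Let \<open>i\<close> be the least index not yet treated and \<open>e\<close> a vector of level \<open>i\<close> orthogonal to everything
  treated. If \<open>\<theta> e\<close> is proportional to \<open>e\<close>, a dual vector with the same eigenvalue is split off. If \<open>\<theta> e\<close>
  pairs nontrivially with \<open>e\<close>, the two span a hyperbolic plane. Otherwise \<open>\<theta> e\<close> has some level
  \<open>j\<close>, and a vector \<open>x\<close> of level \<open>N - 1 - j\<close> dual to \<open>\<theta> e\<close> gives the vector \<open>\<theta> x\<close> dual to \<open>e\<close>.\<close>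

lemma normal_form_step:
  assumes ne: "D \<noteq> {..<N}"
  shows "\<exists>D' g' s'. D \<subset> D' \<and> normal_form_on N p \<theta> D' g' s'"
proof -
  have ext: ?thesis if "S \<noteq> {}" "S \<subseteq> {..<N}" "S \<inter> D = {}" "\<And>k. k \<in> S \<Longrightarrow> N - Suc k \<in> S"
    "\<And>k. k \<in> S \<Longrightarrow> h k \<in> compl" "\<And>k. k \<in> S \<Longrightarrow> h k \<in> flag N p (Suc k)"
    "\<And>k l. k \<in> S \<Longrightarrow> l \<in> S \<Longrightarrow> h k \<bullet> h l = (if Suc (k + l) = N then 1 else 0)"
    "(\<tau>, L) \<in> clans N S" "\<And>k. k \<in> S \<Longrightarrow> \<theta> *\<^sub>v h k = clan_sign L k \<cdot>\<^sub>v h (\<tau> k)" for S h \<tau> L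
  proof -
    have "D \<subset> D \<union> S" using that(1,3) by blast
    then show ?thesis using normal_form_extend[OF that(2-9)] by blast
  qed
  note sub = subspace_vecD[OF compl_subspace]
  define i where "i = (LEAST i. i < N \<and> i \<notin> D)"
  have ex: "\<exists>i. i < N \<and> i \<notin> D" using ne D(1) by auto
  have i: "i < N" "i \<notin> D" using LeastI_ex[OF ex] by (auto simp: i_def)
  have low: "k \<in> D" if "k < i" for k using not_less_Least[of k "\<lambda>i. i < N \<and> i \<notin> D"] that i by (auto simp: i_def)
  let ?w = "N - Suc i"
  have w: "?w < N" "?w \<notin> D" "N - Suc ?w = i" using i D(3)[of ?w] by auto
  have iw: "i \<le> ?w" using low[of ?w] w by (metis not_le)
  \<comment> \<open>The index \<open>j\<close> and its mirror index both lie outside the symmetric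
    set \<open>D\<close>, while every index below \<open>i\<close> is in \<open>D\<close>; so the
    levels in \<open>compl\<close> run only from \<open>i\<close> to \<open>?w\<close>.\<close>
  have lev: "i \<le> j \<and> j \<le> ?w" if v: "v \<in> compl" and j: "j < N" "v \<in> flag N p (Suc j)" "v \<bullet> p (N - Suc j) \<noteq> 0" for v j
  proof -
    have nD: "j \<notin> D" by (rule compl_level[OF v j])
    then have "i \<le> j" using low by (metis not_le)
    moreover have "N - Suc j \<notin> D" using D(3)[of "N - Suc j"] nD j(1) by auto
    then have "i \<le> N - Suc j" using low by (metis not_le)
    ultimately show ?thesis using j(1) by auto
  qed
  have small: "v = 0\<^sub>v N" if v: "v \<in> compl" "v \<in> flag N p i" for v
  proof (rule ccontr)
    assume "v \<noteq> 0\<^sub>v N"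
    then obtain j where j: "j < N" "v \<in> flag N p (Suc j)" "v \<bullet> p (N - Suc j) \<noteq> 0"
      using level_exists compl_carrier[OF v(1)] by blast
    then have "i \<le> j" using lev v by blast
    then show False using v(2) j by (auto simp: flag_iff)
  qed
  have top: "v \<in> flag N p (Suc ?w)" if v: "v \<in> compl" for v
  proof (cases "v = 0\<^sub>v N")
    case True
    then show ?thesis using subspace_vecD(2)[OF subspace_flag[OF p]] by simp
  next
    case False
    then obtain j where j: "j < N" "v \<in> flag N p (Suc j)" "v \<bullet> p (N - Suc j) \<noteq> 0"
      using level_exists compl_carrier[OF v] by blast
    then show ?thesis using lev[OF v j] flag_mono[of "Suc j" "Suc ?w" N p] by auto
  qed
  define e where "e = proj (p i)"
  note e = proj_basis[OF i, folded e_def]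
  note ec = compl_carrier[OF e(1)]
  have e0: "e \<noteq> 0\<^sub>v N" using e(3) hyp_basisD(1)[OF p w(1)] by auto
  define u where "u = \<theta> *\<^sub>v e"
  have u: "u \<in> compl" unfolding u_def by (rule compl_\<theta>[OF e(1)])
  note uc = compl_carrier[OF u]
  have tu: "\<theta> *\<^sub>v u = e" unfolding u_def by (rule \<theta>_inv[OF ec])
  \<comment> \<open>Subtracting the leading coefficient times \<open>e\<close> leaves a vector of
    \<open>compl\<close> inside \<open>flag N p i\<close>, and such a vector is zero by
    \<open>small\<close>.\<close>
  have eigen: "\<exists>c. (c = 1 \<or> c = -1) \<and> u = c \<cdot>\<^sub>v e" if uf: "u \<in> flag N p (Suc i)"
  proof -
    let ?c = "u \<bullet> p ?w"
    have "u - ?c \<cdot>\<^sub>v e \<in> compl" using sub u e by blast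
    moreover have "u - ?c \<cdot>\<^sub>v e \<in> flag N p i" unfolding flag_iff
    proof (intro conjI allI impI)
      fix l assume l: "l + i < N"
      have lc: "p l \<in> carrier_vec N" using hyp_basisD(1)[OF p] l by simp
      show "(u - ?c \<cdot>\<^sub>v e) \<bullet> p l = 0"
      proof (cases "l = ?w")
        case True
        then show ?thesis using uc ec lc e(3) by (simp add: bilN)
      next
        case False
        then show ?thesis using uc ec lc e(2) uf l by (auto simp: bilN flag_iff)
      qed
    qed (use uc ec in simp)
    ultimately have z: "u - ?c \<cdot>\<^sub>v e = 0\<^sub>v N" by (rule small)
    have "u = (u - ?c \<cdot>\<^sub>v e) + ?c \<cdot>\<^sub>v e" using uc ec by auto
    then have ue: "u = ?c \<cdot>\<^sub>v e" unfolding z using ec by simp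
    then have "?c = 1 \<or> ?c = -1" using square_one_cases[OF ec e0] by (simp add: u_def)
    then show ?thesis using ue by blast
  qed
  show ?thesis
  proof (cases "i = ?w")
    case True
    have s: "Suc (i + i) = N" using True i by simp
    have ee: "e \<bullet> e = 1" using flag_pairing_top[OF p e(2) e(2) s] e(3) True by simp
    have "u \<in> flag N p (Suc i)" using top[OF u] True by simp
    then obtain c where c: "c = 1 \<or> c = -1" "u = c \<cdot>\<^sub>v e" using eigen by blast
    define L where "L = (if c = 1 then {} else {i})"
    show ?thesis
    proof (rule ext[of "{i}" "\<lambda>_. e" "\<lambda>k. k" L])
      show "(\<lambda>k. k, L) \<in> clans N {i}" by (rule clans_signs) (use i True in \<open>auto simp: L_def\<close>)
      show "\<theta> *\<^sub>v e = clan_sign L k \<cdot>\<^sub>v e" if "k \<in> {i}" for k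
        using c that by (auto simp: u_def[symmetric] clan_sign_def L_def)
    qed (use i True e ee s in auto)
  next
    case False
    then have ilt: "i < ?w" using iw by simp
    have sw: "Suc (i + ?w) = N" "Suc (?w + i) = N" using i by auto
    have nn: "Suc (i + i) \<noteq> N" "Suc (?w + ?w) \<noteq> N" using ilt sw by linarith+
    have ee: "e \<bullet> e = 0" by (rule flag_pairing_zero[OF p e(2) e(2)]) (use ilt sw in linarith)
    have uu: "u \<bullet> u = 0" using \<theta>_adj[OF ec uc] tu ee by (simp add: u_def)
    define S where "S = {i, ?w}"
    have S: "S \<noteq> {}" "S \<subseteq> {..<N}" "S \<inter> D = {}" "\<And>k. k \<in> S \<Longrightarrow> N - Suc k \<in> S"
      using i w by (auto simp: S_def)
    show ?thesis
    proof (cases "e \<bullet> u = 0")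
      case c: False
      obtain s where s: "s ^ 2 = 1 / (e \<bullet> u)" using nth_root_exists[of 2 "1 / (e \<bullet> u)"] by auto
      have s1: "s * s * (e \<bullet> u) = 1" using s c by (simp add: power2_eq_square)
      define h where "h k = (if k = i then s \<cdot>\<^sub>v e else s \<cdot>\<^sub>v u)" for k
      define \<tau> where "\<tau> k = (if k = i then ?w else if k = ?w then i else k)" for k
      show ?thesis
      proof (rule ext[of S h \<tau> "{}", OF S])
        show "h k \<in> compl" if "k \<in> S" for k using sub(4) e(1) u by (simp add: h_def)
        show "h k \<in> flag N p (Suc k)" if "k \<in> S" for k
          using that top[OF sub(4)[OF u]] subspace_vecD(4)[OF subspace_flag[OF p] e(2)] by (auto simp: h_def S_def)
        show "h k \<bullet> h l = (if Suc (k + l) = N then 1 else 0)" if "k \<in> S" "l \<in> S" for k l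
          using that ilt sw nn ec uc ee uu s1 comN[OF uc ec] by (auto simp: h_def S_def bilN mult.assoc)
        show "(\<tau>, {}) \<in> clans N S"
          by (rule clans_pair[OF S(2,4)]) (use w ilt in \<open>auto simp: \<tau>_def S_def\<close>)
        show "\<theta> *\<^sub>v h k = clan_sign {} k \<cdot>\<^sub>v h (\<tau> k)" if "k \<in> S" for k
          using that ilt \<theta>_lin(3) ec uc tu by (auto simp: h_def \<tau>_def S_def clan_sign_def u_def[symmetric])
      qed
    next
      case eu: True
      have u0: "u \<noteq> 0\<^sub>v N"
      proof
        assume "u = 0\<^sub>v N"
        then have "e = \<theta> *\<^sub>v 0\<^sub>v N" using tu by simp
        also have "\<dots> = 0\<^sub>v N" using \<theta> by (intro eq_vecI) auto
        finally show False using e0 by simp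
      qed
      obtain j where j: "j < N" "u \<in> flag N p (Suc j)" "u \<bullet> p (N - Suc j) \<noteq> 0"
        using level_exists[OF uc u0] by blast
      have jr: "i \<le> j" "j \<le> ?w" using lev[OF u j] by auto
      show ?thesis
      proof (cases "j = i")
        case True
        then obtain c where c: "c = 1 \<or> c = -1" "u = c \<cdot>\<^sub>v e" using eigen j by blast
        have cc: "c * c = 1" using c by auto
        define q where "q = proj (p ?w)"
        note q = proj_basis[OF w(1,2), folded q_def]
        note qc = compl_carrier[OF q(1)]
        have qe: "q \<bullet> e = 1" using flag_pairing_top[OF p q(2) e(2) sw(2)] q(3) e(3) w(3) by simp
        \<comment> \<open>This is the projection of \<open>q\<close> to the eigenspace of \<theta>
          with eigenvalue \<open>c\<close>; it still pairs to 1 with \<open>e\<close>. In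
          \<open>f\<close> a multiple of \<open>e\<close> makes it isotropic without leaving the
          eigenspace.\<close>
        define r where "r = (1 / 2) \<cdot>\<^sub>v (q + c \<cdot>\<^sub>v (\<theta> *\<^sub>v q))"
        have tq: "\<theta> *\<^sub>v q \<in> compl" by (rule compl_\<theta>[OF q(1)])
        have r: "r \<in> compl" unfolding r_def using sub q(1) tq by blast
        note rc = compl_carrier[OF r] and tqc = compl_carrier[OF tq]
        have tr: "\<theta> *\<^sub>v r = c \<cdot>\<^sub>v r"
        proof -
          have "\<theta> *\<^sub>v r = (1 / 2) \<cdot>\<^sub>v (\<theta> *\<^sub>v q + c \<cdot>\<^sub>v q)"
            using qc tqc \<theta>_inv[OF qc] by (simp add: r_def \<theta>_lin)
          also have "\<dots> = c \<cdot>\<^sub>v r"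
          proof -
            have "c \<cdot>\<^sub>v r = (1 / 2) \<cdot>\<^sub>v (c \<cdot>\<^sub>v q + (c * c) \<cdot>\<^sub>v (\<theta> *\<^sub>v q))"
              using qc tqc by (simp add: r_def smult_add_distrib_vec[of _ N] smult_smult_assoc mult.commute mult.left_commute)
            also have "\<dots> = (1 / 2) \<cdot>\<^sub>v (\<theta> *\<^sub>v q + c \<cdot>\<^sub>v q)"
              unfolding cc using qc tqc by (simp add: comm_add_vec[of _ N])
            finally show ?thesis by simp
          qed
          finally show ?thesis .
        qed
        have half: "(1 + 1) / 2 = (1 :: 'k)" using two by simp
        have "(\<theta> *\<^sub>v q) \<bullet> e = c" using \<theta>_adj[OF qc ec] c(2) qe qc ec by (simp add: u_def[symmetric] bilN)
        then have re: "r \<bullet> e = 1" using qc tqc ec qe cc half by (simp add: r_def bilN)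
        define f where "f = r - ((r \<bullet> r) / 2) \<cdot>\<^sub>v e"
        have f: "f \<in> compl" unfolding f_def using sub r e(1) by blast
        note fc = compl_carrier[OF f]
        have fe: "f \<bullet> e = 1" "e \<bullet> f = 1" using rc ec re ee comN[OF fc ec] by (simp_all add: f_def bilN)
        have ff: "f \<bullet> f = 0"
          using rc ec re ee comN[OF rc ec] two by (simp add: f_def bilN)
        have tf: "\<theta> *\<^sub>v f = c \<cdot>\<^sub>v f"
        proof -
          have "\<theta> *\<^sub>v f = c \<cdot>\<^sub>v r - ((r \<bullet> r) / 2) \<cdot>\<^sub>v (c \<cdot>\<^sub>v e)"
            using rc ec by (simp add: f_def \<theta>_lin tr c(2)[symmetric] u_def)
          also have "\<dots> = c \<cdot>\<^sub>v f" using rc ec by (intro eq_vecI) (auto simp: f_def algebra_simps)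
          finally show ?thesis .
        qed
        define h where "h k = (if k = i then e else f)" for k
        define L where "L = (if c = 1 then {} else S)"
        show ?thesis
        proof (rule ext[of S h "\<lambda>k. k" L, OF S])
          show "h k \<in> compl" if "k \<in> S" for k using e f by (simp add: h_def)
          show "h k \<in> flag N p (Suc k)" if "k \<in> S" for k using that top[OF f] e by (auto simp: h_def S_def)
          show "h k \<bullet> h l = (if Suc (k + l) = N then 1 else 0)" if "k \<in> S" "l \<in> S" for k l
            using that ilt sw nn ee ff fe by (auto simp: h_def S_def)
          show "(\<lambda>k. k, L) \<in> clans N S" by (rule clans_signs[OF S(2,4)]) (auto simp: L_def)
          show "\<theta> *\<^sub>v h k = clan_sign L k \<cdot>\<^sub>v h k" if "k \<in> S" for k
            using that c tf by (auto simp: h_def L_def clan_sign_def u_def[symmetric])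
        qed
      next
        case False
        then have ij: "i < j" using jr by simp
        have jw: "j \<noteq> ?w"
        proof
          assume "j = ?w"
          then have "e \<bullet> u \<noteq> 0" using flag_pairing_top[OF p e(2) j(2), of ] j(3) e(3) sw w(3) by simp
          then show False using eu by simp
        qed
        let ?v = "N - Suc j"
        have v: "?v < N" "N - Suc ?v = j" using j by auto
        have sv: "Suc (j + ?v) = N" "Suc (?v + j) = N" using j by auto
        have jv: "j \<noteq> ?v"
        proof
          assume "j = ?v"
          then have "u \<bullet> u \<noteq> 0" using flag_pairing_top[OF p j(2) j(2)] j(3) sv by simp
          then show False using uu by simp
        qed
        have order: "i < ?v" "?v < ?w" "j < ?w" using ij jr jw j i by auto
        have jD: "j \<notin> D" by (rule compl_level[OF u j])
        have vD: "?v \<notin> D" using D(3)[of ?v] jD v(2) by auto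
        define a where "a = u \<bullet> p ?v"
        have a0: "a \<noteq> 0" using j(3) by (simp add: a_def)
        define q where "q = proj (p ?v)"
        note q = proj_basis[OF v(1) vD, folded q_def]
        note qc = compl_carrier[OF q(1)]
        have qu: "q \<bullet> u = a" using flag_pairing_top[OF p q(2) j(2) sv(2)] q(3) v(2) by (simp add: a_def)
        have qe: "q \<bullet> e = 0" by (rule flag_pairing_zero[OF p q(2) e(2)]) (use ij sv in linarith)
        have ue: "u \<bullet> e = 0" using eu comN[OF uc ec] by simp
        \<comment> \<open>The multiple of \<open>u\<close> makes the vector isotropic; its pairing
          with \<open>u\<close> stays \<open>a\<close> because \<open>u\<close> is isotropic
          itself.\<close>
        define q1 where "q1 = q - ((q \<bullet> q) / (2 * a)) \<cdot>\<^sub>v u"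
        have q1: "q1 \<in> compl" unfolding q1_def using sub q(1) u by blast
        note q1c = compl_carrier[OF q1]
        have q1u: "q1 \<bullet> u = a" using qc uc qu uu by (simp add: q1_def bilN)
        have q1e: "q1 \<bullet> e = 0" using qc uc ec qe ue by (simp add: q1_def bilN)
        have q1q1: "q1 \<bullet> q1 = 0"
          using qc uc qu uu comN[OF uc qc] a0 two by (simp add: q1_def bilN field_simps)
        \<comment> \<open>When \<open>u\<close> has the higher level, subtracting it could spoil the
          level of \<open>q\<close>. But then \<open>flag N p (Suc ?v)\<close> is orthogonal to
          itself, so the coefficient of \<open>u\<close> is zero.\<close>
        have q1f: "q1 \<in> flag N p (Suc ?v)"
        proof (cases "j < ?v")
          case True
          then have "u \<in> flag N p (Suc ?v)" using j(2) flag_mono[of "Suc j" "Suc ?v" N p] by auto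
          then show ?thesis unfolding q1_def using q(2) subspace_vecD(4,5)[OF subspace_flag[OF p]] by blast
        next
          case False
          then have "?v < j" using jv by simp
          then have "q \<bullet> q = 0" by (intro flag_pairing_zero[OF p q(2) q(2)]) (use sv in linarith)
          then have "q1 = q" using qc uc by (intro eq_vecI) (auto simp: q1_def)
          then show ?thesis using q(2) by simp
        qed
        define b where "b = (\<theta> *\<^sub>v q1) \<bullet> q1"
        \<comment> \<open>The multiple of \<open>e\<close> removes the pairing \<open>b\<close> of
          the vector with its own image under \<theta>: each of the two arguments contributes half
          of \<open>b\<close>, since the pairing of \<open>\<theta> *\<^sub>v q1\<close> with
          \<open>e\<close> is \<open>a\<close>. Isotropy survives because \<open>e\<close> is
          isotropic and orthogonal to \<open>q1\<close>.\<close>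
        define q2 where "q2 = q1 - (b / (2 * a)) \<cdot>\<^sub>v e"
        have q2: "q2 \<in> compl" unfolding q2_def using sub q1 e(1) by blast
        note q2c = compl_carrier[OF q2]
        have tq2: "\<theta> *\<^sub>v q2 \<in> compl" by (rule compl_\<theta>[OF q2])
        note tq2c = compl_carrier[OF tq2]
        have q2u: "q2 \<bullet> u = a" using q1c uc ec q1u eu by (simp add: q2_def bilN)
        have q2e: "q2 \<bullet> e = 0" using q1c ec q1e ee by (simp add: q2_def bilN)
        have q2q2: "q2 \<bullet> q2 = 0"
          using q1c ec q1q1 q1e ee comN[OF ec q1c] by (simp add: q2_def bilN)
        have tq1c: "\<theta> *\<^sub>v q1 \<in> carrier_vec N" using q1c by simp
        have tq1e: "(\<theta> *\<^sub>v q1) \<bullet> e = a" using \<theta>_adj[OF q1c ec] q1u by (simp add: u_def[symmetric])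
        have tq2q2: "(\<theta> *\<^sub>v q2) \<bullet> q2 = 0"
        proof -
          have "\<theta> *\<^sub>v q2 = \<theta> *\<^sub>v q1 - (b / (2 * a)) \<cdot>\<^sub>v u"
            using q1c ec by (simp add: q2_def \<theta>_lin u_def)
          then have "(\<theta> *\<^sub>v q2) \<bullet> q2 = b - (b / (2 * a)) * a - (b / (2 * a)) * a"
            using q1c tq1c ec uc tq1e q1u ue comN[OF uc q1c] by (simp add: q2_def bilN b_def[symmetric])
          also have "\<dots> = 0" using a0 two by (simp add: field_simps)
          finally show ?thesis .
        qed
        have q2f: "q2 \<in> flag N p (Suc ?v)"
        proof -
          have "e \<in> flag N p (Suc ?v)" using e(2) flag_mono[of "Suc i" "Suc ?v" N p] order by auto
          then show ?thesis unfolding q2_def using q1f subspace_vecD(4,5)[OF subspace_flag[OF p]] by blast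
        qed
        have tq2u: "(\<theta> *\<^sub>v q2) \<bullet> u = 0" using \<theta>_adj[OF q2c uc] tu q2e by simp
        have tq2e: "(\<theta> *\<^sub>v q2) \<bullet> e = a" using \<theta>_adj[OF q2c ec] q2u by (simp add: u_def[symmetric])
        have tq2tq2: "(\<theta> *\<^sub>v q2) \<bullet> (\<theta> *\<^sub>v q2) = 0" using \<theta>_adj[OF q2c tq2c] \<theta>_inv[OF q2c] q2q2 by simp
        define x where "x = (1 / a) \<cdot>\<^sub>v q2"
        define y where "y = (1 / a) \<cdot>\<^sub>v (\<theta> *\<^sub>v q2)"
        have xc: "x \<in> carrier_vec N" and yc: "y \<in> carrier_vec N" using q2c tq2c by (simp_all add: x_def y_def)
        have x: "x \<in> compl" "x \<in> flag N p (Suc ?v)" unfolding x_def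
          using sub(4)[OF q2] subspace_vecD(4)[OF subspace_flag[OF p] q2f] by blast+
        have y: "y \<in> compl" unfolding y_def by (rule sub(4)[OF tq2])
        have tx: "\<theta> *\<^sub>v x = y" using q2c by (simp add: x_def y_def \<theta>_lin)
        have ty: "\<theta> *\<^sub>v y = x" using \<theta>_inv[OF xc] tx by simp
        have G1: "x \<bullet> e = 0" "x \<bullet> u = 1" "x \<bullet> x = 0" "y \<bullet> x = 0" "y \<bullet> e = 1" "y \<bullet> u = 0" "y \<bullet> y = 0"
          using q2e q2u q2q2 tq2q2 tq2e tq2u tq2tq2 q2c tq2c ec uc a0 by (simp_all add: x_def y_def bilN)
        have G2: "e \<bullet> x = 0" "u \<bullet> x = 1" "x \<bullet> y = 0" "e \<bullet> y = 1" "u \<bullet> y = 0"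
          using G1 comN[OF ec xc] comN[OF uc xc] comN[OF xc yc] comN[OF ec yc] comN[OF uc yc] by simp_all
        define S where "S = {i, j, ?v, ?w}"
        have dist: "i \<noteq> j" "i \<noteq> ?v" "i \<noteq> ?w" "j \<noteq> ?v" "j \<noteq> ?w" "?v \<noteq> ?w"
          "j \<noteq> i" "?v \<noteq> i" "?w \<noteq> i" "?v \<noteq> j" "?w \<noteq> j" "?w \<noteq> ?v"
          using ij order jv ilt by auto
        define h where "h k = (if k = i then e else if k = j then u else if k = ?v then x else y)" for k
        have h: "h i = e" "h j = u" "h ?v = x" "h ?w = y" unfolding h_def using dist by (simp_all only: if_True if_False simp_thms)
        define \<tau> where "\<tau> k = (if k = i then j else if k = j then i else if k = ?v then ?w else if k = ?w then ?v else k)" for k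
        have \<tau>: "\<tau> i = j" "\<tau> j = i" "\<tau> ?v = ?w" "\<tau> ?w = ?v" unfolding \<tau>_def using dist by (simp_all only: if_True if_False simp_thms)
        have sums: "Suc (i + j) \<noteq> N" "Suc (j + i) \<noteq> N" "Suc (i + ?v) \<noteq> N" "Suc (?v + i) \<noteq> N" "Suc (i + i) \<noteq> N"
          "Suc (j + j) \<noteq> N" "Suc (j + ?w) \<noteq> N" "Suc (?w + j) \<noteq> N" "Suc (?v + ?v) \<noteq> N" "Suc (?v + ?w) \<noteq> N" "Suc (?w + ?v) \<noteq> N"
          "Suc (?w + ?w) \<noteq> N"
        proof -
          have eqv: "Suc (k + m) = N \<longleftrightarrow> m = N - Suc k" if "k < N" for k m using that by auto
          show "Suc (i + j) \<noteq> N" "Suc (j + i) \<noteq> N" "Suc (i + ?v) \<noteq> N" "Suc (?v + i) \<noteq> N" "Suc (i + i) \<noteq> N"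
            "Suc (j + j) \<noteq> N" "Suc (j + ?w) \<noteq> N" "Suc (?w + j) \<noteq> N" "Suc (?v + ?v) \<noteq> N" "Suc (?v + ?w) \<noteq> N" "Suc (?w + ?v) \<noteq> N"
            "Suc (?w + ?w) \<noteq> N"
            by (simp_all only: eqv[OF i(1)] eqv[OF j(1)] eqv[OF v(1)] eqv[OF w(1)] v(2) w(3) dist simp_thms)
        qed
        have S: "S \<noteq> {}" "S \<subseteq> {..<N}" "S \<inter> D = {}"
          using i w j(1) v(1) jD vD by (auto simp: S_def)
        have SE: "P k" if "k \<in> S" "P i" "P j" "P ?v" "P ?w" for P k
          using that by (auto simp: S_def)
        have Sw: "N - Suc k \<in> S" if "k \<in> S" for k
          using that by (rule SE) (simp_all add: S_def v w)
        show ?thesis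
        proof (rule ext[of S h \<tau> "{}", OF S Sw])
          show "h k \<in> compl" if "k \<in> S" for k using that by (rule SE) (simp_all only: h e u x y)
          show "h k \<in> flag N p (Suc k)" if "k \<in> S" for k
            using that by (rule SE) (simp_all only: h e j x top[OF y])
          show "h k \<bullet> h l = (if Suc (k + l) = N then 1 else 0)" if k: "k \<in> S" and l: "l \<in> S" for k l
            by (rule SE[OF k]; rule SE[OF l]; simp only: h sums sv sw ee eu ue uu G1 G2 if_True if_False refl)
          show "(\<tau>, {}) \<in> clans N S"
          proof (rule clans_pair[OF S(2) Sw])
            show "\<tau> k \<in> S" if "k \<in> S" for k using that by (rule SE) (simp_all only: \<tau>, simp_all add: S_def)
            show "\<tau> (\<tau> k) = k" if "k \<in> S" for k using that by (rule SE) (simp_all only: \<tau>)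
            show "\<tau> (N - Suc k) = N - Suc (\<tau> k)" if "k \<in> S" for k using that by (rule SE) (simp_all only: \<tau> v w)
            show "\<tau> k = k" if "k \<notin> S" for k using that by (auto simp: \<tau>_def S_def)
          qed
          have one: "1 \<cdot>\<^sub>v z = z" for z :: "'k vec" by simp
          show "\<theta> *\<^sub>v h k = clan_sign {} k \<cdot>\<^sub>v h (\<tau> k)" if "k \<in> S" for k
            unfolding clan_sign_def empty_iff if_False one
            using that by (rule SE) (simp_all only: h \<tau> tx ty tu u_def[symmetric])
        qed
      qed
    qed
  qed
qed

end

theorem normal_form_exists: "\<exists>g s. normal_form_on N p \<theta> {..<N} g s"
proof -
  have "\<exists>g s. normal_form_on N p \<theta> {..<N} g s" if "normal_form_on N p \<theta> D g s" for D g s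
    using that
  proof (induction "N - card D" arbitrary: D g s rule: less_induct)
    case less
    obtain \<sigma> M where s: "s = (\<sigma>, M)" by fastforce
    have nf: "normal_form_on N p \<theta> D g (\<sigma>, M)" using less.prems s by simp
    show ?case
    proof (cases "D = {..<N}")
      case True
      then show ?thesis using nf by blast
    next
      case False
      from normal_form_step[OF nf False] obtain D' g' s' where D': "D \<subset> D'" "normal_form_on N p \<theta> D' g' s'" by blast
      obtain \<sigma>' M' where s': "s' = (\<sigma>', M')" by fastforce
      have sub: "D' \<subseteq> {..<N}" using normal_form_onD(1) D'(2) s' by blast
      have "card D < card D'" using D'(1) sub finite_subset psubset_card_mono by blast
      moreover have "card D' \<le> N" using card_mono[OF _ sub] by simp
      ultimately have "N - card D' < N - card D" by linarith
      then show ?thesis by (rule less.hyps[OF _ D'(2)])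
    qed
  qed
  moreover have "normal_form_on N p \<theta> {} (\<lambda>_. 0\<^sub>v N) (\<lambda>k. k, {})"
    by (auto simp: normal_form_on_def clans_def)
  ultimately show ?thesis by blast
qed

end

section \<open>Signatures\<close>

text \<open>Each \<open>w a\<close> is the projection of the a-th unit vector to the complement. If
  all were zero, the square matrix \<open>U\<close> formed from the vectors and filled up with zero
  columns would satisfy U U' = 1 with U' its transpose, although column \<open>r\<close> is
  zero.\<close>

lemma vec_proj_orthonormal:
  fixes u :: "nat \<Rightarrow> 'k::field vec"
  assumes u: "\<And>i. i < r \<Longrightarrow> u i \<in> carrier_vec N" and on: "\<And>i j. i < r \<Longrightarrow> j < r \<Longrightarrow> u i \<bullet> u j = (if i = j then 1 else 0)"
    and r: "r < N"
  shows "\<exists>w. (\<exists>a<N. w a \<noteq> 0\<^sub>v N) \<and> (\<forall>a<N. w a \<in> carrier_vec N \<and> (\<forall>i<r. w a \<bullet> u i = 0) \<and>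
     (\<forall>x \<in> carrier_vec N. (\<forall>i<r. x \<bullet> u i = 0) \<longrightarrow> w a \<bullet> x = x $ a))"
proof -
  define w where "w a = vec N (\<lambda>b. (if a = b then 1 else 0) - (\<Sum>k<r. u k $ a * u k $ b))" for a
  have wx: "w a \<bullet> x = x $ a - (\<Sum>k<r. u k $ a * (x \<bullet> u k))" if a: "a < N" and x: "x \<in> carrier_vec N" for a x
  proof -
    have "w a \<bullet> x = (\<Sum>b<N. (if a = b then x $ b else 0)) - (\<Sum>b<N. \<Sum>k<r. u k $ a * (u k $ b * x $ b))"
      using x by (simp add: w_def scalar_prod_def atLeast0LessThan left_diff_distrib sum_subtractf sum_distrib_right mult.assoc if_distrib[of "\<lambda>y. y * _"] cong: if_cong)
    also have "(\<Sum>b<N. \<Sum>k<r. u k $ a * (u k $ b * x $ b)) = (\<Sum>k<r. u k $ a * (x \<bullet> u k))"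
    proof -
      have "x \<bullet> u k = (\<Sum>b<N. x $ b * u k $ b)" if "k < r" for k
        using u[OF that] by (simp add: scalar_prod_def atLeast0LessThan)
      then show ?thesis by (subst sum.swap) (simp add: sum_distrib_left mult_ac)
    qed
    finally show ?thesis using a by simp
  qed
  have perp: "w a \<bullet> u i = 0" if "a < N" "i < r" for a i
  proof -
    have "(\<Sum>k<r. u k $ a * (u i \<bullet> u k)) = (\<Sum>k<r. if k = i then u i $ a else 0)"
      using on that by (intro sum.cong refl) auto
    then show ?thesis using wx[OF that(1) u[OF that(2)]] that by simp
  qed
  have "\<exists>a<N. w a \<noteq> 0\<^sub>v N"
  proof (rule ccontr)
    assume "\<not> ?thesis"
    then have z: "w a = 0\<^sub>v N" if "a < N" for a using that by blast
    define U where "U = mat N N (\<lambda>(a, k). if k < r then u k $ a else 0)"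
    have U: "U \<in> carrier_mat N N" by (simp add: U_def)
    have "U * transpose_mat U = 1\<^sub>m N"
    proof (rule eq_matI)
      fix a b assume "a < dim_row (1\<^sub>m N)" "b < dim_col (1\<^sub>m N)"
      then have ab: "a < N" "b < N" by auto
      have "(U * transpose_mat U) $$ (a, b) = (\<Sum>k<N. if k < r then u k $ a * u k $ b else 0)"
        using ab by (simp add: U_def scalar_prod_def atLeast0LessThan cong: if_cong) (intro sum.cong refl, simp)
      also have "\<dots> = (\<Sum>k<r. u k $ a * u k $ b)"
        using r by (intro sum.mono_neutral_cong_right) auto
      also have "\<dots> = 1\<^sub>m N $$ (a, b)"
      proof -
        have "w a $ b = 0" using z[OF ab(1)] ab by simp
        then show ?thesis using ab by (auto simp: w_def)
      qed
      finally show "(U * transpose_mat U) $$ (a, b) = 1\<^sub>m N $$ (a, b)" .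
    qed (simp_all add: U_def)
    then have "transpose_mat U * U = 1\<^sub>m N" by (rule mat_mult_left_right_inverse[OF U _, rotated]) (use U in simp)
    then have "(transpose_mat U * U) $$ (r, r) = 1" using r by simp
    moreover have "(transpose_mat U * U) $$ (r, r) = 0" using r by (simp add: U_def scalar_prod_def)
    ultimately show False by simp
  qed
  moreover have "w a \<bullet> x = x $ a" if "x \<in> carrier_vec N" "\<forall>i<r. x \<bullet> u i = 0" "a < N" for x a
    using wx[OF that(3,1)] that(2) by simp
  moreover have "w a \<in> carrier_vec N" for a by (simp add: w_def)
  ultimately show ?thesis using perp by blast
qed

context symmetric_involution begin

text \<open>Some projected unit vector \<open>w a\<close> has a nonzero entry at \<open>b\<close>,
  and this entry is its pairing with \<open>w b\<close>. By polarisation one of \<open>w a\<close>,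
  \<open>w b\<close> and their sum is not isotropic, 2 being nonzero.\<close>

lemma nonisotropic_exists:
  fixes u :: "nat \<Rightarrow> 'k vec"
  assumes u: "\<And>i. i < r \<Longrightarrow> u i \<in> carrier_vec N" and on: "\<And>i j. i < r \<Longrightarrow> j < r \<Longrightarrow> u i \<bullet> u j = (if i = j then 1 else 0)"
    and r: "r < N"
  obtains w where "w \<in> carrier_vec N" "\<And>i. i < r \<Longrightarrow> w \<bullet> u i = 0" "w \<bullet> w \<noteq> 0"
proof -
  obtain w a where a: "a < N" "w a \<noteq> 0\<^sub>v N" and wc: "\<And>b. b < N \<Longrightarrow> w b \<in> carrier_vec N"
    and wu: "\<And>b i. b < N \<Longrightarrow> i < r \<Longrightarrow> w b \<bullet> u i = 0"
    and wx: "\<And>b x. b < N \<Longrightarrow> x \<in> carrier_vec N \<Longrightarrow> (\<And>i. i < r \<Longrightarrow> x \<bullet> u i = 0) \<Longrightarrow> w b \<bullet> x = x $ b"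
    using vec_proj_orthonormal[OF u on r] by auto
  obtain b where b: "b < N" "w a $ b \<noteq> 0" using a wc[OF a(1)] by (metis eq_vecI index_zero_vec carrier_vecD)
  have ba: "w b \<bullet> w a = w a $ b" by (rule wx[OF b(1) wc[OF a(1)] wu[OF a(1)]])
  have "(w a + w b) \<bullet> (w a + w b) = w a \<bullet> w a + 2 * w a $ b + w b \<bullet> w b"
    using wc[OF a(1)] wc[OF b(1)] ba comN[OF wc[OF a(1)] wc[OF b(1)]] by (simp add: bilN)
  then consider "w a \<bullet> w a \<noteq> 0" | "w b \<bullet> w b \<noteq> 0" | "(w a + w b) \<bullet> (w a + w b) \<noteq> 0"
    using b(2) two by fastforce
  then show thesis
  proof cases
    case 3
    moreover have "(w a + w b) \<bullet> u i = 0" if "i < r" for i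
      using wc[OF a(1)] wc[OF b(1)] u[OF that] wu a(1) b(1) that by (simp add: bilN)
    ultimately show thesis using that[of "w a + w b"] wc a b by simp
  qed (use that wc wu a b in blast)+
qed

text \<open>A non-isotropic \<open>w\<close> gives the eigenvectors w + \<theta> w and w - \<theta>
  w, orthogonal to the earlier ones because \<theta> is self-adjoint. Their squares add up to 4
  times \<open>w \<bullet> w\<close>, so at least one of them can be normalised.\<close>

lemma orthonormal_eigenvectors:
  "r \<le> N \<Longrightarrow> \<exists>u \<epsilon>. (\<forall>i<r. u i \<in> carrier_vec N \<and> (\<epsilon> i = 1 \<or> \<epsilon> i = -1) \<and> \<theta> *\<^sub>v u i = \<epsilon> i \<cdot>\<^sub>v u i) \<and>
     (\<forall>i<r. \<forall>j<r. u i \<bullet> u j = (if i = j then 1 else (0::'k)))"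
proof (induction r)
  case (Suc r)
  then obtain u :: "nat \<Rightarrow> 'k vec" and \<epsilon> where
    U: "(\<forall>i<r. u i \<in> carrier_vec N \<and> (\<epsilon> i = 1 \<or> \<epsilon> i = -1) \<and> \<theta> *\<^sub>v u i = \<epsilon> i \<cdot>\<^sub>v u i) \<and>
     (\<forall>i<r. \<forall>j<r. u i \<bullet> u j = (if i = j then 1 else 0))" using Suc_leD by metis
  have u: "\<And>i. i < r \<Longrightarrow> u i \<in> carrier_vec N" and \<epsilon>: "\<And>i. i < r \<Longrightarrow> \<epsilon> i = 1 \<or> \<epsilon> i = -1"
    and ev: "\<And>i. i < r \<Longrightarrow> \<theta> *\<^sub>v u i = \<epsilon> i \<cdot>\<^sub>v u i"
    and on: "\<And>i j. i < r \<Longrightarrow> j < r \<Longrightarrow> u i \<bullet> u j = (if i = j then 1 else 0)" using U by simp_all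
  have rN: "r < N" using Suc.prems by simp
  obtain w where w: "w \<in> carrier_vec N" "\<And>i. i < r \<Longrightarrow> w \<bullet> u i = 0" "w \<bullet> w \<noteq> 0"
    using nonisotropic_exists[OF u on rN] by blast
  have twc: "\<theta> *\<^sub>v w \<in> carrier_vec N" using w by simp
  have tw: "(\<theta> *\<^sub>v w) \<bullet> u i = 0" if "i < r" for i
    using \<theta>_adj[OF w(1) u[OF that]] ev[OF that] w u[OF that] that by (simp add: bilN)
  define x where "x c = w + c \<cdot>\<^sub>v (\<theta> *\<^sub>v w)" for c
  have xc: "x c \<in> carrier_vec N" for c using w twc by (simp add: x_def)
  have xu: "x c \<bullet> u i = 0" if "i < r" for c i using w twc u[OF that] tw[OF that] that by (simp add: x_def bilN)
  have tx: "\<theta> *\<^sub>v x c = c \<cdot>\<^sub>v x c" if "c = 1 \<or> c = -1" for c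
  proof -
    have cc: "c * c = 1" using that by auto
    have "\<theta> *\<^sub>v x c = \<theta> *\<^sub>v w + c \<cdot>\<^sub>v w" using w twc \<theta>_inv[OF w(1)] by (simp add: x_def \<theta>_lin)
    also have "\<dots> = c \<cdot>\<^sub>v w + (c * c) \<cdot>\<^sub>v (\<theta> *\<^sub>v w)" unfolding cc using w twc by (simp add: comm_add_vec[of _ N])
    also have "\<dots> = c \<cdot>\<^sub>v x c" using w twc by (simp add: x_def smult_add_distrib_vec[of _ N] smult_smult_assoc)
    finally show ?thesis .
  qed
  have tt: "(\<theta> *\<^sub>v w) \<bullet> (\<theta> *\<^sub>v w) = w \<bullet> w" using \<theta>_adj[OF w(1) twc] \<theta>_inv[OF w(1)] by simp
  have xx: "x c \<bullet> x c = 2 * (w \<bullet> w) + 2 * c * (w \<bullet> (\<theta> *\<^sub>v w))" if "c = 1 \<or> c = -1" for c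
    using that w(1) twc tt comN[OF twc w(1)] by (auto simp: x_def bilN algebra_simps)
  have "x 1 \<bullet> x 1 + x (-1) \<bullet> x (-1) = 2 * (2 * (w \<bullet> w))" using xx[of 1] xx[of "-1"] by simp
  moreover have "2 * (2 * (w \<bullet> w)) \<noteq> 0" using w(3) two by (intro no_zero_divisors)
  ultimately have "x 1 \<bullet> x 1 + x (-1) \<bullet> x (-1) \<noteq> 0" by simp
  then have "x 1 \<bullet> x 1 \<noteq> 0 \<or> x (-1) \<bullet> x (-1) \<noteq> 0" by auto
  then obtain c where c: "c = 1 \<or> c = -1" "x c \<bullet> x c \<noteq> 0" by blast
  obtain s where s: "s ^ 2 = 1 / (x c \<bullet> x c)" using nth_root_exists[of 2 "1 / (x c \<bullet> x c)"] by auto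
  define y where "y = s \<cdot>\<^sub>v x c"
  have yc: "y \<in> carrier_vec N" using xc by (simp add: y_def)
  have yy: "y \<bullet> y = 1" using xc[of c] s c(2) by (simp add: y_def power2_eq_square mult.assoc[symmetric])
  have yu: "y \<bullet> u i = 0" "u i \<bullet> y = 0" if "i < r" for i
    using xu[OF that] xc[of c] u[OF that] comN[OF yc u[OF that]] by (simp_all add: y_def)
  have ty: "\<theta> *\<^sub>v y = c \<cdot>\<^sub>v y" using tx[OF c(1)] xc[of c] by (simp add: y_def \<theta>_lin smult_smult_assoc mult.commute)
  show ?case
  proof (intro exI[of _ "u(r := y)"] exI[of _ "\<epsilon>(r := c)"] conjI allI impI)
    fix i assume "i < Suc r"
    then have i: "i < r \<or> i = r" by linarith
    show "(u(r := y)) i \<in> carrier_vec N" "(\<epsilon>(r := c)) i = 1 \<or> (\<epsilon>(r := c)) i = -1"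
      "\<theta> *\<^sub>v (u(r := y)) i = (\<epsilon>(r := c)) i \<cdot>\<^sub>v (u(r := y)) i"
      using i u[of i] \<epsilon>[of i] ev[of i] yc c(1) ty by auto
    fix j assume j: "j < Suc r"
    show "(u(r := y)) i \<bullet> (u(r := y)) j = (if i = j then 1 else 0)"
      using \<open>i < Suc r\<close> j on yu yy by (cases "i = r"; cases "j = r") auto
  qed
qed simp

end

definition sign_mat :: "nat \<Rightarrow> nat \<Rightarrow> 'k::field mat" where
  "sign_mat a N = mat N N (\<lambda>(i, j). if i = j then (if i < a then 1 else -1) else 0)"

lemma sign_mat_carrier [simp]: "sign_mat a N \<in> carrier_mat N N"
  by (simp add: sign_mat_def)

lemma mult_diag_entry:
  fixes A :: "'k::field mat"
  assumes "A \<in> carrier_mat N N" "a < N" "i < N"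
  shows "(A * mat N N (\<lambda>(i, j). if i = j then \<mu> i else 0)) $$ (a, i) = A $$ (a, i) * \<mu> i"
proof -
  have "(A * mat N N (\<lambda>(i, j). if i = j then \<mu> i else 0)) $$ (a, i) = (\<Sum>k<N. A $$ (a, k) * (if k = i then \<mu> k else 0))"
    using assms by (simp add: scalar_prod_def atLeast0LessThan)
  also have "\<dots> = (\<Sum>k<N. if k = i then A $$ (a, i) * \<mu> i else 0)" by (intro sum.cong refl) auto
  finally show ?thesis using assms by simp
qed

lemma orthogonal_det: assumes "A \<in> orthogonal_matrices N" shows "det A = 1 \<or> det (A :: 'k::field mat) = -1"
proof -
  note D = orthogonal_matricesD[OF assms]
  have "det (transpose_mat A) * det A = 1"
    using det_mult[of "transpose_mat A" N A] D by simp
  then have "det A * det A = 1" using det_transpose[OF D(1)] by simp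
  then show ?thesis by (simp add: square_eq_1_iff)
qed

lemma orthogonal_uminus:
  assumes A: "A \<in> orthogonal_matrices N"
  shows "- A \<in> orthogonal_matrices N" "det (- A) = (-1) ^ N * det A"
proof -
  note D = orthogonal_matricesD[OF A]
  have e: "- A = (-1) \<cdot>\<^sub>m A" using D(1) by (intro eq_matI) auto
  show "det (- A) = (-1) ^ N * det A" unfolding e using D(1) by simp
  have "transpose_mat (- A) * (- A) = transpose_mat A * A"
    using D(1) by (intro eq_matI) (auto simp: scalar_prod_def sum_negf)
  then show "- A \<in> orthogonal_matrices N" using D by (simp add: orthogonal_matrices_def)
qed

text \<open>The orthonormal eigenvectors, sorted with eigenvalue 1 first, are the columns of
  \<open>h\<close>. If the determinant of \<open>h\<close> is -1, then \<open>- h\<close> serves, as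
  \<open>N\<close> is odd.\<close>

lemma (in symmetric_involution) conjugate_to_sign_mat:
  assumes N: "odd N"
  obtains h d where "h \<in> carrier (SO N)" "d \<le> N" "\<theta> = h * sign_mat d N * transpose_mat h"
proof -
  obtain u :: "nat \<Rightarrow> 'k vec" and \<epsilon> where
    U: "(\<forall>i<N. u i \<in> carrier_vec N \<and> (\<epsilon> i = 1 \<or> \<epsilon> i = -1) \<and> \<theta> *\<^sub>v u i = \<epsilon> i \<cdot>\<^sub>v u i) \<and>
     (\<forall>i<N. \<forall>j<N. u i \<bullet> u j = (if i = j then 1 else 0))" using orthonormal_eigenvectors[OF order_refl] by metis
  have u: "\<And>i. i < N \<Longrightarrow> u i \<in> carrier_vec N" and \<epsilon>: "\<And>i. i < N \<Longrightarrow> \<epsilon> i = 1 \<or> \<epsilon> i = -1"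
    and ev: "\<And>i. i < N \<Longrightarrow> \<theta> *\<^sub>v u i = \<epsilon> i \<cdot>\<^sub>v u i"
    and on: "\<And>i j. i < N \<Longrightarrow> j < N \<Longrightarrow> u i \<bullet> u j = (if i = j then 1 else (0::'k))" using U by simp_all
  let ?A = "{i. i < N \<and> \<epsilon> i = 1}" and ?B = "{i. i < N \<and> \<epsilon> i \<noteq> 1}"
  define d where "d = card ?A"
  have cAB: "card ?A + card ?B = N"
  proof -
    have "card (?A \<union> ?B) = card ?A + card ?B" by (rule card_Un_disjoint) auto
    moreover have "?A \<union> ?B = {..<N}" by auto
    ultimately show ?thesis by simp
  qed
  then have dN: "d \<le> N" by (simp add: d_def)
  obtain f where f: "bij_betw f {..<d} ?A" using finite_same_card_bij[of "{..<d}" ?A] by (auto simp: d_def)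
  have "card {d..<N} = card ?B" using cAB unfolding d_def by simp
  then obtain f' where f': "bij_betw f' {d..<N} ?B" using finite_same_card_bij[of "{d..<N}" ?B] by auto
  define \<pi> where "\<pi> i = (if i < d then f i else f' i)" for i
  have \<pi>A: "\<pi> i \<in> ?A" if "i < d" for i using bij_betwE[OF f] that by (auto simp: \<pi>_def)
  have \<pi>B: "\<pi> i \<in> ?B" if "\<not> i < d" "i < N" for i using bij_betwE[OF f'] that by (auto simp: \<pi>_def)
  have \<pi>N: "\<pi> i < N" if "i < N" for i using \<pi>A[of i] \<pi>B[of i] that by auto
  have \<pi>inj: "\<pi> i = \<pi> j \<longleftrightarrow> i = j" if "i < N" "j < N" for i j
  proof
    assume e: "\<pi> i = \<pi> j"
    have "i < d \<longleftrightarrow> j < d" using \<pi>A[of i] \<pi>A[of j] \<pi>B[of i] \<pi>B[of j] e that by auto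
    then show "i = j" using e f f' that by (auto simp: \<pi>_def bij_betw_def inj_on_def split: if_splits)
  qed simp
  define h where "h = mat N N (\<lambda>(a, i). u (\<pi> i) $ a)"
  have hc: "h \<in> carrier_mat N N" by (simp add: h_def)
  have hh: "transpose_mat h * h = 1\<^sub>m N"
  proof (rule eq_matI)
    fix i j assume "i < dim_row (1\<^sub>m N)" "j < dim_col (1\<^sub>m N)"
    then have ij: "i < N" "j < N" by auto
    have "(transpose_mat h * h) $$ (i, j) = u (\<pi> i) \<bullet> u (\<pi> j)"
      using ij u[OF \<pi>N[OF ij(2)]] by (simp add: h_def scalar_prod_def)
    then show "(transpose_mat h * h) $$ (i, j) = 1\<^sub>m N $$ (i, j)" using on \<pi>N \<pi>inj ij by simp
  qed (simp_all add: h_def)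
  have ho: "h \<in> orthogonal_matrices N" using hc hh by (simp add: orthogonal_matrices_def)
  have th: "\<theta> * h = h * sign_mat d N"
  proof (rule eq_matI)
    fix a i assume "a < dim_row (h * sign_mat d N)" "i < dim_col (h * sign_mat d N)"
    then have ai: "a < N" "i < N" by (auto simp: h_def sign_mat_def)
    have s: "\<epsilon> (\<pi> i) = (if i < d then 1 else -1)" using \<pi>A[of i] \<pi>B[of i] \<epsilon>[OF \<pi>N[OF ai(2)]] ai by auto
    have "(\<theta> * h) $$ (a, i) = (\<theta> *\<^sub>v u (\<pi> i)) $ a"
      using ai \<theta> u[OF \<pi>N[OF ai(2)]] by (simp add: h_def scalar_prod_def)
    also have "\<dots> = (if i < d then 1 else -1) * u (\<pi> i) $ a"
      using ev[OF \<pi>N[OF ai(2)]] u[OF \<pi>N[OF ai(2)]] s ai by simp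
    also have "\<dots> = (h * sign_mat d N) $$ (a, i)"
      unfolding sign_mat_def mult_diag_entry[OF hc ai] using ai by (simp add: h_def)
    finally show "(\<theta> * h) $$ (a, i) = (h * sign_mat d N) $$ (a, i)" .
  qed (use \<theta> in \<open>auto simp: h_def sign_mat_def\<close>)
  have conj: "\<theta> = g * sign_mat d N * transpose_mat g" if g: "g \<in> orthogonal_matrices N" "\<theta> * g = g * sign_mat d N" for g
  proof -
    note D = orthogonal_matricesD[OF g(1)]
    have "g * sign_mat d N * transpose_mat g = \<theta> * (g * transpose_mat g)"
      unfolding g(2)[symmetric] by (rule assoc_mult_mat[OF \<theta> D(1)]) (use D(1) in simp)
    then show ?thesis using D(3) \<theta> by simp
  qed
  show thesis
  proof (cases "det h = 1")
    case True
    then show thesis using that[of h d] ho conj[OF ho th] dN by simp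
  next
    case False
    then have "det (- h) = 1" using orthogonal_uminus(2)[OF ho] orthogonal_det[OF ho] N by auto
    moreover have "\<theta> * (- h) = (- h) * sign_mat d N"
    proof -
      have "\<theta> * (- h) = - (\<theta> * h)" using \<theta> hc by simp
      also have "\<dots> = (- h) * sign_mat d N" unfolding th using hc by (simp add: sign_mat_def)
      finally show ?thesis .
    qed
    ultimately show thesis using that[of "- h" d] orthogonal_uminus(1)[OF ho] conj[of "- h"] dN by simp
  qed
qed

section \<open>Eigenvalue multiplicities from the characteristic polynomial\<close>

lemma order_prod_linear:
  fixes \<mu> :: "'a \<Rightarrow> 'k::field"
  assumes "finite A"
  shows "Polynomial.order c (\<Prod>k\<in>A. [:- \<mu> k, 1:]) = card {k \<in> A. \<mu> k = c}"
  using assms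
proof (induction A rule: finite_induct)
  case (insert x A)
  have nz: "(\<Prod>k\<in>A. [:- \<mu> k, 1:]) \<noteq> 0" using insert by simp
  have "Polynomial.order c [:- \<mu> x, 1:] = (if \<mu> x = c then 1 else 0)"
  proof (cases "\<mu> x = c")
    case True
    then show ?thesis using order_power_n_n[of c 1] by simp
  next
    case False
    then show ?thesis by (simp add: order_0I)
  qed
  moreover have "{k \<in> insert x A. \<mu> k = c} = (if \<mu> x = c then insert x {k \<in> A. \<mu> k = c} else {k \<in> A. \<mu> k = c})" by auto
  moreover have "[:- \<mu> x, 1:] * (\<Prod>k\<in>A. [:- \<mu> k, 1:]) \<noteq> 0" by (rule no_zero_divisors[OF _ nz]) simp
  ultimately show ?case using insert by (simp add: order_mult del: mult_eq_0_iff mult_pCons_left)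
qed simp

text \<open>Root multiplicities count eigenvalues as natural numbers in every characteristic; the
  trace of an involution would give the count only modulo the characteristic.\<close>

lemma similar_diag_order:
  fixes A :: "'k::field mat"
  assumes A: "A \<in> carrier_mat N N" and P: "P \<in> carrier_mat N N" "Q \<in> carrier_mat N N" "P * Q = 1\<^sub>m N"
    and eq: "A = P * mat N N (\<lambda>(i, j). if i = j then \<mu> i else 0) * Q"
  shows "Polynomial.order c (char_poly A) = card {k. k < N \<and> \<mu> k = c}"
proof -
  let ?D = "mat N N (\<lambda>(i, j). if i = j then \<mu> i else 0)"
  have "Q * P = 1\<^sub>m N" by (rule mat_mult_left_right_inverse[OF P])
  then have "similar_mat A ?D"
    by (intro similar_matI[of A ?D P Q N]) (use assms in auto)
  then have "char_poly A = char_poly ?D" by (rule char_poly_similar)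
  also have "\<dots> = (\<Prod>a\<leftarrow>diag_mat ?D. [:- a, 1:])" by (rule char_poly_upper_triangular[of _ N]) auto
  also have "\<dots> = (\<Prod>k<N. [:- \<mu> k, 1:])" 
    by (simp add: diag_mat_def prod.list_conv_set_nth atLeast0LessThan)
  finally show ?thesis using order_prod_linear[of "{..<N}" c \<mu>] by (simp add: Collect_conj_eq)
qed

definition excess :: "nat set \<Rightarrow> (nat \<Rightarrow> nat) \<times> nat set \<Rightarrow> int" where
  "excess I = (\<lambda>(\<sigma>, M). int (card {k \<in> I. \<sigma> k = k \<and> k \<notin> M}) - int (card M))"

lemma normal_form_hyp_basis:
  "normal_form_on N p \<theta> {..<N} g (\<sigma>, M) \<Longrightarrow> hyp_basis N g"
  using normal_form_onD(5,8)[of N p \<theta> "{..<N}" g \<sigma> M] by (simp add: hyp_basis_def)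

lemma eq_on_basis:
  assumes g: "hyp_basis N g" and X: "X \<in> carrier_mat N N" and Y: "Y \<in> carrier_mat N N"
    and e: "\<And>j. j < N \<Longrightarrow> X *\<^sub>v g j = Y *\<^sub>v g j"
  shows "X = Y"
proof (rule coords_inj[OF g X Y])
  show "coords N g X = coords N g Y"
  proof (rule eq_matI)
    fix i j assume "i < dim_row (coords N g Y)" "j < dim_col (coords N g Y)"
    then have "i < N" "j < N" using carrier_matD[OF coords_carrier(1)[OF Y, of g]] by auto
    then show "coords N g X $$ (i, j) = coords N g Y $$ (i, j)" using e by (simp add: coords_entry[OF g] X Y)
  qed (use carrier_matD[OF coords_carrier(1)[OF X, of g]] carrier_matD[OF coords_carrier(1)[OF Y, of g]] in auto)
qed

text \<open>Both families of values have the same sum, so no value can be strictly smaller.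
  Uniqueness of the matching thereby needs only an inequality.\<close>

lemma permutation_le_imp_eq:
  fixes \<sigma> \<tau> :: "nat \<Rightarrow> nat"
  assumes "bij_betw \<sigma> {..<N} {..<N}" "bij_betw \<tau> {..<N} {..<N}" "\<And>k. k < N \<Longrightarrow> \<sigma> k \<le> \<tau> k" "k < N"
  shows "\<sigma> k = \<tau> k"
proof (rule ccontr)
  assume "\<sigma> k \<noteq> \<tau> k"
  then have "\<sigma> k < \<tau> k" using assms(3)[OF assms(4)] by simp
  then have "(\<Sum>k<N. \<sigma> k) < (\<Sum>k<N. \<tau> k)" using assms(3,4) by (intro sum_strict_mono_ex1) auto
  moreover have "(\<Sum>k<N. \<sigma> k) = (\<Sum>k<N. k)" using sum.reindex_bij_betw[OF assms(1), of "\<lambda>k. k"] by simp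
  moreover have "(\<Sum>k<N. \<tau> k) = (\<Sum>k<N. k)" using sum.reindex_bij_betw[OF assms(2), of "\<lambda>k. k"] by simp
  ultimately show False by simp
qed

lemma clan_bij:
  assumes "(\<sigma>, M) \<in> clans N I" shows "bij_betw \<sigma> I I"
  by (rule bij_betw_byWitness[where f' = \<sigma>]) (use clansD[OF assms] in auto)

lemma clan_sign_simps: "clan_sign M k \<noteq> (0 :: 'k::field)" "clan_sign M k * clan_sign M k = (1 :: 'k::field)"
  by (auto simp: clan_sign_def)

context symmetric_involution begin

text \<open>Suppose \<open>\<sigma> l\<close> exceeded \<open>\<sigma>' l\<close>, and let m = N - 1
  - \<sigma> l. By levels, \<open>\<theta> *\<^sub>v g' l\<close> would be orthogonal to
  \<open>g m\<close>; but moving \<theta> to the other factor turns their pairing into that of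
  \<open>g' l\<close> with \<open>g (N - Suc l)\<close>, up to sign, which is nonzero because both
  vectors are adapted to the same flag. The signs at fixed points are compared through the same
  pairing.\<close>

lemma normal_form_unique:
  assumes nf: "normal_form_on N p \<theta> {..<N} g (\<sigma>, M)" and nf': "normal_form_on N p \<theta> {..<N} g' (\<sigma>', M')"
  shows "\<sigma> = \<sigma>'" "M = M'"
proof -
  note D = normal_form_onD[OF nf, unfolded lessThan_iff] and D' = normal_form_onD[OF nf', unfolded lessThan_iff]
  note C = clansD[OF D(6), unfolded lessThan_iff] and C' = clansD[OF D'(6), unfolded lessThan_iff]
  have pair: "g' l \<bullet> g (N - Suc l) \<noteq> 0" if l: "l < N" for l
  proof -
    let ?w = "N - Suc l"
    have w: "?w < N" "Suc (l + ?w) = N" "Suc (?w + l) = N" using l by auto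
    have "g' l \<bullet> g' ?w = (g' l \<bullet> p ?w) * (g' ?w \<bullet> p l)"
      by (rule flag_pairing_top[OF p D'(4)[OF l] D'(4)[OF w(1)] w(2)])
    then have a: "g' l \<bullet> p ?w \<noteq> 0" using D'(5)[OF l w(1)] w by auto
    have "g ?w \<bullet> g l = (g ?w \<bullet> p l) * (g l \<bullet> p ?w)"
      by (rule flag_pairing_top[OF p D(4)[OF w(1)] D(4)[OF l] w(3)])
    then have b: "g ?w \<bullet> p l \<noteq> 0" using D(5)[OF w(1) l] w by auto
    show ?thesis using flag_pairing_top[OF p D'(4)[OF l] D(4)[OF w(1)] w(2)] a b by simp
  qed
  have le: "\<sigma> l \<le> \<sigma>' l" if l: "l < N" for l
  proof (rule ccontr)
    assume n: "\<not> ?thesis"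
    have s: "\<sigma> l < N" "\<sigma>' l < N" using C(1) C'(1) l by auto
    let ?m = "N - Suc (\<sigma> l)"
    have m: "?m < N" using l by simp
    have "\<sigma> ?m = N - Suc (\<sigma> (\<sigma> l))" by (rule C(3)[OF s(1)])
    then have sm: "\<sigma> ?m = N - Suc l" using C(2)[OF l] by simp
    have w: "N - Suc l < N" using l by simp
    have "(\<theta> *\<^sub>v g' l) \<bullet> g ?m = g' l \<bullet> (\<theta> *\<^sub>v g ?m)" by (rule \<theta>_adj[OF D'(8)[OF l] D(8)[OF m]])
    also have "\<dots> = clan_sign M ?m * (g' l \<bullet> g (N - Suc l))"
      using D(7)[OF m] sm D(8)[OF w] D'(8)[OF l] by (simp add: bilN)
    also have "\<dots> \<noteq> 0" using pair[OF l] clan_sign_simps(1) by simp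
    finally have "(\<theta> *\<^sub>v g' l) \<bullet> g ?m \<noteq> 0" .
    moreover have "g' (\<sigma>' l) \<bullet> g ?m = 0"
      by (rule flag_pairing_zero[OF p D'(4)[OF s(2)] D(4)[OF m]]) (use n s in linarith)
    ultimately show False using D'(7)[OF l] D'(8)[OF s(2)] D(8)[OF m] by (simp add: bilN)
  qed
  have eq: "\<sigma> k = \<sigma>' k" if "k < N" for k
    using permutation_le_imp_eq[OF clan_bij[OF D(6)] clan_bij[OF D'(6)] le that] .
  show \<sigma>\<sigma>: "\<sigma> = \<sigma>'"
  proof
    fix k show "\<sigma> k = \<sigma>' k" using eq[of k] C(4)[of k] C'(4)[of k] by (cases "k < N") auto
  qed
  have "k \<in> M \<longleftrightarrow> k \<in> M'" if fx: "\<sigma> k = k" and k: "k < N" for k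
  proof -
    let ?w = "N - Suc k"
    have w: "?w < N" using k by simp
    have fw: "\<sigma> ?w = ?w" using C(3)[OF k] fx by simp
    have "N - Suc ?w = k" using k by simp
    then have Mw: "?w \<in> M \<longleftrightarrow> k \<in> M" using C(7)[of k] C(7)[of ?w] by auto
    have "(\<theta> *\<^sub>v g' k) \<bullet> g ?w = clan_sign M' k * (g' k \<bullet> g ?w)"
      using D'(7)[OF k] fx \<sigma>\<sigma> D'(8)[OF k] D(8)[OF w] by (simp add: bilN)
    moreover have "(\<theta> *\<^sub>v g' k) \<bullet> g ?w = clan_sign M ?w * (g' k \<bullet> g ?w)"
      using \<theta>_adj[OF D'(8)[OF k] D(8)[OF w]] D(7)[OF w] fw D'(8)[OF k] D(8)[OF w] by (simp add: bilN)
    ultimately have "clan_sign M' k = (clan_sign M ?w :: 'k)" using pair[OF k] by simp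
    moreover have "(1 :: 'k) \<noteq> -1" using two by (metis add.right_inverse one_add_one)
    ultimately show ?thesis using Mw by (auto simp: clan_sign_def split: if_splits)
  qed
  moreover have "k \<in> M \<Longrightarrow> \<sigma> k = k \<and> k < N" for k using C(5,6) by auto
  moreover have "k \<in> M' \<Longrightarrow> \<sigma> k = k \<and> k < N" for k using C'(5,6) \<sigma>\<sigma> by auto
  ultimately show "M = M'" by blast
qed

end

text \<open>The base change \<open>clan_base\<close> diagonalises the signed permutation: a two-cycle contributes the
  eigenvectors \<open>e\<^sub>k + e\<^sub>\<sigma>\<^sub>k\<close> and \<open>e\<^sub>\<sigma>\<^sub>k - e\<^sub>k\<close>.\<close>

definition clan_mat :: "nat \<Rightarrow> (nat \<Rightarrow> nat) \<times> nat set \<Rightarrow> 'k::field mat" where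
  "clan_mat N = (\<lambda>(\<sigma>, M). mat N N (\<lambda>(i, j). if i = \<sigma> j then clan_sign M j else 0))"

definition clan_base :: "nat \<Rightarrow> (nat \<Rightarrow> nat) \<Rightarrow> 'k::field mat" where
  "clan_base N \<sigma> = mat N N (\<lambda>(i, j). if i = j then (if \<sigma> j < j then -1 else 1) else if i = \<sigma> j then 1 else 0)"

definition clan_eigenvalue :: "(nat \<Rightarrow> nat) \<times> nat set \<Rightarrow> nat \<Rightarrow> 'k::field" where
  "clan_eigenvalue = (\<lambda>(\<sigma>, M) j. if \<sigma> j = j then clan_sign M j else if j < \<sigma> j then 1 else -1)"

text \<open>The square of \<open>clan_base\<close> is diagonal, with 1 at fixed points and 2 on
  two-cycles, so dividing its columns by these numbers gives the inverse.\<close>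

lemma clan_mat_diagonal:
  assumes two: "(2 :: 'k::field) \<noteq> 0" and cl: "(\<sigma>, M) \<in> clans N {..<N}"
  obtains P Q :: "'k::field mat" where "P \<in> carrier_mat N N" "Q \<in> carrier_mat N N" "P * Q = 1\<^sub>m N"
    "clan_mat N (\<sigma>, M) = P * mat N N (\<lambda>(i, j). if i = j then clan_eigenvalue (\<sigma>, M) i else 0) * Q"
proof -
  note C = clansD[OF cl, unfolded lessThan_iff]
  let ?C = "clan_base N \<sigma> :: 'k mat" and ?m = "clan_eigenvalue (\<sigma>, M) :: nat \<Rightarrow> 'k"
  define c :: "nat \<Rightarrow> 'k" where "c j = (if \<sigma> j = j then 1 else 2)" for j
  define Q where "Q = mat N N (\<lambda>(i, j). ?C $$ (i, j) / c j)"
  let ?D = "mat N N (\<lambda>(i, j). if i = j then ?m i else 0)"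
  let ?T = "clan_mat N (\<sigma>, M) :: 'k mat"
  have Cc: "?C \<in> carrier_mat N N" and Qc: "Q \<in> carrier_mat N N" and Tc: "?T \<in> carrier_mat N N"
    by (auto simp: clan_base_def Q_def clan_mat_def)
  have Ce: "?C $$ (i, j) = (if i = j then (if \<sigma> j < j then -1 else 1) else if i = \<sigma> j then 1 else 0)" if "i < N" "j < N" for i j
    using that by (simp add: clan_base_def)
  have inv: "i = \<sigma> j \<longleftrightarrow> \<sigma> i = j" if "i < N" "j < N" for i j using C(2) that by metis
  have one: "clan_sign M k = (1::'k)" if "\<sigma> k \<noteq> k" for k using C(6) that by (auto simp: clan_sign_def)
  have CC: "(\<Sum>k<N. ?C $$ (i, k) * ?C $$ (k, j)) = (if i = j then c j else 0)" if ij: "i < N" "j < N" for i j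
  proof -
    have si: "\<sigma> i < N" "\<sigma> j < N" using C(1) ij by auto
    have "(\<Sum>k<N. ?C $$ (i, k) * ?C $$ (k, j)) = (\<Sum>k\<in>{i, \<sigma> i}. ?C $$ (i, k) * ?C $$ (k, j))"
      using si ij by (intro sum_eq_sum_support) (auto simp: Ce inv)
    also have "\<dots> = (if i = j then c j else 0)"
    proof (cases "\<sigma> i = i")
      case True
      then show ?thesis using ij inv by (auto simp: Ce c_def)
    next
      case False
      then have "(\<Sum>k\<in>{i, \<sigma> i}. ?C $$ (i, k) * ?C $$ (k, j)) = ?C $$ (i, i) * ?C $$ (i, j) + ?C $$ (i, \<sigma> i) * ?C $$ (\<sigma> i, j)" by simp
      moreover have ssi: "\<sigma> (\<sigma> i) = i" using C(2) ij by simp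
      have E: "?C $$ (i, i) = (if \<sigma> i < i then -1 else 1)" "?C $$ (i, \<sigma> i) = 1" "?C $$ (\<sigma> i, i) = 1"
        "?C $$ (\<sigma> i, \<sigma> i) = (if i < \<sigma> i then -1 else 1)"
        using False ij(1) si(1) ssi by (simp_all add: Ce)
      consider "j = i" | "j = \<sigma> i" | "j \<noteq> i" "j \<noteq> \<sigma> i" by blast
      then have "?C $$ (i, i) * ?C $$ (i, j) + ?C $$ (i, \<sigma> i) * ?C $$ (\<sigma> i, j) = (if i = j then c j else 0)"
      proof cases
        case 1
        then show ?thesis using False by (simp add: E c_def)
      next
        case 2
        then show ?thesis using False by (auto simp add: E)
      next
        case 3
        then have "i \<noteq> \<sigma> j" "\<sigma> i \<noteq> \<sigma> j" using C(2) ij by metis+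
        then show ?thesis using 3 ij si by (simp add: Ce)
      qed
      ultimately show ?thesis by simp
    qed
    finally show ?thesis .
  qed
  have c0: "c j \<noteq> 0" for j using two by (simp add: c_def)
  have CQ: "?C * Q = 1\<^sub>m N"
  proof (rule eq_matI)
    fix i j assume "i < dim_row (1\<^sub>m N)" "j < dim_col (1\<^sub>m N)"
    then have ij: "i < N" "j < N" by auto
    have "(?C * Q) $$ (i, j) = (\<Sum>k<N. ?C $$ (i, k) * ?C $$ (k, j)) / c j"
      unfolding mat_mult_entry[OF Cc Qc ij] using ij by (simp add: Q_def sum_divide_distrib)
    then show "(?C * Q) $$ (i, j) = 1\<^sub>m N $$ (i, j)" using CC[OF ij] c0 ij by simp
  qed (use Cc Qc in auto)
  have TC: "?T * ?C = ?C * ?D"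
  proof (rule eq_matI)
    fix i j assume "i < dim_row (?C * ?D)" "j < dim_col (?C * ?D)"
    then have ij: "i < N" "j < N" using Cc by auto
    have si: "\<sigma> i < N" "\<sigma> j < N" "\<sigma> (\<sigma> i) = i" "\<sigma> (\<sigma> j) = j" using C(1,2) ij by auto
    have "(?T * ?C) $$ (i, j) = (\<Sum>k\<in>{\<sigma> i}. ?T $$ (i, k) * ?C $$ (k, j))"
      unfolding mat_mult_entry[OF Tc Cc ij]
      using si ij by (intro sum_eq_sum_support) (auto simp: clan_mat_def inv)
    also have "\<dots> = clan_sign M (\<sigma> i) * ?C $$ (\<sigma> i, j)" using si ij by (simp add: clan_mat_def)
    also have "\<dots> = ?C $$ (i, j) * ?m j"
    proof -
      consider "\<sigma> j = j" | "\<sigma> j \<noteq> j" "i = j" | "\<sigma> j \<noteq> j" "i = \<sigma> j" | "\<sigma> j \<noteq> j" "i \<noteq> j" "i \<noteq> \<sigma> j" by blast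
      then show ?thesis
      proof cases
        case 1
        then have "\<sigma> i = j \<longleftrightarrow> i = j" using inv[OF ij] by auto
        then show ?thesis using 1 ij si by (auto simp: Ce clan_eigenvalue_def)
      next
        case 2
        then show ?thesis using ij si one[of "\<sigma> j"] by (auto simp: Ce clan_eigenvalue_def)
      next
        case 3
        then show ?thesis using ij si one[of j] by (auto simp: Ce clan_eigenvalue_def)
      next
        case 4
        then have "\<sigma> i \<noteq> j" "\<sigma> i \<noteq> \<sigma> j" using inv[OF ij] si by metis+
        then show ?thesis using 4 ij si by (auto simp: Ce)
      qed
    qed
    also have "\<dots> = (?C * ?D) $$ (i, j)" by (rule mult_diag_entry[OF Cc ij, symmetric])
    finally show "(?T * ?C) $$ (i, j) = (?C * ?D) $$ (i, j)" .
  qed (use Cc Tc in auto)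
  have "?C * ?D * Q = ?T * (?C * Q)" unfolding TC[symmetric] by (rule assoc_mult_mat[OF Tc Cc Qc])
  then have "?T = ?C * ?D * Q" unfolding CQ using Tc by simp
  then show thesis using that[OF Cc Qc CQ] by blast
qed

text \<open>Every two-cycle contributes one eigenvalue 1, booked at its smaller element, and one
  eigenvalue -1; only the signs of fixed points enter the difference of the multiplicities.\<close>

lemma card_clan_eigenvalue:
  assumes two: "(2 :: 'k::field) \<noteq> 0" and cl: "(\<sigma>, M) \<in> clans N {..<N}"
  shows "2 * int (card {k. k < N \<and> clan_eigenvalue (\<sigma>, M) k = (1 :: 'k)}) = int N + excess {..<N} (\<sigma>, M)"
proof -
  note C = clansD[OF cl, unfolded lessThan_iff]
  let ?F = "{k \<in> {..<N}. \<sigma> k = k \<and> k \<notin> M}" and ?U = "{k. k < N \<and> k < \<sigma> k}" and ?L = "{k. k < N \<and> \<sigma> k < k}"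
  have ne: "(1 :: 'k) \<noteq> -1" using two by (metis add.right_inverse one_add_one)
  have M: "M \<subseteq> {..<N}" "finite M" using C(5) finite_subset by auto
  have MF: "\<sigma> k = k" "k < N" if "k \<in> M" for k using C(6) M that by auto
  have "{k. k < N \<and> clan_eigenvalue (\<sigma>, M) k = (1 :: 'k)} = ?F \<union> ?U"
    using ne ne[symmetric] by (auto simp: clan_eigenvalue_def clan_sign_def split: if_splits)
  moreover have "card (?F \<union> ?U) = card ?F + card ?U" by (rule card_Un_disjoint) auto
  moreover have "bij_betw \<sigma> ?U ?L"
    by (rule bij_betw_byWitness[where f' = \<sigma>]) (use C(1,2) in auto)
  then have "card ?U = card ?L" by (rule bij_betw_same_card)
  moreover have "N = card ?F + card M + card ?U + card ?L"
  proof -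
    have "{..<N} = ((?F \<union> M) \<union> ?U) \<union> ?L" using MF by auto
    then have "card {..<N} = card (((?F \<union> M) \<union> ?U) \<union> ?L)" by (rule arg_cong)
    also have "\<dots> = card ((?F \<union> M) \<union> ?U) + card ?L" by (rule card_Un_disjoint) (use M MF in auto)
    also have "card ((?F \<union> M) \<union> ?U) = card (?F \<union> M) + card ?U" by (rule card_Un_disjoint) (use M MF in auto)
    also have "card (?F \<union> M) = card ?F + card M" by (rule card_Un_disjoint) (use M in auto)
    finally show ?thesis by simp
  qed
  ultimately show ?thesis by (simp add: excess_def)
qed

lemma (in symmetric_involution) normal_form_clan_mat:
  assumes nf: "normal_form_on N p \<theta> {..<N} g (\<sigma>, M)"
  shows "\<theta> = basis_mat N g * clan_mat N (\<sigma>, M) * dual_mat N g"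
proof -
  note D = normal_form_onD[OF nf, unfolded lessThan_iff]
  note g = normal_form_hyp_basis[OF nf]
  note C = clansD[OF D(6), unfolded lessThan_iff]
  have "coords N g \<theta> = clan_mat N (\<sigma>, M)"
  proof (rule eq_matI)
    fix i j assume "i < dim_row (clan_mat N (\<sigma>, M))" "j < dim_col (clan_mat N (\<sigma>, M))"
    then have ij: "i < N" "j < N" by (auto simp: clan_mat_def)
    have sj: "\<sigma> j < N" "N - Suc i < N" using C(1) ij by auto
    have "Suc (\<sigma> j + (N - Suc i)) = N \<longleftrightarrow> i = \<sigma> j" using ij sj by auto
    then show "coords N g \<theta> $$ (i, j) = clan_mat N (\<sigma>, M) $$ (i, j)"
      unfolding coords_entry[OF g \<theta> ij] D(7)[OF ij(2)]
      using D(8)[OF sj(1)] D(8)[OF sj(2)] D(5)[OF sj] ij by (simp add: bilN clan_mat_def)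
  qed (use carrier_matD[OF coords_carrier(1)[OF \<theta>, of g]] in \<open>auto simp: clan_mat_def\<close>)
  then show ?thesis using coords_uncoords(2)[OF g \<theta>] by (simp add: uncoords_def)
qed

text \<open>Both diagonalisations of \<theta>, the one by \<open>h\<close> and the one by the clan,
  must give the eigenvalue 1 the same multiplicity.\<close>

lemma (in symmetric_involution) normal_form_signature:
  assumes nf: "normal_form_on N p \<theta> {..<N} g (\<sigma>, M)" and h: "h \<in> orthogonal_matrices N"
    and d: "d \<le> N" and eq: "\<theta> = h * sign_mat d N * transpose_mat h"
  shows "2 * int d = int N + excess {..<N} (\<sigma>, M)"
proof -
  note D = normal_form_onD[OF nf] and g = normal_form_hyp_basis[OF nf] and hD = orthogonal_matricesD[OF h]
  have ne: "(1 :: 'k) \<noteq> -1" using two by (metis add.right_inverse one_add_one)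
  have "Polynomial.order 1 (char_poly \<theta>) = card {k. k < N \<and> (if k < d then 1 else -1 :: 'k) = 1}"
    by (rule similar_diag_order[OF \<theta> hD(1) _ hD(3)]) (use hD(1) eq in \<open>auto simp: sign_mat_def\<close>)
  also have "{k. k < N \<and> (if k < d then 1 else -1 :: 'k) = 1} = {..<d}" using ne d by auto
  finally have o: "Polynomial.order 1 (char_poly \<theta>) = d" by simp
  obtain P Q :: "'k mat" where PQ: "P \<in> carrier_mat N N" "Q \<in> carrier_mat N N" "P * Q = 1\<^sub>m N"
    and e: "clan_mat N (\<sigma>, M) = P * mat N N (\<lambda>(i, j). if i = j then clan_eigenvalue (\<sigma>, M) i else 0) * Q"
    by (rule clan_mat_diagonal[OF two D(6)])
  let ?D = "mat N N (\<lambda>(i, j). if i = j then clan_eigenvalue (\<sigma>, M) i else 0) :: 'k mat"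
  let ?G = "basis_mat N g" and ?H = "dual_mat N g"
  note as = assoc_mult_mat[of _ N N _ N _ N] mult_carrier_mat[of _ N N _ N]
  have Dc: "?D \<in> carrier_mat N N" by simp
  have "?G * P * (Q * ?H) = ?G * (P * Q * ?H)" using PQ(1,2) by (simp add: as del: assoc_mult_mat)
  then have "?G * P * (Q * ?H) = 1\<^sub>m N" using PQ(3) dual_basis_mat(2)[OF g] left_mult_one_mat[of ?H N N] by simp
  moreover have "\<theta> = ?G * P * ?D * (Q * ?H)"
    unfolding normal_form_clan_mat[OF nf] e using PQ(1,2) Dc by (simp add: as del: assoc_mult_mat)
  ultimately have "Polynomial.order 1 (char_poly \<theta>) = card {k. k < N \<and> clan_eigenvalue (\<sigma>, M) k = (1::'k)}"
    by (intro similar_diag_order[OF \<theta>, of "?G * P" "Q * ?H"] mult_carrier_mat[of _ N N _ N])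
       (simp_all add: PQ(1,2))
  then show ?thesis using o card_clan_eigenvalue[OF two D(6)] by simp
qed

section \<open>The symmetric variety as a set of involutions\<close>

lemma sign_mat_commutes_iff:
  assumes two: "(2 :: 'k::field) \<noteq> 0" and k: "(k :: 'k mat) \<in> carrier_mat (a + b) (a + b)"
  shows "k * sign_mat a (a + b) = sign_mat a (a + b) * k \<longleftrightarrow>
    (\<forall>i<a + b. \<forall>j<a + b. (i < a) \<noteq> (j < a) \<longrightarrow> k $$ (i, j) = 0)"
proof -
  let ?N = "a + b" and ?e = "\<lambda>i. if i < a then 1 else -1 :: 'k"
  have l: "(k * sign_mat a ?N) $$ (i, j) = k $$ (i, j) * ?e j" if "i < ?N" "j < ?N" for i j
    unfolding sign_mat_def by (rule mult_diag_entry[OF k that])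
  have r: "(sign_mat a ?N * k) $$ (i, j) = ?e i * k $$ (i, j)" if ij: "i < ?N" "j < ?N" for i j
  proof -
    have "(sign_mat a ?N * k) $$ (i, j) = (\<Sum>l<?N. sign_mat a ?N $$ (i, l) * k $$ (l, j))"
      by (rule mat_mult_entry[OF _ k ij]) simp
    also have "\<dots> = (\<Sum>l<?N. if l = i then ?e i * k $$ (i, j) else 0)"
      by (intro sum.cong refl) (use ij in \<open>auto simp: sign_mat_def\<close>)
    finally show ?thesis using ij by simp
  qed
  show ?thesis
  proof
    assume e: "k * sign_mat a ?N = sign_mat a ?N * k"
    show "\<forall>i<?N. \<forall>j<?N. (i < a) \<noteq> (j < a) \<longrightarrow> k $$ (i, j) = 0"
    proof (intro allI impI)
      fix i j assume ij: "i < ?N" "j < ?N" "(i < a) \<noteq> (j < a)"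
      have "k $$ (i, j) * ?e j = (k * sign_mat a ?N) $$ (i, j)" by (rule l[OF ij(1,2), symmetric])
      also have "\<dots> = ?e i * k $$ (i, j)" unfolding e by (rule r[OF ij(1,2)])
      finally have "k $$ (i, j) * ?e j = ?e i * k $$ (i, j)" .
      moreover have "(?e i = 1 \<and> ?e j = -1) \<or> (?e i = -1 \<and> ?e j = 1)" using ij(3) by auto
      ultimately have "k $$ (i, j) = - k $$ (i, j)" by (elim disjE conjE) (simp_all only: mult_1_right mult_1_left mult_minus1 mult_minus1_right)
      then have "2 * k $$ (i, j) = 0" by (metis add.right_inverse mult_2)
      then show "k $$ (i, j) = 0" using two by simp
    qed
  next
    assume z: "\<forall>i<?N. \<forall>j<?N. (i < a) \<noteq> (j < a) \<longrightarrow> k $$ (i, j) = 0"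
    show "k * sign_mat a ?N = sign_mat a ?N * k"
    proof (rule eq_matI)
      fix i j assume "i < dim_row (sign_mat a ?N * k)" "j < dim_col (sign_mat a ?N * k)"
      then have ij: "i < ?N" "j < ?N" using k by (auto simp: sign_mat_def)
      show "(k * sign_mat a ?N) $$ (i, j) = (sign_mat a ?N * k) $$ (i, j)"
        unfolding l[OF ij] r[OF ij] using z ij by auto
    qed (use k in \<open>auto simp: sign_mat_def\<close>)
  qed
qed

text \<open>Commuting with the sign matrix forces the off-diagonal blocks to vanish, and then both
  diagonal blocks inherit orthogonality. Seen as a centraliser, the subgroup has the fibres of
  \<open>twist\<close> as its cosets.\<close>

lemma S_O_times_O_iff:
  assumes two: "(2 :: 'k::field) \<noteq> 0"
  shows "(k :: 'k mat) \<in> S_O_times_O a b \<longleftrightarrow>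
    k \<in> carrier (SO (a + b)) \<and> k * sign_mat a (a + b) = sign_mat a (a + b) * k"
proof
  assume k: "k \<in> S_O_times_O a b"
  then obtain A D where kS: "k \<in> carrier (SO (a + b))" and eq: "k = four_block_mat A (0\<^sub>m a b) (0\<^sub>m b a) D"
    and AD: "A \<in> orthogonal_matrices a" "D \<in> orthogonal_matrices b" by (auto simp: S_O_times_O_def)
  have kc: "k \<in> carrier_mat (a + b) (a + b)" using kS orthogonal_matricesD(1) by auto
  have c: "A \<in> carrier_mat a a" "D \<in> carrier_mat b b" using AD orthogonal_matricesD(1) by blast+
  have "\<forall>i<a + b. \<forall>j<a + b. (i < a) \<noteq> (j < a) \<longrightarrow> k $$ (i, j) = 0" unfolding eq using c by auto
  then show "k \<in> carrier (SO (a + b)) \<and> k * sign_mat a (a + b) = sign_mat a (a + b) * k"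
    using kS sign_mat_commutes_iff[OF two kc] by simp
next
  assume k: "k \<in> carrier (SO (a + b)) \<and> k * sign_mat a (a + b) = sign_mat a (a + b) * k"
  then have ko: "k \<in> orthogonal_matrices (a + b)" by simp
  note kD = orthogonal_matricesD[OF ko]
  have z: "k $$ (i, j) = 0" if "i < a + b" "j < a + b" "(i < a) \<noteq> (j < a)" for i j
    using k sign_mat_commutes_iff[OF two kD(1)] that by blast
  define A where "A = mat a a (\<lambda>(i, j). k $$ (i, j))"
  define D where "D = mat b b (\<lambda>(i, j). k $$ (i + a, j + a))"
  have eq: "k = four_block_mat A (0\<^sub>m a b) (0\<^sub>m b a) D"
    by (rule eq_matI) (use kD(1) z in \<open>auto simp: A_def D_def\<close>)
  have kk: "(\<Sum>r<a + b. k $$ (r, i) * k $$ (r, j)) = (if i = j then 1 else 0)" if "i < a + b" "j < a + b" for i j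
  proof -
    have "(transpose_mat k * k) $$ (i, j) = (\<Sum>r<a + b. k $$ (r, i) * k $$ (r, j))"
      using kD(1) that by (simp add: scalar_prod_def atLeast0LessThan)
    then show ?thesis using kD(2) that by simp
  qed
  have "A \<in> orthogonal_matrices a" unfolding orthogonal_matrices_def
  proof (intro CollectI conjI eq_matI)
    fix i j assume "i < dim_row (1\<^sub>m a)" "j < dim_col (1\<^sub>m a)"
    then have ij: "i < a" "j < a" by auto
    have "(\<Sum>r<a. k $$ (r, i) * k $$ (r, j)) = (\<Sum>r<a + b. k $$ (r, i) * k $$ (r, j))"
      using z ij by (intro sum.mono_neutral_left) auto
    then show "(transpose_mat A * A) $$ (i, j) = 1\<^sub>m a $$ (i, j)"
      using ij kk[of i j] by (simp add: A_def scalar_prod_def atLeast0LessThan)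
  qed (auto simp: A_def)
  moreover have "D \<in> orthogonal_matrices b" unfolding orthogonal_matrices_def
  proof (intro CollectI conjI eq_matI)
    fix i j assume "i < dim_row (1\<^sub>m b)" "j < dim_col (1\<^sub>m b)"
    then have ij: "i < b" "j < b" by auto
    have "(\<Sum>r<b. k $$ (r + a, i + a) * k $$ (r + a, j + a)) = (\<Sum>r\<in>{a..<a + b}. k $$ (r, i + a) * k $$ (r, j + a))"
      by (rule sum.reindex_bij_witness[of _ "\<lambda>r. r - a" "\<lambda>r. r + a"]) auto
    also have "\<dots> = (\<Sum>r<a + b. k $$ (r, i + a) * k $$ (r, j + a))"
      using z ij by (intro sum.mono_neutral_left) auto
    finally show "(transpose_mat D * D) $$ (i, j) = 1\<^sub>m b $$ (i, j)"
      using ij kk[of "i + a" "j + a"] by (simp add: D_def scalar_prod_def atLeast0LessThan)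
  qed (auto simp: D_def)
  ultimately show "k \<in> S_O_times_O a b" unfolding S_O_times_O_def using k eq by blast
qed

definition twist :: "nat \<Rightarrow> nat \<Rightarrow> 'k::field mat \<Rightarrow> 'k mat" where
  "twist a N g = g * sign_mat a N * transpose_mat g"

text \<open>By \<open>coset_eq_twist_fibre\<close> the fibre over \<open>twist a N g\<close> is the
  coset of \<open>g\<close>. Points of the variety are thus named by involutions, and translation of
  cosets becomes conjugation.\<close>

definition twist_fibre :: "nat \<Rightarrow> nat \<Rightarrow> 'k::field mat \<Rightarrow> 'k mat set" where
  "twist_fibre a N \<theta> = {x \<in> carrier (SO N). twist a N x = \<theta>}"

lemma twist_mult:
  assumes "g \<in> carrier_mat N N" "h \<in> carrier_mat N N"
  shows "twist a N (g * h) = g * twist a N h * transpose_mat g"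
  using assms by (simp add: twist_def transpose_mult[of _ N N _ N] assoc_mult_mat[of _ N N _ N _ N]
      mult_carrier_mat[of _ N N _ N] del: assoc_mult_mat)

lemma twist_carrier: "g \<in> carrier_mat N N \<Longrightarrow> twist a N g \<in> carrier_mat N N"
  by (simp add: twist_def mult_carrier_mat[of _ N N _ N])

lemma conj_cancel:
  assumes g: "g \<in> orthogonal_matrices N" and X: "X \<in> carrier_mat N N"
  shows "transpose_mat g * (g * X * transpose_mat g) * g = X" "g * (transpose_mat g * X * g) * transpose_mat g = X"
proof -
  note D = orthogonal_matricesD[OF g]
  note as = assoc_mult_mat[of _ N N _ N _ N] mult_carrier_mat[of _ N N _ N]
  have 1: "transpose_mat g * (g * Y) = Y" "g * (transpose_mat g * Y) = Y" if "Y \<in> carrier_mat N N" for Y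
    using that D by (simp_all add: as(1)[symmetric])
  show "transpose_mat g * (g * X * transpose_mat g) * g = X" "g * (transpose_mat g * X * g) * transpose_mat g = X"
    using D X by (simp_all add: as 1 del: assoc_mult_mat)
qed

lemma twist_eq_iff:
  assumes g: "g \<in> orthogonal_matrices N" and k: "k \<in> orthogonal_matrices N"
  shows "twist a N (g * k) = twist a N g \<longleftrightarrow> k * sign_mat a N = sign_mat a N * k"
proof -
  note gD = orthogonal_matricesD[OF g] and kD = orthogonal_matricesD[OF k]
  have "twist a N (g * k) = twist a N g \<longleftrightarrow> twist a N k = sign_mat a N"
  proof
    assume e: "twist a N (g * k) = twist a N g"
    have "transpose_mat g * (g * twist a N k * transpose_mat g) * g = transpose_mat g * (g * sign_mat a N * transpose_mat g) * g"
      using e unfolding twist_mult[OF gD(1) kD(1)] by (simp add: twist_def)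
    then show "twist a N k = sign_mat a N"
      unfolding conj_cancel(1)[OF g twist_carrier[OF kD(1)]] conj_cancel(1)[OF g sign_mat_carrier] .
  next
    assume "twist a N k = sign_mat a N"
    then show "twist a N (g * k) = twist a N g" unfolding twist_mult[OF gD(1) kD(1)] by (simp add: twist_def)
  qed
  also have "\<dots> \<longleftrightarrow> k * sign_mat a N = sign_mat a N * k"
  proof
    assume e: "twist a N k = sign_mat a N"
    have "sign_mat a N * k = k * sign_mat a N * transpose_mat k * k" using e by (simp add: twist_def)
    also have "\<dots> = k * sign_mat a N * (transpose_mat k * k)"
      by (rule assoc_mult_mat[of _ N N _ N _ N]) (use kD(1) in \<open>simp_all add: mult_carrier_mat[of _ N N _ N]\<close>)
    also have "\<dots> = k * sign_mat a N" unfolding kD(2) by (rule right_mult_one_mat[of _ N N]) (use kD(1) in \<open>simp add: mult_carrier_mat[of _ N N _ N]\<close>)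
    finally show "k * sign_mat a N = sign_mat a N * k" by simp
  next
    assume e: "k * sign_mat a N = sign_mat a N * k"
    have "twist a N k = sign_mat a N * k * transpose_mat k" by (simp add: twist_def e)
    also have "\<dots> = sign_mat a N * (k * transpose_mat k)"
      by (rule assoc_mult_mat[of _ N N _ N _ N]) (use kD(1) in simp_all)
    finally show "twist a N k = sign_mat a N" unfolding kD(3) right_mult_one_mat[OF sign_mat_carrier] .
  qed
  finally show ?thesis .
qed

lemma coset_eq_twist_fibre:
  assumes two: "(2 :: 'k::field) \<noteq> 0" and g: "(g :: 'k mat) \<in> carrier (SO (a + b))"
  shows "g <#\<^bsub>SO (a + b)\<^esub> S_O_times_O a b = twist_fibre a (a + b) (twist a (a + b) g)"
proof (intro equalityI subsetI)
  let ?N = "a + b"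
  have go: "g \<in> orthogonal_matrices ?N" "det g = 1" using g by auto
  note gD = orthogonal_matricesD[OF go(1)]
  fix x assume "x \<in> g <#\<^bsub>SO ?N\<^esub> S_O_times_O a b"
  then obtain k where k: "k \<in> S_O_times_O a b" "x = g * k" by (auto simp: l_coset_def)
  then have ks: "k \<in> orthogonal_matrices ?N" "det k = 1" "k * sign_mat a ?N = sign_mat a ?N * k"
    using S_O_times_O_iff[OF two] by auto
  then show "x \<in> twist_fibre a ?N (twist a ?N g)"
    using k(2) twist_eq_iff[OF go(1) ks(1)] orthogonal_matrices_mult[OF go(1) ks(1)] det_mult_orthogonal[OF go(1) ks(1)] go(2)
    by (simp add: twist_fibre_def)
next
  let ?N = "a + b"
  have go: "g \<in> orthogonal_matrices ?N" "det g = 1" using g by auto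
  note gD = orthogonal_matricesD[OF go(1)]
  fix x assume "x \<in> twist_fibre a ?N (twist a ?N g)"
  then have xo: "x \<in> orthogonal_matrices ?N" "det x = 1" and e: "twist a ?N x = twist a ?N g" by (auto simp: twist_fibre_def)
  note xD = orthogonal_matricesD[OF xo(1)] and gT = orthogonal_matrices_transpose[OF go(1)]
  define k where "k = transpose_mat g * x"
  have ko: "k \<in> orthogonal_matrices ?N" "det k = 1" unfolding k_def
    using orthogonal_matrices_mult[OF gT xo(1)] det_mult_orthogonal[OF gT xo(1)] det_transpose_orthogonal[OF go(1)] go xo by auto
  have "g * k = g * transpose_mat g * x" unfolding k_def
    by (rule assoc_mult_mat[of _ ?N ?N _ ?N _ ?N, symmetric]) (use gD(1) xD(1) in simp_all)
  then have gk: "g * k = x" using gD(3) xD(1) by simp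
  then have "k * sign_mat a ?N = sign_mat a ?N * k" using twist_eq_iff[OF go(1) ko(1)] e by simp
  then have "k \<in> S_O_times_O a b" using S_O_times_O_iff[OF two] ko by simp
  then show "x \<in> g <#\<^bsub>SO ?N\<^esub> S_O_times_O a b" using gk by (auto simp: l_coset_def)
qed

lemma symmetric_variety_eq:
  assumes two: "(2 :: 'k::field) \<noteq> 0"
  shows "(symmetric_variety a b :: 'k mat set set) = twist_fibre a (a + b) ` twist a (a + b) ` carrier (SO (a + b))"
  unfolding symmetric_variety_def LCOSETS_def using coset_eq_twist_fibre[OF two] by (force simp del: SO_simps)

lemma translate_twist_fibre:
  assumes b: "b \<in> carrier (SO N)" and \<theta>: "\<theta> \<in> carrier_mat N N"
  shows "b <#\<^bsub>SO N\<^esub> twist_fibre a N \<theta> = twist_fibre a N (b * \<theta> * transpose_mat b)"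
proof (intro equalityI subsetI)
  have bo: "b \<in> orthogonal_matrices N" "det b = 1" using b by auto
  note bD = orthogonal_matricesD[OF bo(1)]
  fix x assume "x \<in> b <#\<^bsub>SO N\<^esub> twist_fibre a N \<theta>"
  then obtain y where y: "y \<in> orthogonal_matrices N" "det y = 1" "twist a N y = \<theta>" "x = b * y"
    by (auto simp: l_coset_def twist_fibre_def)
  then show "x \<in> twist_fibre a N (b * \<theta> * transpose_mat b)"
    using twist_mult[OF bD(1) orthogonal_matricesD(1)[OF y(1)]] orthogonal_matrices_mult[OF bo(1) y(1)]
      det_mult_orthogonal[OF bo(1) y(1)] bo(2) by (simp add: twist_fibre_def)
next
  have bo: "b \<in> orthogonal_matrices N" "det b = 1" using b by auto
  note bD = orthogonal_matricesD[OF bo(1)] and bT = orthogonal_matrices_transpose[OF bo(1)]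
  fix x assume "x \<in> twist_fibre a N (b * \<theta> * transpose_mat b)"
  then have x: "x \<in> orthogonal_matrices N" "det x = 1" "twist a N x = b * \<theta> * transpose_mat b" by (auto simp: twist_fibre_def)
  note xD = orthogonal_matricesD[OF x(1)]
  have bTc: "transpose_mat b \<in> carrier_mat N N" using bD(1) by simp
  let ?y = "transpose_mat b * x"
  have "twist a N ?y = transpose_mat b * (b * \<theta> * transpose_mat b) * b"
    unfolding twist_mult[OF bTc xD(1)] x(3) by simp
  then have "twist a N ?y = \<theta>" using conj_cancel(1)[OF bo(1) \<theta>] by simp
  moreover have "?y \<in> orthogonal_matrices N" "det ?y = 1"
    using orthogonal_matrices_mult[OF bT x(1)] det_mult_orthogonal[OF bT x(1)] det_transpose_orthogonal[OF bo(1)] bo(2) x(2) by auto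
  ultimately have "?y \<in> twist_fibre a N \<theta>" by (simp add: twist_fibre_def)
  moreover have "b * ?y = b * transpose_mat b * x"
    by (rule assoc_mult_mat[of _ N N _ N _ N, symmetric]) (use bD(1) xD(1) in simp_all)
  then have "x = b * ?y" using bD(3) xD(1) by simp
  ultimately show "x \<in> b <#\<^bsub>SO N\<^esub> twist_fibre a N \<theta>" by (auto simp: l_coset_def)
qed

lemma symmetric_involution_twist:
  assumes two: "(2 :: 'k::alg_closed_field) \<noteq> 0" and p: "hyp_basis N p" and g: "(g :: 'k mat) \<in> orthogonal_matrices N"
  shows "symmetric_involution N p (twist a N g)"
proof
  note gD = orthogonal_matricesD[OF g]
  let ?E = "sign_mat a N :: 'k mat"
  note as = assoc_mult_mat[of _ N N _ N _ N] mult_carrier_mat[of _ N N _ N]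
  show "(2 :: 'k) \<noteq> 0" "hyp_basis N p" "twist a N g \<in> carrier_mat N N" using two p twist_carrier[OF gD(1)] by auto
  have ET: "transpose_mat ?E = ?E" by (rule eq_matI) (auto simp: sign_mat_def)
  have EE: "?E * ?E = 1\<^sub>m N"
  proof (rule eq_matI)
    fix i j assume "i < dim_row (1\<^sub>m N)" "j < dim_col (1\<^sub>m N)"
    then have ij: "i < N" "j < N" by auto
    have "(?E * ?E) $$ (i, j) = ?E $$ (i, j) * (if j < a then 1 else -1)"
      using mult_diag_entry[OF sign_mat_carrier ij, of a "\<lambda>j. if j < a then 1 else -1"] by (simp add: sign_mat_def[symmetric])
    then show "(?E * ?E) $$ (i, j) = 1\<^sub>m N $$ (i, j)" using ij by (simp add: sign_mat_def)
  qed (auto simp: sign_mat_def)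
  show "transpose_mat (twist a N g) = twist a N g"
    using gD(1) by (simp add: twist_def transpose_mult[of _ N N _ N] as ET del: assoc_mult_mat)
  have 1: "transpose_mat g * (g * Y) = Y" "?E * (?E * Y) = Y" if "Y \<in> carrier_mat N N" for Y
    using that gD EE by (simp_all add: as(1)[symmetric])
  show "twist a N g * twist a N g = 1\<^sub>m N"
    using gD by (simp add: twist_def as 1 del: assoc_mult_mat)
qed

section \<open>Normal forms under the action of the flag stabiliser\<close>

lemma vec_eq_on_basis:
  assumes p: "hyp_basis N p" and x: "x \<in> carrier_vec N" and y: "y \<in> carrier_vec N"
    and e: "\<And>l. l < N \<Longrightarrow> x \<bullet> p l = y \<bullet> p l"
  shows "x = y"
proof -
  have "x - y \<in> flag N p 0"
    using x y e hyp_basisD(1)[OF p] by (simp add: flag_iff bil)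
  then have z: "x - y = 0\<^sub>v N" by (rule flag_0[OF p])
  have "x = (x - y) + y" using x y by auto
  then show ?thesis unfolding z using y by simp
qed

text \<open>Orthogonality of flags gives one inclusion. This places each \<open>p l\<close> in the
  corresponding flag of \<open>g\<close>, and the same argument with the roles exchanged gives the
  other inclusion.\<close>

lemma flag_eq_of_adapted:
  assumes p: "hyp_basis N p" and g: "hyp_basis N g" and ad: "\<And>k. k < N \<Longrightarrow> g k \<in> flag N p (Suc k)"
  shows "flag N g i = flag N p i"
proof -
  have sub: "flag N p i \<subseteq> flag N g i" for i
  proof
    fix v assume v: "v \<in> flag N p i"
    have "v \<bullet> g l = 0" if "l + i < N" for l
      by (rule flag_pairing_zero[OF p v ad]) (use that in auto)
    then show "v \<in> flag N g i" using v by (simp add: flag_iff)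
  qed
  have "flag N g i \<subseteq> flag N p i"
  proof
    fix v assume v: "v \<in> flag N g i"
    have "v \<bullet> p l = 0" if l: "l + i < N" for l
    proof -
      have "p l \<in> flag N g (Suc l)" using sub basis_in_flag[OF p, of l "Suc l"] l by auto
      then show ?thesis by (rule flag_pairing_zero[OF g v]) (use l in simp)
    qed
    then show "v \<in> flag N p i" using v by (simp add: flag_iff)
  qed
  then show ?thesis using sub by blast
qed

lemma normal_form_translate:
  fixes p :: "nat \<Rightarrow> 'k::field vec"
  assumes p: "hyp_basis N p" and \<theta>: "\<theta> \<in> carrier_mat N N"
    and nf: "normal_form_on N p \<theta> {..<N} g (\<sigma>, M)" and b: "b \<in> flag_stabilizer N p"
  shows "normal_form_on N p (b * \<theta> * transpose_mat b) {..<N} (\<lambda>k. b *\<^sub>v g k) (\<sigma>, M)"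
proof -
  note D = normal_form_onD[OF nf, unfolded lessThan_iff]
  note C = clansD[OF D(6), unfolded lessThan_iff]
  have bo: "b \<in> orthogonal_matrices N" and bst: "\<And>j. j < N \<Longrightarrow> b *\<^sub>v p j \<in> flag N p (Suc j)"
    using b unfolding flag_stabilizer_iff[OF p] by auto
  note bD = orthogonal_matricesD[OF bo]
  show ?thesis unfolding normal_form_on_def prod.case lessThan_iff
  proof (intro conjI ballI)
    fix k assume "k \<in> {..<N}"
    then have k: "k < N" by simp
    have kc: "g k \<in> carrier_vec N" by (rule D(8)[OF k])
    show "N - Suc k < N" using k by simp
    show "b *\<^sub>v g k \<in> flag N p (Suc k)" by (rule flag_preserved[OF p bD(1) bst _ D(4)[OF k]]) (use k in auto)
    have sk: "\<sigma> k < N" by (rule C(1)[OF k])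
    have "(b * \<theta> * transpose_mat b) *\<^sub>v (b *\<^sub>v g k) = b *\<^sub>v (\<theta> *\<^sub>v (transpose_mat b *\<^sub>v (b *\<^sub>v g k)))"
      using bD(1) \<theta> kc by (simp add: assoc_mult_mat_vec[of _ N N _ N] mult_carrier_mat[of _ N N _ N])
    also have "\<dots> = b *\<^sub>v (clan_sign M k \<cdot>\<^sub>v g (\<sigma> k))"
      unfolding mult_mat_vec_cancel_orth(1)[OF bo kc] D(7)[OF k] ..
    also have "\<dots> = clan_sign M k \<cdot>\<^sub>v (b *\<^sub>v g (\<sigma> k))" by (rule mult_mat_vec[OF bD(1) D(8)[OF sk]])
    finally show "(b * \<theta> * transpose_mat b) *\<^sub>v (b *\<^sub>v g k) = clan_sign M k \<cdot>\<^sub>v (b *\<^sub>v g (\<sigma> k))" .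
    fix l assume "l \<in> {..<N}"
    then have l: "l < N" by simp
    have "(b *\<^sub>v g k) \<bullet> (b *\<^sub>v g l) = (transpose_mat b *\<^sub>v (b *\<^sub>v g k)) \<bullet> g l"
      using transpose_vec_mult_scalar[OF bD(1) D(8)[OF l], of "b *\<^sub>v g k"] bD(1) kc by simp
    then show "(b *\<^sub>v g k) \<bullet> (b *\<^sub>v g l) = (if Suc (k + l) = N then 1 else 0)"
      unfolding mult_mat_vec_cancel_orth(1)[OF bo kc] using D(5)[OF k l] by simp
  qed (use D(6) in auto)
qed

text \<open>Carry one normal form basis to the other. The resulting \<open>b\<close> is an isometry,
  intertwines the two involutions because the clans coincide, and preserves the flag because both
  bases are adapted to it. If its determinant is -1, then \<open>- b\<close> has determinant 1, as
  \<open>N\<close> is odd, and induces the same conjugation.\<close>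

lemma normal_form_conjugate:
  fixes p :: "nat \<Rightarrow> 'k::field vec"
  assumes N: "odd N" and p: "hyp_basis N p" and \<theta>: "\<theta> \<in> carrier_mat N N" "\<theta>' \<in> carrier_mat N N"
    and nf: "normal_form_on N p \<theta> {..<N} g (\<sigma>, M)" and nf': "normal_form_on N p \<theta>' {..<N} g' (\<sigma>, M)"
  shows "\<exists>b\<in>flag_stabilizer N p. b * \<theta> * transpose_mat b = \<theta>'"
proof -
  note D = normal_form_onD[OF nf, unfolded lessThan_iff] and D' = normal_form_onD[OF nf', unfolded lessThan_iff]
  note C = clansD[OF D(6), unfolded lessThan_iff]
  note g = normal_form_hyp_basis[OF nf] and g' = normal_form_hyp_basis[OF nf']
  define b where "b = basis_mat N g' * dual_mat N g"
  have bc: "b \<in> carrier_mat N N" by (simp add: b_def mult_carrier_mat[of _ N N _ N])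
  have bg: "b *\<^sub>v g k = g' k" if k: "k < N" for k
  proof -
    have kc: "g k \<in> carrier_vec N" by (rule D(8)[OF k])
    have "dual_mat N g *\<^sub>v g k = unit_vec N k"
    proof (rule eq_vecI)
      fix i assume "i < dim_vec (unit_vec N k)"
      then have i: "i < N" by simp
      have ic: "g (N - Suc i) \<in> carrier_vec N" using D(8)[of "N - Suc i"] i by simp
      have "(dual_mat N g *\<^sub>v g k) $ i = g (N - Suc i) \<bullet> g k"
        using i kc ic by (simp add: dual_mat_def scalar_prod_def)
      then show "(dual_mat N g *\<^sub>v g k) $ i = unit_vec N k $ i" using D(5)[of "N - Suc i" k] i k by auto
    qed (simp add: dual_mat_def)
    moreover have "basis_mat N g' *\<^sub>v unit_vec N k = g' k"
    proof (rule eq_vecI)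
      fix i assume "i < dim_vec (g' k)"
      then have i: "i < N" using D'(8)[OF k] by simp
      then show "(basis_mat N g' *\<^sub>v unit_vec N k) $ i = g' k $ i" using k by (simp add: basis_mat_def)
    qed (use D'(8)[OF k] in \<open>simp add: basis_mat_def\<close>)
    ultimately show ?thesis unfolding b_def
      using assoc_mult_mat_vec[of "basis_mat N g'" N N "dual_mat N g" N "g k"] kc by simp
  qed
  have bo: "b \<in> orthogonal_matrices N"
  proof -
    have "transpose_mat b * b = 1\<^sub>m N"
    proof (rule eq_one_by_basis[OF g])
      fix j l assume jl: "j < N" "l < N"
      have c: "g j \<in> carrier_vec N" "g l \<in> carrier_vec N" using D(8) jl by auto
      have "(transpose_mat b * b *\<^sub>v g j) \<bullet> g l = (transpose_mat b *\<^sub>v (b *\<^sub>v g j)) \<bullet> g l"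
        using bc c by (simp add: assoc_mult_mat_vec[of _ N N _ N])
      also have "\<dots> = (b *\<^sub>v g j) \<bullet> (b *\<^sub>v g l)" by (rule transpose_vec_mult_scalar[OF bc c(2)]) (use bc c in simp)
      also have "\<dots> = g j \<bullet> g l" unfolding bg[OF jl(1)] bg[OF jl(2)] D(5)[OF jl] D'(5)[OF jl] ..
      finally show "(transpose_mat b * b *\<^sub>v g j) \<bullet> g l = g j \<bullet> g l" .
    qed (use bc in \<open>simp add: mult_carrier_mat[of _ N N _ N]\<close>)
    then show ?thesis using bc by (simp add: orthogonal_matrices_def)
  qed
  note bD = orthogonal_matricesD[OF bo]
  have com: "b * \<theta> = \<theta>' * b"
  proof (rule eq_on_basis[OF g])
    fix j assume j: "j < N"
    have sj: "\<sigma> j < N" by (rule C(1)[OF j])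
    have "b * \<theta> *\<^sub>v g j = b *\<^sub>v (clan_sign M j \<cdot>\<^sub>v g (\<sigma> j))"
      using assoc_mult_mat_vec[OF bc \<theta>(1) D(8)[OF j]] D(7)[OF j] by simp
    also have "\<dots> = clan_sign M j \<cdot>\<^sub>v g' (\<sigma> j)" using mult_mat_vec[OF bc D(8)[OF sj]] bg[OF sj] by simp
    also have "\<dots> = \<theta>' * b *\<^sub>v g j"
      using assoc_mult_mat_vec[OF \<theta>(2) bc D(8)[OF j]] bg[OF j] D'(7)[OF j] by simp
    finally show "b * \<theta> *\<^sub>v g j = \<theta>' * b *\<^sub>v g j" .
  qed (use bc \<theta> in \<open>simp_all add: mult_carrier_mat[of _ N N _ N]\<close>)
  have conj: "b * \<theta> * transpose_mat b = \<theta>'"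
  proof -
    have "b * \<theta> * transpose_mat b = \<theta>' * (b * transpose_mat b)"
      unfolding com by (rule assoc_mult_mat[OF \<theta>(2) bc]) (use bc in simp)
    then show ?thesis unfolding bD(3) using \<theta>(2) by simp
  qed
  have fl: "flag N g i = flag N p i" for i by (rule flag_eq_of_adapted[OF p g D(4)])
  have bst: "b *\<^sub>v p j \<in> flag N p (Suc j)" if j: "j < N" for j
  proof -
    have "p j \<in> flag N g (Suc j)" unfolding fl using basis_in_flag[OF p lessI j] .
    have "b *\<^sub>v p j \<in> flag N g (Suc j)"
      by (rule flag_preserved[OF g bc _ _ \<open>p j \<in> flag N g (Suc j)\<close>]) (use j bg D'(4) fl in auto)
    then show ?thesis unfolding fl .
  qed
  show ?thesis
  proof (cases "det b = 1")
    case True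
    then have "b \<in> flag_stabilizer N p" unfolding flag_stabilizer_iff[OF p] using bo bst by simp
    then show ?thesis using conj by blast
  next
    case False
    then have "det (- b) = 1" using orthogonal_uminus(2)[OF bo] orthogonal_det[OF bo] N by auto
    moreover have "(- b) *\<^sub>v p j \<in> flag N p (Suc j)" if j: "j < N" for j
    proof -
      have "(- b) *\<^sub>v p j = (-1) \<cdot>\<^sub>v (b *\<^sub>v p j)" using bc hyp_basisD(1)[OF p j] by (intro eq_vecI) auto
      then show ?thesis using subspace_vecD(4)[OF subspace_flag[OF p] bst[OF j]] by simp
    qed
    ultimately have "- b \<in> flag_stabilizer N p" unfolding flag_stabilizer_iff[OF p] using orthogonal_uminus(1)[OF bo] by simp
    moreover have "(- b) * \<theta> * transpose_mat (- b) = b * \<theta> * transpose_mat b"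
    proof -
      have "transpose_mat (- b) = - transpose_mat b" using bc by (intro eq_matI) auto
      moreover have "(- b) * \<theta> = - (b * \<theta>)" using bc \<theta> by simp
      moreover have "(- (b * \<theta>)) * (- transpose_mat b) = b * \<theta> * transpose_mat b"
        using bc \<theta> by (intro eq_matI) (auto simp: scalar_prod_def)
      ultimately show ?thesis by simp
    qed
    ultimately show ?thesis using conj by metis
  qed
qed

text \<open>The flag basis \<open>p\<close> itself is a normal form basis for the signed
  permutation. The compatibility of \<sigma> and \<open>M\<close> with the reversal is what makes
  \<theta> symmetric.\<close>

lemma clan_realised:
  fixes p :: "nat \<Rightarrow> 'k::alg_closed_field vec"
  assumes two: "(2 :: 'k) \<noteq> 0" and p: "hyp_basis N p" and cl: "(\<sigma>, M) \<in> clans N {..<N}"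
  defines "\<theta> \<equiv> uncoords N p (clan_mat N (\<sigma>, M))"
  shows "symmetric_involution N p \<theta>" "normal_form_on N p \<theta> {..<N} p (\<sigma>, M)"
proof -
  note C = clansD[OF cl, unfolded lessThan_iff] and pD = hyp_basisD[OF p]
  have Tc: "(clan_mat N (\<sigma>, M) :: 'k mat) \<in> carrier_mat N N" by (simp add: clan_mat_def)
  have \<theta>: "\<theta> \<in> carrier_mat N N" unfolding \<theta>_def using Tc by simp
  have co: "coords N p \<theta> = clan_mat N (\<sigma>, M)" unfolding \<theta>_def by (rule coords_uncoords(1)[OF p Tc])
  have sN: "\<sigma> k < N" if "k < N" for k using C(1) that by simp
  have tp: "\<theta> *\<^sub>v p k = clan_sign M k \<cdot>\<^sub>v p (\<sigma> k)" if k: "k < N" for k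
  proof (rule vec_eq_on_basis[OF p])
    fix l assume l: "l < N"
    have w: "N - Suc l < N" "N - Suc (N - Suc l) = l" using l by auto
    have "(\<theta> *\<^sub>v p k) \<bullet> p l = clan_mat N (\<sigma>, M) $$ (N - Suc l, k)"
      using coords_entry[OF p \<theta> w(1) k] w(2) co by simp
    also have "\<dots> = (if N - Suc l = \<sigma> k then clan_sign M k else 0)" using w(1) k by (simp add: clan_mat_def)
    also have "N - Suc l = \<sigma> k \<longleftrightarrow> Suc (\<sigma> k + l) = N" using l sN[OF k] by auto
    finally show "(\<theta> *\<^sub>v p k) \<bullet> p l = (clan_sign M k \<cdot>\<^sub>v p (\<sigma> k)) \<bullet> p l"
      using pD(1)[OF l] pD(1)[OF sN[OF k]] pD(2)[OF sN[OF k] l] by simp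
  qed (use \<theta> pD(1) k sN in auto)
  have sgn: "clan_sign M (\<sigma> k) = (clan_sign M k :: 'k)" if k: "k < N" for k
  proof -
    have "\<sigma> k \<in> M \<longleftrightarrow> k \<in> M" using C(6)[of k] C(6)[of "\<sigma> k"] C(2)[OF k] by auto
    then show ?thesis by (simp add: clan_sign_def)
  qed
  show nf: "normal_form_on N p \<theta> {..<N} p (\<sigma>, M)"
    unfolding normal_form_on_def prod.case
    using cl tp pD basis_in_flag[OF p lessI] by auto
  show "symmetric_involution N p \<theta>"
  proof
    show "\<theta> * \<theta> = 1\<^sub>m N"
    proof (rule eq_on_basis[OF p])
      fix j assume j: "j < N"
      note sj = sN[OF j]
      have "\<theta> * \<theta> *\<^sub>v p j = \<theta> *\<^sub>v (clan_sign M j \<cdot>\<^sub>v p (\<sigma> j))"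
        using assoc_mult_mat_vec[OF \<theta> \<theta> pD(1)[OF j]] tp[OF j] by simp
      also have "\<dots> = clan_sign M j \<cdot>\<^sub>v (clan_sign M j \<cdot>\<^sub>v p j)"
        using mult_mat_vec[OF \<theta> pD(1)[OF sj]] tp[OF sj] sgn[OF j] C(2)[OF j] by simp
      also have "\<dots> = 1\<^sub>m N *\<^sub>v p j" using pD(1)[OF j] by (simp add: smult_smult_assoc clan_sign_simps(2))
      finally show "\<theta> * \<theta> *\<^sub>v p j = 1\<^sub>m N *\<^sub>v p j" .
    qed (use \<theta> in \<open>simp_all add: mult_carrier_mat[of _ N N _ N]\<close>)
    show "transpose_mat \<theta> = \<theta>"
    proof (rule eq_on_basis[OF p])
      fix j assume j: "j < N"
      show "transpose_mat \<theta> *\<^sub>v p j = \<theta> *\<^sub>v p j"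
      proof (rule vec_eq_on_basis[OF p])
        fix l assume l: "l < N"
        note sj = sN[OF j] and sl = sN[OF l]
        have "(transpose_mat \<theta> *\<^sub>v p j) \<bullet> p l = p j \<bullet> (\<theta> *\<^sub>v p l)"
          by (rule transpose_vec_mult_scalar[OF \<theta> pD(1)[OF l] pD(1)[OF j]])
        also have "\<dots> = clan_sign M l * (if Suc (j + \<sigma> l) = N then 1 else 0)"
          unfolding tp[OF l] using pD(1)[OF j] pD(1)[OF sl] pD(2)[OF j sl] by simp
        also have "\<dots> = clan_sign M j * (if Suc (\<sigma> j + l) = N then 1 else 0)"
        proof -
          have 1: "Suc (\<sigma> a + b) = N \<Longrightarrow> Suc (a + \<sigma> b) = N \<and> (a \<in> M \<longrightarrow> b \<in> M)" if "a < N" "b < N" for a b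
          proof -
            assume e: "Suc (\<sigma> a + b) = N"
            then have b: "b = N - Suc (\<sigma> a)" by auto
            have "\<sigma> (N - Suc (\<sigma> a)) = N - Suc (\<sigma> (\<sigma> a))" by (rule C(3)[OF sN[OF that(1)]])
            then have "\<sigma> b = N - Suc a" unfolding b using C(2)[OF that(1)] by simp
            moreover have "a \<in> M \<longrightarrow> b \<in> M" using C(6)[of a] C(7)[of a] b by auto
            ultimately show ?thesis using that by auto
          qed
          show ?thesis
          proof (cases "Suc (\<sigma> j + l) = N")
            case True
            then have 2: "Suc (j + \<sigma> l) = N" "j \<in> M \<longrightarrow> l \<in> M" using 1[OF j l] by auto
            then have "Suc (\<sigma> l + j) = N" by simp
            then have "l \<in> M \<longrightarrow> j \<in> M" using 1[OF l j] by auto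
            then show ?thesis using True 2 by (auto simp: clan_sign_def)
          next
            case False
            have "Suc (j + \<sigma> l) \<noteq> N"
            proof
              assume "Suc (j + \<sigma> l) = N"
              then have "Suc (\<sigma> l + j) = N" by simp
              then show False using 1[OF l j] False by (simp add: add.commute)
            qed
            then show ?thesis using False by simp
          qed
        qed
        also have "\<dots> = (\<theta> *\<^sub>v p j) \<bullet> p l"
          unfolding tp[OF j] using pD(1)[OF l] pD(1)[OF sj] pD(2)[OF sj l] by simp
        finally show "(transpose_mat \<theta> *\<^sub>v p j) \<bullet> p l = (\<theta> *\<^sub>v p j) \<bullet> p l" .
      qed (use \<theta> pD(1)[OF j] in auto)
    qed (use \<theta> in simp_all)
  qed (use two p \<theta> in auto)
qed

section \<open>The correspondence between orbits and clans\<close>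

lemma card_image_eq_of_same_kernel:
  assumes "\<And>x y. x \<in> A \<Longrightarrow> y \<in> A \<Longrightarrow> f x = f y \<longleftrightarrow> g x = g y"
  shows "finite (g ` A) \<Longrightarrow> finite (f ` A)" "card (f ` A) = card (g ` A)"
proof -
  let ?h = "\<lambda>y. g (inv_into A f y)"
  have h: "?h (f x) = g x" if "x \<in> A" for x
    using assms[OF inv_into_into[of "f x" f A] that] f_inv_into_f[of "f x" f A] that by auto
  have b: "bij_betw ?h (f ` A) (g ` A)" unfolding bij_betw_def
  proof
    show "inj_on ?h (f ` A)" using h assms by (auto simp: inj_on_def)
    show "?h ` f ` A = g ` A" using h by (force simp: image_image)
  qed
  show "card (f ` A) = card (g ` A)" by (rule bij_betw_same_card[OF b])
  show "finite (g ` A) \<Longrightarrow> finite (f ` A)" using bij_betw_finite[OF b] by simp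
qed

text \<open>As \<sigma> is the identity off \<open>I\<close>, it is determined by its restriction to
  the finite set \<open>I\<close>.\<close>

lemma finite_clans: "finite I \<Longrightarrow> finite (clans N I)"
proof (rule inj_on_finite[where f = "\<lambda>(\<sigma>, M). (restrict \<sigma> I, M)" and B = "PiE I (\<lambda>_. I) \<times> Pow I"])
  show "inj_on (\<lambda>(\<sigma>, M). (restrict \<sigma> I, M)) (clans N I)"
  proof (rule inj_onI, clarsimp)
    fix \<sigma> M \<tau> assume a: "(\<sigma>, M) \<in> clans N I" "(\<tau>, M) \<in> clans N I" "restrict \<sigma> I = restrict \<tau> I"
    show "\<sigma> = \<tau>"
    proof
      fix k show "\<sigma> k = \<tau> k"
        using clansD(4)[OF a(1), of k] clansD(4)[OF a(2), of k] fun_cong[OF a(3), of k] by (cases "k \<in> I") auto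
    qed
  qed
  show "(\<lambda>(\<sigma>, M). (restrict \<sigma> I, M)) ` clans N I \<subseteq> PiE I (\<lambda>_. I) \<times> Pow I"
    by (auto simp: clans_def)
qed (auto intro: finite_PiE)

text \<open>Orbits and clans are both images of the set of involutions \<open>twist a N g\<close>,
  under \<open>orb\<close> and under \<kappa>. The two maps identify the same pairs, because the
  clan is an invariant of the orbit and determines it; the signature cuts out the clans of the right
  excess.\<close>

theorem card_orbits_eq_card_clans:
  fixes p :: "nat \<Rightarrow> 'k::alg_closed_field vec"
  assumes two: "(2 :: 'k) \<noteq> 0" and N: "N = a + b" "odd N" and p: "hyp_basis N p"
  shows "finite (orbits_on_symmetric_variety a b (flag_stabilizer N p))"
    "card (orbits_on_symmetric_variety a b (flag_stabilizer N p)) =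
     card {c \<in> clans N {..<N}. excess {..<N} c = int a - int b}"
proof -
  let ?B = "flag_stabilizer N p" and ?\<Theta> = "twist a N ` carrier (SO N) :: 'k mat set"
  let ?act = "\<lambda>c \<theta>. c * \<theta> * transpose_mat c"
  let ?K = "{c \<in> clans N {..<N}. excess {..<N} c = int a - int b}"
  note SD = subgroup_SO_D[OF subgroup_flag_stabilizer[OF p]]
  define orb where "orb \<theta> = {twist_fibre a N (?act c \<theta>) | c. c \<in> ?B}" for \<theta>
  have \<Theta>D: "\<exists>h. h \<in> orthogonal_matrices N \<and> \<theta> = twist a N h \<and> symmetric_involution N p \<theta> \<and> \<theta> \<in> carrier_mat N N"
    if \<theta>: "\<theta> \<in> ?\<Theta>" for \<theta>
  proof -
    obtain h where h: "h \<in> orthogonal_matrices N" "\<theta> = twist a N h" using \<theta> by auto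
    show ?thesis using h symmetric_involution_twist[OF two p h(1), of a] twist_carrier[OF orthogonal_matricesD(1)[OF h(1)], of a]
      by (intro exI[of _ h]) simp
  qed
  have act\<Theta>: "?act c \<theta> \<in> ?\<Theta>" if c: "c \<in> ?B" and \<theta>: "\<theta> \<in> ?\<Theta>" for c \<theta>
  proof -
    obtain h where h: "h \<in> orthogonal_matrices N" "det h = 1" "\<theta> = twist a N h" using \<theta> by auto
    have co: "c \<in> orthogonal_matrices N" "det c = 1" using SD(1,6)[OF c] by auto
    have "?act c \<theta> = twist a N (c * h)"
      unfolding h(3) by (rule twist_mult[symmetric]) (use co h orthogonal_matricesD(1) in auto)
    then show ?thesis using orthogonal_matrices_mult[OF co(1) h(1)] det_mult_orthogonal[OF co(1) h(1)] co h by auto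
  qed
  have act_mult: "?act c (?act d \<theta>) = ?act (c * d) \<theta>" if "c \<in> ?B" "d \<in> ?B" "\<theta> \<in> carrier_mat N N" for c d \<theta>
    using SD(2)[OF that(1)] SD(2)[OF that(2)] that(3)
    by (simp add: transpose_mult[of _ N N _ N] assoc_mult_mat[of _ N N _ N _ N] mult_carrier_mat[of _ N N _ N] del: assoc_mult_mat)
  have act_one: "?act (1\<^sub>m N) \<theta> = \<theta>" if "\<theta> \<in> carrier_mat N N" for \<theta> :: "'k mat"
    using left_mult_one_mat[OF that] right_mult_one_mat[OF that] by simp
  have fibre_inj: "\<theta> = \<theta>'" if \<theta>: "\<theta> \<in> ?\<Theta>" and e: "twist_fibre a N \<theta> = twist_fibre a N \<theta>'" for \<theta> \<theta>'
  proof -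
    obtain h where "h \<in> carrier (SO N)" "\<theta> = twist a N h" using \<theta> by auto
    then have "h \<in> twist_fibre a N \<theta>" by (simp add: twist_fibre_def)
    then show ?thesis using e by (auto simp: twist_fibre_def)
  qed
  have orbits: "orbits_on_symmetric_variety a b ?B = orb ` ?\<Theta>"
  proof -
    have "orbit (SO N\<lparr>carrier := ?B\<rparr>) (\<lambda>c X. c <#\<^bsub>SO N\<^esub> X) (twist_fibre a N \<theta>) = orb \<theta>" if "\<theta> \<in> ?\<Theta>" for \<theta>
    proof -
      have "\<theta> \<in> carrier_mat N N" using \<Theta>D[OF that] by blast
      then have "c <#\<^bsub>SO N\<^esub> twist_fibre a N \<theta> = twist_fibre a N (?act c \<theta>)" if "c \<in> ?B" for c
        using translate_twist_fibre[OF SD(7)[OF that]] by blast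
      then show ?thesis unfolding orbit_def orb_def by auto
    qed
    then show ?thesis
      unfolding orbits_on_symmetric_variety_def orbits_def N(1)[symmetric] symmetric_variety_eq[OF two, of a b, folded N(1)]
      by (auto simp del: SO_simps)
  qed
  \<comment> \<open>Any normal form may be chosen here: by \<open>normal_form_unique\<close> its
    clan does not depend on the choice.\<close>
  define \<kappa> where "\<kappa> \<theta> = (SOME s. \<exists>g. normal_form_on N p \<theta> {..<N} g s)" for \<theta>
  have \<kappa>nf: "\<exists>g. normal_form_on N p \<theta> {..<N} g (\<kappa> \<theta>)" if "\<theta> \<in> ?\<Theta>" for \<theta>
  proof -
    interpret symmetric_involution N p \<theta> using \<Theta>D[OF that] by blast
    have "\<exists>s g. normal_form_on N p \<theta> {..<N} g s" using normal_form_exists by blast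
    then show ?thesis unfolding \<kappa>_def by (rule someI_ex)
  qed
  have \<kappa>uniq: "\<kappa> \<theta> = s" if mem: "\<theta> \<in> ?\<Theta>" and nf: "normal_form_on N p \<theta> {..<N} g s" for \<theta> g s
  proof -
    interpret symmetric_involution N p \<theta> using \<Theta>D[OF mem] by blast
    obtain \<sigma> M where s: "s = (\<sigma>, M)" by fastforce
    obtain \<sigma>' M' where k: "\<kappa> \<theta> = (\<sigma>', M')" by fastforce
    obtain g' where "normal_form_on N p \<theta> {..<N} g' (\<sigma>', M')" using \<kappa>nf[OF mem] k by auto
    then show ?thesis using normal_form_unique[of g' \<sigma>' M' g \<sigma> M] nf s k by simp
  qed
  have \<kappa>act: "\<kappa> (?act c \<theta>) = \<kappa> \<theta>" if c: "c \<in> ?B" and \<theta>: "\<theta> \<in> ?\<Theta>" for c \<theta>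
  proof -
    obtain \<sigma> M where k: "\<kappa> \<theta> = (\<sigma>, M)" by fastforce
    obtain g where g: "normal_form_on N p \<theta> {..<N} g (\<sigma>, M)" using \<kappa>nf[OF \<theta>] k by auto
    have \<theta>c: "\<theta> \<in> carrier_mat N N" using \<Theta>D[OF \<theta>] by blast
    show ?thesis unfolding k by (rule \<kappa>uniq[OF act\<Theta>[OF c \<theta>] normal_form_translate[OF p \<theta>c g c]])
  qed
  have ker: "orb \<theta> = orb \<theta>' \<longleftrightarrow> \<kappa> \<theta> = \<kappa> \<theta>'" if \<theta>: "\<theta> \<in> ?\<Theta>" "\<theta>' \<in> ?\<Theta>" for \<theta> \<theta>'
  proof
    have \<theta>c: "\<theta> \<in> carrier_mat N N" using \<Theta>D[OF \<theta>(1)] by blast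
    assume e: "orb \<theta> = orb \<theta>'"
    have "twist_fibre a N \<theta> \<in> orb \<theta>" unfolding orb_def using SD(4) act_one[OF \<theta>c] by (metis (mono_tags, lifting) mem_Collect_eq)
    then obtain c where c: "c \<in> ?B" "twist_fibre a N \<theta> = twist_fibre a N (?act c \<theta>')" unfolding e by (auto simp: orb_def)
    then have "\<theta> = ?act c \<theta>'" using fibre_inj[OF \<theta>(1)] by blast
    then show "\<kappa> \<theta> = \<kappa> \<theta>'" using \<kappa>act[OF c(1) \<theta>(2)] by simp
  next
    have sub: "orb (?act c \<eta>) \<subseteq> orb \<eta>" if "c \<in> ?B" "\<eta> \<in> carrier_mat N N" for c \<eta>
    proof
      fix X assume "X \<in> orb (?act c \<eta>)"
      then obtain d where d: "d \<in> ?B" "X = twist_fibre a N (?act d (?act c \<eta>))" by (auto simp: orb_def)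
      then have "X = twist_fibre a N (?act (d * c) \<eta>)" using act_mult[OF d(1) that] by simp
      then show "X \<in> orb \<eta>" using SD(5)[OF d(1) that(1)] by (auto simp: orb_def)
    qed
    have one: "orb \<eta>' \<subseteq> orb \<eta>" if k: "\<kappa> \<eta> = \<kappa> \<eta>'" and \<eta>: "\<eta> \<in> ?\<Theta>" "\<eta>' \<in> ?\<Theta>" for \<eta> \<eta>'
    proof -
      obtain \<sigma> M where s: "\<kappa> \<eta> = (\<sigma>, M)" by fastforce
      obtain g g' where g: "normal_form_on N p \<eta> {..<N} g (\<sigma>, M)" "normal_form_on N p \<eta>' {..<N} g' (\<sigma>, M)"
        using \<kappa>nf[OF \<eta>(1)] \<kappa>nf[OF \<eta>(2)] k s by auto
      have c: "\<eta> \<in> carrier_mat N N" "\<eta>' \<in> carrier_mat N N" using \<Theta>D \<eta> by blast+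
      obtain d where "d \<in> ?B" "?act d \<eta> = \<eta>'" using normal_form_conjugate[OF N(2) p c g] by blast
      then show ?thesis using sub[of d \<eta>] c by auto
    qed
    assume "\<kappa> \<theta> = \<kappa> \<theta>'"
    then show "orb \<theta> = orb \<theta>'" using one[of \<theta> \<theta>'] one[of \<theta>' \<theta>] \<theta> by auto
  qed
  have aN: "a \<le> N" using N by simp
  have img: "\<kappa> ` ?\<Theta> = ?K"
  proof (intro equalityI subsetI)
    fix c assume "c \<in> \<kappa> ` ?\<Theta>"
    then obtain \<theta> where mem: "\<theta> \<in> ?\<Theta>" "c = \<kappa> \<theta>" by blast
    obtain \<sigma> M where s: "\<kappa> \<theta> = (\<sigma>, M)" by fastforce
    obtain g where g: "normal_form_on N p \<theta> {..<N} g (\<sigma>, M)" using \<kappa>nf[OF mem(1)] s by auto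
    obtain h where h: "h \<in> orthogonal_matrices N" "\<theta> = twist a N h" "symmetric_involution N p \<theta>" using \<Theta>D[OF mem(1)] by blast
    interpret symmetric_involution N p \<theta> by (rule h(3))
    have "2 * int a = int N + excess {..<N} (\<sigma>, M)"
      by (rule normal_form_signature[OF g h(1) aN]) (use h(2) in \<open>simp add: twist_def\<close>)
    then show "c \<in> ?K" using mem(2) s normal_form_onD(6)[OF g] N by simp
  next
    fix c assume c: "c \<in> ?K"
    obtain \<sigma> M where s: "c = (\<sigma>, M)" by fastforce
    have cl: "(\<sigma>, M) \<in> clans N {..<N}" and ex: "excess {..<N} (\<sigma>, M) = int a - int b" using c s by auto
    define \<theta> where "\<theta> = uncoords N p (clan_mat N (\<sigma>, M))"
    interpret symmetric_involution N p \<theta> unfolding \<theta>_def by (rule clan_realised(1)[OF two p cl])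
    have nf: "normal_form_on N p \<theta> {..<N} p (\<sigma>, M)" unfolding \<theta>_def by (rule clan_realised(2)[OF two p cl])
    \<comment> \<open>The realised involution is conjugate to some \<open>sign_mat d N\<close>. Its
      excess forces \<open>d = a\<close>, so it comes from a point of the variety.\<close>
    obtain h d where h: "h \<in> carrier (SO N)" "d \<le> N" "\<theta> = h * sign_mat d N * transpose_mat h"
      by (rule conjugate_to_sign_mat[OF N(2)])
    have "h \<in> orthogonal_matrices N" using h(1) by simp
    from normal_form_signature[OF nf this h(2,3)] ex N(1) have "d = a" by simp
    then have mem: "\<theta> \<in> ?\<Theta>" using h by (auto simp: twist_def simp del: SO_simps)
    have "c = \<kappa> \<theta>" unfolding s by (rule \<kappa>uniq[OF mem nf, symmetric])
    then show "c \<in> \<kappa> ` ?\<Theta>" by (rule image_eqI[OF _ mem])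
  qed
  have "finite ?K" using finite_clans[of "{..<N}" N] by simp
  then show "finite (orbits_on_symmetric_variety a b ?B)"
    unfolding orbits using card_image_eq_of_same_kernel(1)[of ?\<Theta> orb \<kappa>] ker img by simp
  show "card (orbits_on_symmetric_variety a b ?B) = card ?K"
    unfolding orbits img[symmetric] by (rule card_image_eq_of_same_kernel(2)[OF ker])
qed

section \<open>Counting clans\<close>

definition clan_agrees :: "nat set \<Rightarrow> (nat \<Rightarrow> nat) \<Rightarrow> nat set \<Rightarrow> (nat \<Rightarrow> nat) \<times> nat set \<Rightarrow> bool" where
  "clan_agrees S \<tau> L = (\<lambda>(\<sigma>, M). (\<forall>k\<in>S. \<sigma> k = \<tau> k) \<and> M \<inter> S = L)"

definition clan_count :: "nat \<Rightarrow> nat set \<Rightarrow> int \<Rightarrow> nat" where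
  "clan_count N I d = card {c \<in> clans N I. excess I c = d}"

text \<open>Gluing the prescribed piece on \<open>S\<close> to a clan on \<open>I - S\<close> is a
  bijection, and the excess is additive. Nothing in \<open>I - S\<close> can be matched into
  \<open>S\<close>, because \<sigma> is an involution that maps \<open>S\<close> to itself.\<close>

lemma clan_count_agrees:
  assumes I: "I \<subseteq> {..<N}" "\<And>k. k \<in> I \<Longrightarrow> N - Suc k \<in> I" and S: "S \<subseteq> I" "\<And>k. k \<in> S \<Longrightarrow> N - Suc k \<in> S"
    and cl: "(\<tau>, L) \<in> clans N S"
  shows "card {c \<in> clans N I. excess I c = d \<and> clan_agrees S \<tau> L c} = clan_count N (I - S) (d - excess S (\<tau>, L))"
proof -
  define F where "F = (\<lambda>(\<sigma>, M). (\<lambda>k. if k \<in> S then \<tau> k else \<sigma> k :: nat, M \<union> L))"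
  note T = clansD[OF cl]
  have fin: "finite I" using I(1) finite_subset by blast
  have IS: "N - Suc k \<in> I - S" if "k \<in> I - S" for k
  proof -
    have "N - Suc (N - Suc k) = k" using that I(1) by auto
    then show ?thesis using that I(2) S(2)[of "N - Suc k"] by auto
  qed
  have Fin: "F c \<in> clans N I \<and> clan_agrees S \<tau> L (F c) \<and> excess I (F c) = excess (I - S) c + excess S (\<tau>, L)"
    if c: "c \<in> clans N (I - S)" for c
  proof -
    obtain \<sigma> M where sM: "c = (\<sigma>, M)" by fastforce
    have c': "(\<sigma>, M) \<in> clans N (I - S)" using c sM by simp
    note C = clansD[OF c']
    have "(I - S) \<union> S = I" using S by auto
    then have 1: "F c \<in> clans N I" unfolding F_def sM using clans_merge[OF c' cl _ S(2) IS] by auto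
    have 2: "clan_agrees S \<tau> L (F c)" unfolding F_def sM clan_agrees_def using C(5) T(5) by auto
    have fM: "finite M" "finite L" "M \<inter> L = {}" using C(5) T(5) fin S(1) finite_subset[of M I] finite_subset[of L I] by auto
    have "{k \<in> I. (if k \<in> S then \<tau> k else \<sigma> k) = k \<and> k \<notin> M \<union> L}
      = {k \<in> I - S. \<sigma> k = k \<and> k \<notin> M} \<union> {k \<in> S. \<tau> k = k \<and> k \<notin> L}"
      using S(1) C(5) T(5) by auto
    moreover have "card ({k \<in> I - S. \<sigma> k = k \<and> k \<notin> M} \<union> {k \<in> S. \<tau> k = k \<and> k \<notin> L})
      = card {k \<in> I - S. \<sigma> k = k \<and> k \<notin> M} + card {k \<in> S. \<tau> k = k \<and> k \<notin> L}"
      using fin finite_subset[OF S(1) fin] by (intro card_Un_disjoint) auto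
    ultimately have 3: "excess I (F c) = excess (I - S) c + excess S (\<tau>, L)"
      using card_Un_disjoint[OF fM] by (simp add: F_def sM excess_def)
    show ?thesis using 1 2 3 by blast
  qed
  have inj: "inj_on F (clans N (I - S))"
  proof (rule inj_onI)
    fix c c' assume c: "c \<in> clans N (I - S)" "c' \<in> clans N (I - S)" "F c = F c'"
    obtain \<sigma> M \<sigma>' M' where sM: "c = (\<sigma>, M)" "c' = (\<sigma>', M')" by fastforce
    have C: "(\<sigma>, M) \<in> clans N (I - S)" "(\<sigma>', M') \<in> clans N (I - S)" using c sM by auto
    have e: "(\<lambda>k. if k \<in> S then \<tau> k else \<sigma> k) = (\<lambda>k. if k \<in> S then \<tau> k else \<sigma>' k)" "M \<union> L = M' \<union> L"
      using c(3) sM by (auto simp: F_def)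
    have "\<sigma> k = \<sigma>' k" for k
      using fun_cong[OF e(1), of k] clansD(4)[OF C(1), of k] clansD(4)[OF C(2), of k] by (cases "k \<in> S") auto
    moreover have "M = M'" using e(2) clansD(5)[OF C(1)] clansD(5)[OF C(2)] T(5) by blast
    ultimately show "c = c'" using sM by auto
  qed
  have surj: "\<exists>c\<in>clans N (I - S). F c = c'" if c': "c' \<in> clans N I" "clan_agrees S \<tau> L c'" for c'
  proof -
    obtain \<sigma> M where sM: "c' = (\<sigma>, M)" by fastforce
    have cI: "(\<sigma>, M) \<in> clans N I" using c' sM by simp
    note C = clansD[OF cI]
    have ag: "\<And>k. k \<in> S \<Longrightarrow> \<sigma> k = \<tau> k" "M \<inter> S = L" using c'(2) sM by (auto simp: clan_agrees_def)
    have st: "\<sigma> k \<notin> S" if "k \<in> I - S" for k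
    proof
      assume "\<sigma> k \<in> S"
      then have "\<sigma> (\<sigma> k) \<in> S" using ag(1) T(1) by metis
      then show False using C(2) that by auto
    qed
    let ?c = "(\<lambda>k. if k \<in> S then k else \<sigma> k, M - S)"
    have "?c \<in> clans N (I - S)" unfolding clans_def
    proof (intro CollectI case_prodI conjI ballI allI impI subsetI)
      fix k assume k: "k \<in> I - S"
      show "(if k \<in> S then k else \<sigma> k) \<in> I - S" using k st C(1) by auto
      show "(if (if k \<in> S then k else \<sigma> k) \<in> S then if k \<in> S then k else \<sigma> k else \<sigma> (if k \<in> S then k else \<sigma> k)) = k"
        using k st C(2) by auto
      show "(if N - Suc k \<in> S then N - Suc k else \<sigma> (N - Suc k)) = N - Suc (if k \<in> S then k else \<sigma> k)"
        using k IS[OF k] C(3) by auto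
    next
      fix k assume "k \<notin> I - S"
      then show "(if k \<in> S then k else \<sigma> k) = k" using C(4) by auto
    next
      fix k assume k: "k \<in> M - S"
      then show "k \<in> I - S" "(if k \<in> S then k else \<sigma> k) = k" using C(5,6) by auto
    next
      fix k assume k: "k \<in> M - S"
      then have "k \<in> I - S" using C(5) by auto
      then show "N - Suc k \<in> M - S" using C(7) k IS by auto
    qed
    moreover have "F ?c = c'" unfolding F_def sM using ag by auto
    ultimately show ?thesis by blast
  qed
  let ?A = "{c \<in> clans N (I - S). excess (I - S) c = d - excess S (\<tau>, L)}"
  have "F ` ?A = {c \<in> clans N I. excess I c = d \<and> clan_agrees S \<tau> L c}"
  proof (intro equalityI subsetI)
    fix c assume "c \<in> F ` ?A"
    then obtain c0 where c0: "c0 \<in> clans N (I - S)" "excess (I - S) c0 = d - excess S (\<tau>, L)" "c = F c0" by blast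
    then show "c \<in> {c \<in> clans N I. excess I c = d \<and> clan_agrees S \<tau> L c}" using Fin[OF c0(1)] by simp
  next
    fix c assume "c \<in> {c \<in> clans N I. excess I c = d \<and> clan_agrees S \<tau> L c}"
    then have c: "c \<in> clans N I" "excess I c = d" "clan_agrees S \<tau> L c" by auto
    obtain c0 where c0: "c0 \<in> clans N (I - S)" "F c0 = c" using surj[OF c(1,3)] by blast
    then have "excess (I - S) c0 = d - excess S (\<tau>, L)" using Fin[OF c0(1)] c(2) by simp
    then show "c \<in> F ` ?A" using c0 by blast
  qed
  moreover have "card (F ` ?A) = card ?A" by (rule card_image) (rule inj_on_subset[OF inj], blast)
  ultimately show ?thesis by (simp add: clan_count_def)
qed

text \<open>Distinguish the fate of \<open>x\<close>: fixed with sign plus or minus, the mirror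
  point \<open>y\<close> then sharing the sign, so that the pair contributes 2 or -2; matched with
  \<open>y\<close>; or matched with another \<open>z\<close>, which forces \<open>y\<close> to be
  matched with the mirror of \<open>z\<close>. The middle \<open>m\<close> is its own mirror image,
  so matching \<open>x\<close> with it would give x = y.\<close>

lemma clan_count_rec:
  assumes I: "I \<subseteq> {..<N}" "\<And>k. k \<in> I \<Longrightarrow> N - Suc k \<in> I" and m: "Suc (m + m) = N" "m \<in> I"
    and x: "x \<in> I" "x \<noteq> m"
  defines "y \<equiv> N - Suc x"
  shows "clan_count N I d = clan_count N (I - {x, y}) (d - 2) + clan_count N (I - {x, y}) (d + 2)
    + clan_count N (I - {x, y}) d + (\<Sum>z\<in>I - {x, y, m}. clan_count N (I - {x, z, y, N - Suc z}) d)"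
proof -
  have fin: "finite I" using I(1) finite_subset by blast
  have y: "y \<in> I" "y < N" "N - Suc y = x" "y \<noteq> x" "x \<noteq> y"
    using x I m by (auto simp: y_def)
  let ?A = "{c \<in> clans N I. excess I c = d}"
  let ?P = "\<lambda>S \<tau> L. {c \<in> clans N I. excess I c = d \<and> clan_agrees S \<tau> L c}"
  define \<tau> where "\<tau> z k = (if k = x then z else if k = z then x else if k = y then N - Suc z else if k = N - Suc z then y else k)" for z k
  define sw where "sw k = (if k = x then y else if k = y then x else k)" for k
  let ?S = "{x, y}" and ?Z = "I - {x, y, m}"
  let ?T = "\<lambda>z. {x, z, y, N - Suc z}"
  let ?P1 = "?P ?S (\<lambda>k. k) {}" and ?P2 = "?P ?S (\<lambda>k. k) ?S" and ?P3 = "?P ?S sw {}" and ?Q = "\<lambda>z. ?P (?T z) (\<tau> z) {}"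
  have S: "?S \<subseteq> I" "\<And>k. k \<in> ?S \<Longrightarrow> N - Suc k \<in> ?S" using x y by (auto simp: y_def[symmetric])
  have z: "z \<in> I" "z < N" "N - Suc z \<in> I" "N - Suc (N - Suc z) = z" "z \<noteq> x" "z \<noteq> y" "N - Suc z \<noteq> z" "N - Suc z \<noteq> x" "N - Suc z \<noteq> y"
    if "z \<in> ?Z" for z
  proof -
    show z: "z \<in> I" "z < N" "N - Suc z \<in> I" "N - Suc (N - Suc z) = z" "z \<noteq> x" "z \<noteq> y" using that I by auto
    show "N - Suc z \<noteq> z" using that z(2) m by auto
    show "N - Suc z \<noteq> x" using z y_def by (metis)
    show "N - Suc z \<noteq> y" using z y(3) by (metis)
  qed
  have cl1: "((\<lambda>k. k), {}) \<in> clans N ?S" and cl2: "((\<lambda>k. k), ?S) \<in> clans N ?S"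
    using y by (auto simp: clans_def y_def[symmetric])
  have cl3: "(sw, {}) \<in> clans N ?S"
    using y by (auto simp: clans_def sw_def y_def[symmetric])
  have wx: "N - Suc x = y" by (simp add: y_def)
  have T: "?T z \<subseteq> I" "\<And>k. k \<in> ?T z \<Longrightarrow> N - Suc k \<in> ?T z" if zz: "z \<in> ?Z" for z
  proof -
    show "?T z \<subseteq> I" using x(1) y(1) z(1,3)[OF zz] by simp
    show "N - Suc k \<in> ?T z" if "k \<in> ?T z" for k
      using that by (elim insertE emptyE) (simp_all add: wx y(3) z(4)[OF zz])
  qed
  have \<tau>s: "\<tau> z x = z" "\<tau> z z = x" "\<tau> z y = N - Suc z" "\<tau> z (N - Suc z) = y" if "z \<in> ?Z" for z
    using z[OF that] y by (auto simp: \<tau>_def)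
  have cl4: "(\<tau> z, {}) \<in> clans N (?T z)" if zz: "z \<in> ?Z" for z
    unfolding clans_def
  proof (intro CollectI case_prodI conjI ballI allI impI)
    fix k assume k: "k \<in> ?T z"
    show "\<tau> z k \<in> ?T z" using k by (elim insertE emptyE) (simp_all add: \<tau>s[OF zz])
    show "\<tau> z (\<tau> z k) = k" using k by (elim insertE emptyE) (simp_all add: \<tau>s[OF zz])
    show "\<tau> z (N - Suc k) = N - Suc (\<tau> z k)"
      using k by (elim insertE emptyE) (simp_all add: \<tau>s[OF zz] wx y(3) z(4)[OF zz])
  next
    fix k assume "k \<notin> ?T z"
    then show "\<tau> z k = k" by (auto simp: \<tau>_def)
  qed auto
  have e1: "excess ?S ((\<lambda>k. k), {}) = 2" and e2: "excess ?S ((\<lambda>k. k), ?S) = -2"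
  proof -
    have "{k \<in> ?S. k = k \<and> k \<notin> {}} = ?S" "{k \<in> ?S. k = k \<and> k \<notin> ?S} = {}" by auto
    then show "excess ?S ((\<lambda>k. k), {}) = 2" "excess ?S ((\<lambda>k. k), ?S) = -2"
      unfolding excess_def prod.case using y(5) by simp_all
  qed
  have e3: "excess ?S (sw, {}) = 0"
  proof -
    have "{k \<in> ?S. sw k = k \<and> k \<notin> {}} = {}" using y by (auto simp: sw_def)
    then show ?thesis unfolding excess_def prod.case by simp
  qed
  have e4: "excess (?T z) (\<tau> z, {}) = 0" if "z \<in> ?Z" for z
  proof -
    have "{k \<in> ?T z. \<tau> z k = k \<and> k \<notin> {}} = {}" using \<tau>s[OF that] z[OF that] by auto
    then show ?thesis unfolding excess_def prod.case by simp
  qed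
  have cover: "?A = ((?P1 \<union> ?P2) \<union> ?P3) \<union> (\<Union>z\<in>?Z. ?Q z)"
  proof (intro equalityI subsetI)
    fix c assume c: "c \<in> ?A"
    obtain \<sigma> M where sM: "c = (\<sigma>, M)" by fastforce
    have cI: "(\<sigma>, M) \<in> clans N I" using c sM by simp
    note C = clansD[OF cI]
    have sy: "\<sigma> y = N - Suc (\<sigma> x)" using C(3)[OF x(1)] by (simp add: y_def)
    consider "\<sigma> x = x" | "\<sigma> x = y" | "\<sigma> x \<noteq> x" "\<sigma> x \<noteq> y" by blast
    then show "c \<in> ((?P1 \<union> ?P2) \<union> ?P3) \<union> (\<Union>z\<in>?Z. ?Q z)"
    proof cases
      case 1
      then have "\<sigma> y = y" using sy by (simp add: y_def)
      moreover have "x \<in> M \<longleftrightarrow> y \<in> M" using C(7)[of x] C(7)[of y] y by (auto simp: y_def)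
      then have "M \<inter> ?S = {} \<or> M \<inter> ?S = ?S" by auto
      ultimately have "clan_agrees ?S (\<lambda>k. k) {} c \<or> clan_agrees ?S (\<lambda>k. k) ?S c"
        using 1 by (auto simp: clan_agrees_def sM)
      then show ?thesis using c by blast
    next
      case 2
      then have "\<sigma> y = x" using sy y by simp
      then have "clan_agrees ?S sw {} c" using 2 C(6)[of x] C(6)[of y] y by (auto simp: clan_agrees_def sM sw_def)
      then show ?thesis using c by blast
    next
      case 3
      have "\<sigma> x \<noteq> m"
      proof
        assume e: "\<sigma> x = m"
        then have "\<sigma> m = x" using C(2)[OF x(1)] by simp
        moreover have "N - Suc m = m" using m by auto
        ultimately have "x = N - Suc x" using C(3)[OF m(2)] by simp
        then show False using y by (simp add: y_def)
      qed
      then have zz: "\<sigma> x \<in> ?Z" using 3 C(1)[OF x(1)] by simp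
      let ?z = "\<sigma> x"
      have szz: "\<sigma> ?z = x" using C(2)[OF x(1)] .
      have swz: "\<sigma> (N - Suc ?z) = y" using C(3)[OF z(1)[OF zz]] szz by (simp add: y_def)
      have "clan_agrees (?T ?z) (\<tau> ?z) {} c"
        unfolding clan_agrees_def sM prod.case
        using \<tau>s[OF zz] szz sy swz z[OF zz] C(6)[of x] C(6)[of ?z] C(6)[of y] C(6)[of "N - Suc ?z"] by auto
      then show ?thesis using c zz by blast
    qed
  qed blast
  have ag: "(\<forall>k\<in>S. fst c k = t k) \<and> snd c \<inter> S = L" if "clan_agrees S t L c" for S t L c
    using that by (auto simp: clan_agrees_def split: prod.splits)
  have finA: "finite ?A" using finite_clans[OF fin] by simp
  have finP: "finite (?P S' t L)" for S' t L using finA by (rule rev_finite_subset) auto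
  have P1v: "fst c x = x \<and> x \<notin> snd c" if "c \<in> ?P1" for c using ag[of ?S "\<lambda>k. k" "{}" c] that by simp
  have P2v: "fst c x = x \<and> x \<in> snd c" if "c \<in> ?P2" for c using ag[of ?S "\<lambda>k. k" ?S c] that by blast
  have P3v: "fst c x = y" if "c \<in> ?P3" for c using ag[of ?S sw "{}" c] that by (simp add: sw_def)
  have Qv: "fst c x = z" if "z \<in> ?Z" "c \<in> ?Q z" for c z
    using ag[of "?T z" "\<tau> z" "{}" c] that(2) \<tau>s(1)[OF that(1)] by simp
  have dQ: "?Q z \<inter> ?Q z' = {}" if zz: "z \<in> ?Z" "z' \<in> ?Z" "z \<noteq> z'" for z z'
  proof (rule equals0I)
    fix c assume "c \<in> ?Q z \<inter> ?Q z'"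
    then show False using Qv[OF zz(1), of c] Qv[OF zz(2), of c] zz(3) by simp
  qed
  have d12: "?P1 \<inter> ?P2 = {}" using P1v P2v by blast
  have d3: "(?P1 \<union> ?P2) \<inter> ?P3 = {}"
  proof (rule equals0I)
    fix c assume "c \<in> (?P1 \<union> ?P2) \<inter> ?P3"
    then show False using P1v[of c] P2v[of c] P3v[of c] y(5) by auto
  qed
  have d4: "((?P1 \<union> ?P2) \<union> ?P3) \<inter> (\<Union>z\<in>?Z. ?Q z) = {}"
  proof (rule equals0I)
    fix c assume c: "c \<in> ((?P1 \<union> ?P2) \<union> ?P3) \<inter> (\<Union>z\<in>?Z. ?Q z)"
    then obtain z' where c': "z' \<in> ?Z" "c \<in> ?Q z'" by blast
    have "fst c x = z'" by (rule Qv[OF c'])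
    moreover have "fst c x = x \<or> fst c x = y" using c P1v[of c] P2v[of c] P3v[of c] by blast
    ultimately show False using z(5,6)[OF c'(1)] by simp
  qed
  have "card ?A = card ((?P1 \<union> ?P2) \<union> ?P3) + card (\<Union>z\<in>?Z. ?Q z)"
    unfolding cover by (rule card_Un_disjoint) (use finP fin d4 in blast)+
  also have "card ((?P1 \<union> ?P2) \<union> ?P3) = card (?P1 \<union> ?P2) + card ?P3"
    by (rule card_Un_disjoint) (use finP d3 in blast)+
  also have "card (?P1 \<union> ?P2) = card ?P1 + card ?P2"
    by (rule card_Un_disjoint) (use finP d12 in blast)+
  also have "card (\<Union>z\<in>?Z. ?Q z) = (\<Sum>z\<in>?Z. card (?Q z))"
    by (rule card_UN_disjoint) (use fin finP dQ in blast)+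
  also have "card ?P1 = clan_count N (I - ?S) (d - 2)" using clan_count_agrees[OF I S cl1, of d] e1 by simp
  also have "card ?P2 = clan_count N (I - ?S) (d + 2)" using clan_count_agrees[OF I S cl2, of d] e2 by simp
  also have "card ?P3 = clan_count N (I - ?S) d" using clan_count_agrees[OF I S cl3, of d] e3 by simp
  also have "(\<Sum>z\<in>?Z. card (?Q z)) = (\<Sum>z\<in>?Z. clan_count N (I - ?T z) d)"
    by (intro sum.cong refl) (use clan_count_agrees[OF I T cl4] e4 in simp)
  finally show ?thesis by (simp add: clan_count_def)
qed

text \<open>Here \<open>l\<close> is the number of mirror pairs besides the middle point, whose sign
  alone is the excess when \<open>l\<close> is 0. Starting from \<open>Suc l\<close> pairs, a point
  with its mirror image leaves 2 l partners other than the middle. At l = 0 the truncated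
  \<open>l - 1\<close> is annulled by the factor.\<close>

fun clan_number :: "nat \<Rightarrow> int \<Rightarrow> nat" where
  "clan_number 0 d = (if d = 1 \<or> d = -1 then 1 else 0)"
| "clan_number (Suc l) d = clan_number l (d - 2) + clan_number l (d + 2) + clan_number l d + 2 * l * clan_number (l - 1) d"

lemma clan_count_singleton:
  assumes m: "Suc (m + m) = N"
  shows "clan_count N {m} d = clan_number 0 d"
proof -
  have w: "N - Suc m = m" using m by auto
  have "clans N {m} = {((\<lambda>k. k), {}), ((\<lambda>k. k), {m})}"
  proof (intro equalityI subsetI)
    fix c assume c: "c \<in> clans N {m}"
    obtain \<sigma> M where sM: "c = (\<sigma>, M)" by fastforce
    have "(\<sigma>, M) \<in> clans N {m}" using c sM by simp
    note C = clansD[OF this]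
    have "\<sigma> k = k" for k using C(1)[of k] C(4)[of k] by (cases "k = m") auto
    moreover have "M = {} \<or> M = {m}" using C(5) by auto
    ultimately show "c \<in> {((\<lambda>k. k), {}), ((\<lambda>k. k), {m})}" using sM by auto
  qed (auto simp: clans_def w)
  moreover have "excess {m} ((\<lambda>k. k), {}) = 1" "excess {m} ((\<lambda>k. k), {m}) = -1" by (simp_all add: excess_def)
  ultimately have "{c \<in> clans N {m}. excess {m} c = d} =
     (if d = 1 then {((\<lambda>k. k), {})} else if d = -1 then {((\<lambda>k. k), {m})} else {})" by auto
  then show ?thesis by (simp add: clan_count_def)
qed

text \<open>All sets on the right of \<open>clan_count_rec\<close> are symmetric and contain
  \<open>m\<close>, so only their sizes matter. Strong induction is needed since matching with
  \<open>z\<close> removes two mirror pairs at once.\<close>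

lemma clan_count_eq:
  assumes "I \<subseteq> {..<N}" "\<And>k. k \<in> I \<Longrightarrow> N - Suc k \<in> I" "Suc (m + m) = N" "m \<in> I" "card I = Suc (2 * l)"
  shows "clan_count N I d = clan_number l d"
  using assms
proof (induction l arbitrary: I d rule: less_induct)
  case (less l I d)
  note I = less.prems(1,2) and m = less.prems(3,4) and card = less.prems(5)
  have fin: "finite I" using I(1) finite_subset by blast
  show ?case
  proof (cases l)
    case 0
    then have "I = {m}" using card m(2) by (metis One_nat_def card_1_singletonE mult_0_right singletonD)
    then show ?thesis using clan_count_singleton[OF m(1)] 0 by simp
  next
    case (Suc l')
    have "card (I - {m}) = 2 * l" using card m(2) fin by simp
    then have "I - {m} \<noteq> {}" using Suc by (metis card.empty mult_eq_0_iff nat.distinct(1) zero_neq_numeral)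
    then obtain x where x: "x \<in> I" "x \<noteq> m" by blast
    define y where "y = N - Suc x"
    have xN: "x < N" using x I by auto
    have y: "y \<in> I" "N - Suc y = x" "y \<noteq> x" "y \<noteq> m" using x I(2) xN m(1) by (auto simp: y_def)
    have c2: "card (I - {x, y}) = Suc (2 * l')" using card Suc x(1) y fin by (simp add: card_Diff_subset)
    have w2: "N - Suc k \<in> I - {x, y}" if "k \<in> I - {x, y}" for k
    proof -
      have "N - Suc (N - Suc k) = k" using that I(1) by auto
      then show ?thesis using that I(2) y(2) by (auto simp: y_def)
    qed
    have r2: "clan_count N (I - {x, y}) e = clan_number l' e" for e
    proof (rule less.IH[OF _ _ w2 m(1) _ c2])
      show "l' < l" using Suc by simp
      show "I - {x, y} \<subseteq> {..<N}" using I(1) by blast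
      show "m \<in> I - {x, y}" using m(2) x(2) y(4) by simp
    qed
    have r4: "clan_count N (I - {x, z, y, N - Suc z}) d = clan_number (l' - 1) d" if z: "z \<in> I - {x, y, m}" for z
    proof -
      have zN: "z < N" "N - Suc (N - Suc z) = z" using z I(1) by auto
      have wz: "N - Suc z \<in> I - {x, y}" using w2 z by blast
      have wz': "N - Suc z \<noteq> z" "N - Suc z \<noteq> m" using z zN m(1) by auto
      have eq: "I - {x, z, y, N - Suc z} = (I - {x, y}) - {z, N - Suc z}" by auto
      have "card ((I - {x, y}) - {z, N - Suc z}) = card (I - {x, y}) - 2"
        using z wz wz' fin by (subst card_Diff_subset) auto
      moreover have "2 \<le> card (I - {x, y})"
      proof -
        have "card {z, N - Suc z} \<le> card (I - {x, y})" by (rule card_mono) (use z wz fin in auto)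
        then show ?thesis using wz' by simp
      qed
      ultimately have c4: "card (I - {x, z, y, N - Suc z}) = Suc (2 * (l' - 1))" using c2 unfolding eq by linarith
      have w4: "N - Suc k \<in> I - {x, z, y, N - Suc z}" if "k \<in> I - {x, z, y, N - Suc z}" for k
      proof -
        have kk: "N - Suc (N - Suc k) = k" using that I(1) by auto
        have "N - Suc k \<in> I - {x, y}" by (rule w2) (use that in simp)
        moreover have "N - Suc k \<noteq> z" using kk that by force
        moreover have "N - Suc k \<noteq> N - Suc z"
        proof
          assume "N - Suc k = N - Suc z"
          then have "k = z" using kk zN(2) by metis
          then show False using that by simp
        qed
        ultimately show ?thesis by simp
      qed
      have "I - {x, z, y, N - Suc z} \<subseteq> {..<N}" using I(1) by blast
      moreover have "m \<in> I - {x, z, y, N - Suc z}" using m(2) x(2) y(4) z wz'(2) by simp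
      moreover have "l' - 1 < l" using Suc by simp
      ultimately show ?thesis by (intro less.IH[OF _ _ w4 m(1) _ c4])
    qed
    have "card (I - {x, y, m}) = 2 * l'"
    proof -
      have "I - {x, y, m} = (I - {x, y}) - {m}" by auto
      then show ?thesis using c2 m(2) x y fin by simp
    qed
    then have "(\<Sum>z\<in>I - {x, y, m}. clan_count N (I - {x, z, y, N - Suc z}) d) = 2 * l' * clan_number (l' - 1) d"
      using r4 by simp
    then show ?thesis
      using clan_count_rec[OF I m x, of d, folded y_def] r2 Suc by simp
  qed
qed

section \<open>Difference equations with polynomial solutions\<close>

lemma binomial_difference:
  fixes x :: "'k::comm_ring_1"
  shows "(x + 1) ^ m - x ^ m = (\<Sum>k<m. of_nat (m choose k) * x ^ k)"
proof -
  have "(x + 1) ^ m = (\<Sum>k\<le>m. of_nat (m choose k) * x ^ k)"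
    using binomial_ring[of x 1 m] by simp
  also have "\<dots> = (\<Sum>k<m. of_nat (m choose k) * x ^ k) + x ^ m"
    by (simp add: lessThan_Suc_atMost[symmetric])
  finally show ?thesis by simp
qed

text \<open>Discrete integration: the difference of the power of degree n + 1 has leading term (n +
  1) x^n, so a suitable multiple of it removes the top coefficient of \<open>Q\<close> and lowers
  the degree. The division by \<open>Suc n\<close> is the source of the denominators in
  \<open>clan_lead\<close>.\<close>

lemma antidifference_exists:
  fixes Q :: "rat poly"
  assumes "degree Q \<le> n"
  shows "\<exists>P. (\<forall>x. poly P (x + 1) - poly P x = poly Q x) \<and> degree P \<le> Suc n \<and> coeff P (Suc n) = coeff Q n / of_nat (Suc n)"
  using assms
proof (induction n arbitrary: Q)
  case 0
  then obtain q where "Q = [:q:]" using degree_eq_zeroE by blast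
  then show ?case by (intro exI[of _ "[:0, q:]"]) (auto simp: algebra_simps)
next
  case (Suc n)
  define q where "q = coeff Q (Suc n) / of_nat (Suc (Suc n))"
  define R :: "rat poly" where "R = (\<Sum>k<Suc (Suc n). monom (of_nat (Suc (Suc n) choose k)) k)"
  have R: "poly R x = (x + 1) ^ Suc (Suc n) - x ^ Suc (Suc n)" for x
    unfolding binomial_difference R_def by (simp add: poly_sum poly_monom del: sum.lessThan_Suc binomial_Suc_Suc)
  have cR: "coeff R k = (if k < Suc (Suc n) then of_nat (Suc (Suc n) choose k) else 0)" for k
    unfolding R_def coeff_sum coeff_monom by (simp del: sum.lessThan_Suc binomial_Suc_Suc)
  have "degree (Q - smult q R) \<le> n"
  proof (rule degree_le, intro allI impI)
    fix k assume "n < k"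
    then consider "k = Suc n" | "Suc n < k" by linarith
    then show "coeff (Q - smult q R) k = 0"
    proof cases
      case 1
      have "Suc (Suc n) choose Suc n = Suc (Suc n)" using binomial_symmetric[of "Suc n" "Suc (Suc n)"] by simp
      then show ?thesis unfolding 1 coeff_diff coeff_smult cR by (simp add: q_def del: of_nat_Suc binomial_Suc_Suc)
    next
      case 2
      then show ?thesis using Suc.prems by (simp add: cR coeff_eq_0 del: binomial_Suc_Suc)
    qed
  qed
  then obtain P where P: "\<And>x. poly P (x + 1) - poly P x = poly (Q - smult q R) x" "degree P \<le> Suc n"
    using Suc.IH by blast
  let ?P = "P + monom q (Suc (Suc n))"
  have "poly ?P (x + 1) - poly ?P x = poly Q x" for x
  proof -
    have "poly ?P (x + 1) - poly ?P x = (poly P (x + 1) - poly P x) + q * ((x + 1) ^ Suc (Suc n) - x ^ Suc (Suc n))"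
      by (simp add: poly_monom algebra_simps)
    then show ?thesis unfolding P(1) R[symmetric] by simp
  qed
  moreover have "degree ?P \<le> Suc (Suc n)"
    using P(2) by (intro degree_add_le degree_monom_le) simp
  moreover have "coeff ?P (Suc (Suc n)) = q" using P(2) by (simp add: coeff_eq_0)
  ultimately show ?case unfolding q_def by blast
qed

text \<open>In closed form \<open>clan_lead k\<close> is the sum of \<open>1 / (r! s!)\<close> over \<open>2 r + s = k\<close>.\<close>

fun clan_lead :: "nat \<Rightarrow> rat" where
  "clan_lead 0 = 1"
| "clan_lead (Suc 0) = 1"
| "clan_lead (Suc (Suc k)) = (clan_lead (Suc k) + 2 * clan_lead k) / of_nat (Suc (Suc k))"

lemma clan_lead_pos: "clan_lead k > 0"
  by (induction k rule: clan_lead.induct) (auto intro!: divide_pos_pos add_pos_pos simp del: of_nat_Suc)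

text \<open>Two consecutive values below 1 bound the next one, at k + 7, by 3 / (k + 7). The
  induction cannot start before 5, since the values at 2, 3 and 4 are 3/2, 7/6 and 25/24.\<close>

lemma clan_lead_less_one: "clan_lead (k + 5) < 1 \<and> clan_lead (k + 6) < 1"
proof (induction k)
  case 0
  show ?case by (simp add: numeral_eq_Suc)
next
  case (Suc k)
  have e: "Suc k + 6 = Suc (Suc (k + 5))" "Suc (k + 5) = k + 6" "Suc (k + 6) = k + 7" by simp_all
  have "clan_lead (Suc k + 6) = (clan_lead (Suc (k + 5)) + 2 * clan_lead (k + 5)) / of_nat (Suc (Suc (k + 5)))"
    by (subst e(1)) (rule clan_lead.simps(3))
  also have "\<dots> = (clan_lead (k + 6) + 2 * clan_lead (k + 5)) / of_nat (k + 7)"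
    by (simp only: e(2,3))
  also have "\<dots> < 1" using Suc by (simp add: divide_less_eq)
  finally show ?case using Suc by (simp add: add.commute)
qed

lemma clan_lead_odd_not_int:
  assumes "n > 0" shows "clan_lead (2 * n + 1) \<notin> \<int>"
proof (cases "n = 1")
  case True
  have "clan_lead (2 * n + 1) = 7 / 6" unfolding True by (simp add: numeral_eq_Suc)
  moreover have "(7 / 6 :: rat) \<notin> \<int>"
  proof
    assume "(7 / 6 :: rat) \<in> \<int>"
    then obtain z :: int where "7 / 6 = (of_int z :: rat)" by (elim Ints_cases)
    then have "of_int (6 * z) = (of_int 7 :: rat)" by simp
    then have "6 * z = 7" by (simp only: of_int_eq_iff)
    then show False by presburger
  qed
  ultimately show ?thesis by (simp only: not_False_eq_True)
next
  case False
  then have "2 * n + 1 = (2 * n - 4) + 5" using assms by linarith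
  then have "clan_lead (2 * n + 1) < 1" using clan_lead_less_one[of "2 * n - 4"] by simp
  moreover have "0 < clan_lead (2 * n + 1)" by (rule clan_lead_pos)
  ultimately show ?thesis by (auto elim!: Ints_cases)
qed

section \<open>Polynomiality of the clan numbers along diagonals\<close>

lemma clan_number_zero: "d > 2 * int l + 1 \<Longrightarrow> clan_number l d = 0"
proof (induction l d rule: clan_number.induct)
  case (2 l d)
  moreover have "2 * l * clan_number (l - 1) d = 0" 
    using 2 by (cases l) auto
  ultimately show ?case by simp
qed simp

text \<open>The largest possible excess is \<open>2 * int l + 1\<close>, all points being fixed with
  sign plus, and 2 k is the defect from it. For the k-th diagonal the four terms of the recursion
  for \<open>clan_number\<close> lie, in this order, on the diagonals k, k - 2, k - 1 and k -
  2.\<close>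

definition clan_diag :: "nat \<Rightarrow> nat \<Rightarrow> nat" where
  "clan_diag k l = clan_number l (2 * int l + 1 - 2 * int k)"

text \<open>All terms of the recursion but the first ask for an excess beyond the maximum and
  vanish; the single clan that is counted has all points fixed with sign plus.\<close>

lemma clan_diag_0: "clan_diag 0 l = 1"
proof (induction l)
  case (Suc l)
  have "2 * l * clan_number (l - 1) (2 * int l + 3) = 0" using clan_number_zero[of "l - 1" "2 * int l + 3"] by (cases l) auto
  then show ?case using Suc clan_number_zero[of l "2 * int l + 5"] clan_number_zero[of l "2 * int l + 3"]
    by (simp add: clan_diag_def algebra_simps)
qed (simp add: clan_diag_def)

lemma clan_diag_1: "clan_diag (Suc 0) l = l + 1"
proof (induction l)
  case (Suc l)
  have "2 * l * clan_number (l - 1) (2 * int l + 1) = 0" using clan_number_zero[of "l - 1" "2 * int l + 1"] by (cases l) auto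
  then show ?case using Suc clan_number_zero[of l "2 * int l + 3"] clan_diag_0[of l]
    by (simp add: clan_diag_def algebra_simps)
qed (simp add: clan_diag_def)

lemma clan_diag_Suc_Suc:
  "clan_diag (Suc (Suc k)) 0 = 0"
  "clan_diag (Suc (Suc k)) (Suc l) = clan_diag (Suc (Suc k)) l + clan_diag (Suc k) l + clan_diag k l + 2 * l * clan_diag k (l - 1)"
proof -
  show "clan_diag (Suc (Suc k)) 0 = 0" by (simp add: clan_diag_def)
  have "2 * l * clan_number (l - 1) (2 * int (Suc l) + 1 - 2 * int (Suc (Suc k))) = 2 * l * clan_diag k (l - 1)"
    by (cases l) (simp_all add: clan_diag_def algebra_simps)
  then show "clan_diag (Suc (Suc k)) (Suc l) = clan_diag (Suc (Suc k)) l + clan_diag (Suc k) l + clan_diag k l + 2 * l * clan_diag k (l - 1)"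
    by (simp add: clan_diag_def algebra_simps)
qed

text \<open>By the recursion, the difference of the diagonal k + 2 is the sum of the diagonals k + 1
  and k at l and of 2 l times the diagonal k at l - 1. This is a polynomial of degree k + 1 with
  leading coefficient \<open>clan_lead (Suc k) + 2 * clan_lead k\<close>; summation raises the
  degree by one and divides by k + 2.\<close>

lemma clan_diag_polynomial:
  "\<exists>P :: rat poly. (\<forall>l. of_nat (clan_diag k l) = poly P (of_nat l)) \<and> degree P = k \<and> lead_coeff P = clan_lead k"
proof (induction k rule: clan_lead.induct)
  case 1
  show ?case by (intro exI[of _ 1]) (simp add: clan_diag_0)
next
  case 2
  show ?case by (intro exI[of _ "[:1, 1:]"]) (simp add: clan_diag_1 add.commute)
next
  case (3 k)
  obtain P where P: "\<And>l. of_nat (clan_diag (Suc k) l) = poly P (of_nat l)" "degree P = Suc k" "lead_coeff P = clan_lead (Suc k)"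
    using 3(1) by blast
  obtain R where R: "\<And>l. of_nat (clan_diag k l) = poly R (of_nat l)" "degree R = k" "lead_coeff R = clan_lead k"
    using 3(2) by blast
  \<comment> \<open>The argument is shifted to l - 1. The truncation at l = 0 is harmless because
    the term carries the factor \<open>l\<close>.\<close>
  define R' where "R' = pcompose R [:-1, 1:]"
  have R': "degree R' = k" "coeff R' k = clan_lead k"
    using R(2,3) lead_coeff_comp[of "[:-1, 1:]" R] by (simp_all add: R'_def)
  define Q where "Q = P + R + [:0, 2:] * R'"
  have dQ: "degree Q \<le> Suc k"
    unfolding Q_def using P(2) R(2) R'(1) degree_mult_le[of "[:0, 2:]" R']
    by (intro degree_add_le) auto
  have cQ: "coeff Q (Suc k) = clan_lead (Suc k) + 2 * clan_lead k"
    using P(2,3) R(2) R' by (simp add: Q_def coeff_eq_0)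
  obtain S where S: "\<And>x. poly S (x + 1) - poly S x = poly Q x" "degree S \<le> Suc (Suc k)"
      "coeff S (Suc (Suc k)) = coeff Q (Suc k) / of_nat (Suc (Suc k))"
    using antidifference_exists[OF dQ] by blast
  \<comment> \<open>The antidifference is normalised to vanish at 0, as the diagonal does there: a
    single point has excess 1 or -1, which are the values for k = 0 and k = 1.\<close>
  define T where "T = S - [:poly S 0:]"
  have cT: "coeff T (Suc (Suc k)) = clan_lead (Suc (Suc k))"
    using S(3) cQ by (simp add: T_def del: of_nat_Suc)
  have dT: "degree T = Suc (Suc k)"
  proof (rule antisym)
    show "degree T \<le> Suc (Suc k)" unfolding T_def by (rule degree_diff_le[OF S(2)]) simp
    show "Suc (Suc k) \<le> degree T" by (rule le_degree) (use cT clan_lead_pos[of "Suc (Suc k)"] in \<open>simp del: clan_lead.simps\<close>)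
  qed
  have "of_nat (clan_diag (Suc (Suc k)) l) = poly T (of_nat l)" for l
  proof (induction l)
    case 0
    show ?case by (simp add: clan_diag_Suc_Suc(1) T_def)
  next
    case (Suc l)
    have r: "of_nat (2 * l * clan_diag k (l - 1)) = 2 * of_nat l * poly R' (of_nat l)"
    proof (cases l)
      case (Suc l')
      then show ?thesis by (simp add: R'_def poly_pcompose R(1)[symmetric] algebra_simps)
    qed simp
    have "of_nat (clan_diag (Suc (Suc k)) (Suc l)) = poly T (of_nat l) + poly Q (of_nat l)"
      unfolding clan_diag_Suc_Suc(2) of_nat_add r Suc P(1) R(1) by (simp add: Q_def algebra_simps)
    also have "\<dots> = poly T (of_nat l + 1)" using S(1)[of "of_nat l"] by (simp add: T_def)
    finally show ?case by (simp add: add.commute)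
  qed
  moreover have "lead_coeff T = clan_lead (Suc (Suc k))" unfolding dT by (rule cT)
  ultimately show ?case using dT by (intro exI[of _ T] conjI allI)
qed

theorem theorem6p4:
  fixes n :: nat
  assumes "CHAR('k::alg_closed_field) \<noteq> 2"
  shows "\<exists>p :: rat poly.
    (\<forall>m. \<forall>B :: 'k mat set. borel_subgroup (2 * m + 2 * n + 1) B \<longrightarrow>
       finite (orbits_on_symmetric_variety (2 * m) (2 * n + 1) B) \<and>
       of_nat (card (orbits_on_symmetric_variety (2 * m) (2 * n + 1) B)) = poly p (of_nat m)) \<and>
    degree p = 2 * n + 1 \<and>
    (n > 0 \<longrightarrow> lead_coeff p \<notin> \<int>)"
proof -
  \<comment> \<open>Characteristic 1 does not occur in a field, so excluding 2 makes the element 2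
    nonzero; in this form the assumption is used throughout.\<close>
  have "CHAR('k) dvd 2 \<longleftrightarrow> CHAR('k) = 1 \<or> CHAR('k) = 2" using prime_nat_iff two_is_prime_nat by auto
  then have "\<not> CHAR('k) dvd 2" using assms by simp
  then have two: "(2 :: 'k) \<noteq> 0" using of_nat_eq_0_iff_char_dvd[of 2, where 'a = 'k] by simp
  obtain P :: "rat poly" where P: "\<And>l. of_nat (clan_diag (2 * n + 1) l) = poly P (of_nat l)"
    "degree P = 2 * n + 1" "lead_coeff P = clan_lead (2 * n + 1)"
    using clan_diag_polynomial[of "2 * n + 1"] by blast
  \<comment> \<open>The matrix size is 2 l + 1 with l = m + n, and the excess 2 m - (2 n + 1) equals
    2 l + 1 - 2 k for k = 2 n + 1. The shift of the argument by \<open>n\<close> changes neither the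
    degree nor the leading coefficient.\<close>
  define p where "p = pcompose P [:of_nat n, 1:]"
  have count: "finite (orbits_on_symmetric_variety (2 * m) (2 * n + 1) B) \<and>
       of_nat (card (orbits_on_symmetric_variety (2 * m) (2 * n + 1) B)) = poly p (of_nat m)"
    if B: "borel_subgroup (2 * m + 2 * n + 1) B" for m and B :: "'k mat set"
  proof -
    let ?N = "2 * m + 2 * n + 1"
    have N: "?N = 2 * m + (2 * n + 1)" "odd ?N" by simp_all
    obtain f where f: "hyp_basis ?N f" "B = flag_stabilizer ?N f"
      by (rule borel_subgroup_is_flag_stabilizer[OF two N(2) B])
    have "card (orbits_on_symmetric_variety (2 * m) (2 * n + 1) B) =
        clan_count ?N {..<?N} (int (2 * m) - int (2 * n + 1))"
      unfolding f(2) clan_count_def by (rule card_orbits_eq_card_clans(2)[OF two N f(1)])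
    also have "\<dots> = clan_number (m + n) (int (2 * m) - int (2 * n + 1))"
      by (rule clan_count_eq[where m = "m + n"]) auto
    also have "\<dots> = clan_diag (2 * n + 1) (m + n)" by (simp add: clan_diag_def algebra_simps)
    finally have "of_nat (card (orbits_on_symmetric_variety (2 * m) (2 * n + 1) B)) = poly P (of_nat (m + n))"
      using P(1) by simp
    then show ?thesis
      using card_orbits_eq_card_clans(1)[OF two N f(1)] f(2) by (simp add: p_def poly_pcompose add.commute)
  qed
  have "degree p = 2 * n + 1" using P(2) by (simp add: p_def)
  moreover have "lead_coeff p = clan_lead (2 * n + 1)"
    using lead_coeff_comp[of "[:of_nat n, 1:]" P] P(3) by (simp add: p_def)
  ultimately show ?thesis using count clan_lead_odd_not_int by (intro exI[of _ p]) auto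
qed

end
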